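(* Let $B\subset\mathbb{R}^3$ be a ball, $T>0$, $Q:=B\times(0,T)$, and let $u$ be a distributional solution to the Navier–Stokes equations in $Q$, with vorticity $\omega:=\operatorname{curl}u$, satisfying $$u\in L^{s',s},\qquad \frac{2}{s'}+\frac{3}{s}=1,\qquad s'\in(2,\infty).$$ Then, if $s'\ge 4$, necessarily $\omega\in L^{2,2}$. The same conclusion holds if $s'\in(2,4)$ provided $u\in L^{4,p}$ for some $p>1$.
   Context: Distributional solution: let $\mathcal D(Q)$ be the space of ($\mathbb{R}^3$-valued) functions in $C_0^\infty(Q)$ that are solenoidal, i.e. divergence-free in $x$. A vector field $u\in L^2(Q)$, $u:Q\to\mathbb{R}^3$, is a distributional solution to the Navier–Stokes equations in $Q$ if $$\int_Q u\cdot(\varphi_t+\Delta\varphi+u\cdot\nabla\varphi)\,dx\,dt=0\quad\text{for all }\varphi\in\mathcal D(Q),$$ and, for a.e. $t\in(0,T)$, $\int_B u\cdot\nabla\phi\,dx=0$ for all $\phi\in C_0^\infty(B)$. Here $(u\cdot\nabla\varphi)_i=\sum_j u_j\partial_j\varphi_i$. The curl is taken in the spatial variables in the sense of distributions. Local notation: $g\in L^{r,q}$ (time exponent first) means $g\in L^r_{\rm loc}((0,T);L^q_{\rm loc}(B))$, i.e. $g\in L^r((t_1,t_2);L^q(B'))$ for every cylinder $B'\times(t_1,t_2)$ compactly contained in $Q$. *)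

theory Defs
  imports "HOL-Analysis.Analysis"
begin

section \<open>Smooth compactly supported functions\<close>

definition partial_deriv ::
  "'a::euclidean_space \<Rightarrow> ('a \<Rightarrow> 'b::real_normed_vector) \<Rightarrow> 'a \<Rightarrow> 'b" where
  "partial_deriv v f = (\<lambda>z. frechet_derivative f (at z) v)"

primrec C_k :: "nat \<Rightarrow> ('a::euclidean_space \<Rightarrow> 'b::real_normed_vector) \<Rightarrow> bool" where
  "C_k 0 f \<longleftrightarrow> continuous_on UNIV f"
| "C_k (Suc k) f \<longleftrightarrow> (\<forall>z. f differentiable (at z)) \<and> (\<forall>v\<in>Basis. C_k k (partial_deriv v f))"

text \<open>An element of \<open>C\<^sub>0\<^sup>\<infinity>(\<Omega>)\<close> is represented by its extension by zero to the whole space.\<close>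

definition test_functions ::
  "'a::euclidean_space set \<Rightarrow> ('a \<Rightarrow> 'b::real_normed_vector) set" where
  "test_functions \<Omega> = {\<phi>. (\<forall>k. C_k k \<phi>) \<and>
     compact (closure {z. \<phi> z \<noteq> 0}) \<and> closure {z. \<phi> z \<noteq> 0} \<subseteq> \<Omega>}"

section \<open>Differential operators in space-time\<close>

text \<open>Points of space-time are pairs \<open>(x, t)\<close>, with \<open>x\<close> in \<open>real^3\<close> and \<open>t\<close> in \<open>real\<close>.\<close>

definition dt :: "((real^3) \<times> real \<Rightarrow> 'b::real_normed_vector) \<Rightarrow> (real^3) \<times> real \<Rightarrow> 'b" where
  "dt = partial_deriv (0, 1)"

definition dx :: "3 \<Rightarrow> ((real^3) \<times> real \<Rightarrow> 'b::real_normed_vector) \<Rightarrow> (real^3) \<times> real \<Rightarrow> 'b" where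
  "dx j = partial_deriv (axis j 1, 0)"

definition laplacian_x ::
  "((real^3) \<times> real \<Rightarrow> 'b::real_normed_vector) \<Rightarrow> (real^3) \<times> real \<Rightarrow> 'b" where
  "laplacian_x \<phi> z = (\<Sum>j\<in>UNIV. dx j (dx j \<phi>) z)"

definition div_x :: "((real^3) \<times> real \<Rightarrow> real^3) \<Rightarrow> (real^3) \<times> real \<Rightarrow> real" where
  "div_x \<phi> z = (\<Sum>j\<in>UNIV. dx j \<phi> z $ j)"

definition curl_x :: "((real^3) \<times> real \<Rightarrow> real^3) \<Rightarrow> (real^3) \<times> real \<Rightarrow> real^3" where
  "curl_x \<phi> z = vector
     [dx 2 \<phi> z $ 3 - dx 3 \<phi> z $ 2,
      dx 3 \<phi> z $ 1 - dx 1 \<phi> z $ 3,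
      dx 1 \<phi> z $ 2 - dx 2 \<phi> z $ 1]"

definition convection ::
  "((real^3) \<times> real \<Rightarrow> real^3) \<Rightarrow> ((real^3) \<times> real \<Rightarrow> real^3) \<Rightarrow> (real^3) \<times> real \<Rightarrow> real^3" where
  "convection u \<phi> z = (\<Sum>j\<in>UNIV. (u z $ j) *\<^sub>R dx j \<phi> z)"

definition gradient :: "(real^3 \<Rightarrow> real) \<Rightarrow> real^3 \<Rightarrow> real^3" where
  "gradient \<phi> x = (\<chi> j. partial_deriv (axis j 1) \<phi> x)"

section \<open>Lebesgue and local mixed Lebesgue spaces\<close>

definition in_Lp :: "real \<Rightarrow> 'a measure \<Rightarrow> ('a \<Rightarrow> 'b::euclidean_space) \<Rightarrow> bool" where
  "in_Lp p M f \<longleftrightarrow> f \<in> borel_measurable M \<and> integrable M (\<lambda>x. norm (f x) powr p)"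

definition Lp_norm :: "real \<Rightarrow> 'a measure \<Rightarrow> ('a \<Rightarrow> 'b::euclidean_space) \<Rightarrow> real" where
  "Lp_norm p M f = (LINT x|M. norm (f x) powr p) powr (1 / p)"

text \<open>\<open>in_mixed_Lp r q B I g\<close> is \<open>g \<in> L\<^sup>r(I; L\<^sup>q(B))\<close>; measurability is joint Lebesgue measurability
  on \<open>B \<times> I\<close>. On the null set of times where the slice is not in \<open>L\<^sup>q(B)\<close>, \<open>Lp_norm\<close> takes an
  irrelevant value.\<close>

definition in_mixed_Lp ::
  "real \<Rightarrow> real \<Rightarrow> (real^3) set \<Rightarrow> real set \<Rightarrow> ((real^3) \<times> real \<Rightarrow> real^3) \<Rightarrow> bool" where
  "in_mixed_Lp r q B I g \<longleftrightarrow>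
     g \<in> borel_measurable (lebesgue_on (B \<times> I)) \<and>
     (AE t in lebesgue_on I. in_Lp q (lebesgue_on B) (\<lambda>x. g (x, t))) \<and>
     in_Lp r (lebesgue_on I) (\<lambda>t. Lp_norm q (lebesgue_on B) (\<lambda>x. g (x, t)))"

definition compactly_contained :: "'a::topological_space set \<Rightarrow> 'a set \<Rightarrow> bool" where
  "compactly_contained A Q \<longleftrightarrow> compact (closure A) \<and> closure A \<subseteq> Q"

text \<open>The space \<open>L\<^sup>r\<^sub>l\<^sub>o\<^sub>c((0,T); L\<^sup>q\<^sub>l\<^sub>o\<^sub>c(B))\<close>, time exponent first.\<close>

definition Lloc :: "(real^3) set \<Rightarrow> real \<Rightarrow> real \<Rightarrow> real \<Rightarrow> ((real^3) \<times> real \<Rightarrow> real^3) set" where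
  "Lloc B T r q = {g. \<forall>B' t1 t2. open B' \<and>
     compactly_contained (B' \<times> {t1<..<t2}) (B \<times> {0<..<T}) \<longrightarrow>
     in_mixed_Lp r q B' {t1<..<t2} g}"

definition locally_integrable_on ::
  "('a::euclidean_space \<Rightarrow> 'b::euclidean_space) \<Rightarrow> 'a set \<Rightarrow> bool" where
  "locally_integrable_on f Q \<longleftrightarrow> (\<forall>K. compact K \<and> K \<subseteq> Q \<longrightarrow> integrable (lebesgue_on K) f)"

section \<open>Distributional curl and distributional solutions\<close>

text \<open>The distribution \<open>curl u\<close> on \<open>Q\<close>. Integrating by parts, \<open>curl\<close> is formally self-adjoint, so no
  sign appears.\<close>

definition curl_distr ::
  "((real^3) \<times> real) set \<Rightarrow> ((real^3) \<times> real \<Rightarrow> real^3) \<Rightarrow> ((real^3) \<times> real \<Rightarrow> real^3) \<Rightarrow> real" where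
  "curl_distr Q u \<phi> = (LINT z|lebesgue_on Q. u z \<bullet> curl_x \<phi> z)"

text \<open>A distribution is identified with a locally integrable function if it acts on test fields
  by integration against that function.\<close>

definition distr_represented_by ::
  "((real^3) \<times> real) set \<Rightarrow> (((real^3) \<times> real \<Rightarrow> real^3) \<Rightarrow> real) \<Rightarrow>
   ((real^3) \<times> real \<Rightarrow> real^3) \<Rightarrow> bool" where
  "distr_represented_by Q F w \<longleftrightarrow> locally_integrable_on w Q \<and>
     (\<forall>\<phi>\<in>test_functions Q. F \<phi> = (LINT z|lebesgue_on Q. w z \<bullet> \<phi> z))"

definition solenoidal_test_functions ::
  "((real^3) \<times> real) set \<Rightarrow> ((real^3) \<times> real \<Rightarrow> real^3) set" where
  "solenoidal_test_functions Q = {\<phi> \<in> test_functions Q. \<forall>z. div_x \<phi> z = 0}"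

definition distributional_solution ::
  "(real^3) set \<Rightarrow> real \<Rightarrow> ((real^3) \<times> real \<Rightarrow> real^3) \<Rightarrow> bool" where
  "distributional_solution B T u \<longleftrightarrow>
     in_Lp 2 (lebesgue_on (B \<times> {0<..<T})) u \<and>
     (\<forall>\<phi>\<in>solenoidal_test_functions (B \<times> {0<..<T}).
        (LINT z|lebesgue_on (B \<times> {0<..<T}).
           u z \<bullet> (dt \<phi> z + laplacian_x \<phi> z + convection u \<phi> z)) = 0) \<and>
     (AE t in lebesgue_on {0<..<T}.
        \<forall>\<phi>\<in>test_functions B. (LINT x|lebesgue_on B. u (x, t) \<bullet> gradient \<phi> x) = 0)"

end

theory Submission
  imports Defs
begin

text \<open>Multiply the curl of \<open>u(t)\<close> by a cutoff and expand it in a Fourier series on a cube, with coefficients \<open>W(k, t)\<close>;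
 testing the equation with curls of cut-off trigonometric polynomials gives their time derivatives. The quantity
 \<open>E\<^sub>N(t) = (\<Sum>k. |W(k, t)|^2 / ((1 + |k|^2) (1 + |k|^2 / N)))\<close> is a Yosida regularization of the squared $H^{-1}$ norm of the
 localized vorticity. Hoelder and Sobolev give \<open>\<integral> |u|^2 |g|^2 \<le> \<delta> \<parallel>\<nabla>g\<parallel>^2 + C \<kappa> \<parallel>g\<parallel>^2\<close> with \<open>\<kappa> = (1 + \<integral> |u|^s)\<close> to the power
 \<open>s' / s\<close>, which is integrable in time by the Serrin condition. As \<open>u\<close> is solenoidal, its localization is recovered
 from \<open>W\<close> up to a remainder that is in $H^1$ and bounded by \<open>\<parallel>u\<parallel>\<close>, so that the convection term is absorbed by the
 dissipation \<open>D\<^sub>N\<close> (the same sum, each term multiplied by \<open>1 + |k|^2\<close>) up to \<open>C \<kappa> E\<^sub>N\<close> and terms that are integrable in time.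
 Gronwall's inequality bounds \<open>\<integral> D\<^sub>N dt\<close> uniformly in \<open>N\<close>; as \<open>N \<longlonglongrightarrow> \<infinity>\<close> this bounds \<open>\<integral> (\<Sum>k. |W(k, t)|^2) dt\<close>,
 and the Fourier series converge in $L^2$ to the vorticity near each smaller cylinder.\<close>

text \<open>The level H^-1 is chosen because there the energy of the vorticity is bounded by the
  squared L^2 norm of u, so a starting value for Gronwall costs only the time integral of that norm,
  and because the dissipation is then the L^2 norm of the vorticity itself. The delicate term is the
  convection of the remainder. Estimating |u| times the remainder by the form bound would produce
  \<open>\<kappa>\<close> times the squared norm of u, a product of two functions of time that are
  merely integrable. As u is divergence-free, the derivative can be moved onto the remainder, which
  is in H^1, and the form bound is spent on the other factor. There are two approximation parameters
  because only finitely many modes are tested: the Fourier truncation error meets one derivative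
  more than the dissipation controls. The Yosida factor bounds this derivative at the price of a
  factor N, and the error vanishes as the modes exhaust the lattice with N fixed. The bound that is
  left does not depend on N.\<close>

type_synonym R3 = "real^3"

abbreviation ind :: "'a set => 'a => 'b::zero_neq_one" where "ind \<equiv> indicator"

abbreviation L1 :: "('a::euclidean_space => 'b::{banach, second_countable_topology}) => bool" where
 "L1 \<equiv> integrable lborel"

abbreviation Borel :: "('a::topological_space => 'b::topological_space) => bool" where
 "Borel f \<equiv> f \<in> borel_measurable borel"

abbreviation cmp :: "('a => 'b::real_inner) => 'b => 'a => real" where
 "cmp h b \<equiv> \<lambda>x. h x \<bullet> b"

abbreviation fsum :: "R3 set => (R3 => complex) => R3 => complex" where
 "fsum F c x \<equiv> \<Sum>k\<in>F. c k * cis (k \<bullet> x)"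

abbreviation lborel2 :: "('a::euclidean_space \<times> 'b::euclidean_space) measure" where
 "lborel2 \<equiv> lborel \<Otimes>\<^sub>M lborel"

abbreviation nst :: "(R3 \<times> real => R3) => (R3 \<times> real => R3) => R3 \<times> real => R3" where
 "nst v \<phi> z \<equiv> dt \<phi> z + laplacian_x \<phi> z + convection v \<phi> z"

abbreviation lc :: "'i set => ('i => real) => ('i => 'a => 'b) => 'a => 'b::real_vector" where
 "lc I c h \<equiv> \<lambda>x. \<Sum>i\<in>I. c i *\<^sub>R h i x"

abbreviation cyl :: "R3 => real => real => (R3 \<times> real) set" where
 "cyl x0 R T \<equiv> ball x0 R \<times> {0<..<T}"

lemmas L1_add = Bochner_Integration.integrable_add
lemmas L1_diff = Bochner_Integration.integrable_diff
lemmas L1_sum = Bochner_Integration.integrable_sum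
lemmas L1_bound = Bochner_Integration.integrable_bound
lemmas LINT_add = Bochner_Integration.integral_add
lemmas LINT_diff = Bochner_Integration.integral_diff
lemmas LINT_sum = Bochner_Integration.integral_sum
lemmas LINT_cong = Bochner_Integration.integral_cong

section \<open>Smooth functions\<close>

definition smooth :: "('a::euclidean_space => 'b::real_normed_vector) => bool" where
 "smooth f \<longleftrightarrow> (\<forall>k. C_k k f)"

lemma partial_deriv_eq: "(f has_derivative f') (at z) ==> partial_deriv v f z = f' v"
 unfolding partial_deriv_def by (metis frechet_derivative_at)

lemma C_k_SucI:
 assumes "\<And>z. (f has_derivative f' z) (at z)" "\<And>v. v \<in> Basis ==> C_k k (\<lambda>z. f' z v)"
 shows "C_k (Suc k) f"
proof -
 have "partial_deriv v f = (\<lambda>z. f' z v)" for v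
  using partial_deriv_eq[OF assms(1)] by auto
 then show ?thesis using assms by (auto simp: differentiable_def)
qed

lemma C_k_has_derivative:
 assumes "C_k (Suc k) f" shows "(f has_derivative (\<lambda>v. partial_deriv v f z)) (at z)"
 using assms by (auto simp: partial_deriv_def frechet_derivative_works[symmetric])

lemma C_k_continuous: "C_k k f ==> continuous_on UNIV f"
 by (cases k) (auto intro!: continuous_at_imp_continuous_on differentiable_imp_continuous_within)

lemma C_k_Suc_D: "C_k (Suc k) f ==> C_k k f"
proof (induction k arbitrary: f)
 case 0 then show ?case using C_k_continuous[of "Suc 0"] by simp
next
 case (Suc k)
 then show ?case by (metis C_k.simps(2))
qed

lemma C_k_partial: "C_k (Suc k) f ==> v \<in> Basis ==> C_k k (partial_deriv v f)"
 by simp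

lemma C_k_const [simp]: "C_k k (\<lambda>z. c)"
proof (induction k arbitrary: c)
 case (Suc k)
 show ?case by (rule C_k_SucI[where f'="\<lambda>z v. 0"]) (use Suc in auto)
qed simp

lemma C_k_add: "C_k k f ==> C_k k g ==> C_k k (\<lambda>z. f z + g z)"
proof (induction k arbitrary: f g)
 case (Suc k)
 show ?case
  by (rule C_k_SucI[OF has_derivative_add[OF C_k_has_derivative[OF Suc.prems(1)] C_k_has_derivative[OF Suc.prems(2)]]])
   (use Suc in auto)
qed (auto intro: continuous_on_add)

lemma C_k_sum: "(\<And>i. i \<in> I ==> C_k k (f i)) ==> C_k k (\<lambda>z. \<Sum>i\<in>I. f i z)"
 by (induction I rule: infinite_finite_induct) (auto intro: C_k_add)

lemma C_k_bounded_linear: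
 assumes "bounded_linear L" shows "C_k k f ==> C_k k (\<lambda>z. L (f z))"
proof (induction k arbitrary: f)
 case 0 then show ?case using assms by (auto intro: bounded_linear.continuous_on)
next
 case (Suc k)
 show ?case
  by (rule C_k_SucI[OF bounded_linear.has_derivative[OF assms C_k_has_derivative[OF Suc.prems(1)]]])
   (use Suc in auto)
qed

lemma C_k_bilinear:
 assumes "bounded_bilinear L" shows "C_k k f ==> C_k k g ==> C_k k (\<lambda>z. L (f z) (g z))"
proof (induction k arbitrary: f g)
 case 0 then show ?case using assms by (auto intro: bounded_bilinear.continuous_on)
next
 case (Suc k)
 show ?case
  by (rule C_k_SucI[OF bounded_bilinear.FDERIV[OF assms C_k_has_derivative[OF Suc.prems(1)] C_k_has_derivative[OF Suc.prems(2)]]])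
   (intro C_k_add Suc.IH C_k_partial Suc.prems C_k_Suc_D[OF Suc.prems(1)] C_k_Suc_D[OF Suc.prems(2)])
qed

lemma C_k_id: "C_k k (\<lambda>z. z)"
proof (cases k)
 case (Suc n) then show ?thesis by (metis C_k_SucI[OF has_derivative_ident] C_k_const)
qed simp

lemma C_k_comp_affine:
 fixes A :: "'a::euclidean_space => 'b::euclidean_space"
 assumes A: "bounded_linear A" shows "C_k k f ==> C_k k (\<lambda>z. f (A z + c))"
proof (induction k arbitrary: f)
 case 0
 have "continuous_on UNIV (\<lambda>z. A z + c)"
  by (intro continuous_on_add continuous_on_const linear_continuous_on A)
 then show ?case using 0 continuous_on_compose2[of UNIV f UNIV "\<lambda>z. A z + c"] by simp
next
 case (Suc k)
 \<comment> \<open>\<open>A v\<close> is expanded in the basis because \<open>C_k\<close> controls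
   partial derivatives along basis vectors only.\<close>
 let ?D = "\<lambda>z v. (\<Sum>b\<in>Basis. (A v \<bullet> b) *\<^sub>R partial_deriv b f (A z + c))"
 have "((\<lambda>z. f (A z + c)) has_derivative ?D z) (at z)" for z
 proof -
  note d = C_k_has_derivative[OF Suc.prems, of "A z + c"]
  have 1: "((\<lambda>z. A z + c) has_derivative A) (at z)"
   by (auto intro!: derivative_eq_intros bounded_linear_imp_has_derivative A)
  have "((f \<circ> (\<lambda>z. A z + c)) has_derivative ((\<lambda>v. partial_deriv v f (A z + c)) \<circ> A)) (at z)"
   by (rule diff_chain_at[OF 1]) (use d in simp)
  moreover have "partial_deriv (A v) f (A z + c) = ?D z v" for v
  proof -
   interpret L: bounded_linear "\<lambda>v. partial_deriv v f (A z + c)"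
    using d by (rule has_derivative_bounded_linear)
   have "A v = (\<Sum>b\<in>Basis. (A v \<bullet> b) *\<^sub>R b)" by (simp add: euclidean_representation)
   then have "partial_deriv (A v) f (A z + c) = partial_deriv (\<Sum>b\<in>Basis. (A v \<bullet> b) *\<^sub>R b) f (A z + c)" by simp
   then show ?thesis by (simp add: L.sum L.scaleR)
  qed
  ultimately show ?thesis by (simp add: o_def)
 qed
 then show ?case
 proof (rule C_k_SucI[where f'="?D"])
  fix v :: 'a
  show "C_k k (\<lambda>z. ?D z v)"
   by (rule C_k_sum, rule C_k_bounded_linear[OF bounded_linear_scaleR_right], rule Suc.IH, rule C_k_partial[OF Suc.prems])
 qed
qed

lemma C_k_comp_real:
 fixes g :: "real => real" and f :: "'a::euclidean_space => real"
 shows "C_k k g ==> C_k k f ==> C_k k (\<lambda>z. g (f z))"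
proof (induction k arbitrary: f g)
 case 0
 then show ?case using continuous_on_compose2[of UNIV g UNIV f] by simp
next
 case (Suc k)
 let ?D = "\<lambda>z v. partial_deriv 1 g (f z) * partial_deriv v f z"
 have "((\<lambda>z. g (f z)) has_derivative ?D z) (at z)" for z
 proof -
  note d = C_k_has_derivative[OF Suc.prems(1), of "f z"]
  have "((g \<circ> f) has_derivative ((\<lambda>v. partial_deriv v g (f z)) \<circ> (\<lambda>v. partial_deriv v f z))) (at z)"
   by (rule diff_chain_at[OF C_k_has_derivative[OF Suc.prems(2)] d])
  moreover
  have "partial_deriv a g (f z) = partial_deriv 1 g (f z) * a" for a
  proof -
   interpret L: bounded_linear "\<lambda>v. partial_deriv v g (f z)"
    using d by (rule has_derivative_bounded_linear)
   have "partial_deriv (a *\<^sub>R 1) g (f z) = a *\<^sub>R partial_deriv 1 g (f z)" by (rule L.scaleR)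
   then show ?thesis by (simp add: mult.commute)
  qed
  then have "(\<lambda>v. partial_deriv v g (f z)) \<circ> (\<lambda>v. partial_deriv v f z) = ?D z"
   unfolding o_def by (rule ext)
  ultimately show ?thesis by (simp only: o_def)
 qed
 then show ?case
 proof (rule C_k_SucI[where f'="?D"])
  fix v :: 'a assume "v \<in> Basis"
  then show "C_k k (\<lambda>z. partial_deriv 1 g (f z) * partial_deriv v f z)"
   using C_k_bilinear[OF bounded_bilinear_mult Suc.IH[OF C_k_partial[OF Suc.prems(1)] C_k_Suc_D[OF Suc.prems(2)]]
    C_k_partial[OF Suc.prems(2)]] by simp
 qed
qed

lemma smoothI:
 assumes "\<And>z. (f has_derivative f' z) (at z)" "\<And>v. v \<in> Basis ==> smooth (\<lambda>z. f' z v)"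
 shows "smooth f"
 unfolding smooth_def
proof
 fix k show "C_k k f"
  by (rule C_k_Suc_D[OF C_k_SucI[OF assms(1)]]) (use assms(2) in \<open>simp_all add: smooth_def\<close>)
qed

lemma smooth_has_derivative:
 "smooth f ==> (f has_derivative (\<lambda>v. partial_deriv v f z)) (at z)"
 by (rule C_k_has_derivative[of 0]) (simp add: smooth_def del: C_k.simps)

lemma smooth_continuous: "smooth f ==> continuous_on UNIV f"
 by (rule C_k_continuous[of 0]) (simp add: smooth_def del: C_k.simps)

lemma smooth_const [simp]: "smooth (\<lambda>z. c)" by (simp add: smooth_def)
lemma smooth_add: "smooth f ==> smooth g ==> smooth (\<lambda>z. f z + g z)" using C_k_add[of _ f g] by (simp add: smooth_def)
lemma smooth_sum: "(\<And>i. i \<in> I ==> smooth (f i)) ==> smooth (\<lambda>z. \<Sum>i\<in>I. f i z)" using C_k_sum[of I _ f] by (simp add: smooth_def)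
lemma smooth_bounded_linear: "bounded_linear L ==> smooth f ==> smooth (\<lambda>z. L (f z))" using C_k_bounded_linear[of L _ f] by (simp add: smooth_def)
lemma smooth_bilinear: "bounded_bilinear L ==> smooth f ==> smooth g ==> smooth (\<lambda>z. L (f z) (g z))" using C_k_bilinear[of L _ f g] by (simp add: smooth_def)
lemma smooth_id: "smooth (\<lambda>z. z)" by (simp add: smooth_def C_k_id)
lemma smooth_comp_affine: "bounded_linear A ==> smooth f ==> smooth (\<lambda>z. f (A z + c))" using C_k_comp_affine[of A _ f c] by (simp add: smooth_def)
lemma smooth_comp_real: "smooth g ==> smooth f ==> smooth (\<lambda>z. g (f z))" for g :: "real => real" using C_k_comp_real[of _ g f] by (simp add: smooth_def)
lemma smooth_mult: "smooth f ==> smooth g ==> smooth (\<lambda>z. f z * g z)" for f g :: "_ => real" using smooth_bilinear[OF bounded_bilinear_mult, of f g] by simp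
lemma smooth_scaleR: "smooth f ==> smooth g ==> smooth (\<lambda>z. f z *\<^sub>R g z)" using smooth_bilinear[OF bounded_bilinear_scaleR, of f g] by simp
lemma smooth_minus: "smooth f ==> smooth (\<lambda>z. - f z)" using smooth_bounded_linear[OF bounded_linear_minus[OF bounded_linear_ident], of f] by simp
lemma smooth_diff: "smooth f ==> smooth g ==> smooth (\<lambda>z. f z - g z)"
 using smooth_add[of f "\<lambda>z. - g z"] smooth_minus[of g] by simp
lemma smooth_inner: "smooth f ==> smooth g ==> smooth (\<lambda>z. f z \<bullet> g z)" using smooth_bilinear[OF bounded_bilinear_inner, of f g] by simp

lemma smooth_partial_Basis: "smooth f ==> v \<in> Basis ==> smooth (partial_deriv v f)"
 unfolding smooth_def using C_k_partial[of _ f v] by simp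

lemma smooth_partial: assumes "smooth f" shows "smooth (partial_deriv v f)"
proof -
 have "partial_deriv v f = (\<lambda>z. \<Sum>b\<in>Basis. (v \<bullet> b) *\<^sub>R partial_deriv b f z)"
 proof
  fix z
  interpret L: bounded_linear "\<lambda>v. partial_deriv v f z"
   using smooth_has_derivative[OF assms] by (rule has_derivative_bounded_linear)
  have "partial_deriv v f z = partial_deriv (\<Sum>b\<in>Basis. (v \<bullet> b) *\<^sub>R b) f z"
   by (simp add: euclidean_representation)
  then show "partial_deriv v f z = (\<Sum>b\<in>Basis. (v \<bullet> b) *\<^sub>R partial_deriv b f z)" by (simp add: L.sum L.scaleR)
 qed
 moreover have "smooth (\<lambda>z. \<Sum>b\<in>Basis. (v \<bullet> b) *\<^sub>R partial_deriv b f z)"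
  by (intro smooth_sum smooth_scaleR smooth_const smooth_partial_Basis assms)
 ultimately show ?thesis by simp
qed

lemma smooth_line:
 assumes "smooth f"
 shows "((\<lambda>h. f (x + h *\<^sub>R v)) has_vector_derivative partial_deriv v f (x + h *\<^sub>R v)) (at h within S)"
proof -
 interpret L: bounded_linear "\<lambda>w. partial_deriv w f (x + h *\<^sub>R v)"
  using smooth_has_derivative[OF assms] by (rule has_derivative_bounded_linear)
 have 1: "((\<lambda>h. x + h *\<^sub>R v) has_derivative (\<lambda>d. d *\<^sub>R v)) (at h)"
  by (auto intro!: derivative_eq_intros)
 have "((f \<circ> (\<lambda>h. x + h *\<^sub>R v)) has_derivative ((\<lambda>w. partial_deriv w f (x + h *\<^sub>R v)) \<circ> (\<lambda>d. d *\<^sub>R v))) (at h)"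
  by (rule diff_chain_at[OF 1]) (rule smooth_has_derivative[OF assms])
 then show ?thesis
  by (auto simp: has_vector_derivative_def o_def L.scaleR intro: has_derivative_at_withinI)
qed

text \<open>The second difference of \<open>f\<close> along \<open>v\<close> and \<open>w\<close> is
  symmetric in the two directions, and two applications of the mean value theorem identify it with
  \<open>h * h\<close> times a mixed derivative at a nearby point, in either order.\<close>

lemma smooth_partial_commute:
 fixes f :: "'a::euclidean_space => real"
 assumes "smooth f"
 shows "partial_deriv v (partial_deriv w f) x = partial_deriv w (partial_deriv v f) x"
proof -
 have mv: "\<exists>a b. 0 < a \<and> a < h \<and> 0 < b \<and> b < h \<and>
  f (x + h *\<^sub>R v + h *\<^sub>R w) - f (x + h *\<^sub>R v) - f (x + h *\<^sub>R w) + f x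
   = h * h * partial_deriv w (partial_deriv v f) (x + a *\<^sub>R v + b *\<^sub>R w)" if "h > 0" for h v w
 proof -
  define g where "g = (\<lambda>t. f ((x + h *\<^sub>R w) + t *\<^sub>R v) - f (x + t *\<^sub>R v))"
  have "(g has_real_derivative (partial_deriv v f ((x + h *\<^sub>R w) + t *\<^sub>R v) - partial_deriv v f (x + t *\<^sub>R v))) (at t)" for t
   unfolding g_def has_real_derivative_iff_has_vector_derivative
   by (intro has_vector_derivative_diff smooth_line assms)
  from MVT2[OF \<open>h > 0\<close> this] obtain a where a: "0 < a" "a < h"
   "g h - g 0 = h * (partial_deriv v f ((x + h *\<^sub>R w) + a *\<^sub>R v) - partial_deriv v f (x + a *\<^sub>R v))" by auto
  define k where "k = (\<lambda>t. partial_deriv v f ((x + a *\<^sub>R v) + t *\<^sub>R w))"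
  have "(k has_real_derivative (partial_deriv w (partial_deriv v f) ((x + a *\<^sub>R v) + t *\<^sub>R w))) (at t)" for t
   unfolding k_def has_real_derivative_iff_has_vector_derivative
   by (intro smooth_line smooth_partial assms)
  from MVT2[OF \<open>h > 0\<close> this] obtain b where b: "0 < b" "b < h"
   "k h - k 0 = h * partial_deriv w (partial_deriv v f) (x + a *\<^sub>R v + b *\<^sub>R w)" by auto
  have "k h - k 0 = partial_deriv v f ((x + h *\<^sub>R w) + a *\<^sub>R v) - partial_deriv v f (x + a *\<^sub>R v)"
   by (simp add: k_def algebra_simps)
  then have "g h - g 0 = h * h * partial_deriv w (partial_deriv v f) (x + a *\<^sub>R v + b *\<^sub>R w)"
   using a b by simp
  moreover have "g h - g 0 = f (x + h *\<^sub>R v + h *\<^sub>R w) - f (x + h *\<^sub>R v) - f (x + h *\<^sub>R w) + f x"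
   by (simp add: g_def algebra_simps)
  ultimately show ?thesis using a b by metis
 qed
 define hh where "hh n = 1 / real (Suc n)" for n
 have hh: "hh n > 0" for n by (simp add: hh_def)
 have hh0: "hh \<longlonglongrightarrow> 0" unfolding hh_def by (rule LIMSEQ_Suc[OF lim_1_over_n])
 \<comment> \<open>\<open>Q\<close> packages the mean value statement so that the intermediate
   points can be chosen as sequences in \<open>n\<close>.\<close>
 define Q where "Q v w n a b \<longleftrightarrow> 0 < a \<and> a < hh n \<and> 0 < b \<and> b < hh n \<and>
  f (x + hh n *\<^sub>R v + hh n *\<^sub>R w) - f (x + hh n *\<^sub>R v) - f (x + hh n *\<^sub>R w) + f x
   = hh n * hh n * partial_deriv w (partial_deriv v f) (x + a *\<^sub>R v + b *\<^sub>R w)" for v w n a b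
 have "\<forall>n. \<exists>a b. Q v w n a b" for v w
  unfolding Q_def using mv[OF hh] by blast
 then have Q: "\<exists>a b. \<forall>n. Q v w n (a n) (b n)" for v w
  unfolding choice_iff .
 obtain a b where ab: "\<And>n. Q v w n (a n) (b n)" using Q by blast
 obtain c d where cd: "\<And>n. Q w v n (c n) (d n)" using Q by blast
 note ab = ab[unfolded Q_def] and cd = cd[unfolded Q_def]
 have eq: "partial_deriv w (partial_deriv v f) (x + a n *\<^sub>R v + b n *\<^sub>R w) =
  partial_deriv v (partial_deriv w f) (x + c n *\<^sub>R w + d n *\<^sub>R v)" for n
 proof -
  have "hh n * hh n * partial_deriv w (partial_deriv v f) (x + a n *\<^sub>R v + b n *\<^sub>R w) =
   hh n * hh n * partial_deriv v (partial_deriv w f) (x + c n *\<^sub>R w + d n *\<^sub>R v)"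
   using ab[of n] cd[of n] by (simp add: algebra_simps)
  then show ?thesis using hh[of n] by simp
 qed
 have z: "e \<longlonglongrightarrow> 0" if "\<And>n. 0 < e n \<and> e n < hh n" for e
  by (rule tendsto_sandwich[OF _ _ tendsto_const hh0]) (use that less_imp_le in \<open>auto intro!: always_eventually\<close>)
 have lim: "(\<lambda>n. g (x + e n *\<^sub>R p + e' n *\<^sub>R q)) \<longlonglongrightarrow> g x" if "smooth g" "e \<longlonglongrightarrow> 0" "e' \<longlonglongrightarrow> 0" for g :: "'a => real" and e e' p q
 proof -
  have "(\<lambda>n. x + e n *\<^sub>R p + e' n *\<^sub>R q) \<longlonglongrightarrow> x + 0 *\<^sub>R p + 0 *\<^sub>R q"
   by (intro tendsto_intros that)
  moreover have "isCont g x" using smooth_continuous[OF that(1)] by (simp add: continuous_on_eq_continuous_at)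
  ultimately show ?thesis using isCont_tendsto_compose by fastforce
 qed
 have "(\<lambda>n. partial_deriv w (partial_deriv v f) (x + a n *\<^sub>R v + b n *\<^sub>R w)) \<longlonglongrightarrow> partial_deriv w (partial_deriv v f) x"
  by (rule lim) (use ab in \<open>auto intro!: smooth_partial assms z\<close>)
 moreover have "(\<lambda>n. partial_deriv v (partial_deriv w f) (x + c n *\<^sub>R w + d n *\<^sub>R v)) \<longlonglongrightarrow> partial_deriv v (partial_deriv w f) x"
  by (rule lim) (use cd in \<open>auto intro!: smooth_partial assms z\<close>)
 ultimately show ?thesis unfolding eq using LIMSEQ_unique by blast
qed

section \<open>Bump and cutoff functions\<close>

definition flat :: "real poly => real => real" where
 "flat p t = (if t > 0 then poly p (1 / t) * exp (- (1 / t)) else 0)"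

lemma poly_times_exp_neg_tendsto: "((\<lambda>y::real. poly p y * exp (- y)) \<longlongrightarrow> 0) at_top"
proof -
 have "((\<lambda>y::real. \<Sum>i\<le>degree p. coeff p i * (y ^ i / exp y)) \<longlongrightarrow> (\<Sum>i\<le>degree p. coeff p i * 0)) at_top"
  by (intro tendsto_sum tendsto_mult_left tendsto_power_div_exp_0)
 then show ?thesis
  by (simp add: poly_altdef exp_minus divide_simps sum_distrib_right sum_distrib_left field_simps)
qed

text \<open>In the variable y = 1/t differentiation is -y^2 d/dy, which turns p(y) exp(-y) into y^2
  (p - p') exp(-y). The family \<open>flat\<close> is therefore closed under differentiation, and
  its smoothness is an induction over all \<open>p\<close> at once.\<close>

lemma flat_deriv:
 "(flat p has_real_derivative flat ([:0, 0, 1:] * (p - pderiv p)) t) (at t)"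
proof -
 consider "t > 0" | "t < 0" | "t = 0" by linarith
 then show ?thesis
 proof cases
  case 1
  have "((\<lambda>t. poly p (1 / t) * exp (- (1 / t))) has_real_derivative
   poly ([:0, 0, 1:] * (p - pderiv p)) (1 / t) * exp (- (1 / t))) (at t)"
   using 1 by (auto intro!: derivative_eq_intros DERIV_chain2[OF poly_DERIV] simp: field_simps power2_eq_square)
  then have "(flat p has_real_derivative poly ([:0, 0, 1:] * (p - pderiv p)) (1 / t) * exp (- (1 / t))) (at t)"
   by (rule has_field_derivative_transform_within_open[where S="{0<..}"]) (use 1 in \<open>auto simp: flat_def\<close>)
  then show ?thesis using 1 by (simp add: flat_def)
 next
  case 2
  have "((\<lambda>t::real. 0::real) has_real_derivative 0) (at t)" by simp
  then have "(flat p has_real_derivative 0) (at t)"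
   by (rule has_field_derivative_transform_within_open[where S="{..<0}"]) (use 2 in \<open>auto simp: flat_def\<close>)
  then show ?thesis using 2 by (simp add: flat_def)
 next
  case 3
  \<comment> \<open>Substituting h = 1/y turns the difference quotient at 0 into y p(y) exp(-y),
    hence the polynomial \<open>pCons 0 p\<close> below.\<close>
  have "((\<lambda>h. flat p h / h) \<longlongrightarrow> 0) (at_right 0)"
   unfolding filterlim_at_right_to_top
  proof (rule Lim_transform_eventually[OF poly_times_exp_neg_tendsto[of "pCons 0 p"]])
   show "\<forall>\<^sub>F x in at_top. poly (pCons 0 p) x * exp (- x) = flat p (inverse x) / inverse x"
    using eventually_gt_at_top[of 0] by eventually_elim (auto simp: flat_def field_simps)
  qed
  moreover have "((\<lambda>h. flat p h / h) \<longlongrightarrow> 0) (at_left 0)"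
   by (rule tendsto_eventually) (auto simp: flat_def eventually_at_left_field intro!: exI[of _ "-1"])
  ultimately have "((\<lambda>h. flat p h / h) \<longlongrightarrow> 0) (at 0)"
   using filterlim_split_at by blast
  then show ?thesis using 3 by (simp add: DERIV_def flat_def)
 qed
qed

lemma smooth_flat: "smooth (flat p)"
proof -
 have "C_k k (flat p)" for k
 proof (induction k arbitrary: p)
  case 0
  then show ?case by (auto intro!: continuous_at_imp_continuous_on DERIV_isCont flat_deriv)
 next
  case (Suc k)
  show ?case
   by (rule C_k_SucI[where f'="\<lambda>z v. flat ([:0, 0, 1:] * (p - pderiv p)) z * v"])
    (use flat_deriv[of p] Suc[of "[:0, 0, 1:] * (p - pderiv p)"] in \<open>auto simp: has_field_derivative_def\<close>)
 qed
 then show ?thesis by (simp add: smooth_def)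
qed

text \<open>The normalized primitive of the bump \<open>b\<close>, which is positive on (0, 1) and
  zero elsewhere.\<close>

lemma smooth_step:
 obtains S :: "real => real" where "smooth S" "\<And>t. t \<le> 0 ==> S t = 0" "\<And>t. t \<ge> 1 ==> S t = 1"
  "\<And>t. 0 \<le> S t" "\<And>t. S t \<le> 1"
proof -
 define b where "b t = flat 1 t * flat 1 (1 - t)" for t
 have sb: "smooth b"
  unfolding b_def using smooth_comp_affine[OF bounded_linear_minus[OF bounded_linear_ident] smooth_flat, of 1 1]
  by (intro smooth_mult smooth_flat) (simp add: algebra_simps)
 have b0: "b t = 0" if "t \<le> 0 \<or> t \<ge> 1" for t using that by (auto simp: b_def flat_def)
 have bp: "b t > 0" if "0 < t" "t < 1" for t using that by (auto simp: b_def flat_def)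
 have bnn: "b t \<ge> 0" for t by (simp add: b_def flat_def)
 obtain B where B: "\<And>t. (B has_real_derivative b t) (at t)"
  using einterval_antiderivative[of "-\<infinity>" "\<infinity>" b] smooth_continuous[OF sb]
  by (auto simp: has_real_derivative_iff_has_vector_derivative continuous_on_eq_continuous_at)
 have B01: "B 0 < B 1"
 proof (rule DERIV_pos_imp_increasing_open[of 0 1 B])
  show "\<exists>y. (B has_real_derivative y) (at x) \<and> 0 < y" if "0 < x" "x < 1" for x
   using B[of x] bp[OF that] by blast
  show "continuous_on {0..1} B"
   by (intro continuous_at_imp_continuous_on ballI DERIV_isCont) (rule B)
 qed simp
 have mono: "B s \<le> B t" if "s \<le> t" for s t
  by (rule DERIV_nonneg_imp_nondecreasing[OF that]) (use B bnn in auto)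
 have lo: "B t = B 0" if "t \<le> 0" for t
 proof (cases "t = 0")
  case False
  then have neg: "t < 0" using that by simp
  obtain z where "t < z" "z < 0" "B 0 - B t = (0 - t) * b z"
   using MVT2[OF neg, of B b] B by blast
  then show ?thesis using b0[of z] by simp
 qed simp
 have hi: "B t = B 1" if "t \<ge> 1" for t
 proof (cases "t = 1")
  case False
  then have pos: "1 < t" using that by simp
  obtain z where "1 < z" "z < t" "B t - B 1 = (t - 1) * b z"
   using MVT2[OF pos, of B b] B by blast
  then show ?thesis using b0[of z] by simp
 qed simp
 define S where "S t = (B t - B 0) / (B 1 - B 0)" for t
 have "(S has_real_derivative (1 / (B 1 - B 0)) * b t) (at t)" for t
  using DERIV_cdivide[OF DERIV_diff[OF B[of t] DERIV_const[of "B 0"]], of "B 1 - B 0"] by (simp add: S_def[abs_def])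
 note dS = this[unfolded has_field_derivative_def]
 show ?thesis
 proof
  show "smooth S"
   by (rule smoothI[OF dS]) (intro smooth_mult smooth_const sb)
  show "S t = 0" if "t \<le> 0" for t using lo[OF that] by (simp add: S_def)
  show "S t = 1" if "t \<ge> 1" for t using hi[OF that] B01 by (simp add: S_def)
  show "0 \<le> S t" for t
   using mono[of 0 t] lo[of t] B01 by (cases "t \<le> 0") (auto simp: S_def)
  show "S t \<le> 1" for t
   using mono[of t 1] hi[of t] B01 by (cases "t \<ge> 1") (auto simp: S_def)
 qed
qed

text \<open>The cutoff is a function of the squared distance, so that it is smooth at the centre as
  well; \<open>q\<close> is at least 1 on the inner ball and at most 0 outside the outer
  one.\<close>

lemma smooth_cutoff:
 fixes x0 :: "'a::euclidean_space"
 assumes "0 \<le> r1" "r1 < r2"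
 obtains \<psi> :: "'a => real" where "smooth \<psi>" "\<And>x. x \<in> cball x0 r1 ==> \<psi> x = 1" "\<And>x. x \<notin> cball x0 r2 ==> \<psi> x = 0"
  "\<And>x. 0 \<le> \<psi> x" "\<And>x. \<psi> x \<le> 1"
proof -
 obtain S :: "real => real" where S: "smooth S" "\<And>t. t \<le> 0 ==> S t = 0" "\<And>t. t \<ge> 1 ==> S t = 1"
  "\<And>t. 0 \<le> S t" "\<And>t. S t \<le> 1" using smooth_step by blast
 have r: "r2^2 - r1^2 > 0" using assms by (simp add: power_strict_mono)
 define q where "q x = (1 / (r2^2 - r1^2)) * (r2^2 - (x - x0) \<bullet> (x - x0))" for x :: 'a
 have sq: "smooth q" unfolding q_def
  by (intro smooth_mult smooth_const smooth_diff smooth_inner smooth_id)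
 show ?thesis
 proof
  show "smooth (\<lambda>x. S (q x))" by (rule smooth_comp_real[OF S(1) sq])
  fix x
  have q: "q x = (r2^2 - (dist x0 x)^2) / (r2^2 - r1^2)"
   by (simp add: q_def dist_norm norm_minus_commute[of x0 x] power2_norm_eq_inner[symmetric])
  { assume "x \<in> cball x0 r1"
   then have "(dist x0 x)^2 \<le> r1^2" by (simp add: power_mono)
   then show "S (q x) = 1" using r by (intro S(3)) (simp add: q) }
  { assume "x \<notin> cball x0 r2"
   then have "(dist x0 x)^2 \<ge> r2^2" using assms by (simp add: power_mono)
   then show "S (q x) = 0" using r by (intro S(2)) (simp add: q divide_simps) }
 qed (use S in auto)
qed

lemma partial_deriv_zero_open:
 assumes "open U" "z \<in> U" "\<And>y. y \<in> U ==> f y = 0"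
 shows "partial_deriv v f z = 0"
proof -
 have "((\<lambda>y. 0) has_derivative (\<lambda>y. 0)) (at z)" by simp
 then have "(f has_derivative (\<lambda>y. 0)) (at z)"
  by (rule has_derivative_transform_within_open[OF _ assms(1,2)]) (use assms(3) in simp)
 then show ?thesis by (simp add: partial_deriv_eq)
qed

section \<open>Test functions and integrals of derivatives\<close>

lemma test_functionsI:
 assumes "smooth f" "compact K" "K \<subseteq> \<Omega>" "\<And>z. z \<notin> K ==> f z = 0"
 shows "f \<in> test_functions \<Omega>"
proof -
 have "closure {z. f z \<noteq> 0} \<subseteq> K"
  by (rule closure_minimal) (use assms compact_imp_closed in auto)
 moreover have "compact (closure {z. f z \<noteq> 0})"
  using compact_Int_closed[OF assms(2) closed_closure, of "{z. f z \<noteq> 0}"] calculation by (simp add: Int_absorb1)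
 ultimately show ?thesis using assms(1,3) by (simp add: test_functions_def smooth_def del: C_k.simps)
qed

lemma test_functionsD:
 assumes "f \<in> test_functions \<Omega>"
 obtains K where "smooth f" "compact K" "K \<subseteq> \<Omega>" "\<And>z. z \<notin> K ==> f z = 0"
proof
 show "z \<notin> closure {z. f z \<noteq> 0} ==> f z = 0" for z using closure_subset[of "{z. f z \<noteq> 0}"] by auto
qed (use assms in \<open>auto simp: test_functions_def smooth_def\<close>)

lemma partial_deriv_zero_outside:
 assumes "compact K" "\<And>z. z \<notin> K ==> f z = 0" "z \<notin> K"
 shows "partial_deriv v f z = 0"
 by (rule partial_deriv_zero_open[of "- K"]) (use assms compact_imp_closed in auto)

lemma integrable_compact_support:
 fixes f :: "'a::euclidean_space => 'b::euclidean_space"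
 assumes "continuous_on UNIV f" "compact K" "\<And>z. z \<notin> K ==> f z = 0"
 shows "L1 f"
proof -
 have "L1 (\<lambda>x. ind K x *\<^sub>R f x)"
  by (rule borel_integrable_compact[OF assms(2) continuous_on_subset[OF assms(1)]]) simp
 moreover have "(\<lambda>x. ind K x *\<^sub>R f x) = f" using assms(3) by (auto simp: indicator_def)
 ultimately show ?thesis by simp
qed

lemma integral_translate_lborel:
 fixes f :: "'a::euclidean_space => 'b::euclidean_space"
 assumes [measurable]: "Borel f"
 shows "integral\<^sup>L lborel (\<lambda>x. f (x + c)) = integral\<^sup>L lborel f"
proof -
 have "integral\<^sup>L (distr lborel borel ((+) c)) f = integral\<^sup>L lborel (\<lambda>x. f (c + x))"
  by (rule integral_distr) auto
 then show ?thesis by (simp add: lborel_distr_plus add.commute)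
qed

text \<open>By translation invariance every difference quotient has integral zero, and the quotients
  converge to the derivative under a common compactly supported bound.\<close>

lemma integral_partial_deriv:
 fixes f :: "'a::euclidean_space => real"
 assumes f: "smooth f" and K: "compact K" "\<And>z. z \<notin> K ==> f z = 0"
 shows "integral\<^sup>L lborel (partial_deriv v f) = 0"
proof -
 \<comment> \<open>\<open>K'\<close> is swept out by \<open>K\<close> moving back along
   \<open>v\<close> for times in [0, 1]; it contains the support of every difference quotient, as
   all steps \<open>h n\<close> are at most 1.\<close>
 define K' where "K' = (\<lambda>(x, t). x - t *\<^sub>R v) ` (K \<times> {0..1::real})"
 have cK': "compact K'" unfolding K'_def
  by (intro compact_continuous_image compact_Times K) (auto simp: case_prod_unfold intro!: continuous_intros)
 note cp = smooth_continuous[OF smooth_partial[OF f, of v]]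
 have "bounded (partial_deriv v f ` K)"
  by (intro compact_imp_bounded compact_continuous_image K continuous_on_subset[OF cp]) auto
 then obtain M where "\<And>z. z \<in> K ==> norm (partial_deriv v f z) \<le> M" by (auto simp: bounded_iff)
 then have M: "\<bar>partial_deriv v f z\<bar> \<le> max M 0" for z
  using partial_deriv_zero_outside[OF K, where z=z and v=v] by (cases "z \<in> K") force+
 have Mnn: "max M 0 \<ge> 0" by simp
 define h where "h n = 1 / real (Suc n)" for n
 have h: "0 < h n" "h n \<le> 1" for n by (auto simp: h_def)
 have hlim: "h \<longlonglongrightarrow> 0" unfolding h_def by (rule LIMSEQ_Suc[OF lim_1_over_n])
 define g where "g n x = (f (x + h n *\<^sub>R v) - f x) / h n" for n x
 have [measurable]: "Borel f" "Borel (partial_deriv v f)"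
  using smooth_continuous[OF f] cp by (auto intro: borel_measurable_continuous_onI)
 have [measurable]: "Borel (g n)" for n unfolding g_def by simp
 have "(\<lambda>n. integral\<^sup>L lborel (g n)) \<longlonglongrightarrow> integral\<^sup>L lborel (partial_deriv v f)"
 proof (rule integral_dominated_convergence[where w="\<lambda>x. ind K' x *\<^sub>R max M 0"])
  show "L1 (\<lambda>x. ind K' x *\<^sub>R max M 0)"
   by (rule borel_integrable_compact[OF cK']) auto
  show "AE x in lborel. (\<lambda>n. g n x) \<longlonglongrightarrow> partial_deriv v f x" (is "AE x in _. ?P x")
  proof (rule AE_I2)
   fix x
   have "((\<lambda>t. f (x + t *\<^sub>R v)) has_real_derivative partial_deriv v f (x + 0 *\<^sub>R v)) (at 0)"
    unfolding has_real_derivative_iff_has_vector_derivative by (rule smooth_line[OF f])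
   then have "((\<lambda>t. (f (x + t *\<^sub>R v) - f x) / t) \<longlongrightarrow> partial_deriv v f x) (at 0)"
    by (simp add: DERIV_def)
   moreover have "filterlim h (at 0) sequentially"
    using hlim h by (auto simp: filterlim_at intro!: always_eventually) (metis less_irrefl)
   ultimately show "?P x"
    unfolding g_def by (rule filterlim_compose)
  qed
  show "AE x in lborel. norm (g n x) \<le> ind K' x *\<^sub>R max M 0" for n
  proof (rule AE_I2)
   fix x
   obtain z where z: "0 < z" "z < h n" "f (x + h n *\<^sub>R v) - f (x + 0 *\<^sub>R v) = (h n - 0) * partial_deriv v f (x + z *\<^sub>R v)"
    using MVT2[OF h(1)[of n], of "\<lambda>t. f (x + t *\<^sub>R v)" "\<lambda>t. partial_deriv v f (x + t *\<^sub>R v)"] smooth_line[OF f, of x v _ UNIV]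
    by (auto simp: has_real_derivative_iff_has_vector_derivative)
   have g: "g n x = partial_deriv v f (x + z *\<^sub>R v)" using z h(1)[of n] by (simp add: g_def)
   show "norm (g n x) \<le> ind K' x *\<^sub>R max M 0"
   proof (cases "x + z *\<^sub>R v \<in> K")
    case True
    then have "x \<in> K'" unfolding K'_def using z h(2)[of n]
     by (intro image_eqI[of _ _ "(x + z *\<^sub>R v, z)"]) auto
    then show ?thesis using M by (simp add: g)
   next
    case False
    then show ?thesis using partial_deriv_zero_outside[OF K False] Mnn by (simp add: g)
   qed
  qed
 qed auto
 moreover have "integral\<^sup>L lborel (g n) = 0" for n
 proof -
  have i1: "L1 f" by (rule integrable_compact_support[OF smooth_continuous[OF f] K])
  have i2: "L1 (\<lambda>x. f (x + h n *\<^sub>R v))"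
  proof (rule integrable_compact_support)
   show "compact ((\<lambda>x. x - h n *\<^sub>R v) ` K)"
    by (intro compact_continuous_image K) (auto intro!: continuous_intros)
   show "f (z + h n *\<^sub>R v) = 0" if "z \<notin> (\<lambda>x. x - h n *\<^sub>R v) ` K" for z
    using that by (intro K(2)) (auto simp: image_iff)
   show "continuous_on UNIV (\<lambda>x. f (x + h n *\<^sub>R v))"
    by (rule continuous_on_compose2[OF smooth_continuous[OF f]]) (auto intro!: continuous_intros)
  qed
  have "integral\<^sup>L lborel (\<lambda>x. f (x + h n *\<^sub>R v) - f x) = 0"
   using integral_translate_lborel[of f "h n *\<^sub>R v"] by (simp add: LINT_diff[OF i2 i1])
  moreover have "g n = (\<lambda>x. (f (x + h n *\<^sub>R v) - f x) / h n)" by (simp add: g_def fun_eq_iff)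
  ultimately show ?thesis by simp
 qed
 ultimately have "(\<lambda>n. 0::real) \<longlonglongrightarrow> integral\<^sup>L lborel (partial_deriv v f)" by simp
 from LIMSEQ_unique[OF tendsto_const this] show ?thesis by simp
qed

section \<open>The Sobolev inequality and the Serrin condition\<close>

lemma Basis_real3: "(Basis :: R3 set) = {axis 1 1, axis 2 1, axis 3 1}"
 by (auto simp: Basis_vec_def UNIV_3)

lemma prod_Basis_real3: "(\<Prod>b\<in>(Basis :: R3 set). f b) = f (axis 1 1) * f (axis 2 1) * f (axis 3 1)"
 unfolding Basis_real3 by (simp add: axis_eq_axis mult.assoc)

abbreviation vec3 :: "real => real => real => R3" where "vec3 a b c \<equiv> vector [a, b, c]"

lemma prod_Basis_real_triple: "(\<Prod>b\<in>(Basis :: (real \<times> real \<times> real) set). f b) = f (1, 0, 0) * f (0, 1, 0) * f (0, 0, 1)"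
proof -
 have "(Basis :: (real \<times> real \<times> real) set) = {(1, 0, 0), (0, 1, 0), (0, 0, 1)}" by (auto simp: Basis_prod_def zero_prod_def)
 then have "(\<Prod>b\<in>(Basis :: (real \<times> real \<times> real) set). f b) = prod f {(1, 0, 0), (0, 1, 0), (0, 0, 1)}" by (rule arg_cong)
 also have "... = f (1, 0, 0) * f (0, 1, 0) * f (0, 0, 1)" by (simp add: mult.assoc)
 finally show ?thesis .
qed

lemma mem_box_triple: "(a, b, c) \<in> box (l1, l2, l3) (u1, u2, u3) \<longleftrightarrow>
  (l1 < a \<and> a < u1) \<and> (l2 < b \<and> b < u2) \<and> l3 < c \<and> c < (u3 :: real)" for a b c :: real
 by (auto simp: box_def Basis_prod_def zero_prod_def ball_Un)

lemma continuous_vec3: "continuous_on UNIV (\<lambda>p::real \<times> real \<times> real. vec3 (fst p) (fst (snd p)) (snd (snd p)))"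
proof -
 have "(\<lambda>p::real \<times> real \<times> real. vec3 (fst p) (fst (snd p)) (snd (snd p))) =
   (\<lambda>p. fst p *\<^sub>R axis 1 1 + fst (snd p) *\<^sub>R axis 2 1 + snd (snd p) *\<^sub>R axis 3 1)"
  by (auto simp: vec_eq_iff forall_3 axis_def fun_eq_iff)
 then show ?thesis by (simp only:) (intro continuous_intros)
qed

text \<open>Prepares Fubini one coordinate at a time: the image of Lebesgue measure on nested pairs
  agrees with \<open>lborel\<close> on boxes, which determines it.\<close>

lemma lborel_real3:
 "(lborel :: R3 measure) = distr lborel borel (\<lambda>p. vec3 (fst p) (fst (snd p)) (snd (snd p)))"
proof (rule lborel_eqI)
 fix l u :: "R3" assume lu: "\<And>b. b \<in> Basis ==> l \<bullet> b \<le> u \<bullet> b"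
 have le: "l $ i \<le> u $ i" for i using lu[of "axis i 1"] by (simp add: inner_axis axis_in_Basis_iff)
 have m: "(\<lambda>p. vec3 (fst p) (fst (snd p)) (snd (snd p))) \<in> measurable lborel borel"
  using borel_measurable_continuous_onI[OF continuous_vec3] by simp
 have pre: "(\<lambda>p. vec3 (fst p) (fst (snd p)) (snd (snd p))) -` box l u \<inter> space lborel
  = box (l$1, l$2, l$3) (u$1, u$2, u$3)"
  by (auto simp: mem_box_cart forall_3 mem_box_triple)
 have "emeasure (distr lborel borel (\<lambda>p. vec3 (fst p) (fst (snd p)) (snd (snd p)))) (box l u)
  = emeasure lborel (box (l$1, l$2, l$3) (u$1, u$2, u$3))"
  by (subst emeasure_distr[OF m]) (simp_all add: pre[simplified])
 also have "... = (\<Prod>b\<in>Basis. ((u$1, u$2, u$3) - (l$1, l$2, l$3)) \<bullet> b)"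
  by (rule emeasure_lborel_box) (use le in \<open>auto simp: Basis_prod_def\<close>)
 also have "... = (\<Prod>b\<in>Basis. (u - l) \<bullet> b)"
  by (simp add: prod_Basis_real3 inner_axis mult.assoc inner_diff_left prod_Basis_real_triple)
 finally show "emeasure (distr lborel borel (\<lambda>p. vec3 (fst p) (fst (snd p)) (snd (snd p)))) (box l u) = \<dots>" .
qed simp

lemma measurable_vec3[measurable (raw)]:
 assumes [measurable]: "a \<in> borel_measurable M" "b \<in> borel_measurable M" "c \<in> borel_measurable M"
 shows "(\<lambda>x. vec3 (a x) (b x) (c x)) \<in> borel_measurable M"
proof -
 have "(\<lambda>x. vec3 (a x) (b x) (c x)) = (\<lambda>x. a x *\<^sub>R axis 1 1 + b x *\<^sub>R axis 2 1 + c x *\<^sub>R axis 3 1)"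
  by (auto simp: vec_eq_iff forall_3 axis_def fun_eq_iff)
 moreover have "\<dots> \<in> borel_measurable M" by measurable
 ultimately show ?thesis by simp
qed

lemma nn_integral_real3:
 fixes f :: "R3 => ennreal"
 assumes [measurable]: "Borel f"
 shows "(\<integral>\<^sup>+x. f x \<partial>lborel) = (\<integral>\<^sup>+a. \<integral>\<^sup>+b. \<integral>\<^sup>+c. f (vec3 a b c) \<partial>lborel \<partial>lborel \<partial>lborel)"
proof -
 have "(\<integral>\<^sup>+x. f x \<partial>lborel) = (\<integral>\<^sup>+p. f (vec3 (fst p) (fst (snd p)) (snd (snd p))) \<partial>lborel)"
  by (subst lborel_real3, subst nn_integral_distr) (auto intro!: measurable_vec3 simp: borel_prod[symmetric])
 also have "... = (\<integral>\<^sup>+p. f (vec3 (fst p) (fst (snd p)) (snd (snd p))) \<partial>(lborel \<Otimes>\<^sub>M lborel2))"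
  by (simp add: lborel_prod)
 also have "... = (\<integral>\<^sup>+a. \<integral>\<^sup>+q. f (vec3 a (fst q) (snd q)) \<partial>lborel2 \<partial>lborel)"
 proof -
  have "sigma_finite_measure (lborel \<Otimes>\<^sub>M lborel :: (real \<times> real) measure)"
   unfolding lborel_prod by (rule sigma_finite_lborel)
  from sigma_finite_measure.nn_integral_fst[OF this, symmetric]
  show ?thesis by (rule trans) simp_all
 qed
 also have "... = (\<integral>\<^sup>+a. \<integral>\<^sup>+b. \<integral>\<^sup>+c. f (vec3 a b c) \<partial>lborel \<partial>lborel \<partial>lborel)"
  by (intro nn_integral_cong, subst lborel.nn_integral_fst[symmetric]) simp_all
 finally show ?thesis .
qed

text \<open>Cauchy-Schwarz in \<open>z\<close> for fixed \<open>x\<close> and \<open>y\<close>, then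
  in the pair \<open>(x, y)\<close>; the bound for the square of the inner integral is a function of
  \<open>y\<close> times a function of \<open>x\<close>, so its double integral factors.\<close>

lemma Loomis_Whitney:
 fixes A B C :: "real => real => ennreal"
 assumes [measurable]: "case_prod A \<in> borel_measurable lborel2"
  "case_prod B \<in> borel_measurable lborel2" "case_prod C \<in> borel_measurable lborel2"
 shows "(\<integral>\<^sup>+x. \<integral>\<^sup>+y. \<integral>\<^sup>+z. A y z * B x z * C x y \<partial>lborel \<partial>lborel \<partial>lborel)^2 \<le>
  (\<integral>\<^sup>+y. \<integral>\<^sup>+z. (A y z)^2 \<partial>lborel \<partial>lborel) * (\<integral>\<^sup>+x. \<integral>\<^sup>+z. (B x z)^2 \<partial>lborel \<partial>lborel)
   * (\<integral>\<^sup>+x. \<integral>\<^sup>+y. (C x y)^2 \<partial>lborel \<partial>lborel)"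
proof -
 define I where "I x y = (\<integral>\<^sup>+z. A y z * B x z \<partial>lborel)" for x y
 have mI[measurable]: "case_prod I \<in> borel_measurable lborel2"
  unfolding I_def by measurable
 have I2: "(I x y)^2 \<le> (\<integral>\<^sup>+z. (A y z)^2 \<partial>lborel) * (\<integral>\<^sup>+z. (B x z)^2 \<partial>lborel)" for x y
  unfolding I_def by (rule Cauchy_Schwarz_nn_integral) measurable
 have "(\<integral>\<^sup>+x. \<integral>\<^sup>+y. \<integral>\<^sup>+z. A y z * B x z * C x y \<partial>lborel \<partial>lborel \<partial>lborel)
  = (\<integral>\<^sup>+x. \<integral>\<^sup>+y. I x y * C x y \<partial>lborel \<partial>lborel)"
  unfolding I_def by (intro nn_integral_cong nn_integral_multc) measurable
 also have "... = (\<integral>\<^sup>+p. case_prod I p * case_prod C p \<partial>lborel2)"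
  by (subst lborel.nn_integral_fst[symmetric]) simp_all
 also have "...^2 \<le> (\<integral>\<^sup>+p. (case_prod I p)^2 \<partial>lborel2) * (\<integral>\<^sup>+p. (case_prod C p)^2 \<partial>lborel2)"
  by (rule Cauchy_Schwarz_nn_integral) measurable
 also have "(\<integral>\<^sup>+p. (case_prod C p)^2 \<partial>lborel2) = (\<integral>\<^sup>+x. \<integral>\<^sup>+y. (C x y)^2 \<partial>lborel \<partial>lborel)"
  by (subst lborel.nn_integral_fst[symmetric]) simp_all
 also have "(\<integral>\<^sup>+p. (case_prod I p)^2 \<partial>lborel2) = (\<integral>\<^sup>+x. \<integral>\<^sup>+y. (I x y)^2 \<partial>lborel \<partial>lborel)"
  by (subst lborel.nn_integral_fst[symmetric]) simp_all
 also have "... \<le> (\<integral>\<^sup>+x. \<integral>\<^sup>+y. (\<integral>\<^sup>+z. (A y z)^2 \<partial>lborel) * (\<integral>\<^sup>+z. (B x z)^2 \<partial>lborel) \<partial>lborel \<partial>lborel)"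
  by (intro nn_integral_mono I2)
 also have "... = (\<integral>\<^sup>+y. \<integral>\<^sup>+z. (A y z)^2 \<partial>lborel \<partial>lborel) * (\<integral>\<^sup>+x. \<integral>\<^sup>+z. (B x z)^2 \<partial>lborel \<partial>lborel)"
  by (subst nn_integral_multc, simp, subst nn_integral_cmult) auto
 finally show ?thesis by (simp add: mult_right_mono)
qed

text \<open>The fundamental theorem of calculus, started at a point to the left of the
  support.\<close>

lemma abs_le_nn_integral_deriv:
 fixes h h' :: "real => real"
 assumes d: "\<And>t. (h has_real_derivative h' t) (at t)" and c: "continuous_on UNIV h'"
  and z: "\<And>t. \<bar>t\<bar> > M ==> h t = 0"
 shows "ennreal \<bar>h t\<bar> \<le> (\<integral>\<^sup>+s. ennreal \<bar>h' s\<bar> \<partial>lborel)"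
proof -
 define a where "a = - \<bar>M\<bar> - \<bar>t\<bar> - 1"
 have a: "a \<le> t" "h a = 0" using z[of a] by (auto simp: a_def)
 have hb: "has_bochner_integral lborel (\<lambda>x. ind {a..t} x *\<^sub>R h' x) (h t - h a)"
  by (rule has_bochner_integral_FTC_Icc[OF a(1)])
   (use d c in \<open>auto simp: has_real_derivative_iff_has_vector_derivative[symmetric] intro: has_field_derivative_at_within continuous_on_subset\<close>)
 then have eq: "h t = (LBINT x. ind {a..t} x *\<^sub>R h' x)" and i: "L1 (\<lambda>x. ind {a..t} x *\<^sub>R h' x)"
  using a by (auto simp: has_bochner_integral_iff)
 have "ennreal \<bar>h t\<bar> \<le> ennreal (LBINT x. norm (ind {a..t} x *\<^sub>R h' x))"
  unfolding eq using integral_norm_bound[of lborel "\<lambda>x. ind {a..t} x *\<^sub>R h' x"] by (intro ennreal_leI) simp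
 also have "... = (\<integral>\<^sup>+x. ennreal (norm (ind {a..t} x *\<^sub>R h' x)) \<partial>lborel)"
  by (rule nn_integral_eq_integral[symmetric]) (use i in \<open>auto intro!: integrable_norm simp del: norm_scaleR\<close>)
 also have "... \<le> (\<integral>\<^sup>+s. ennreal \<bar>h' s\<bar> \<partial>lborel)"
  by (intro nn_integral_mono) (auto simp: indicator_def)
 finally show ?thesis .
qed

abbreviation pd :: "3 => (R3 => 'b::real_normed_vector) => R3 => 'b" where
 "pd j \<equiv> partial_deriv (axis j 1)"

abbreviation tri :: "R3 => (R3 => R3) => R3 => real" where
 "tri a g x \<equiv> \<Sum>j\<in>UNIV. a $ j * (a \<bullet> pd j g x)"

lemma Borel_component[measurable]: "Borel (\<lambda>w :: R3. w $ j)" by (intro borel_measurable_continuous_onI continuous_intros)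

lemma borel_measurable_smooth[measurable_dest]: "smooth f ==> f \<in> borel_measurable borel"
 by (intro borel_measurable_continuous_onI smooth_continuous)

lemma pd_pow4:
 fixes f :: "R3 => real"
 assumes "smooth f" shows "pd j (\<lambda>x. f x ^ 4) x = 4 * f x ^ 3 * pd j f x"
 by (subst partial_deriv_eq[OF has_derivative_power[OF smooth_has_derivative[OF assms]]])
  (simp add: algebra_simps)

lemma vec3_shift: "vec3 t b c = vec3 0 b c + t *\<^sub>R axis 1 1" "vec3 a t c = vec3 a 0 c + t *\<^sub>R axis 2 1"
 "vec3 a b t = vec3 a b 0 + t *\<^sub>R axis 3 1"
 by (auto simp: vec_eq_iff forall_3 axis_def)

text \<open>The one-dimensional bound on a line; the second part of \<open>e\<close> guarantees that
  a line parameter beyond \<open>M\<close> has left the support.\<close>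

lemma abs_le_line_integral:
 fixes g :: "R3 => real"
 assumes g: "smooth g" and K: "\<And>x. norm x > M ==> g x = 0"
  and e: "norm e = 1" "\<And>t. \<bar>t\<bar> \<le> norm (y + t *\<^sub>R e)"
 shows "ennreal \<bar>g (y + t *\<^sub>R e)\<bar> \<le> (\<integral>\<^sup>+s. ennreal \<bar>partial_deriv e g (y + s *\<^sub>R e)\<bar> \<partial>lborel)"
proof (rule abs_le_nn_integral_deriv[where M=M and h="\<lambda>t. g (y + t *\<^sub>R e)"])
 show "((\<lambda>t. g (y + t *\<^sub>R e)) has_real_derivative partial_deriv e g (y + t *\<^sub>R e)) (at t)" for t
  unfolding has_real_derivative_iff_has_vector_derivative by (rule smooth_line[OF g])
 show "continuous_on UNIV (\<lambda>t. partial_deriv e g (y + t *\<^sub>R e))"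
  by (rule continuous_on_compose2[OF smooth_continuous[OF smooth_partial[OF g]]]) (auto intro!: continuous_intros)
 show "g (y + t *\<^sub>R e) = 0" if "\<bar>t\<bar> > M" for t
  using e(2)[of t] that by (intro K) linarith
qed

lemma nn_integral_swap_lborel:
 fixes f :: "real => real => ennreal"
 assumes "case_prod f \<in> borel_measurable lborel2"
 shows "(\<integral>\<^sup>+x. \<integral>\<^sup>+y. f x y \<partial>lborel \<partial>lborel) = (\<integral>\<^sup>+y. \<integral>\<^sup>+x. f x y \<partial>lborel \<partial>lborel)"
 using lborel_pair.Fubini'[of f] assms by simp

lemma ennreal_sqrt_square: "G < \<infinity> ==> (ennreal (sqrt (enn2real G)))^2 = G"
 by (simp add: ennreal_power ennreal_enn2real)

text \<open>The Gagliardo-Nirenberg argument for \<open>g\<close> = f^4. Each of the three factors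
  f^2 of f^6 is at most the square root of the integral of a partial derivative of \<open>g\<close>
  along one axis; Loomis-Whitney combines the three, and Cauchy-Schwarz applied to 4 |f|^3 |d f|
  brings back the integral of f^6, which is then cancelled.\<close>

theorem Sobolev_inequality_real3:
 fixes f :: "R3 => real"
 assumes f: "smooth f" and K: "compact K" "\<And>x. x \<notin> K ==> f x = 0"
 shows "(LBINT x. f x ^ 6) \<le> 4096 * (LBINT x. (pd 1 f x)^2) * (LBINT x. (pd 2 f x)^2) * (LBINT x. (pd 3 f x)^2)"
proof -
 define g where "g x = f x ^ 4" for x
 have g4: "g = (\<lambda>x. f x * f x * (f x * f x))" by (simp add: g_def fun_eq_iff power4_eq_xxxx mult.assoc)
 have sg: "smooth g" unfolding g4 by (intro smooth_mult f)
 have dg: "pd j g x = 4 * f x ^ 3 * pd j f x" for j x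
  unfolding g_def[abs_def] by (rule pd_pow4[OF f])
 obtain M where M: "\<And>x. x \<in> K ==> norm x \<le> M" using compact_imp_bounded[OF K(1)] by (auto simp: bounded_iff)
 have gM: "g x = 0" if "norm x > M" for x
 proof -
  have "x \<notin> K" using M[of x] that by auto
  then show ?thesis using K(2) by (simp add: g_def)
 qed
 define H where "H j x = ennreal \<bar>pd j g x\<bar>" for j x
 have mH[measurable]: "Borel (H j)" for j
  unfolding H_def using borel_measurable_smooth[OF smooth_partial[OF sg]] by measurable
 define G1 where "G1 b c = (\<integral>\<^sup>+a. H 1 (vec3 a b c) \<partial>lborel)" for b c
 define G2 where "G2 a c = (\<integral>\<^sup>+b. H 2 (vec3 a b c) \<partial>lborel)" for a c
 define G3 where "G3 a b = (\<integral>\<^sup>+c. H 3 (vec3 a b c) \<partial>lborel)" for a b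
 have mG[measurable]: "case_prod G1 \<in> borel_measurable lborel2" "case_prod G2 \<in> borel_measurable lborel2"
  "case_prod G3 \<in> borel_measurable lborel2"
  unfolding G1_def G2_def G3_def by measurable
 have e: "norm (axis j (1::real) :: R3) = 1" for j by simp
 obtain N where N: "\<And>j x. \<bar>pd j g x\<bar> \<le> N"
 proof -
  have "\<exists>N. \<forall>x. \<bar>pd j g x\<bar> \<le> N" for j
  proof -
   have "bounded (pd j g ` K)"
    by (intro compact_imp_bounded compact_continuous_image K continuous_on_subset[OF smooth_continuous[OF smooth_partial[OF sg]]]) auto
   then obtain N where "\<And>z. z \<in> K ==> \<bar>pd j g z\<bar> \<le> N" by (auto simp: bounded_iff)
   moreover have "pd j g z = 0" if "z \<notin> K" for z
    by (rule partial_deriv_zero_outside[OF K(1) _ that]) (simp add: g_def K(2))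
   ultimately have "\<bar>pd j g z\<bar> \<le> max N 0" for z by (cases "z \<in> K") force+
   then show ?thesis by blast
  qed
  then obtain N where N: "\<And>j x. \<bar>pd j g x\<bar> \<le> N j" by metis
  have "\<bar>pd j g x\<bar> \<le> N 1 + N 2 + N 3" for j x
   using N[of j x] N[of 1 x] N[of 2 x] N[of 3 x] exhaust_3[of j] by (auto simp: abs_le_iff)
  then show ?thesis by (rule that)
 qed
 have H0: "H j x = 0" if "norm x > M" for j x
 proof -
  have "pd j g x = 0"
   by (rule partial_deriv_zero_open[of "- cball 0 M"]) (use gM that in \<open>auto intro: open_Compl\<close>)
  then show ?thesis by (simp add: H_def)
 qed
 \<comment> \<open>Finiteness matters because \<open>r\<close> takes the square root through
   \<open>enn2real\<close>, which sends infinity to 0.\<close>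
 have fin: "(\<integral>\<^sup>+t. H j (y + t *\<^sub>R axis j 1) \<partial>lborel) < \<infinity>" if y: "\<And>t. \<bar>t\<bar> \<le> norm (y + t *\<^sub>R axis j 1)" for j y
 proof -
  have "(\<integral>\<^sup>+t. H j (y + t *\<^sub>R axis j 1) \<partial>lborel) \<le> (\<integral>\<^sup>+t. ennreal N * ind {-M..M} t \<partial>lborel)"
  proof (rule nn_integral_mono)
   fix t
   show "H j (y + t *\<^sub>R axis j 1) \<le> ennreal N * ind {-M..M} t"
   proof (cases "\<bar>t\<bar> \<le> M")
    case True then have "t \<in> {-M..M}" by (simp add: abs_le_iff)
    then show ?thesis using N[of j "y + t *\<^sub>R axis j 1"] by (simp add: H_def ennreal_leI)
   next
    case False then show ?thesis using y[of t] by (subst H0) auto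
   qed
  qed
  also have "... = ennreal N * emeasure lborel {-M..M}" by (subst nn_integral_cmult_indicator) auto
  also have "... < \<infinity>" by (simp add: emeasure_lborel_Icc_eq ennreal_mult_less_top)
  finally show ?thesis .
 qed
 have coord: "\<bar>t\<bar> \<le> norm (y + t *\<^sub>R axis j 1)" if "y $ j = 0" for y :: "R3" and t j
  using component_le_norm_cart[of "y + t *\<^sub>R axis j 1" j] that by (simp add: axis_def)
 have finG: "G1 b c < \<infinity>" "G2 a c < \<infinity>" "G3 a b < \<infinity>" for a b c
  using fin[OF coord[where y="vec3 0 b c" and j=1]] fin[OF coord[where y="vec3 a 0 c" and j=2]] fin[OF coord[where y="vec3 a b 0" and j=3]]
  by (simp_all add: G1_def G2_def G3_def vec3_shift[symmetric])
 have le: "ennreal \<bar>g (vec3 a b c)\<bar> \<le> G1 b c" "ennreal \<bar>g (vec3 a b c)\<bar> \<le> G2 a c" "ennreal \<bar>g (vec3 a b c)\<bar> \<le> G3 a b" for a b c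
  using abs_le_line_integral[OF sg gM e coord[where y="vec3 0 b c" and j=1], where t=a]
   abs_le_line_integral[OF sg gM e coord[where y="vec3 a 0 c" and j=2], where t=b]
   abs_le_line_integral[OF sg gM e coord[where y="vec3 a b 0" and j=3], where t=c]
  by (simp_all add: G1_def G2_def G3_def H_def vec3_shift[symmetric])
 define r where "r G = ennreal (sqrt (enn2real G))" for G
 have [measurable]: "Borel r" unfolding r_def by measurable
 have root: "ennreal ((f x)^2) \<le> r G" if "ennreal \<bar>g x\<bar> \<le> G" "G < \<infinity>" for x G
 proof -
  have "\<bar>g x\<bar> \<le> enn2real G" using that
   by (metis abs_ge_zero enn2real_ennreal enn2real_mono infinity_ennreal_def)
  then have "((f x)^2)^2 \<le> enn2real G" by (simp add: g_def)
  then have "(f x)^2 \<le> sqrt (enn2real G)" by (simp add: real_le_rsqrt)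
  then show ?thesis unfolding r_def by (rule ennreal_leI)
 qed
 have f6: "ennreal (f x ^ 6) = ennreal ((f x)^2) * ennreal ((f x)^2) * ennreal ((f x)^2)" for x
  by (simp add: ennreal_mult'[symmetric] power_mult[symmetric] flip: power_add)
 have [measurable]: "Borel f" by (rule borel_measurable_smooth[OF f])
 define S where "S = (\<integral>\<^sup>+x. ennreal (f x ^ 6) \<partial>lborel)"
 define h where "h j = (\<integral>\<^sup>+x. H j x \<partial>lborel)" for j
 have "S = (\<integral>\<^sup>+a. \<integral>\<^sup>+b. \<integral>\<^sup>+c. ennreal (f (vec3 a b c) ^ 6) \<partial>lborel \<partial>lborel \<partial>lborel)"
  unfolding S_def by (rule nn_integral_real3) measurable
 also have "... \<le> (\<integral>\<^sup>+a. \<integral>\<^sup>+b. \<integral>\<^sup>+c. r (G1 b c) * r (G2 a c) * r (G3 a b) \<partial>lborel \<partial>lborel \<partial>lborel)"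
  unfolding f6 by (intro nn_integral_mono mult_mono root le finG) auto
 finally have "S^2 \<le> (\<integral>\<^sup>+a. \<integral>\<^sup>+b. \<integral>\<^sup>+c. r (G1 b c) * r (G2 a c) * r (G3 a b) \<partial>lborel \<partial>lborel \<partial>lborel)^2"
  by (intro power_mono) auto
 also have "... \<le> (\<integral>\<^sup>+b. \<integral>\<^sup>+c. (r (G1 b c))^2 \<partial>lborel \<partial>lborel) * (\<integral>\<^sup>+a. \<integral>\<^sup>+c. (r (G2 a c))^2 \<partial>lborel \<partial>lborel) * (\<integral>\<^sup>+a. \<integral>\<^sup>+b. (r (G3 a b))^2 \<partial>lborel \<partial>lborel)"
  by (rule Loomis_Whitney) measurable
 also have "... = (\<integral>\<^sup>+b. \<integral>\<^sup>+c. G1 b c \<partial>lborel \<partial>lborel) * (\<integral>\<^sup>+a. \<integral>\<^sup>+c. G2 a c \<partial>lborel \<partial>lborel) * (\<integral>\<^sup>+a. \<integral>\<^sup>+b. G3 a b \<partial>lborel \<partial>lborel)"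
  unfolding r_def ennreal_sqrt_square[OF finG(1)] ennreal_sqrt_square[OF finG(2)] ennreal_sqrt_square[OF finG(3)] ..
 also have "(\<integral>\<^sup>+a. \<integral>\<^sup>+b. G3 a b \<partial>lborel \<partial>lborel) = h 3"
  unfolding G3_def h_def by (rule nn_integral_real3[symmetric]) measurable
 also have "(\<integral>\<^sup>+a. \<integral>\<^sup>+c. G2 a c \<partial>lborel \<partial>lborel) = h 2"
  unfolding G2_def h_def by (subst nn_integral_real3, measurable, intro nn_integral_cong nn_integral_swap_lborel) measurable
 also have "(\<integral>\<^sup>+b. \<integral>\<^sup>+c. G1 b c \<partial>lborel \<partial>lborel) = h 1"
 proof -
  have "(\<integral>\<^sup>+b. \<integral>\<^sup>+c. G1 b c \<partial>lborel \<partial>lborel) = (\<integral>\<^sup>+b. \<integral>\<^sup>+a. \<integral>\<^sup>+c. H 1 (vec3 a b c) \<partial>lborel \<partial>lborel \<partial>lborel)"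
   unfolding G1_def by (intro nn_integral_cong nn_integral_swap_lborel) measurable
  also have "... = (\<integral>\<^sup>+a. \<integral>\<^sup>+b. \<integral>\<^sup>+c. H 1 (vec3 a b c) \<partial>lborel \<partial>lborel \<partial>lborel)"
   by (intro nn_integral_swap_lborel) measurable
  finally show ?thesis unfolding h_def by (subst nn_integral_real3) simp_all
 qed
 finally have S2: "S^2 \<le> h 1 * h 2 * h 3" .
 have cS: "L1 (\<lambda>x. f x ^ 6)"
  by (rule integrable_compact_support[OF _ K(1)]) (auto intro!: continuous_intros smooth_continuous[OF f] simp: K(2))
 have S': "S = ennreal (LBINT x. f x ^ 6)"
  unfolding S_def by (rule nn_integral_eq_integral[OF cS]) simp
 have iD: "L1 (\<lambda>x. (pd j f x)^2)" for j
  by (rule integrable_compact_support[OF _ K(1)])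
   (auto intro!: continuous_intros smooth_continuous[OF smooth_partial[OF f]] simp: partial_deriv_zero_outside[OF K])
 have [measurable]: "Borel (pd j f)" for j by (rule borel_measurable_smooth[OF smooth_partial[OF f]])
 have h2: "(h j)^2 \<le> ennreal (16 * (LBINT x. f x ^ 6) * (LBINT x. (pd j f x)^2))" for j
 proof -
  have "h j = (\<integral>\<^sup>+x. ennreal (\<bar>f x\<bar> ^ 3) * ennreal (4 * \<bar>pd j f x\<bar>) \<partial>lborel)"
   unfolding h_def H_def dg by (intro nn_integral_cong) (simp add: ennreal_mult'[symmetric] abs_mult power_abs ac_simps)
  also have "...^2 \<le> (\<integral>\<^sup>+x. (ennreal (\<bar>f x\<bar> ^ 3))^2 \<partial>lborel) * (\<integral>\<^sup>+x. (ennreal (4 * \<bar>pd j f x\<bar>))^2 \<partial>lborel)"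
   by (rule Cauchy_Schwarz_nn_integral) measurable
  also have "... = (\<integral>\<^sup>+x. ennreal (f x ^ 6) \<partial>lborel) * (\<integral>\<^sup>+x. ennreal (16 * (pd j f x)^2) \<partial>lborel)"
   by (simp add: ennreal_power power_mult_distrib flip: power_mult)
  also have "(\<integral>\<^sup>+x. ennreal (16 * (pd j f x)^2) \<partial>lborel) = ennreal (LBINT x. 16 * (pd j f x)^2)"
   by (rule nn_integral_eq_integral) (use iD in auto)
  finally show ?thesis using S' by (simp add: S_def ennreal_mult'[symmetric] ac_simps)
 qed
 define S0 where "S0 = (LBINT x. f x ^ 6)"
 define D where "D j = (LBINT x. (pd j f x)^2)" for j
 have nn: "S0 \<ge> 0" "D j \<ge> 0" for j unfolding S0_def D_def by (auto intro!: integral_nonneg_AE)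
 have hf: "h j < \<infinity>" for j
 proof -
  have "(h j)^2 < top" using h2[of j] by (rule le_less_trans) simp
  then show ?thesis by (cases "h j = top") (auto simp: power2_eq_square less_top)
 qed
 define k where "k j = enn2real (h j)" for j
 have hk: "h j = ennreal (k j)" "k j \<ge> 0" for j using hf[of j] by (auto simp: k_def ennreal_enn2real)
 have k2: "(k j)^2 \<le> 16 * S0 * D j" for j
  using h2[of j] nn hk(2)[of j] unfolding hk(1) S0_def[symmetric] D_def[symmetric] by (simp add: ennreal_power)
 have Sk: "S0^2 \<le> k 1 * k 2 * k 3"
  using S2 nn hk(2) unfolding hk(1) S' S0_def[symmetric] by (simp add: ennreal_power ennreal_mult'[symmetric])
 have "(S0^2)^2 \<le> (k 1 * k 2 * k 3)^2" using Sk by (intro power_mono) auto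
 also have "... = (k 1)^2 * (k 2)^2 * (k 3)^2" by (simp add: power_mult_distrib)
 also have "... \<le> (16 * S0 * D 1) * (16 * S0 * D 2) * (16 * S0 * D 3)"
  using nn by (intro mult_mono k2) auto
 \<comment> \<open>4096 is 16^3, one factor 16 from each use of \<open>k2\<close>.\<close>
 finally have "S0 ^ 3 * S0 \<le> S0 ^ 3 * (4096 * D 1 * D 2 * D 3)"
  by (simp add: power2_eq_square power3_eq_cube algebra_simps)
 then have "S0 \<le> 4096 * D 1 * D 2 * D 3"
  using nn by (cases "S0 = 0") (auto simp: mult_le_cancel_left)
 then show ?thesis unfolding S0_def D_def .
qed

section \<open>The form bound under the Serrin condition\<close>

lemma Youngs_inequality_three:
 fixes x y z :: real
 assumes "0 < \<alpha>" "0 < \<beta>" "0 < \<gamma>" "\<alpha> + \<beta> + \<gamma> = 1" "0 < x" "0 < y" "0 < z"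
 shows "x powr \<alpha> * y powr \<beta> * z powr \<gamma> \<le> \<alpha> * x + \<beta> * y + \<gamma> * z"
proof -
 \<comment> \<open>The last two factors are grouped into one weighted geometric mean, so that the
   two-term inequality is applied twice.\<close>
 define w where "w = y powr (\<beta> / (\<beta> + \<gamma>)) * z powr (\<gamma> / (\<beta> + \<gamma>))"
 have bg: "\<beta> + \<gamma> > 0" using assms by simp
 have "w \<le> \<beta> / (\<beta> + \<gamma>) * y + \<gamma> / (\<beta> + \<gamma>) * z"
  unfolding w_def by (rule Youngs_inequality_0) (use assms bg in \<open>auto simp: add_divide_distrib[symmetric]\<close>)
 then have w: "(\<beta> + \<gamma>) * w \<le> \<beta> * y + \<gamma> * z"
  using bg mult_left_mono[of w "\<beta> / (\<beta> + \<gamma>) * y + \<gamma> / (\<beta> + \<gamma>) * z" "\<beta> + \<gamma>"] by (simp add: distrib_left)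
 have wp: "w > 0" using assms by (simp add: w_def)
 have "x powr \<alpha> * w powr (\<beta> + \<gamma>) \<le> \<alpha> * x + (\<beta> + \<gamma>) * w"
  by (rule Youngs_inequality_0) (use assms wp in auto)
 moreover have "w powr (\<beta> + \<gamma>) = y powr \<beta> * z powr \<gamma>"
  using assms bg by (simp add: w_def powr_mult powr_powr)
 ultimately show ?thesis using w by (simp add: mult.assoc)
qed

text \<open>Hoelder splits |f|^2 G^2 into |f|^s, G^2 and G^6 with exponents 2/s, 2/s' and 1/s; by
  the Serrin condition these add up to 1 and leave the power 2 on G. Sobolev turns the G^6 factor
  into the power 3/s of the Dirichlet integral, and Young with exponents 3/s and 2/s' splits it off
  with an arbitrarily small coefficient.\<close>

lemma Serrin_form_bound_compact_support:
 fixes s s' \<delta> :: real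
 assumes s: "2 < s'" "2 / s' + 3 / s = 1" and \<delta>: "\<delta> > 0"
 obtains c where "c > 0" "\<And>(f :: R3 => R3) G K A. f \<in> borel_measurable borel ==> smooth G ==> compact K ==>
  (\<And>x. x \<notin> K ==> G x = 0) ==> A \<in> sets borel ==> L1 (\<lambda>x. ind A x * norm (f x) powr s) ==>
  L1 (\<lambda>x. ind A x * ((norm (f x))^2 * (G x)^2)) \<and>
  (LBINT x. ind A x * ((norm (f x))^2 * (G x)^2)) \<le>
   \<delta> * (\<Sum>j\<in>UNIV. LBINT x. (pd j G x)^2)
   + c * (1 + (LBINT x. ind A x * norm (f x) powr s)) powr (s' / s) * (LBINT x. (G x)^2)"
proof -
 have s3: "s > 3"
 proof -
  have "3 / s = 1 - 2 / s'" "2 / s' < 1" "2 / s' > 0" using s by (auto simp: field_simps)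
  then have "3 / s > 0" "3 / s < 1" by auto
  then show ?thesis by (auto simp: field_simps zero_less_divide_iff split: if_splits)
 qed
 \<comment> \<open>Chosen so that \<open>c powr (2 / s')\<close> is 4096^(1/s) times
   \<open>\<delta>\<close> to the power -3/s, which makes the constants cancel in the final Young
   inequality; 4096 is the Sobolev constant.\<close>
 define c where "c = (4096 powr (1 / s) * \<delta> powr (- (3 / s))) powr (s' / 2)"
 have c0: "c > 0" using \<delta> by (simp add: c_def)
 show ?thesis
 proof (rule that[OF c0])
  fix f :: "R3 => R3" and G :: "R3 => real" and K A
  assume [measurable]: "Borel f" "A \<in> sets borel" and G: "smooth G" and K: "compact K" "\<And>x. x \<notin> K ==> G x = 0"
   and iV: "L1 (\<lambda>x. ind A x * norm (f x) powr s)"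
  have [measurable]: "Borel G" by (rule borel_measurable_smooth[OF G])
  define V where "V = (LBINT x. ind A x * norm (f x) powr s)"
  define D where "D = (\<Sum>j\<in>UNIV. LBINT x. (pd j G x)^2)"
  define M where "M = (LBINT x. (G x)^2)"
  define S where "S = (LBINT x. G x ^ 6)"
  have iG: "L1 (\<lambda>x. G x ^ 6)" "L1 (\<lambda>x. (G x)^2)"
   by (rule integrable_compact_support[OF _ K(1)]; auto intro!: continuous_intros smooth_continuous[OF G] simp: K(2))+
  have nn: "V \<ge> 0" "M \<ge> 0" "(LBINT x. (pd j G x)^2) \<ge> 0" for j
   unfolding V_def M_def by (auto intro!: integral_nonneg_AE)
  then have D0: "D \<ge> 0" unfolding D_def by (intro sum_nonneg) auto
  have Dj: "(LBINT x. (pd j G x)^2) \<le> D" for j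
   unfolding D_def by (rule member_le_sum) (use nn in auto)
  have "S \<le> 4096 * (LBINT x. (pd 1 G x)^2) * (LBINT x. (pd 2 G x)^2) * (LBINT x. (pd 3 G x)^2)"
   unfolding S_def by (rule Sobolev_inequality_real3[OF G K])
  also have "... \<le> 4096 * D * D * D"
   by (intro mult_mono Dj) (use nn D0 in auto)
  finally have SD: "S \<le> 4096 * D ^ 3" by (simp add: power3_eq_cube mult.assoc)
  define h where "h x = ind A x * ((norm (f x))^2 * (G x)^2)" for x
  have hm[measurable]: "Borel h" unfolding h_def by measurable
  \<comment> \<open>\<open>M1\<close> and \<open>S1\<close> are strictly larger than the integrals
    \<open>M\<close> and \<open>S\<close>, and \<open>1 + V\<close> replaces \<open>V\<close>, so
    that the normalizations below never divide by zero.\<close>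
  have bound: "L1 h \<and> (LBINT x. h x) \<le>
    (1+V) powr (2 / s) * M1 powr (2 / s') * S1 powr (1 / s)" if "M < M1" "S < S1" "0 < M1" "0 < S1" for M1 S1
  proof -
   define X where "X = (1+V) powr (2 / s) * M1 powr (2 / s') * S1 powr (1 / s)"
   have X: "X > 0" using that nn by (simp add: X_def)
   have sum1: "2 / s + 2 / s' + 1 / s = 1" using s by simp
   \<comment> \<open>Hoelder is obtained pointwise from the three-term Young inequality for
     normalized factors; the normalization makes the integral of \<open>b\<close> at most
     \<open>X\<close>.\<close>
   define b where "b x = 2 / s * ((X / (1 + V)) * (ind A x * norm (f x) powr s)) + 2 / s' * ((X / M1) * (G x)^2) + 1 / s * ((X / S1) * G x ^ 6)" for x
   have hb: "h x \<le> b x" for x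
   proof (cases "x \<in> A \<and> norm (f x) \<noteq> 0 \<and> G x \<noteq> 0")
    case False
    have "h x = 0" using False by (auto simp: h_def)
    moreover have "b x \<ge> 0" unfolding b_def using s s3 X nn that
     by (intro add_nonneg_nonneg mult_nonneg_nonneg divide_nonneg_nonneg) auto
    ultimately show ?thesis by simp
   next
    case True
    then have p: "norm (f x) > 0" "\<bar>G x\<bar> > 0" by auto
    have G6: "G x ^ 6 = \<bar>G x\<bar> powr 6" "(G x)^2 = \<bar>G x\<bar> powr 2"
     using p powr_realpow[of "\<bar>G x\<bar>" 6] powr_realpow[of "\<bar>G x\<bar>" 2] by simp_all
    have Gp: "G x ^ 6 > 0" using p by simp
    have "((X / (1 + V)) * norm (f x) powr s) powr (2 / s) * ((X / M1) * (G x)^2) powr (2 / s') * ((X / S1) * G x ^ 6) powr (1 / s)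
     \<le> 2 / s * ((X / (1 + V)) * norm (f x) powr s) + 2 / s' * ((X / M1) * (G x)^2) + 1 / s * ((X / S1) * G x ^ 6)"
     by (rule Youngs_inequality_three) (use s s3 sum1 X nn that p Gp in \<open>auto intro!: mult_pos_pos divide_pos_pos\<close>)
    also have "... = b x" using True by (simp add: b_def)
    also have "((X / (1 + V)) * norm (f x) powr s) powr (2 / s) * ((X / M1) * (G x)^2) powr (2 / s') * ((X / S1) * G x ^ 6) powr (1 / s)
      = (X powr (2 / s) * X powr (2 / s') * X powr (1 / s)) / ((1+V) powr (2 / s) * M1 powr (2 / s') * S1 powr (1 / s))
      * (norm (f x) powr 2 * (\<bar>G x\<bar> powr (4 / s') * \<bar>G x\<bar> powr (6 / s)))"
    proof -
     have e: "(G x)\<^sup>2 powr (2 / s') = \<bar>G x\<bar> powr (4 / s')" "(G x ^ 6) powr (1 / s) = \<bar>G x\<bar> powr (6 / s)"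
      unfolding G6 powr_powr by simp_all
     show ?thesis using X nn that p s3 by (simp add: powr_mult powr_divide powr_powr e)
    qed
    also have "X powr (2 / s) * X powr (2 / s') * X powr (1 / s) = X"
     using X sum1 by (simp add: powr_add[symmetric])
    also have "\<bar>G x\<bar> powr (4 / s') * \<bar>G x\<bar> powr (6 / s) = \<bar>G x\<bar> powr 2"
    proof -
     have "4 / s' + 6 / s = 2 * (2 / s' + 3 / s)" by (simp add: distrib_left)
     also have "... = 2" unfolding s(2) by simp
     finally show ?thesis by (simp only: powr_add[symmetric])
    qed
    also have "X / ((1+V) powr (2 / s) * M1 powr (2 / s') * S1 powr (1 / s)) = 1" using X unfolding X_def by (intro divide_self) linarith
    finally have "1 * (norm (f x) powr 2 * \<bar>G x\<bar> powr 2) \<le> b x" .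
    moreover have "h x = 1 * (norm (f x) powr 2 * \<bar>G x\<bar> powr 2)" using True p by (simp add: h_def)
    ultimately show ?thesis by (simp only:)
   qed
   have ib: "L1 b" unfolding b_def using iV iG by auto
   have h0: "h x \<ge> 0" for x by (simp add: h_def)
   have ih: "L1 h"
    by (rule L1_bound[OF ib]) (use hb h0 in \<open>auto intro!: AE_I2 order_trans[OF hb abs_ge_self]\<close>)
   have "(LBINT x. h x) \<le> (LBINT x. b x)" by (rule integral_mono[OF ih ib hb])
   also have "... = 2 / s * ((X / (1 + V)) * V) + 2 / s' * ((X / M1) * M) + 1 / s * ((X / S1) * S)"
    unfolding b_def V_def M_def S_def using iV iG by (simp add: integral_add)
   also have "... \<le> 2 / s * X + 2 / s' * X + 1 / s * X"
   proof -
    have "X / (1 + V) * V \<le> X" "X / M1 * M \<le> X" "X / S1 * S \<le> X"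
     using X nn that by (auto simp: field_simps intro!: mult_left_mono)
    then show ?thesis using s s3 by (intro add_mono mult_left_mono) auto
   qed
   also have "... = (2 / s + 2 / s' + 1 / s) * X" by (simp only: distrib_right)
   also have "... = X" unfolding sum1 by simp
   finally show ?thesis using ih by (simp add: X_def)
  qed
  \<comment> \<open>All strict inequalities are paid for by one slack parameter \<open>t\<close>,
    which is removed at the end by letting it tend to 0.\<close>
  have lin: "(LBINT x. h x) \<le> \<delta> * (D + t) + c * (1 + V) powr (s' / s) * (M + t)" if t: "t > 0" for t
  proof -
   have S1: "S < 4096 * (D + t) ^ 3" using SD t D0 power_strict_mono[of D "D + t" 3] by linarith
   define a where "a = \<delta> * (D + t)"
   define b where "b = c * (1 + V) powr (s' / s) * (M + t)"
   have pos: "a > 0" "b > 0" "D + t > 0" "M + t > 0" "1 + V > 0" using \<delta> D0 t c0 nn by (auto simp: a_def b_def intro!: mult_pos_pos)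
   have "(LBINT x. h x) \<le> (1+V) powr (2 / s) * (M + t) powr (2 / s') * (4096 * (D + t) ^ 3) powr (1 / s)"
    using bound[of "M + t" "4096 * (D + t) ^ 3"] S1 t nn D0 by simp
   also have "(4096 * (D + t) ^ 3) powr (1 / s) = 4096 powr (1 / s) * (D + t) powr (3 / s)"
   proof -
    have "(D + t) ^ 3 = (D + t) powr 3" using powr_realpow[of "D + t" 3] pos by simp
    then show ?thesis by (simp add: powr_mult powr_powr)
   qed
   also have "(1+V) powr (2 / s) * (M + t) powr (2 / s') * (4096 powr (1 / s) * (D + t) powr (3 / s)) = a powr (3 / s) * b powr (2 / s')"
   proof -
    have "c powr (2 / s') = 4096 powr (1 / s) * \<delta> powr (- (3 / s))"
     using s \<delta> by (simp add: c_def powr_powr)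
    then have "a powr (3 / s) * b powr (2 / s') = (\<delta> powr (3 / s) * \<delta> powr (- (3 / s))) * ((1+V) powr (2 / s) * (M + t) powr (2 / s') * (4096 powr (1 / s) * (D + t) powr (3 / s)))"
     using pos \<delta> c0 s s3 by (simp add: a_def b_def powr_mult powr_powr)
    also have "\<delta> powr (3 / s) * \<delta> powr (- (3 / s)) = 1" using \<delta> by (simp add: powr_minus)
    finally show ?thesis by simp
   qed
   also have "... \<le> 3 / s * a + 2 / s' * b"
    by (rule Youngs_inequality_0) (use s s3 pos in auto)
   also have "... \<le> 1 * a + 1 * b"
    using s s3 pos by (intro add_mono mult_right_mono) auto
   finally show ?thesis by (simp add: a_def b_def)
  qed
  have "(LBINT x. h x) \<le> \<delta> * D + c * (1 + V) powr (s' / s) * M"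
  proof (rule field_le_epsilon)
   fix e :: real assume e: "e > 0"
   define L where "L = \<delta> + c * (1 + V) powr (s' / s)"
   have L: "L > 0" using \<delta> c0 by (simp add: L_def add_pos_nonneg)
   have "(LBINT x. h x) \<le> \<delta> * D + c * (1 + V) powr (s' / s) * M + L * (e / L)"
   proof -
    have eq: "\<delta> * (D + t) + k * (M + t) = \<delta> * D + k * M + (\<delta> + k) * t" for t k by (simp add: algebra_simps)
    show ?thesis using lin[of "e / L"] e L unfolding eq L_def[symmetric] by simp
   qed
   then show "(LBINT x. h x) \<le> \<delta> * D + c * (1 + V) powr (s' / s) * M + e" using L by simp
  qed
  moreover have "L1 h" using bound[of "M + 1" "\<bar>S\<bar> + 1"] nn by auto
  ultimately show "L1 (\<lambda>x. ind A x * ((norm (f x))^2 * (G x)^2)) \<and>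
  (LBINT x. ind A x * ((norm (f x))^2 * (G x)^2)) \<le>
   \<delta> * (\<Sum>j\<in>UNIV. LBINT x. (pd j G x)^2)
   + c * (1 + (LBINT x. ind A x * norm (f x) powr s)) powr (s' / s) * (LBINT x. (G x)^2)"
   unfolding h_def D_def V_def M_def by simp
 qed
qed

lemma integrable_bounded_mult:
 fixes h :: "'a::euclidean_space => 'b::euclidean_space" and w :: "'a => real"
 assumes h: "L1 h" and w: "Borel w" "\<And>x. \<bar>w x\<bar> \<le> M"
 shows "L1 (\<lambda>x. w x *\<^sub>R h x)"
proof (rule L1_bound[where f="\<lambda>x. M * norm (h x)"])
 show "L1 (\<lambda>x. M * norm (h x))" using h by auto
 show "(\<lambda>x. w x *\<^sub>R h x) \<in> borel_measurable lborel" using h w by auto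
 show "AE x in lborel. norm (w x *\<^sub>R h x) \<le> norm (M * norm (h x))"
  by (rule AE_I2) (use w(2) in \<open>auto simp: abs_mult intro!: mult_right_mono order_trans[OF w(2) abs_ge_self]\<close>)
qed

lemma L1_mult_bounded:
 fixes h w :: "'a::euclidean_space => real"
 shows "L1 h ==> Borel w ==> (\<And>x. \<bar>w x\<bar> \<le> M) ==> L1 (\<lambda>x. w x * h x)"
 using integrable_bounded_mult[of h w M] by simp

section \<open>Fourier series on a cube\<close>

locale box3 = fixes x0 :: "R3" and R :: real assumes R: "0 < R"
begin

text \<open>Half-open, so that its translates by \<open>2 * R\<close> along the axes tile the space.
  \<open>lat\<close> below is the lattice of frequencies whose waves are periodic under these
  translations.\<close>

definition "cube = {x::R3. \<forall>i. x0 $ i - R \<le> x $ i \<and> x $ i < x0 $ i + R}"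
definition "lat = {k::R3. \<forall>i. \<exists>m::int. k $ i = pi / R * of_int m}"
definition "vol = measure lborel cube"

lemma cube_measurable[measurable]: "cube \<in> sets borel"
proof -
 have "cube = (\<Inter>i\<in>UNIV. {x. x0 $ i - R \<le> x $ i} \<inter> {x. x $ i < x0 $ i + R})" by (auto simp: cube_def)
 also have "... \<in> sets borel"
  by (intro sets.finite_INT sets.Int borel_closed borel_open closed_Collect_le open_Collect_less continuous_intros) auto
 finally show ?thesis .
qed

lemma cube_subset_cbox: "cube \<subseteq> cbox (x0 - (\<chi> i. R)) (x0 + (\<chi> i. R))"
 by (auto simp: cube_def mem_box_cart less_imp_le)

lemma cball_subset_cube: "r < R ==> cball x0 r \<subseteq> cube"
proof
 fix x assume r: "r < R" and x: "x \<in> cball x0 r"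
 have "\<bar>x $ i - x0 $ i\<bar> < R" for i
 proof -
  have "\<bar>(x - x0) $ i\<bar> \<le> norm (x - x0)" by (rule component_le_norm_cart)
  then show ?thesis using x r by (simp add: dist_norm norm_minus_commute)
 qed
 then show "x \<in> cube" unfolding cube_def by (auto simp: abs_less_iff) (smt (verit))+
qed

lemma emeasure_cube: "emeasure lborel cube < \<infinity>"
 using emeasure_mono[OF cube_subset_cbox, of lborel] emeasure_lborel_cbox_finite
 by (auto intro: le_less_trans)

lemma vol_pos: "vol > 0"
proof -
 have sub: "box (x0 - (\<chi> i. R)) (x0 + (\<chi> i. R)) \<subseteq> cube" by (auto simp: cube_def mem_box_cart less_imp_le)
 have "measure lborel (box (x0 - (\<chi> i. R)) (x0 + (\<chi> i. R))) \<le> vol"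
  unfolding vol_def by (rule measure_mono_fmeasurable[OF sub]) (use emeasure_cube in \<open>auto simp: fmeasurable_def\<close>)
 moreover have "measure lborel (box (x0 - (\<chi> i. R)) (x0 + (\<chi> i. R))) > 0"
  using R by (subst measure_lborel_box) (auto simp: Basis_vec_def inner_axis prod_Basis_real3 intro!: prod_pos)
 ultimately show ?thesis by simp
qed

lemma integrable_cube_continuous:
 fixes g :: "R3 => 'b::euclidean_space"
 assumes "continuous_on UNIV g"
 shows "L1 (\<lambda>x. ind cube x *\<^sub>R g x)"
proof -
 have "L1 (\<lambda>x. ind (cbox (x0 - (\<chi> i. R)) (x0 + (\<chi> i. R))) x *\<^sub>R g x)"
  by (rule borel_integrable_compact[OF compact_cbox continuous_on_subset[OF assms]]) simp
 then have "L1 (\<lambda>x. ind cube x *\<^sub>R (ind (cbox (x0 - (\<chi> i. R)) (x0 + (\<chi> i. R))) x *\<^sub>R g x))"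
  by (rule integrable_mult_indicator[rotated]) simp
 moreover have "(\<lambda>x. ind cube x *\<^sub>R (ind (cbox (x0 - (\<chi> i. R)) (x0 + (\<chi> i. R))) x *\<^sub>R g x)) = (\<lambda>x. ind cube x *\<^sub>R g x)"
  using cube_subset_cbox by (auto simp: indicator_def fun_eq_iff)
 ultimately show ?thesis by simp
qed

lemma integrable_cube_continuous_real:
 fixes g :: "R3 => real"
 assumes "continuous_on UNIV g"
 shows "L1 (\<lambda>x. ind cube x * g x)"
 using integrable_cube_continuous[OF assms] by simp

lemma cis_inner_add: "cis (k \<bullet> x) * cis (\<eta> \<bullet> x) = cis ((k + \<eta>) \<bullet> x)"
 by (simp add: cis_mult inner_add_left)

lemma lat_diff: "k \<in> lat ==> \<eta> \<in> lat ==> k - \<eta> \<in> lat"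
 unfolding lat_def mem_Collect_eq
proof
 fix i assume "\<forall>i. \<exists>m::int. k $ i = pi / R * of_int m" "\<forall>i. \<exists>m::int. \<eta> $ i = pi / R * of_int m"
 then obtain m l :: int where "k $ i = pi / R * of_int m" "\<eta> $ i = pi / R * of_int l" by blast
 then have "(k - \<eta>) $ i = pi / R * of_int (m - l)" by (simp add: right_diff_distrib)
 then show "\<exists>m::int. (k - \<eta>) $ i = pi / R * of_int m" by blast
qed

lemma lat_zero: "0 \<in> lat" by (auto simp: lat_def intro!: exI[of _ 0])
lemma lat_uminus: "k \<in> lat ==> - k \<in> lat" using lat_diff[OF lat_zero] by simp
lemma lat_add: "k \<in> lat ==> \<eta> \<in> lat ==> k + \<eta> \<in> lat" using lat_diff[OF _ lat_uminus] by simp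

lemma countable_lat: "countable lat"
proof -
 have "lat \<subseteq> range (\<lambda>(a::int, b::int, c::int). vec3 (pi / R * a) (pi / R * b) (pi / R * c))"
 proof
  fix k :: "R3" assume "k \<in> lat"
  then obtain m :: "3 => int" where m: "\<And>i. k $ i = pi / R * of_int (m i)" unfolding lat_def by (auto simp: choice_iff)
  have "k = vec3 (pi / R * m 1) (pi / R * m 2) (pi / R * m 3)" by (simp add: vec_eq_iff forall_3 m)
  then show "k \<in> range (\<lambda>(a::int, b::int, c::int). vec3 (pi / R * a) (pi / R * b) (pi / R * c))"
   by (intro image_eqI[of _ _ "(m 1, m 2, m 3)"]) auto
 qed
 then show ?thesis by (rule countable_subset) simp
qed

text \<open>A shift by half a wavelength changes the sign of the exponential, while the shifted cube
  differs from the cube only by a slab moved by a full period. Hence the integral equals its own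
  negative.\<close>

lemma integral_cis:
 assumes "\<zeta> \<in> lat"
 shows "(LBINT x. ind cube x *\<^sub>R cis (\<zeta> \<bullet> x)) = (if \<zeta> = 0 then of_real vol else 0)"
proof (cases "\<zeta> = 0")
 case True
 have "(LBINT x. ind cube x *\<^sub>R (1::complex)) = of_real vol"
  using emeasure_cube by (simp add: vol_def scaleR_conv_of_real)
 then show ?thesis using True by simp
next
 case False
 then obtain j where j: "\<zeta> $ j \<noteq> 0" by (auto simp: vec_eq_iff)
 obtain k :: int where k: "\<zeta> $ j = pi / R * of_int k" using assms by (auto simp: lat_def)
 have k0: "k \<noteq> 0" using j k by auto
 \<comment> \<open>Half a wavelength in direction \<open>j\<close>: the phase changes by pi times
   the sign of \<open>k\<close>. As \<open>k\<close> is a nonzero integer, \<open>d\<close> is at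
   most \<open>R\<close> and thus shorter than the side of the cube.\<close>
 define d where "d = R / \<bar>of_int k\<bar>"
 have k1: "\<bar>real_of_int k\<bar> \<ge> 1" using k0 by linarith
 have d: "0 < d" "d \<le> R" using R k0 k1 by (auto simp: d_def divide_le_eq mult_le_cancel_left1)
 define e :: "R3" where "e = axis j 1"
 define L where "L = {x\<in>cube. x $ j < x0 $ j - R + d}"
 have Lm[measurable]: "L \<in> sets borel"
 proof -
  have "L = cube \<inter> {x. x $ j < x0 $ j - R + d}" by (auto simp: L_def)
  also have "... \<in> sets borel" by (intro sets.Int cube_measurable borel_open open_Collect_less continuous_intros)
  finally show ?thesis .
 qed
 \<comment> \<open>The translated cube loses the slab \<open>L\<close> at one face and gains the
   translate of \<open>L\<close> by the full period at the opposite face.\<close>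
 have ic: "ind cube (x - d *\<^sub>R e) = (ind cube x - ind L x + ind L (x - (2 * R) *\<^sub>R e) :: real)" for x
 proof -
  define P where "P \<longleftrightarrow> (\<forall>i. i \<noteq> j \<longrightarrow> x0 $ i - R \<le> x $ i \<and> x $ i < x0 $ i + R)"
  have cj: "x - t *\<^sub>R e \<in> cube \<longleftrightarrow> P \<and> x0 $ j - R \<le> x $ j - t \<and> x $ j - t < x0 $ j + R" for t
   unfolding cube_def P_def e_def by (auto simp: axis_def)
  have "x \<in> cube \<longleftrightarrow> P \<and> x0 $ j - R \<le> x $ j \<and> x $ j < x0 $ j + R" using cj[of 0] by simp
  moreover have "(x - (2 * R) *\<^sub>R e) $ j = x $ j - 2 * R" by (simp add: e_def)
  ultimately show ?thesis using cj[of d] cj[of "2 * R"] d R by (auto simp: indicator_def L_def)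
 qed
 define J where "J = (LBINT x. ind cube x *\<^sub>R cis (\<zeta> \<bullet> x))"
 have iC: "L1 (\<lambda>x. ind cube x *\<^sub>R cis (\<zeta> \<bullet> x))"
  by (intro integrable_cube_continuous continuous_intros)
 have iL: "L1 (\<lambda>x. ind L x *\<^sub>R cis (\<zeta> \<bullet> x))"
 proof -
  have "L1 (\<lambda>x. ind L x *\<^sub>R (ind cube x *\<^sub>R cis (\<zeta> \<bullet> x)))"
   by (rule integrable_mult_indicator[OF _ iC]) simp
  moreover have "(\<lambda>x. ind L x *\<^sub>R (ind cube x *\<^sub>R cis (\<zeta> \<bullet> x))) = (\<lambda>x. ind L x *\<^sub>R cis (\<zeta> \<bullet> x))"
   by (auto simp: L_def indicator_def fun_eq_iff)
  ultimately show ?thesis by simp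
 qed
 have cm[measurable]: "Borel (\<lambda>x::R3. cis (\<zeta> \<bullet> x))"
  by (intro borel_measurable_continuous_onI continuous_intros)
 have per: "cis (\<zeta> \<bullet> (x + (2 * R) *\<^sub>R e)) = cis (\<zeta> \<bullet> x)" for x
 proof -
  have "\<zeta> \<bullet> ((2 * R) *\<^sub>R e) = 2 * pi * of_int k" using R k by (simp add: e_def inner_axis)
  then have "cis (\<zeta> \<bullet> ((2 * R) *\<^sub>R e)) = 1" by (simp only:) (rule cis_multiple_2pi, simp)
  then show ?thesis by (simp only: inner_add_right cis_mult[symmetric] mult_1_right)
 qed
 have half: "cis (\<zeta> \<bullet> (x + d *\<^sub>R e)) = - cis (\<zeta> \<bullet> x)" for x
 proof -
  have "\<zeta> \<bullet> (d *\<^sub>R e) = pi * sgn (of_int k)" using R k k0 by (simp add: e_def inner_axis d_def sgn_if)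
  then have "cis (\<zeta> \<bullet> (d *\<^sub>R e)) = -1" using k0 by (auto simp: sgn_if complex_eq_iff)
  then show ?thesis by (simp only: inner_add_right cis_mult[symmetric] mult_minus1_right)
 qed
 have "- J = (LBINT x. ind cube x *\<^sub>R cis (\<zeta> \<bullet> (x + d *\<^sub>R e)))"
  unfolding half J_def by simp
 also have "... = (LBINT x. ind cube (x - d *\<^sub>R e) *\<^sub>R cis (\<zeta> \<bullet> x))"
  using integral_translate_lborel[of "\<lambda>x. ind cube (x - d *\<^sub>R e) *\<^sub>R cis (\<zeta> \<bullet> x)" "d *\<^sub>R e"] by simp
 also have "... = (LBINT x. (ind cube x *\<^sub>R cis (\<zeta> \<bullet> x) - ind L x *\<^sub>R cis (\<zeta> \<bullet> x)) + ind L (x - (2 * R) *\<^sub>R e) *\<^sub>R cis (\<zeta> \<bullet> x))"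
  unfolding ic by (simp add: scaleR_add_left scaleR_diff_left)
 also have "... = J - (LBINT x. ind L x *\<^sub>R cis (\<zeta> \<bullet> x)) + (LBINT x. ind L (x - (2 * R) *\<^sub>R e) *\<^sub>R cis (\<zeta> \<bullet> x))"
 proof -
  have "L1 (\<lambda>x. ind L (x - (2 * R) *\<^sub>R e) *\<^sub>R cis (\<zeta> \<bullet> x))"
  proof -
   have "integrable (distr lborel borel ((+) (- ((2 * R) *\<^sub>R e)))) (\<lambda>x. ind L x *\<^sub>R cis (\<zeta> \<bullet> x))"
    unfolding lborel_distr_plus by (rule iL)
   then have "L1 (\<lambda>x. ind L (- ((2 * R) *\<^sub>R e) + x) *\<^sub>R cis (\<zeta> \<bullet> (- ((2 * R) *\<^sub>R e) + x)))"
    by (subst (asm) integrable_distr_eq) simp_all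
   moreover have "cis (\<zeta> \<bullet> (- ((2 * R) *\<^sub>R e) + x)) = cis (\<zeta> \<bullet> x)" for x
    using per[of "- ((2 * R) *\<^sub>R e) + x"] by simp
   ultimately show ?thesis by simp
  qed
  then show ?thesis using iC iL unfolding J_def by (simp add: LINT_add LINT_diff)
 qed
 also have "(LBINT x. ind L (x - (2 * R) *\<^sub>R e) *\<^sub>R cis (\<zeta> \<bullet> x)) = (LBINT x. ind L x *\<^sub>R cis (\<zeta> \<bullet> (x + (2 * R) *\<^sub>R e)))"
  using integral_translate_lborel[of "\<lambda>x. ind L (x - (2 * R) *\<^sub>R e) *\<^sub>R cis (\<zeta> \<bullet> x)" "(2 * R) *\<^sub>R e"] by simp
 finally have "J = 0" unfolding per by simp
 then show ?thesis using False by (simp add: J_def)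
qed

section \<open>Finite Parseval identity and Bessel's inequality\<close>

lemma integral_cis_poly_square:
 assumes F: "finite F" "F \<subseteq> lat"
 shows "(LBINT x. ind cube x * (cmod (fsum F c x))^2) = vol * (\<Sum>k\<in>F. (cmod (c k))^2)"
proof -
 have i: "L1 (\<lambda>x. (c k * cnj (c \<eta>)) * (ind cube x *\<^sub>R cis ((k - \<eta>) \<bullet> x)))" for k \<eta>
  by (intro integrable_mult_right integrable_cube_continuous continuous_intros)
 have "complex_of_real (LBINT x. ind cube x * (cmod (fsum F c x))^2)
  = (LBINT x. of_real (ind cube x * (cmod (fsum F c x))^2))"
  by (rule integral_complex_of_real[symmetric])
 also have "... = (LBINT x. (\<Sum>k\<in>F. \<Sum>\<eta>\<in>F. (c k * cnj (c \<eta>)) * (ind cube x *\<^sub>R cis ((k - \<eta>) \<bullet> x))))"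
 proof (rule LINT_cong[OF refl])
  fix x
  have "complex_of_real ((cmod (fsum F c x))^2) = (fsum F c x) * (\<Sum>\<eta>\<in>F. cnj (c \<eta>) * cis (- (\<eta> \<bullet> x)))"
   unfolding complex_norm_square by (simp add: cis_cnj)
  also have "... = (\<Sum>k\<in>F. \<Sum>\<eta>\<in>F. (c k * cnj (c \<eta>)) * cis ((k - \<eta>) \<bullet> x))"
  proof -
   have e: "cis ((k - \<eta>) \<bullet> x) = cis (k \<bullet> x) * cis (- (\<eta> \<bullet> x))" for k \<eta> by (simp add: cis_mult inner_diff_left)
   show ?thesis unfolding e sum_product by (intro sum.cong refl) (simp only: ac_simps)
  qed
  finally show "complex_of_real (ind cube x * (cmod (fsum F c x))^2) =
   (\<Sum>k\<in>F. \<Sum>\<eta>\<in>F. (c k * cnj (c \<eta>)) * (ind cube x *\<^sub>R cis ((k - \<eta>) \<bullet> x)))"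
   by (cases "x \<in> cube") simp_all
 qed
 also have "... = (\<Sum>k\<in>F. \<Sum>\<eta>\<in>F. (c k * cnj (c \<eta>)) * (LBINT x. ind cube x *\<^sub>R cis ((k - \<eta>) \<bullet> x)))"
  using i by (simp add: LINT_sum L1_sum del: mult_scaleR_right)
 also have "... = (\<Sum>k\<in>F. \<Sum>\<eta>\<in>F. if k = \<eta> then of_real (vol * (cmod (c k))^2) else 0)"
 proof (intro sum.cong refl)
  fix k \<eta> assume "k \<in> F" "\<eta> \<in> F"
  then have l: "k - \<eta> \<in> lat" using F(2) lat_diff by blast
  show "(c k * cnj (c \<eta>)) * (LBINT x. ind cube x *\<^sub>R cis ((k - \<eta>) \<bullet> x)) = (if k = \<eta> then of_real (vol * (cmod (c k))^2) else 0)"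
   unfolding integral_cis[OF l] of_real_mult complex_norm_square by simp
 qed
 also have "... = complex_of_real (vol * (\<Sum>k\<in>F. (cmod (c k))^2))"
  using F(1) by (simp add: sum.delta sum_distrib_left)
 finally show ?thesis using of_real_eq_iff by blast
qed

text \<open>Functions are extended by zero, so that integrals over the cube become integrals over
  the space.\<close>

definition inL2 :: "(R3 => 'b::euclidean_space) => bool" where
 "inL2 h \<longleftrightarrow> h \<in> borel_measurable borel \<and> (\<forall>x. x \<notin> cube \<longrightarrow> h x = 0) \<and> L1 (\<lambda>x. (norm (h x))^2)"

lemma inL2_integrable:
 fixes h :: "R3 => 'b::euclidean_space"
 assumes "inL2 h" shows "L1 h"
proof (rule L1_bound)
 show "L1 (\<lambda>x. ind cube x + (norm (h x))^2)"
  using assms emeasure_cube by (intro L1_add integrable_real_indicator) (auto simp: inL2_def)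
 show "AE x in lborel. norm (h x) \<le> norm (ind cube x + (norm (h x))^2)"
 proof (rule AE_I2)
  fix x
  have "norm (h x) \<le> 1 + (norm (h x))^2" using zero_le_power2[of "norm (h x) - 1 / 2"] by (simp add: power2_eq_square algebra_simps)
  then show "norm (h x) \<le> norm (ind cube x + (norm (h x))^2 :: real)"
   using assms by (cases "x \<in> cube") (auto simp: inL2_def)
 qed
qed (use assms in \<open>auto simp: inL2_def\<close>)

definition Ft :: "(R3 => real) => R3 => complex" where
 "Ft h k = (LBINT x. h x *\<^sub>R cis (- (k \<bullet> x))) / vol"

text \<open>Completing the square in every coefficient. For \<open>c\<close> = \<open>Ft h\<close>
  this yields Bessel's inequality; for general \<open>c\<close> it says that the Fourier
  coefficients are the best choice.\<close>

lemma residual: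
 assumes F: "finite F" "F \<subseteq> lat" and h: "inL2 h"
 shows "L1 (\<lambda>x. ind cube x * (cmod (of_real (h x) - (fsum F c x)))^2)" (is ?G1)
  and "(LBINT x. ind cube x * (cmod (of_real (h x) - (fsum F c x)))^2) =
   (LBINT x. (h x)^2) - vol * (\<Sum>k\<in>F. (cmod (Ft h k))^2) + vol * (\<Sum>k\<in>F. (cmod (c k - Ft h k))^2)" (is ?G2)
proof -
 define S where "S x = (fsum F c x)" for x
 have cS: "continuous_on UNIV S" unfolding S_def by (intro continuous_intros)
 have hm[measurable]: "Borel h" and h0: "\<And>x. x \<notin> cube ==> h x = 0" and h2: "L1 (\<lambda>x. (h x)^2)"
  using h by (auto simp: inL2_def)
 have ih: "L1 h" by (rule inL2_integrable[OF h])
 have [measurable]: "Borel (\<lambda>x. cis (- (k \<bullet> x)))" for k :: "R3"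
  by (intro borel_measurable_continuous_onI continuous_intros)
 have ihc: "L1 (\<lambda>x. h x *\<^sub>R cis (- (k \<bullet> x)))" for k
  by (rule L1_bound[OF ih]) auto
 have ihS: "L1 (\<lambda>x. h x *\<^sub>R cnj (S x))"
  unfolding S_def by (simp add: cis_cnj scaleR_sum_right) (auto intro!: L1_sum integrable_mult_right ihc simp flip: mult_scaleR_right)
 have iS: "L1 (\<lambda>x. ind cube x * (cmod (S x))^2)"
  by (intro integrable_cube_continuous_real continuous_intros cS)
 have eq: "ind cube x * (cmod (of_real (h x) - S x))^2 = (h x)^2 - 2 * Re (h x *\<^sub>R cnj (S x)) + ind cube x * (cmod (S x))^2" for x
 proof (cases "x \<in> cube")
  case True
  have "(cmod (of_real (h x) - S x))^2 = (h x)^2 - 2 * Re (h x *\<^sub>R cnj (S x)) + (cmod (S x))^2"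
   unfolding cmod_power2 by (simp add: power2_eq_square algebra_simps)
  then show ?thesis using True by simp
 qed (simp add: h0)
 show ?G1
  unfolding S_def[symmetric] eq using h2 ihS iS by (intro L1_add L1_diff integrable_mult_right integrable_Re)
 have "(LBINT x. h x *\<^sub>R cnj (S x)) = (\<Sum>k\<in>F. cnj (c k) * (of_real vol * Ft h k))"
 proof -
  have "(LBINT x. h x *\<^sub>R cnj (S x)) = (LBINT x. (\<Sum>k\<in>F. cnj (c k) * (h x *\<^sub>R cis (- (k \<bullet> x)))))"
   unfolding S_def by (simp add: cis_cnj scaleR_sum_right)
  also have "... = (\<Sum>k\<in>F. cnj (c k) * (of_real vol * Ft h k))"
   by (subst LINT_sum) (use ihc vol_pos in \<open>auto simp: Ft_def simp del: mult_scaleR_right\<close>)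
  finally show ?thesis .
 qed
 then have Re: "(LBINT x. Re (h x *\<^sub>R cnj (S x))) = vol * (\<Sum>k\<in>F. Re (cnj (c k) * Ft h k))"
  using integral_Re[OF ihS] by (simp add: sum_distrib_left algebra_simps)
 have "(LBINT x. ind cube x * (cmod (of_real (h x) - S x))^2) =
   (LBINT x. (h x)^2) - 2 * (vol * (\<Sum>k\<in>F. Re (cnj (c k) * Ft h k))) + vol * (\<Sum>k\<in>F. (cmod (c k))^2)"
  unfolding eq Re[symmetric] integral_cis_poly_square[OF F, symmetric] S_def[symmetric] using h2 ihS iS integrable_Re[OF ihS]
  by (simp add: LINT_add LINT_diff)
 also have "... = (LBINT x. (h x)^2) + vol * (\<Sum>k\<in>F. (cmod (c k))^2 - 2 * Re (cnj (c k) * Ft h k))"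
  by (simp add: sum_subtractf sum_distrib_left algebra_simps)
 also have "(\<Sum>k\<in>F. (cmod (c k))^2 - 2 * Re (cnj (c k) * Ft h k)) = (\<Sum>k\<in>F. (cmod (c k - Ft h k))^2 - (cmod (Ft h k))^2)"
  unfolding cmod_power2 by (intro sum.cong refl) (simp add: power2_eq_square algebra_simps)
 finally show ?G2
  by (simp add: S_def sum_subtractf right_diff_distrib)
qed

lemma Bessel:
 assumes "finite F" "F \<subseteq> lat" "inL2 h"
 shows "vol * (\<Sum>k\<in>F. (cmod (Ft h k))^2) \<le> (LBINT x. (h x)^2)"
proof -
 have "0 \<le> (LBINT x. ind cube x * (cmod (of_real (h x) - (fsum F (Ft h) x)))^2)"
  by (rule integral_nonneg_AE) simp
 then show ?thesis unfolding residual(2)[OF assms] by simp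
qed

section \<open>Density of trigonometric polynomials\<close>

inductive trigp :: "(R3 => complex) => bool" where
 cis: "k \<in> lat ==> trigp (\<lambda>x. a * cis (k \<bullet> x))"
| add: "trigp f ==> trigp g ==> trigp (\<lambda>x. f x + g x)"

lemma trigp_cmult: "trigp f ==> trigp (\<lambda>x. a * f x)"
proof (induction rule: trigp.induct)
 case (cis k b)
 then show ?case using trigp.cis[of k "a * b"] by (simp add: mult.assoc)
next
 case (add f g)
 then show ?case using trigp.add by (simp add: distrib_left)
qed

lemma trigp_mult_cis: "trigp f ==> k \<in> lat ==> trigp (\<lambda>x. cis (k \<bullet> x) * f x)"
proof (induction rule: trigp.induct)
 case (cis \<eta> b)
 have "(\<lambda>x. cis (k \<bullet> x) * (b * cis (\<eta> \<bullet> x))) = (\<lambda>x. b * cis ((k + \<eta>) \<bullet> x))"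
  by (simp only: cis_inner_add[symmetric] fun_eq_iff ac_simps simp_thms)
 then show ?case using trigp.cis[OF lat_add[OF cis(2,1)], of b] by simp
next
 case (add f g)
 then show ?case using trigp.add by (simp add: distrib_left)
qed

lemma trigp_mult: "trigp f ==> trigp g ==> trigp (\<lambda>x. f x * g x)"
proof (induction rule: trigp.induct)
 case (cis k a)
 then show ?case using trigp_cmult[OF trigp_mult_cis[of g k], of a] by (simp add: mult.assoc)
next
 case (add f f')
 then show ?case using trigp.add by (simp add: distrib_right)
qed

lemma trigp_const: "trigp (\<lambda>x. a)" using trigp.cis[OF lat_zero, of a] by simp

lemma trigp_sum: "finite I ==> (\<And>i. i \<in> I ==> trigp (f i)) ==> trigp (\<lambda>x. \<Sum>i\<in>I. f i x)"
 by (induction I rule: finite_induct) (auto intro: trigp_const trigp.add)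

text \<open>The inductive form suits products, the indexed form suits Parseval; coefficients are
  added on the union of the two index sets.\<close>

lemma trigp_finite_sum:
 "trigp g ==> \<exists>F c. finite F \<and> F \<subseteq> lat \<and> (\<forall>x. g x = (fsum F c x))"
proof (induction rule: trigp.induct)
 case (cis k a)
 then show ?case by (intro exI[of _ "{k}"] exI[of _ "\<lambda>_. a"]) simp
next
 case (add f g)
 obtain F c where A: "finite F \<and> F \<subseteq> lat \<and> (\<forall>x. f x = (fsum F c x))"
  using add.IH(1) by blast
 obtain G d where B: "finite G \<and> G \<subseteq> lat \<and> (\<forall>x. g x = (\<Sum>k\<in>G. d k * cis (k \<bullet> x)))"
  using add.IH(2) by blast
 from A B have *: "finite F" "F \<subseteq> lat" "\<And>x. f x = (fsum F c x)"
  "finite G" "G \<subseteq> lat" "\<And>x. g x = (\<Sum>k\<in>G. d k * cis (k \<bullet> x))" by simp_all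
 let ?c = "\<lambda>k. (if k \<in> F then c k else 0) + (if k \<in> G then d k else 0)"
 have "f x + g x = (\<Sum>k\<in>F \<union> G. ?c k * cis (k \<bullet> x))" for x
 proof -
  have "f x = (\<Sum>k\<in>F \<union> G. (if k \<in> F then c k else 0) * cis (k \<bullet> x))"
   unfolding *(3) by (rule sum.mono_neutral_cong_left) (use * in auto)
  moreover have "g x = (\<Sum>k\<in>F \<union> G. (if k \<in> G then d k else 0) * cis (k \<bullet> x))"
   unfolding *(6) by (rule sum.mono_neutral_cong_left) (use * in auto)
  ultimately show ?thesis by (simp only: distrib_right sum.distrib)
 qed
 then show ?case using * by (intro exI[of _ "F \<union> G"] exI[of _ ?c]) auto
qed

text \<open>Periodic functions factor through this map, and real polynomials in the real and
  imaginary parts of its coordinates are trigonometric polynomials.\<close>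

definition torus :: "R3 => complex^3" where
 "torus x = (\<chi> i. cis (pi / R * (x $ i)))"

lemma trigp_torus_component: "trigp (\<lambda>x. torus x $ i)" "trigp (\<lambda>x. cnj (torus x $ i))"
proof -
 have l: "axis i (pi / R) \<in> lat"
  by (auto simp: lat_def axis_def intro: exI[of _ 1] exI[of _ 0])
 show "trigp (\<lambda>x. torus x $ i)"
  using trigp.cis[OF l, of 1] by (simp add: torus_def inner_axis')
 show "trigp (\<lambda>x. cnj (torus x $ i))"
  using trigp.cis[OF lat_uminus[OF l], of 1] by (simp add: torus_def inner_axis' cis_cnj)
qed

lemma trigp_real_polynomial:
 "real_polynomial_function f ==> trigp (\<lambda>x. of_real (f (torus x)))"
proof (induction rule: real_polynomial_function.induct)
 case (linear f)
 \<comment> \<open>A real linear functional is expanded in the real and imaginary parts of the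
   coordinates, and these in the coordinates and their conjugates, which are exponentials.\<close>
 have "complex_of_real (f (torus x)) = (\<Sum>i\<in>UNIV. of_real (f (axis i 1) / 2) * (torus x $ i + cnj (torus x $ i))
   + of_real (f (axis i \<i>) / 2) * (- \<i> * (torus x $ i - cnj (torus x $ i))))" for x
 proof -
  interpret f: bounded_linear f by (rule linear)
  have "torus x = (\<Sum>i\<in>UNIV. Re (torus x $ i) *\<^sub>R axis i 1 + Im (torus x $ i) *\<^sub>R axis i \<i>)"
   unfolding vec_eq_iff
  proof
   fix j
   have "(\<Sum>i\<in>UNIV. Re (torus x $ i) *\<^sub>R axis i 1 + Im (torus x $ i) *\<^sub>R axis i \<i>) $ j = (\<Sum>i\<in>UNIV. if i = j then torus x $ i else 0)"
    unfolding sum_component by (intro sum.cong refl) (auto simp: axis_def complex_eq_iff)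
   then show "torus x $ j = (\<Sum>i\<in>UNIV. Re (torus x $ i) *\<^sub>R axis i 1 + Im (torus x $ i) *\<^sub>R axis i \<i>) $ j"
    by (simp add: sum.delta)
  qed
  then have "f (torus x) = f (\<Sum>i\<in>UNIV. Re (torus x $ i) *\<^sub>R axis i 1 + Im (torus x $ i) *\<^sub>R axis i \<i>)" by simp
  also have "... = (\<Sum>i\<in>UNIV. Re (torus x $ i) * f (axis i 1) + Im (torus x $ i) * f (axis i \<i>))"
   by (simp add: f.sum f.add f.scaleR)
  finally show ?thesis
   by (simp add: complex_eq_iff sum.distrib[symmetric] algebra_simps)
 qed
 moreover have "trigp (\<lambda>x. (\<Sum>i\<in>UNIV. of_real (f (axis i 1) / 2) * (torus x $ i + cnj (torus x $ i))
   + of_real (f (axis i \<i>) / 2) * (- \<i> * (torus x $ i + (- 1) * cnj (torus x $ i)))))"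
  by (intro trigp_sum trigp.add trigp_cmult trigp_torus_component) simp
 ultimately show ?case by simp
next
 case (const c)
 then show ?case by (rule trigp_const)
next
 case (add f g)
 then show ?case using trigp.add by simp
next
 case (mult f g)
 then show ?case using trigp_mult by simp
qed

end

context box3 begin

abbreviation "cbx \<equiv> cbox (x0 - (\<chi> i. R)) (x0 + (\<chi> i. R))"

lemma continuous_torus: "continuous_on S torus"
 unfolding torus_def by (intro continuous_on_vec_lambda continuous_intros)

text \<open>On the closed box distinct points are identified only if they lie on opposite faces,
  where the functions to be approximated vanish.\<close>

lemma torus_eq:
 assumes "x \<in> cbx" "y \<in> cbx" "torus x = torus y" "x \<noteq> y"
 shows "\<exists>i. \<bar>x $ i - x0 $ i\<bar> = R" (is ?G1) "\<exists>i. \<bar>y $ i - x0 $ i\<bar> = R"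
proof -
 obtain i where i: "x $ i \<noteq> y $ i" using assms(4) by (auto simp: vec_eq_iff)
 have "cis (pi / R * x $ i) = cis (pi / R * y $ i)" using assms(3) by (auto simp: torus_def vec_eq_iff)
 then have "exp (\<i> * of_real (pi / R * x $ i)) = exp (\<i> * of_real (pi / R * y $ i))" by (simp add: cis_conv_exp)
 then obtain n :: int where "\<i> * of_real (pi / R * x $ i) = \<i> * of_real (pi / R * y $ i) + (of_int (2 * n) * pi) * \<i>"
  using exp_eq by blast
 then have "\<i> * complex_of_real (pi / R * x $ i) = \<i> * complex_of_real (pi / R * y $ i + of_int (2 * n) * pi)" by (simp add: algebra_simps)
 then have "pi / R * x $ i = pi / R * y $ i + of_int (2 * n) * pi" by (simp only: mult_cancel_left complex_i_not_zero of_real_eq_iff simp_thms)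
 then have "pi * (x $ i) = pi * (y $ i + 2 * of_int n * R)" using R by (simp add: field_simps)
 then have eq: "x $ i - y $ i = 2 * of_int n * R" by simp
 have bx: "\<bar>x $ i - x0 $ i\<bar> \<le> R" "\<bar>y $ i - x0 $ i\<bar> \<le> R" using assms by (auto simp: mem_box_cart abs_le_iff algebra_simps)
 have n0: "n \<noteq> 0" using eq i by auto
 have "\<bar>2 * of_int n * R\<bar> \<le> 2 * R" unfolding eq[symmetric] using bx by linarith
 then have "\<bar>of_int n :: real\<bar> \<le> 1" using R by (simp add: abs_mult)
 then have "n = 1 \<or> n = -1" using n0 by linarith
 then have "\<bar>x $ i - x0 $ i\<bar> = R \<and> \<bar>y $ i - x0 $ i\<bar> = R" using eq bx R by auto
 then show ?G1 "\<exists>i. \<bar>y $ i - x0 $ i\<bar> = R" by blast+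
qed

text \<open>A function vanishing on the faces descends to the compact image of the box under
  \<open>torus\<close>, where Stone-Weierstrass provides a polynomial.\<close>

lemma trigp_uniform_approx:
 assumes g: "continuous_on UNIV g" and g0: "\<And>x. \<exists>i. \<bar>x $ i - x0 $ i\<bar> = R ==> g x = (0::real)" and "\<epsilon> > 0"
 shows "\<exists>t. trigp t \<and> (\<forall>x\<in>cbx. cmod (of_real (g x) - t x) < \<epsilon>)"
proof -
 define S where "S = torus ` cbx"
 \<comment> \<open>The choice of the preimage is immaterial: two preimages either coincide or both
   give the value 0.\<close>
 define f where "f z = g (SOME x. x \<in> cbx \<and> torus x = z)" for z
 have f: "f (torus x) = g x" if "x \<in> cbx" for x
 proof -
  have "\<exists>y. y \<in> cbx \<and> torus y = torus x" using that by blast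
  from someI_ex[OF this] have y: "(SOME y. y \<in> cbx \<and> torus y = torus x) \<in> cbx" "torus (SOME y. y \<in> cbx \<and> torus y = torus x) = torus x" by auto
  show ?thesis
  proof (cases "(SOME y. y \<in> cbx \<and> torus y = torus x) = x")
   case True then show ?thesis by (simp add: f_def)
  next
   case False
   then show ?thesis using torus_eq[OF y(1) that y(2) False] g0 by (simp add: f_def)
  qed
 qed
 have cS: "compact S" unfolding S_def by (intro compact_continuous_image continuous_torus compact_cbox)
 \<comment> \<open>Preimages of closed sets under \<open>f\<close> are images of compact sets under
   \<open>torus\<close>.\<close>
 have "continuous_on S f"
  unfolding continuous_on_closed_vimage[OF compact_imp_closed[OF cS]]
 proof (intro allI impI)
  fix V :: "real set" assume V: "closed V"
  have "f -` V \<inter> S = torus ` (g -` V \<inter> cbx)" using f by (auto simp: S_def)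
  moreover have "closed (g -` V)" using g V by (simp add: continuous_on_closed_vimage)
  then have "compact (g -` V \<inter> cbx)" by (simp add: closed_Int_compact)
  ultimately show "closed (f -` V \<inter> S)" by (simp add: compact_imp_closed compact_continuous_image continuous_torus)
 qed
 from Stone_Weierstrass_real_polynomial_function[OF cS this \<open>\<epsilon> > 0\<close>] obtain p
  where p: "real_polynomial_function p" "\<And>z. z \<in> S ==> \<bar>f z - p z\<bar> < \<epsilon>" by blast
 show ?thesis
 proof (intro exI[of _ "\<lambda>x. of_real (p (torus x))"] conjI ballI)
  show "trigp (\<lambda>x. complex_of_real (p (torus x)))" by (rule trigp_real_polynomial[OF p(1)])
  fix x assume x: "x \<in> cbx"
  then have "\<bar>g x - p (torus x)\<bar> < \<epsilon>" using p(2)[of "torus x"] f by (simp add: S_def)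
  then show "cmod (of_real (g x) - of_real (p (torus x))) < \<epsilon>"
   unfolding of_real_diff[symmetric] norm_of_real .
 qed
qed

definition dst :: "(R3 => real) => (R3 => complex) => real" where
 "dst h t = (LBINT x. ind cube x * (cmod (of_real (h x) - t x))^2)"

text \<open>Membership in the L^2 closure of the trigonometric polynomials.\<close>

definition apx :: "(R3 => real) => bool" where
 "apx h \<longleftrightarrow> inL2 h \<and> (\<forall>\<epsilon>>0. \<exists>t. trigp t \<and> dst h t < \<epsilon>)"

lemma dst_integrable:
 assumes "inL2 h" "trigp t" shows "L1 (\<lambda>x. ind cube x * (cmod (of_real (h x) - t x))^2)"
proof -
 obtain F c where F: "finite F" "F \<subseteq> lat" "\<forall>x. t x = (fsum F c x)"
  using trigp_finite_sum[OF assms(2)] by blast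
 show ?thesis using residual(1)[OF F(1,2) assms(1), of c] F(3) by simp
qed

lemma square_add_le: "norm (a + b) ^ 2 \<le> 2 * norm a ^ 2 + 2 * norm b ^ 2" for a b :: "'a::real_normed_vector"
proof -
 have "norm (a + b) ^ 2 \<le> (norm a + norm b) ^ 2" by (intro power_mono norm_triangle_ineq) simp
 also have "... \<le> 2 * norm a ^ 2 + 2 * norm b ^ 2"
  using zero_le_power2[of "norm a - norm b"] by (simp add: power2_eq_square algebra_simps)
 finally show ?thesis .
qed

lemma inL2_add:
 fixes h g :: "R3 => 'b::euclidean_space"
 assumes "inL2 h" "inL2 g" shows "inL2 (\<lambda>x. h x + g x)"
proof -
 have [measurable]: "Borel h" "Borel g" using assms by (auto simp: inL2_def)
 have "L1 (\<lambda>x. (norm (h x + g x))^2)"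
 proof (rule L1_bound)
  show "L1 (\<lambda>x. 2 * (norm (h x))^2 + 2 * (norm (g x))^2)" using assms by (auto simp: inL2_def)
  show "AE x in lborel. norm ((norm (h x + g x))^2) \<le> norm (2 * (norm (h x))^2 + 2 * (norm (g x))^2)"
   by (rule AE_I2) (simp add: square_add_le)
 qed measurable
 then show ?thesis using assms by (auto simp: inL2_def)
qed

lemma inL2_diff: "inL2 h ==> inL2 g ==> inL2 (\<lambda>x. h x - g x)" for h g :: "R3 => 'b::euclidean_space"
 using inL2_add[of h "\<lambda>x. - g x"] by (simp add: inL2_def)

lemma dst_triangle:
 assumes "inL2 h" "inL2 g" "trigp t"
 shows "dst h t \<le> 2 * (LBINT x. (h x - g x)^2) + 2 * dst g t"
proof -
 have i: "L1 (\<lambda>x. (h x - g x)^2)" using inL2_diff[OF assms(1,2)] by (simp add: inL2_def)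
 have "dst h t \<le> (LBINT x. 2 * (h x - g x)^2 + 2 * (ind cube x * (cmod (of_real (g x) - t x))^2))"
  unfolding dst_def
 proof (rule integral_mono)
  fix x
  have "(cmod (of_real (h x) - t x))^2 \<le> 2 * (cmod (of_real (h x - g x)))^2 + 2 * (cmod (of_real (g x) - t x))^2"
   using square_add_le[of "complex_of_real (h x - g x)" "of_real (g x) - t x"] by simp
  then show "ind cube x * (cmod (of_real (h x) - t x))^2 \<le> 2 * (h x - g x)^2 + 2 * (ind cube x * (cmod (of_real (g x) - t x))^2)"
   by (cases "x \<in> cube") (simp_all del: of_real_diff)
 qed (use assms i dst_integrable in auto)
 also have "... = 2 * (LBINT x. (h x - g x)^2) + 2 * dst g t"
  unfolding dst_def using i dst_integrable[OF assms(2,3)] by (simp add: LINT_add)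
 finally show ?thesis .
qed

lemma apx_limit:
 assumes h: "inL2 h" and "\<And>\<epsilon>. \<epsilon> > 0 ==> \<exists>g. apx g \<and> (LBINT x. (h x - g x)^2) < \<epsilon>"
 shows "apx h"
 unfolding apx_def
proof (intro conjI allI impI h)
 fix \<epsilon> :: real assume "\<epsilon> > 0"
 then obtain g where g: "apx g" "(LBINT x. (h x - g x)^2) < \<epsilon> / 4" using assms(2)[of "\<epsilon> / 4"] by auto
 then obtain t where t: "trigp t" "dst g t < \<epsilon> / 4" using \<open>\<epsilon> > 0\<close> unfolding apx_def by (metis zero_less_divide_iff zero_less_numeral)
 have "dst h t < \<epsilon>" using dst_triangle[OF h _ t(1), of g] g t by (auto simp: apx_def)
 then show "\<exists>t. trigp t \<and> dst h t < \<epsilon>" using t by blast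
qed

lemma apx_continuous:
 assumes g: "continuous_on UNIV g" and g0: "\<And>x. x \<notin> box (x0 - (\<chi> i. R)) (x0 + (\<chi> i. R)) ==> g x = (0::real)"
 shows "apx g"
 unfolding apx_def
proof (intro conjI allI impI)
 have gb: "g x = 0" if "x \<notin> cube" for x
 proof (rule g0)
  have "box (x0 - (\<chi> i. R)) (x0 + (\<chi> i. R)) \<subseteq> cube" by (auto simp: cube_def mem_box_cart less_imp_le)
  then show "x \<notin> box (x0 - (\<chi> i. R)) (x0 + (\<chi> i. R))" using that by blast
 qed
 have [measurable]: "Borel g" using g by (rule borel_measurable_continuous_onI)
 have "L1 (\<lambda>x. ind cube x * (g x)^2)" by (intro integrable_cube_continuous_real continuous_intros g)
 moreover have "(\<lambda>x. ind cube x * (g x)^2) = (\<lambda>x. (g x)^2)" using gb by (auto simp: indicator_def fun_eq_iff)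
 ultimately show i: "inL2 g" using gb by (simp add: inL2_def)
 fix \<epsilon> :: real assume "\<epsilon> > 0"
 define e where "e = sqrt (\<epsilon> / (2 * vol))"
 have e: "e > 0" "e^2 = \<epsilon> / (2 * vol)" using \<open>\<epsilon> > 0\<close> vol_pos by (auto simp: e_def)
 have "\<And>x. \<exists>i. \<bar>x $ i - x0 $ i\<bar> = R ==> g x = 0"
 proof (rule g0)
  fix x assume "\<exists>i. \<bar>x $ i - x0 $ i\<bar> = R"
  then obtain i where "\<bar>x $ i - x0 $ i\<bar> = R" by blast
  then have "\<not> (x0 $ i - R < x $ i \<and> x $ i < x0 $ i + R)" by linarith
  then show "x \<notin> box (x0 - (\<chi> i. R)) (x0 + (\<chi> i. R))" by (auto simp: mem_box_cart)
 qed
 from trigp_uniform_approx[OF g this e(1)] obtain t where t: "trigp t" "\<And>x. x \<in> cbx ==> cmod (of_real (g x) - t x) < e" by blast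
 have "dst g t \<le> (LBINT x. ind cube x * e^2)"
  unfolding dst_def
 proof (rule integral_mono)
  show "L1 (\<lambda>x. ind cube x * e^2)" by (intro integrable_cube_continuous_real continuous_intros)
  fix x show "ind cube x * (cmod (of_real (g x) - t x))^2 \<le> ind cube x * e^2"
  proof (cases "x \<in> cube")
   case True
   then have "cmod (of_real (g x) - t x) \<le> e" using t(2)[of x] cube_subset_cbox by (auto simp: less_imp_le)
   then show ?thesis using True by (simp add: power_mono)
  qed simp
 qed (rule dst_integrable[OF i t(1)])
 also have "... = vol * e^2" by (simp add: vol_def)
 also have "... < \<epsilon>" using \<open>\<epsilon> > 0\<close> vol_pos by (simp add: e(2))
 finally show "\<exists>t. trigp t \<and> dst g t < \<epsilon>" using t(1) by blast
qed

text \<open>Read off from the characterization of Lebesgue measurability by limits of continuous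
  functions off a negligible set.\<close>

lemma ex_continuous_approximation:
 fixes h :: "'a::euclidean_space => real"
 assumes "Borel h"
 shows "\<exists>c. (\<forall>n::nat. continuous_on UNIV (c n)) \<and> (AE x in lborel. (\<lambda>n. c n x) \<longlonglongrightarrow> h x)"
proof -
 have "h \<in> borel_measurable lebesgue" using assms by (intro measurable_completion) simp
 then have "h measurable_on UNIV" by (intro lebesgue_measurable_imp_measurable_on) auto
 then obtain N c where N: "negligible N" "\<And>n. continuous_on UNIV (c n)" "\<And>x. x \<notin> N ==> (\<lambda>n. c n x) \<longlonglongrightarrow> h x"
  by (auto simp: measurable_on_def)
 have "AE x in lebesgue. x \<notin> N" using N(1) by (simp add: negligible_iff_null_sets AE_not_in)
 then have "AE x in lborel. (\<lambda>n. c n x) \<longlonglongrightarrow> h x" unfolding AE_completion_iff by eventually_elim (rule N(3))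
 then show ?thesis using N(2) by blast
qed

text \<open>Clamping to [-k, k] makes the function bounded. The bounded function is an almost
  everywhere limit of continuous functions, which are clamped too and multiplied by
  \<open>\<psi>\<close> so that they vanish near the faces. Dominated convergence applies to both
  limits.\<close>

lemma apx_all:
 assumes h: "inL2 h" and h0: "\<And>x. x \<notin> cball x0 r ==> h x = (0::real)" and r: "r < R"
 shows "apx h"
proof -
 have hm[measurable]: "Borel h" and h2: "L1 (\<lambda>x. (h x)^2)" using h by (auto simp: inL2_def)
 \<comment> \<open>A radius strictly between the support and the faces; the maximum with 0 covers
   negative \<open>r\<close>.\<close>
 define q where "q = (max 0 r + R) / 2"
 have q: "max 0 r < q" "q < R" "0 \<le> max 0 r" using r R by (auto simp: q_def)
 obtain \<psi> :: "R3 => real" where \<psi>: "smooth \<psi>" "\<And>x. x \<in> cball x0 (max 0 r) ==> \<psi> x = 1" "\<And>x. x \<notin> cball x0 q ==> \<psi> x = 0" "\<And>x. 0 \<le> \<psi> x" "\<And>x. \<psi> x \<le> 1"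
  using smooth_cutoff[OF q(3,1), of x0] by blast
 have qB: "cball x0 q \<subseteq> box (x0 - (\<chi> i. R)) (x0 + (\<chi> i. R))"
 proof
  fix x assume x: "x \<in> cball x0 q"
  have "\<bar>x $ i - x0 $ i\<bar> < R" for i
   using component_le_norm_cart[of "x - x0" i] x q(2) by (simp add: dist_norm norm_minus_commute)
  then show "x \<in> box (x0 - (\<chi> i. R)) (x0 + (\<chi> i. R))" by (auto simp: mem_box_cart abs_less_iff algebra_simps)
 qed
 obtain c where c: "\<And>n::nat. continuous_on UNIV (c n)" "AE x in lborel. (\<lambda>n. c n x) \<longlonglongrightarrow> h x"
  using ex_continuous_approximation[OF hm] by blast
 define cl where "cl k y = max (- k) (min k y)" for k y :: real
 have clc: "continuous_on UNIV (\<lambda>x. cl k (f x))" if "continuous_on UNIV f" for k and f :: "R3 => real"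
  unfolding cl_def by (intro continuous_intros that)
 have cb: "\<bar>cl k y\<bar> \<le> k" "\<bar>cl k y\<bar> \<le> \<bar>y\<bar>" "\<bar>y - cl k y\<bar> \<le> \<bar>y\<bar>" if "k \<ge> 0" for k y using that by (auto simp: cl_def)
 have sq: "a^2 \<le> b^2" if "\<bar>a\<bar> \<le> b" for a b :: real using power_mono[OF that, of 2] by simp
 have sm: "\<exists>i. f i < \<epsilon>" if "f \<longlonglongrightarrow> 0" "\<epsilon> > 0" for f :: "nat => real" and \<epsilon>
  using order_tendstoD(2)[OF that] by (auto simp: eventually_sequentially)
 have clm[measurable]: "Borel (\<lambda>x. cl k (h x))" for k unfolding cl_def by measurable
 have i: "inL2 (\<lambda>x. cl k (h x))" if "k \<ge> 0" for k
 proof -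
  have "L1 (\<lambda>x. (cl k (h x))^2)"
   by (rule L1_bound[OF h2]) (use cb(2)[OF that] in \<open>auto intro: abs_le_square_iff[THEN iffD1]\<close>)
  then show ?thesis using h that by (auto simp: inL2_def cl_def)
 qed
 have "apx (\<lambda>x. cl k (h x))" if k: "k \<ge> 0" for k
 proof (rule apx_limit[OF i[OF k]])
  fix \<epsilon> :: real assume \<epsilon>: "\<epsilon> > 0"
  define g where "g n x = \<psi> x * cl k (c n x)" for n x
  have gc: "continuous_on UNIV (g n)" for n unfolding g_def by (intro continuous_intros clc c smooth_continuous \<psi>(1))
  have [measurable]: "Borel (g n)" for n by (rule borel_measurable_continuous_onI[OF gc])
  have "(\<lambda>n. LBINT x. (cl k (h x) - g n x)^2) \<longlonglongrightarrow> (LINT x|(lborel::R3 measure). 0)"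
  proof (rule integral_dominated_convergence[where w="\<lambda>x. (2 * k)^2 * ind cube x"])
   show "L1 (\<lambda>x. (2 * k)^2 * ind cube x)" using emeasure_cube by (intro integrable_mult_right integrable_real_indicator) auto
   show "AE x in lborel. (\<lambda>n. (cl k (h x) - g n x)^2) \<longlonglongrightarrow> 0"
    using c(2)
   proof eventually_elim
    case (elim x)
    have "(\<lambda>n. (cl k (h x) - g n x)^2) \<longlonglongrightarrow> (cl k (h x) - \<psi> x * cl k (h x))^2"
     unfolding g_def cl_def by (intro tendsto_intros elim)
    moreover have "cl k (h x) = \<psi> x * cl k (h x)" using \<psi>(2)[of x] h0[of x] k by (cases "x \<in> cball x0 r") (auto simp: cl_def)
    ultimately show ?case by simp
   qed
   show "AE x in lborel. norm ((cl k (h x) - g n x)^2) \<le> (2 * k)^2 * ind cube x" for n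
   proof (rule AE_I2)
    fix x
    have "\<bar>g n x\<bar> \<le> 1 * k" unfolding g_def abs_mult using \<psi>(4,5)[of x] by (intro mult_mono cb(1)[OF k]) auto
    then have "(cl k (h x) - g n x)^2 \<le> (2 * k)^2" using cb(1)[OF k, of "h x"] by (intro sq) linarith
    moreover have "h x = 0 \<and> \<psi> x = 0" if "x \<notin> cube" using that h subsetD[OF cball_subset_cube[OF q(2)], of x] \<psi>(3)[of x] by (simp only: inL2_def) blast
    ultimately show "norm ((cl k (h x) - g n x)^2) \<le> (2 * k)^2 * ind cube x"
     using k by (cases "x \<in> cube") (auto simp: g_def cl_def)
   qed
  qed simp_all
  then obtain n where "(LBINT x. (cl k (h x) - g n x)^2) < \<epsilon>" using sm[OF _ \<epsilon>] by auto
  moreover have "apx (g n)" by (rule apx_continuous[OF gc]) (use \<psi>(3) subsetD[OF qB] in \<open>unfold g_def, blast intro: mult_eq_0_iff[THEN iffD2]\<close>)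
  ultimately show "\<exists>g. apx g \<and> (LBINT x. (cl k (h x) - g x)^2) < \<epsilon>" by blast
 qed
 note ak = this
 show ?thesis
 proof (rule apx_limit[OF h])
  fix \<epsilon> :: real assume \<epsilon>: "\<epsilon> > 0"
  have "(\<lambda>n. LBINT x. (h x - cl (real n) (h x))^2) \<longlonglongrightarrow> (LINT x|(lborel::R3 measure). 0)"
  proof (rule integral_dominated_convergence[OF _ _ h2])
   show "AE x in lborel. (\<lambda>n. (h x - cl (real n) (h x))^2) \<longlonglongrightarrow> 0"
   proof (intro AE_I2 tendsto_eventually eventually_sequentiallyI)
    fix x n assume "n \<ge> nat \<lceil>\<bar>h x\<bar>\<rceil>"
    then show "(h x - cl (real n) (h x))^2 = 0" by (auto simp: cl_def nat_ceiling_le_eq abs_le_iff)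
   qed
  qed (use cb(3) in \<open>auto intro!: AE_I2 simp: abs_le_square_iff[symmetric]\<close>)
  then obtain n where "(LBINT x. (h x - cl (real n) (h x))^2) < \<epsilon>" using sm[OF _ \<epsilon>] by auto
  then show "\<exists>g. apx g \<and> (LBINT x. (h x - g x)^2) < \<epsilon>" using ak[of "real n"] by auto
 qed
qed

text \<open>By the best approximation property in \<open>residual\<close>, an approximating
  polynomial is beaten by the Fourier sum over every larger set of frequencies.\<close>

lemma completeness_real:
 assumes h: "inL2 h" "\<And>x. x \<notin> cball x0 r ==> h x = (0::real)" "r < R" and \<epsilon>: "\<epsilon> > 0"
 shows "\<exists>F0. finite F0 \<and> F0 \<subseteq> lat \<and> (\<forall>F. finite F \<and> F0 \<subseteq> F \<and> F \<subseteq> lat \<longrightarrow> dst h (fsum F (Ft h)) < \<epsilon>)"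
proof -
 obtain t where t: "trigp t" "dst h t < \<epsilon>" using apx_all[OF h] \<epsilon> unfolding apx_def by blast
 obtain F0 c where F0: "finite F0" "F0 \<subseteq> lat" "\<forall>x. t x = (\<Sum>k\<in>F0. c k * cis (k \<bullet> x))"
  using trigp_finite_sum[OF t(1)] by blast
 have "dst h (fsum F (Ft h)) < \<epsilon>" if F: "finite F" "F0 \<subseteq> F" "F \<subseteq> lat" for F
 proof -
  have "t x = (\<Sum>k\<in>F. (if k \<in> F0 then c k else 0) * cis (k \<bullet> x))" for x
   unfolding F0(3)[rule_format] by (rule sum.mono_neutral_cong_left) (use F in auto)
  then have "t = (\<lambda>x. \<Sum>k\<in>F. (if k \<in> F0 then c k else 0) * cis (k \<bullet> x))" by blast
  then have "dst h t \<ge> dst h (fsum F (Ft h))"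
   unfolding dst_def using residual(2)[OF F(1,3) h(1), of "Ft h"] residual(2)[OF F(1,3) h(1), of "\<lambda>k. if k \<in> F0 then c k else 0"] vol_pos
   by (simp add: sum_nonneg)
  then show ?thesis using t(2) by simp
 qed
 then show ?thesis using F0 by blast
qed

section \<open>Real vector-valued Fourier sums\<close>

definition T :: "R3 set => (R3 => 'b::euclidean_space) => (R3 => 'b) => R3 => 'b" where
 "T F p q x = (\<Sum>k\<in>F. cos (k \<bullet> x) *\<^sub>R p k + sin (k \<bullet> x) *\<^sub>R q k)"

text \<open>Without the usual factor 2: \<open>lat\<close> contains k together with -k, so every
  nonconstant wave occurs twice in a sum over a symmetric set.\<close>

definition Ac :: "(R3 => 'b::euclidean_space) => R3 => 'b" where
 "Ac h k = (1 / vol) *\<^sub>R (LBINT x. cos (k \<bullet> x) *\<^sub>R h x)"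

definition As :: "(R3 => 'b::euclidean_space) => R3 => 'b" where
 "As h k = (1 / vol) *\<^sub>R (LBINT x. sin (k \<bullet> x) *\<^sub>R h x)"

lemma T_has_derivative:
 "(T F p q has_derivative (\<lambda>v. T F (\<lambda>k. (k \<bullet> v) *\<^sub>R q k) (\<lambda>k. - ((k \<bullet> v) *\<^sub>R p k)) x)) (at x)"
 unfolding T_def
 by (auto intro!: derivative_eq_intros sum.cong simp: fun_eq_iff algebra_simps)

lemma smooth_T: "smooth (T F p q)"
proof -
 have "C_k k (T F p q)" for k
 proof (induction k arbitrary: p q)
  case 0
  show ?case by (auto simp: T_def intro!: continuous_intros)
 next
  case (Suc k)
  show ?case by (rule C_k_SucI[OF T_has_derivative]) (rule Suc)
 qed
 then show ?thesis by (simp add: smooth_def)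
qed

lemma pd_T: "pd j (T F p q) = T F (\<lambda>k. k $ j *\<^sub>R q k) (\<lambda>k. - (k $ j *\<^sub>R p k))"
 using partial_deriv_eq[OF T_has_derivative, of "axis j 1" F p q] by (simp add: fun_eq_iff inner_axis)

lemma T_inner: "T F p q x \<bullet> b = T F (cmp p b) (cmp q b) x"
 by (simp add: T_def inner_sum_left inner_add_left)

text \<open>The pair \<open>(p, q)\<close> corresponds to the complex coefficient p - i q.\<close>

lemma T_real: "T F p q x = Re (\<Sum>k\<in>F. Complex (p k) (- q k) * cis (k \<bullet> x))"
 by (simp add: T_def algebra_simps)

text \<open>An inequality only, as \<open>F\<close> need not be symmetric: the real part is bounded
  by the modulus, for which Parseval is exact.\<close>

lemma T_L2_real:
 fixes p q :: "R3 => real"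
 assumes F: "finite F" "F \<subseteq> lat"
 shows "(LBINT x. ind cube x * (T F p q x)^2) \<le> vol * (\<Sum>k\<in>F. (p k)^2 + (q k)^2)"
proof -
 have "(LBINT x. ind cube x * (T F p q x)^2) \<le> (LBINT x. ind cube x * (cmod (\<Sum>k\<in>F. Complex (p k) (- q k) * cis (k \<bullet> x)))^2)"
 proof (rule integral_mono)
  show "L1 (\<lambda>x. ind cube x * (T F p q x)^2)"
   by (intro integrable_cube_continuous_real continuous_intros smooth_continuous smooth_T)
  show "L1 (\<lambda>x. ind cube x * (cmod (\<Sum>k\<in>F. Complex (p k) (- q k) * cis (k \<bullet> x)))^2)"
   by (intro integrable_cube_continuous_real continuous_intros)
  show "ind cube x * (T F p q x)^2 \<le> ind cube x * (cmod (\<Sum>k\<in>F. Complex (p k) (- q k) * cis (k \<bullet> x)))^2" for x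
   unfolding T_real cmod_power2 by (intro mult_left_mono) auto
 qed
 also have "... = vol * (\<Sum>k\<in>F. (p k)^2 + (q k)^2)"
  by (simp only: integral_cis_poly_square[OF F]) (simp add: cmod_power2)
 finally show ?thesis .
qed

lemma norm_square_Basis: "(norm x)^2 = (\<Sum>b\<in>Basis. (x \<bullet> b)^2)" for x :: "'b::euclidean_space"
 by (subst power2_norm_eq_inner, subst euclidean_inner) (simp add: power2_eq_square)

lemma integrable_cube_T: "L1 (\<lambda>x. ind cube x * (norm (T F p q x))^2)"
 by (intro integrable_cube_continuous_real continuous_intros smooth_continuous smooth_T)

lemma integrable_cube_T_real:
 fixes p q :: "R3 => real" shows "L1 (\<lambda>x. ind cube x * (T F p q x)^2)"
 using integrable_cube_T[of F p q] by simp

lemma T_L2: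
 fixes p q :: "R3 => 'b::euclidean_space"
 assumes F: "finite F" "F \<subseteq> lat"
 shows "(LBINT x. ind cube x * (norm (T F p q x))^2) \<le> vol * (\<Sum>k\<in>F. (norm (p k))^2 + (norm (q k))^2)"
proof -
 have "(LBINT x. ind cube x * (norm (T F p q x))^2) = (LBINT x. (\<Sum>b\<in>Basis. ind cube x * (T F (cmp p b) (cmp q b) x)^2))"
  unfolding norm_square_Basis T_inner sum_distrib_left ..
 also have "... = (\<Sum>b\<in>Basis. LBINT x. ind cube x * (T F (cmp p b) (cmp q b) x)^2)"
  by (rule LINT_sum) (rule integrable_cube_T_real)
 also have "... \<le> (\<Sum>b\<in>Basis. vol * (\<Sum>k\<in>F. (p k \<bullet> b)^2 + (q k \<bullet> b)^2))"
  by (intro sum_mono T_L2_real F)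
 also have "... = vol * (\<Sum>k\<in>F. \<Sum>b\<in>Basis. (p k \<bullet> b)^2 + (q k \<bullet> b)^2)"
  unfolding sum_distrib_left[symmetric] by (subst sum.swap) simp
 also have "... = vol * (\<Sum>k\<in>F. (norm (p k))^2 + (norm (q k))^2)"
  by (simp add: norm_square_Basis sum.distrib)
 finally show ?thesis .
qed

lemma integrable_cos_sin:
 fixes h :: "R3 => 'b::euclidean_space"
 assumes "L1 h" shows "L1 (\<lambda>x. cos (k \<bullet> x) *\<^sub>R h x)" "L1 (\<lambda>x. sin (k \<bullet> x) *\<^sub>R h x)"
 by (rule integrable_bounded_mult[OF assms, of _ 1]; simp)+

lemma Ac_inner:
 assumes "L1 h"
 shows "Ac h k \<bullet> b = Ac (cmp h b) k" "As h k \<bullet> b = As (cmp h b) k"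
 using integral_inner_left[OF integrable_cos_sin(1)[OF assms, of k], of b] integral_inner_left[OF integrable_cos_sin(2)[OF assms, of k], of b]
 by (simp_all add: Ac_def As_def)

lemma Ft_Ac_As:
 assumes "inL2 h" shows "Ft h k = Complex (Ac h k) (- As h k)"
proof -
 have ih: "L1 h" by (rule inL2_integrable[OF assms])
 have m[measurable]: "Borel (\<lambda>x::R3. cis (- (k \<bullet> x)))" by (intro borel_measurable_continuous_onI continuous_intros)
 have i: "L1 (\<lambda>x. h x *\<^sub>R cis (- (k \<bullet> x)))"
  by (rule L1_bound[OF ih]) (use ih in auto)
 show ?thesis
  using integral_Re[OF i] integral_Im[OF i] by (simp add: complex_eq_iff Ft_def Ac_def As_def mult.commute minus_divide_left)
qed

lemma inL2_inner:
 fixes h :: "R3 => 'b::euclidean_space"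
 assumes "inL2 h" shows "inL2 (cmp h b)"
proof -
 have [measurable]: "Borel h" using assms by (simp add: inL2_def)
 have "L1 (\<lambda>x. (norm (h x \<bullet> b))^2)"
 proof (rule L1_bound)
  show "L1 (\<lambda>x. (norm b)^2 * (norm (h x))^2)" using assms by (simp add: inL2_def)
  show "AE x in lborel. norm ((norm (h x \<bullet> b))^2) \<le> norm ((norm b)^2 * (norm (h x))^2)" (is "AE x in _. ?P x")
  proof (rule AE_I2)
   fix x
   have "(\<bar>h x \<bullet> b\<bar>)^2 \<le> (norm (h x) * norm b)^2" by (intro power_mono Cauchy_Schwarz_ineq2) simp
   then show "?P x" by (simp add: power_mult_distrib mult.commute)
  qed
 qed measurable
 then show ?thesis using assms by (auto simp: inL2_def)
qed

lemma integral_norm_square_Basis: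
 fixes h :: "R3 => 'b::euclidean_space"
 assumes "inL2 h" shows "(LBINT x. (norm (h x))^2) = (\<Sum>b\<in>Basis. LBINT x. (h x \<bullet> b)^2)"
 unfolding norm_square_Basis
 by (rule LINT_sum) (use inL2_inner[OF assms] in \<open>simp add: inL2_def\<close>)

lemma Bessel_vec:
 fixes h :: "R3 => 'b::euclidean_space"
 assumes F: "finite F" "F \<subseteq> lat" and h: "inL2 h"
 shows "vol * (\<Sum>k\<in>F. (norm (Ac h k))^2 + (norm (As h k))^2) \<le> (LBINT x. (norm (h x))^2)"
proof -
 have "vol * (\<Sum>k\<in>F. (norm (Ac h k))^2 + (norm (As h k))^2) = (\<Sum>b\<in>Basis. vol * (\<Sum>k\<in>F. (Ac (cmp h b) k)^2 + (As (cmp h b) k)^2))"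
  unfolding norm_square_Basis Ac_inner[OF inL2_integrable[OF h]] sum_distrib_left[symmetric]
  by (subst sum.swap) (simp add: sum.distrib)
 also have "... \<le> (\<Sum>b\<in>Basis. LBINT x. (h x \<bullet> b)^2)"
  by (intro sum_mono) (use Bessel[OF F inL2_inner[OF h]] in \<open>simp add: Ft_Ac_As[OF inL2_inner[OF h]] cmod_power2\<close>)
 finally show ?thesis unfolding integral_norm_square_Basis[OF h] .
qed

definition resid :: "(R3 => 'b::euclidean_space) => R3 set => R3 => 'b" where
 "resid h F x = ind cube x *\<^sub>R (h x - T F (Ac h) (As h) x)"

lemma inL2_cube_continuous:
 fixes g :: "R3 => 'b::euclidean_space"
 assumes "continuous_on UNIV g" shows "inL2 (\<lambda>x. ind cube x *\<^sub>R g x)"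
proof -
 have [measurable]: "Borel g" by (rule borel_measurable_continuous_onI[OF assms])
 have "(\<lambda>x. (norm (ind cube x *\<^sub>R g x))^2) = (\<lambda>x. ind cube x * (norm (g x))^2)" by (auto simp: indicator_def fun_eq_iff)
 moreover have "L1 (\<lambda>x. ind cube x * (norm (g x))^2)"
  by (intro integrable_cube_continuous_real continuous_intros assms)
 ultimately show ?thesis by (simp add: inL2_def)
qed

lemma inL2_resid:
 fixes h :: "R3 => 'b::euclidean_space"
 assumes "inL2 h" shows "inL2 (resid h F)"
proof -
 have "resid h F = (\<lambda>x. h x - ind cube x *\<^sub>R T F (Ac h) (As h) x)"
  using assms by (auto simp: resid_def inL2_def fun_eq_iff indicator_def)
 then show ?thesis using inL2_diff[OF assms inL2_cube_continuous[OF smooth_continuous[OF smooth_T]]] by simp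
qed

lemma resid_le_dst:
 fixes h :: "R3 => 'b::euclidean_space"
 assumes F: "finite F" "F \<subseteq> lat" and h: "inL2 h"
 shows "(LBINT x. (norm (resid h F x))^2) \<le> (\<Sum>b\<in>Basis. dst (cmp h b) (fsum F (Ft (cmp h b))))"
 unfolding integral_norm_square_Basis[OF inL2_resid[OF h]]
proof (rule sum_mono)
 fix b :: 'b
 show "(LBINT x. (resid h F x \<bullet> b)^2) \<le> dst (cmp h b) (fsum F (Ft (cmp h b)))"
  unfolding dst_def
 proof (rule integral_mono)
  show "L1 (\<lambda>x. (resid h F x \<bullet> b)^2)" using inL2_inner[OF inL2_resid[OF h]] by (simp add: inL2_def)
  show "L1 (\<lambda>x. ind cube x * (cmod (of_real (h x \<bullet> b) - (fsum F (Ft (cmp h b)) x)))^2)"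
   by (rule residual(1)[OF F inL2_inner[OF h]])
  fix x
  have "(resid h F x \<bullet> b)^2 = ind cube x * (h x \<bullet> b - T F (Ac h) (As h) x \<bullet> b)^2"
   by (cases "x \<in> cube") (simp_all add: resid_def inner_diff_left)
  also have "h x \<bullet> b - T F (Ac h) (As h) x \<bullet> b = Re (of_real (h x \<bullet> b) - (fsum F (Ft (cmp h b)) x))"
   unfolding T_inner Ac_inner[OF inL2_integrable[OF h]] T_real Ft_Ac_As[OF inL2_inner[OF h]] by simp
  also have "ind cube x * (\<dots>)^2 \<le> ind cube x * (cmod (of_real (h x \<bullet> b) - (fsum F (Ft (cmp h b)) x)))^2"
   unfolding cmod_power2 by (intro mult_left_mono) auto
  finally show "(resid h F x \<bullet> b)^2 \<le> ind cube x * (cmod (of_real (h x \<bullet> b) - (fsum F (Ft (cmp h b)) x)))^2" .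
 qed
qed

lemma resid_bound:
 fixes h :: "R3 => 'b::euclidean_space"
 assumes F: "finite F" "F \<subseteq> lat" and h: "inL2 h"
 shows "(LBINT x. (norm (resid h F x))^2) \<le> (LBINT x. (norm (h x))^2)"
proof -
 have "dst (cmp h b) (fsum F (Ft (cmp h b))) \<le> (LBINT x. (h x \<bullet> b)^2)" for b
  unfolding dst_def residual(2)[OF F inL2_inner[OF h]] using vol_pos by (simp add: sum_nonneg)
 then have "(\<Sum>b\<in>Basis. dst (cmp h b) (fsum F (Ft (cmp h b)))) \<le> (\<Sum>b\<in>Basis. LBINT x. (h x \<bullet> b)^2)"
  by (intro sum_mono)
 then show ?thesis using resid_le_dst[OF assms] unfolding integral_norm_square_Basis[OF h] by simp
qed

definition "Fn n = from_nat_into lat ` {..n::nat}"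

lemma Fn: "finite (Fn n)" "Fn n \<subseteq> lat" "m \<le> n ==> Fn m \<subseteq> Fn n"
 using from_nat_into[of lat] lat_zero by (auto simp: Fn_def)

lemma Fn_exhausts: "finite F ==> F \<subseteq> lat ==> \<exists>N. \<forall>n\<ge>N. F \<subseteq> Fn n"
proof -
 assume F: "finite F" "F \<subseteq> lat"
 show ?thesis
 proof (intro exI[of _ "Max (to_nat_on lat ` F)"] allI impI subsetI)
  fix n k assume n: "Max (to_nat_on lat ` F) \<le> n" and x: "k \<in> F"
  have "to_nat_on lat k \<le> n" using n x F by (meson Max_ge finite_imageI image_eqI order_trans)
  moreover have "from_nat_into lat (to_nat_on lat k) = k" using x F countable_lat by (intro from_nat_into_to_nat_on) auto
  ultimately show "k \<in> Fn n" unfolding Fn_def by (metis atMost_iff image_eqI)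
 qed
qed

lemma resid_tendsto:
 fixes h :: "R3 => 'b::euclidean_space"
 assumes h: "inL2 h" "\<And>x. x \<notin> cball x0 r ==> h x = 0" "r < R"
 shows "(\<lambda>n. LBINT x. (norm (resid h (Fn n) x))^2) \<longlonglongrightarrow> 0"
proof -
 have d: "(\<lambda>n. dst (cmp h b) (fsum (Fn n) (Ft (cmp h b)))) \<longlonglongrightarrow> 0" for b
 proof (rule LIMSEQ_I)
  fix \<epsilon> :: real assume "\<epsilon> > 0"
  then obtain F0 where F0: "finite F0" "F0 \<subseteq> lat" "\<forall>F. finite F \<and> F0 \<subseteq> F \<and> F \<subseteq> lat \<longrightarrow> dst (cmp h b) (fsum F (Ft (cmp h b))) < \<epsilon>"
   using completeness_real[OF inL2_inner[OF h(1)] _ h(3), of b \<epsilon>] h(2) by auto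
  obtain N where N: "\<forall>n\<ge>N. F0 \<subseteq> Fn n" using Fn_exhausts[OF F0(1,2)] by blast
  have "dst g t \<ge> 0" for g t unfolding dst_def by (rule integral_nonneg_AE) simp
  then show "\<exists>N. \<forall>n\<ge>N. norm (dst (cmp h b) (fsum (Fn n) (Ft (cmp h b))) - 0) < \<epsilon>"
   using N F0(3) Fn(1,2) by (intro exI[of _ N]) (simp add: abs_of_nonneg)
 qed
 have "(\<lambda>n. \<Sum>b\<in>Basis. dst (cmp h b) (fsum (Fn n) (Ft (cmp h b)))) \<longlonglongrightarrow> (\<Sum>b\<in>(Basis :: 'b set). 0)"
  by (intro tendsto_sum d)
 then have lim: "(\<lambda>n. \<Sum>b\<in>Basis. dst (cmp h b) (fsum (Fn n) (Ft (cmp h b)))) \<longlonglongrightarrow> 0" by simp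
 show ?thesis
  by (rule tendsto_sandwich[OF _ _ tendsto_const lim]) (use resid_le_dst[OF Fn(1,2) h(1)] in \<open>auto intro!: always_eventually integral_nonneg_AE\<close>)
qed

end

section \<open>Localized curl and its Fourier coefficients\<close>

lemma pd_add: "smooth f ==> smooth g ==> pd j (\<lambda>x. f x + g x) x = pd j f x + pd j g x"
 by (rule partial_deriv_eq[OF has_derivative_add[OF smooth_has_derivative smooth_has_derivative]])

lemma pd_sum: "(\<And>i. i \<in> I ==> smooth (f i)) ==> pd j (\<lambda>x. \<Sum>i\<in>I. f i x) x = (\<Sum>i\<in>I. pd j (f i) x)"
 by (rule partial_deriv_eq[OF has_derivative_sum[OF smooth_has_derivative]])

lemma pd_scaleR: "smooth f ==> smooth g ==> pd j (\<lambda>x. f x *\<^sub>R g x) x = f x *\<^sub>R pd j g x + pd j f x *\<^sub>R g x"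
 by (rule partial_deriv_eq[OF has_derivative_scaleR[OF smooth_has_derivative smooth_has_derivative]])

lemma pd_mult: "smooth f ==> smooth g ==> pd j (\<lambda>x. f x * g x) x = f x * pd j g x + pd j f x * (g x :: real)"
 using pd_scaleR[of f g j x] by simp

lemma pd_inner: "smooth f ==> smooth g ==> pd j (\<lambda>x. f x \<bullet> g x) x = f x \<bullet> pd j g x + pd j f x \<bullet> g x"
 by (rule partial_deriv_eq[OF has_derivative_inner[OF smooth_has_derivative smooth_has_derivative]])

lemma pd_bounded_linear: "bounded_linear L ==> smooth f ==> pd j (\<lambda>x. L (f x)) x = L (pd j f x)"
 by (rule partial_deriv_eq[OF bounded_linear.has_derivative[OF _ smooth_has_derivative]])

lemma bounded_compact_support:
 assumes "continuous_on UNIV f" "compact K" "\<And>x. x \<notin> K ==> f x = 0"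
 shows "\<exists>M. \<forall>x. norm (f x) \<le> M"
proof -
 have "bounded (f ` K)"
  by (intro compact_imp_bounded compact_continuous_image continuous_on_subset[OF assms(1)] assms(2)) simp
 then obtain N where N: "\<forall>z\<in>K. norm (f z) \<le> N" by (auto simp: bounded_iff)
 have "norm (f z) \<le> max N 0" for z
 proof (cases "z \<in> K")
  case True then show ?thesis using N by fastforce
 qed (simp add: assms(3))
 then show ?thesis by blast
qed

text \<open>\<open>ch\<close> localizes the vorticity. \<open>et\<close> equals 1 on the support of
  \<open>ch\<close> and gives compact support to the function whose gradient is paired with the
  solenoidal field. \<open>ps\<close> equals 1 on \<open>K\<close> and gives compact support to
  trigonometric polynomials, so that Sobolev's inequality can be applied to them.\<close>

locale ns_cut = box3 +
 fixes s s' r1 r2 r3 :: real and ch et ps :: "R3 => real"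
 assumes s: "2 < s'" "2 / s' + 3 / s = 1"
  and r: "0 < r1" "r1 < r2" "r2 < r3" "r3 < R"
  and ch: "smooth ch" "\<And>x. x \<notin> cball x0 r1 ==> ch x = 0"
  and et: "smooth et" "\<And>x. x \<in> cball x0 r1 ==> et x = 1" "\<And>x. x \<notin> cball x0 r2 ==> et x = 0"
  and ps: "smooth ps" "\<And>x. x \<in> cball x0 r2 ==> ps x = 1" "\<And>x. x \<notin> cball x0 r3 ==> ps x = 0"
   "\<And>x. 0 \<le> ps x" "\<And>x. ps x \<le> 1"
begin

abbreviation "K \<equiv> cball x0 r2"

definition "V f = (LBINT x. ind K x * norm (f x :: R3) powr s)"
text \<open>The power \<open>s' / s\<close> turns the integral of |f|^s into the power s' of the
  s-norm, which is what the Serrin condition makes integrable in time. The summand 1 gives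
  \<open>\<kappa>\<close> \<ge> 1, so that lower-order terms can be absorbed into terms with
  \<open>\<kappa>\<close>.\<close>

definition "\<kappa> f = (1 + V f) powr (s' / s)"

text \<open>What is known of a slice of the solution at almost every time. The spatial estimates
  below concern one such field.\<close>

definition adm :: "(R3 => R3) => bool" where
 "adm f \<longleftrightarrow> f \<in> borel_measurable borel \<and> L1 (\<lambda>x. (norm (f x))^2) \<and>
  L1 (\<lambda>x. ind K x * norm (f x) powr s) \<and>
  (\<forall>\<phi>\<in>test_functions (ball x0 R). (LBINT x. f x \<bullet> gradient \<phi> x) = 0)"

lemma s_pos: "s > 3"
proof -
 have "3 / s = 1 - 2 / s'" "2 / s' < 1" "2 / s' > 0" using s by (auto simp: field_simps)
 then have "3 / s > 0" "3 / s < 1" by auto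
 then show ?thesis by (auto simp: field_simps zero_less_divide_iff split: if_splits)
qed

lemma V_nonneg: "V f \<ge> 0" unfolding V_def by (rule integral_nonneg_AE) simp

lemma kappa_ge_1: "\<kappa> f \<ge> 1"
 unfolding \<kappa>_def using V_nonneg[of f] s s_pos by (intro ge_one_powr_ge_zero) auto

lemma ps_bound: obtains M where "M \<ge> 0" "\<And>j x. \<bar>pd j ps x\<bar> \<le> M"
proof -
 have "\<forall>j. \<exists>M. \<forall>x. norm (pd j ps x) \<le> M"
 proof
  fix j
  show "\<exists>M. \<forall>x. norm (pd j ps x) \<le> M"
   by (rule bounded_compact_support[of _ "cball x0 r3"])
    (use partial_deriv_zero_outside[of "cball x0 r3" ps _ "axis j 1"] ps(3) in \<open>auto intro: smooth_continuous smooth_partial ps(1)\<close>)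
 qed
 then obtain N where N: "\<And>j x. \<bar>pd j ps x\<bar> \<le> N j" unfolding choice_iff by auto
 have "\<bar>pd j ps x\<bar> \<le> N 1 + N 2 + N 3" for j x
  using N[of j x] N[of 1 x] N[of 2 x] N[of 3 x] exhaust_3[of j] by (auto simp: abs_le_iff)
 moreover have "N 1 + N 2 + N 3 \<ge> 0" using N[of 1 x0] N[of 2 x0] N[of 3 x0] by linarith
 ultimately show ?thesis using that by blast
qed

abbreviation nsum :: "R3 set => (R3 => 'b::euclidean_space) => (R3 => 'b) => real" where
 "nsum F p q \<equiv> (\<Sum>k\<in>F. (norm (p k))^2 + (norm (q k))^2)"
abbreviation nsum1 :: "R3 set => (R3 => 'b::euclidean_space) => (R3 => 'b) => real" where
 "nsum1 F p q \<equiv> (\<Sum>k\<in>F. (norm k)^2 * ((norm (p k))^2 + (norm (q k))^2))"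

lemma norm_square_real3: "(norm x)^2 = (\<Sum>j\<in>UNIV. (x $ j)^2)" for x :: "R3"
 by (simp add: norm_vec_def L2_set_def sum_nonneg)

lemma sum_pd_T_L2:
 fixes p q :: "R3 => 'b::euclidean_space"
 assumes "finite F" "F \<subseteq> lat"
 shows "(\<Sum>j\<in>UNIV. LBINT x. ind cube x * (norm (pd j (T F p q) x))^2) \<le> vol * nsum1 F p q"
proof -
 have "(\<Sum>j\<in>UNIV. LBINT x. ind cube x * (norm (pd j (T F p q) x))^2) \<le> (\<Sum>j\<in>UNIV. vol * (\<Sum>k\<in>F. (norm (k $ j *\<^sub>R q k))^2 + (norm (- (k $ j *\<^sub>R p k)))^2))"
  unfolding pd_T by (intro sum_mono T_L2 assms)
 also have "... = vol * (\<Sum>k\<in>F. \<Sum>j\<in>UNIV. (k $ j)^2 * ((norm (p k))^2 + (norm (q k))^2))"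
  unfolding sum_distrib_left[symmetric] by (subst sum.swap) (simp add: power_mult_distrib algebra_simps)
 also have "... = vol * nsum1 F p q"
  by (simp add: norm_square_real3 sum_distrib_right)
 finally show ?thesis .
qed

text \<open>The Serrin bound is applied to \<open>G\<close>, which agrees with the polynomial on
  \<open>K\<close>. The product rule costs a factor 2 in the Dirichlet term, which is why the bound
  is taken with \<open>\<delta> / 2\<close>; its zero-order part joins the constant because
  \<open>\<kappa>\<close> \<ge> 1.\<close>

lemma form_bound_real:
 assumes "\<delta> > 0"
 obtains c where "c > 0" "\<And>f F (p :: R3 => real) q. adm f ==> finite F ==> F \<subseteq> lat ==>
  L1 (\<lambda>x. ind K x * ((norm (f x))^2 * (T F p q x)^2)) \<and>
  (LBINT x. ind K x * ((norm (f x))^2 * (T F p q x)^2)) \<le> \<delta> * (vol * nsum1 F p q) + c * \<kappa> f * (vol * nsum F p q)"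
proof -
 obtain M where M: "M \<ge> 0" "\<And>j x. \<bar>pd j ps x\<bar> \<le> M" using ps_bound by blast
 have d2: "\<delta> / 2 > 0" using assms by simp
 obtain c where c: "c > 0" "\<And>(f :: R3 => R3) G K A. f \<in> borel_measurable borel ==> smooth G ==> compact K ==>
  (\<And>x. x \<notin> K ==> G x = 0) ==> A \<in> sets borel ==> L1 (\<lambda>x. ind A x * norm (f x) powr s) ==>
  L1 (\<lambda>x. ind A x * ((norm (f x))^2 * (G x)^2)) \<and>
  (LBINT x. ind A x * ((norm (f x))^2 * (G x)^2)) \<le>
   \<delta> / 2 * (\<Sum>j\<in>UNIV. LBINT x. (pd j G x)^2)
   + c * (1 + (LBINT x. ind A x * norm (f x) powr s)) powr (s' / s) * (LBINT x. (G x)^2)"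
  using Serrin_form_bound_compact_support[OF s d2] by blast
 \<comment> \<open>\<open>3 * \<delta> * M^2\<close> is \<open>\<delta> / 2\<close> times the
   coefficient \<open>6 * M^2\<close> of the zero-order part in fact \<open>B\<close>.\<close>
 define c' where "c' = 3 * \<delta> * M^2 + c"
 have c': "c' > 0" using c(1) assms by (simp add: c'_def add_nonneg_pos)
 show ?thesis
 proof (rule that[OF c'])
  fix f F and p q :: "R3 => real"
  assume f: "adm f" and F: "finite F" "F \<subseteq> lat"
  define g where "g = T F p q"
  have sg: "smooth g" unfolding g_def by (rule smooth_T)
  define G where "G x = ps x * g x" for x
  have sG: "smooth G" unfolding G_def by (intro smooth_mult ps sg)
  have G0: "G x = 0" if "x \<notin> cball x0 r3" for x using ps(3)[OF that] by (simp add: G_def)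
  have cc: "cball x0 r3 \<subseteq> cube" by (rule cball_subset_cube) (use r in auto)
  have pG: "pd j G x = ps x * pd j g x + pd j ps x * g x" for j x
   unfolding G_def[abs_def] by (rule pd_mult[OF ps(1) sg])
  have gi: "L1 (\<lambda>x. ind cube x * (g x)^2)" "L1 (\<lambda>x. ind cube x * (pd j g x)^2)" for j
   by (intro integrable_cube_continuous_real continuous_intros smooth_continuous smooth_partial sg)+
  have Gi: "L1 (\<lambda>x. (G x)^2)" "L1 (\<lambda>x. (pd j G x)^2)" for j
  proof -
   have c: "continuous_on UNIV G" "continuous_on UNIV (pd j G)"
    using sG by (auto intro: smooth_continuous smooth_partial)
   show "L1 (\<lambda>x. (G x)^2)" "L1 (\<lambda>x. (pd j G x)^2)"
    using G0 partial_deriv_zero_outside[of "cball x0 r3" G _ "axis j 1"]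
    by (auto intro!: integrable_compact_support[where K="cball x0 r3"] continuous_intros c)
  qed
  have A: "(LBINT x. (G x)^2) \<le> vol * nsum F p q"
  proof -
   have "(LBINT x. (G x)^2) \<le> (LBINT x. ind cube x * (g x)^2)"
   proof (rule integral_mono[OF Gi(1) gi(1)])
    fix x show "(G x)^2 \<le> ind cube x * (g x)^2"
    proof (cases "x \<in> cube")
     case True
     then show ?thesis using ps(4,5)[of x] by (auto simp: G_def power_mult_distrib intro!: mult_left_le_one_le power_le_one)
    next
     case False
     then have "G x = 0" using cc by (intro G0) blast
     then show ?thesis by simp
    qed
   qed
   also have "... \<le> vol * nsum F p q" using T_L2[OF F, of p q] by (simp add: g_def)
   finally show ?thesis .
  qed
  have B: "(\<Sum>j\<in>UNIV. LBINT x. (pd j G x)^2) \<le> 2 * (vol * nsum1 F p q) + 6 * M^2 * (vol * nsum F p q)"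
  proof -
   have "(LBINT x. (pd j G x)^2) \<le> 2 * (LBINT x. ind cube x * (pd j g x)^2) + 2 * M^2 * (LBINT x. ind cube x * (g x)^2)" for j
   proof -
    have "(LBINT x. (pd j G x)^2) \<le> (LBINT x. 2 * (ind cube x * (pd j g x)^2) + 2 * M^2 * (ind cube x * (g x)^2))"
    proof (rule integral_mono[OF Gi(2)])
     show "L1 (\<lambda>x. 2 * (ind cube x * (pd j g x)^2) + 2 * M^2 * (ind cube x * (g x)^2))"
      using gi by auto
     fix x show "(pd j G x)^2 \<le> 2 * (ind cube x * (pd j g x)^2) + 2 * M^2 * (ind cube x * (g x)^2)"
     proof (cases "x \<in> cube")
      case True
      have "(pd j G x)^2 \<le> 2 * (ps x * pd j g x)^2 + 2 * (pd j ps x * g x)^2"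
       unfolding pG using square_add_le[of "ps x * pd j g x" "pd j ps x * g x"] by simp
      also have "... = 2 * ((ps x)^2 * (pd j g x)^2) + 2 * ((pd j ps x)^2 * (g x)^2)" by (simp add: power_mult_distrib)
      also have "... \<le> 2 * (1 * (pd j g x)^2) + 2 * (M^2 * (g x)^2)"
       using ps(4,5)[of x] M(2)[of j x] M(1)
       by (intro add_mono mult_left_mono mult_right_mono) (auto simp: power_le_one abs_le_square_iff[symmetric])
      finally show ?thesis using True by simp
     next
      case False
      then have "x \<notin> cball x0 r3" using cc by blast
      then show ?thesis using partial_deriv_zero_outside[of "cball x0 r3" G x "axis j 1"] G0 by simp
     qed
    qed
    then show ?thesis using gi by (simp add: LINT_add)
   qed
   then have "(\<Sum>j\<in>UNIV. LBINT x. (pd j G x)^2) \<le> (\<Sum>j\<in>(UNIV::3 set). 2 * (LBINT x. ind cube x * (pd j g x)^2) + 2 * M^2 * (LBINT x. ind cube x * (g x)^2))"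
    by (intro sum_mono)
   also have "... = 2 * (\<Sum>j\<in>UNIV. LBINT x. ind cube x * (pd j g x)^2) + 6 * M^2 * (LBINT x. ind cube x * (g x)^2)"
    by (simp add: sum.distrib sum_distrib_left)
   also have "... \<le> 2 * (vol * nsum1 F p q) + 6 * M^2 * (vol * nsum F p q)"
    using sum_pd_T_L2[OF F, of p q] T_L2[OF F, of p q] M(1)
    by (intro add_mono mult_left_mono) (auto simp: g_def)
   finally show ?thesis .
  qed
  have KK: "ind K x * ((norm (f x))^2 * (G x)^2) = ind K x * ((norm (f x))^2 * (g x)^2)" for x
   using ps(2)[of x] by (cases "x \<in> K") (auto simp: G_def)
  note c2 = c(2)[of f G "cball x0 r3" K, unfolded KK, folded V_def, folded \<kappa>_def]
  have I: "L1 (\<lambda>x. ind K x * ((norm (f x))^2 * (g x)^2)) \<and>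
  (LBINT x. ind K x * ((norm (f x))^2 * (g x)^2)) \<le>
   \<delta> / 2 * (\<Sum>j\<in>UNIV. LBINT x. (pd j G x)^2) + c * \<kappa> f * (LBINT x. (G x)^2)"
   by (rule c2) (use f sG G0 in \<open>auto simp: adm_def\<close>)
  have nn: "vol * nsum F p q \<ge> 0" using vol_pos by (simp add: sum_nonneg)
  have k1: "\<kappa> f \<ge> 1" by (rule kappa_ge_1)
  have "\<delta> / 2 * (\<Sum>j\<in>UNIV. LBINT x. (pd j G x)^2) + c * \<kappa> f * (LBINT x. (G x)^2)
   \<le> \<delta> / 2 * (2 * (vol * nsum1 F p q) + 6 * M^2 * (vol * nsum F p q)) + c * \<kappa> f * (vol * nsum F p q)"
   using A B assms c(1) k1 by (intro add_mono mult_left_mono) auto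
  also have "... = \<delta> * (vol * nsum1 F p q) + (3 * \<delta> * M^2 * 1 + c * \<kappa> f) * (vol * nsum F p q)"
   by (simp add: algebra_simps)
  also have "... \<le> \<delta> * (vol * nsum1 F p q) + (3 * \<delta> * M^2 * \<kappa> f + c * \<kappa> f) * (vol * nsum F p q)"
   using k1 assms nn by (intro add_left_mono mult_right_mono add_right_mono mult_left_mono) auto
  also have "... = \<delta> * (vol * nsum1 F p q) + c' * \<kappa> f * (vol * nsum F p q)" by (simp add: c'_def algebra_simps)
  finally show "L1 (\<lambda>x. ind K x * ((norm (f x))^2 * (T F p q x)^2)) \<and>
  (LBINT x. ind K x * ((norm (f x))^2 * (T F p q x)^2)) \<le> \<delta> * (vol * nsum1 F p q) + c' * \<kappa> f * (vol * nsum F p q)"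
   using I by (simp add: g_def)
 qed
qed

text \<open>In operator terms, multiplication by |f|^2 on \<open>K\<close> is form-bounded relative
  to the Laplacian with relative bound \<open>\<delta>\<close>. All fields to which this is applied
  are finite Fourier sums.\<close>

definition form_bounded :: "real => real => (R3 => R3) => bool" where
 "form_bounded \<delta> c f \<longleftrightarrow> (\<forall>F (p :: R3 => R3) q. finite F \<longrightarrow> F \<subseteq> lat \<longrightarrow>
  L1 (\<lambda>x. ind K x * ((norm (f x))^2 * (norm (T F p q x))^2)) \<and>
  (LBINT x. ind K x * ((norm (f x))^2 * (norm (T F p q x))^2)) \<le> \<delta> * (vol * nsum1 F p q) + c * \<kappa> f * (vol * nsum F p q))"

text \<open>Componentwise from the real case. The constant is uniform over all admissible fields,
  which enter through \<open>\<kappa>\<close> alone.\<close>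

lemma form_bound:
 assumes "\<delta> > 0"
 obtains c where "c > 0" "\<And>f. adm f ==> form_bounded \<delta> c f"
proof -
 obtain c where c: "c > 0" "\<And>f F (p :: R3 => real) q. adm f ==> finite F ==> F \<subseteq> lat ==>
  L1 (\<lambda>x. ind K x * ((norm (f x))^2 * (T F p q x)^2)) \<and>
  (LBINT x. ind K x * ((norm (f x))^2 * (T F p q x)^2)) \<le> \<delta> * (vol * nsum1 F p q) + c * \<kappa> f * (vol * nsum F p q)"
  using form_bound_real[OF assms] by blast
 show ?thesis
 proof (rule that[OF c(1)])
  fix f assume f: "adm f"
  show "form_bounded \<delta> c f"
   unfolding form_bounded_def
  proof (intro allI impI)
   fix F and p q :: "R3 => R3" assume F: "finite F" "F \<subseteq> lat"
   have eq: "ind K x * ((norm (f x))^2 * (norm (T F p q x))^2) = (\<Sum>b\<in>Basis. ind K x * ((norm (f x))^2 * (T F (cmp p b) (cmp q b) x)^2))" for x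
    unfolding norm_square_Basis[of "T F p q x"] T_inner sum_distrib_left ..
   note cb = c(2)[OF f F]
   have "(LBINT x. ind K x * ((norm (f x))^2 * (norm (T F p q x))^2)) = (\<Sum>b\<in>Basis. LBINT x. ind K x * ((norm (f x))^2 * (T F (cmp p b) (cmp q b) x)^2))"
    unfolding eq by (rule LINT_sum) (use cb in blast)
   also have "... \<le> (\<Sum>b\<in>Basis. \<delta> * (vol * nsum1 F (cmp p b) (cmp q b)) + c * \<kappa> f * (vol * nsum F (cmp p b) (cmp q b)))"
    by (intro sum_mono) (use cb in blast)
   also have "... = \<delta> * (vol * (\<Sum>b\<in>Basis. nsum1 F (cmp p b) (cmp q b))) + c * \<kappa> f * (vol * (\<Sum>b\<in>Basis. nsum F (cmp p b) (cmp q b)))"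
    by (simp only: sum.distrib sum_distrib_left[symmetric])
   also have "(\<Sum>b\<in>Basis. nsum F (cmp p b) (cmp q b)) = nsum F p q"
    by (subst sum.swap) (simp add: norm_square_Basis[of "p _"] norm_square_Basis[of "q _"] sum.distrib)
   also have "(\<Sum>b\<in>Basis. nsum1 F (cmp p b) (cmp q b)) = nsum1 F p q"
    by (subst sum.swap) (simp add: norm_square_Basis[of "p _"] norm_square_Basis[of "q _"] sum.distrib[symmetric] sum_distrib_left)
   finally have *: "(LBINT x. ind K x * ((norm (f x))^2 * (norm (T F p q x))^2)) \<le> \<delta> * (vol * nsum1 F p q) + c * \<kappa> f * (vol * nsum F p q)" .
   show "L1 (\<lambda>x. ind K x * ((norm (f x))^2 * (norm (T F p q x))^2)) \<and>
   (LBINT x. ind K x * ((norm (f x))^2 * (norm (T F p q x))^2)) \<le> \<delta> * (vol * nsum1 F p q) + c * \<kappa> f * (vol * nsum F p q)"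
   proof -
    have "L1 (\<lambda>x. ind K x * ((norm (f x))^2 * (norm (T F p q x))^2))"
     unfolding eq by (rule L1_sum) (use cb in blast)
    then show ?thesis using * by blast
   qed
  qed
 qed
qed

end

section \<open>Vector calculus in terms of the cross product\<close>

lemma bounded_linear_cross3_right: "bounded_linear (cross3 a)"
 by (simp add: linear_conv_bounded_linear[symmetric] linear_iff cross_add_right cross_mult_right)

lemma norm_cross3_le: "norm (cross3 a b) \<le> norm a * norm b"
proof -
 have "(norm (cross3 a b))^2 \<le> (norm a * norm b)^2" using norm_cross_dot[of a b] zero_le_power2[of "a \<bullet> b"] by linarith
 then show ?thesis by (rule power2_le_imp_le) simp
qed

lemma bounded_bilinear_cross3: "bounded_bilinear cross3"
 by (intro bounded_bilinear.intro exI[of _ 1]) (auto simp: cross_add_left cross_add_right cross_mult_left cross_mult_right norm_cross3_le)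

lemma cross_diff_right: "cross3 a (b - c) = cross3 a b - cross3 a c"
 by (simp add: cross3_simps)

lemma inner_cross3: "u \<bullet> cross3 v w = w \<bullet> cross3 u v"
 by (metis cross_triple inner_commute)

lemma sum_cross3_axis: "(\<Sum>k\<in>UNIV. cross3 (axis k 1) (v $ k *\<^sub>R w)) = cross3 v w"
 by (simp add: sum_3 vec_eq_iff forall_3 cross3_def axis_def vector_def)

lemma smooth_cross3: "smooth f ==> smooth g ==> smooth (\<lambda>x. cross3 (f x) (g x))"
 using smooth_bilinear[OF bounded_bilinear_cross3, of f g] by simp

lemma pd_cross3: "smooth f ==> smooth g ==> pd j (\<lambda>x. cross3 (f x) (g x)) x = cross3 (f x) (pd j g x) + cross3 (pd j f x) (g x)"
 by (rule partial_deriv_eq[OF bounded_bilinear.FDERIV[OF bounded_bilinear_cross3 smooth_has_derivative smooth_has_derivative]])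

lemma partial_deriv_inner_const: "smooth f ==> partial_deriv v (\<lambda>x. f x \<bullet> b) = (\<lambda>x. partial_deriv v f x \<bullet> b)"
 by (rule ext) (rule partial_deriv_eq[OF bounded_linear.has_derivative[OF bounded_linear_inner_left smooth_has_derivative]])

lemma smooth_partial_commute_vec:
 fixes f :: "'a::euclidean_space => 'b::euclidean_space"
 assumes "smooth f"
 shows "partial_deriv v (partial_deriv w f) x = partial_deriv w (partial_deriv v f) x"
proof (rule euclidean_eqI)
 fix b :: 'b
 have "partial_deriv v (partial_deriv w f) x \<bullet> b = partial_deriv v (partial_deriv w (\<lambda>x. f x \<bullet> b)) x"
  by (simp add: partial_deriv_inner_const smooth_partial assms)
 also have "... = partial_deriv w (partial_deriv v (\<lambda>x. f x \<bullet> b)) x"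
  by (rule smooth_partial_commute) (intro smooth_inner assms smooth_const)
 also have "... = partial_deriv w (partial_deriv v f) x \<bullet> b"
  by (simp add: partial_deriv_inner_const smooth_partial assms)
 finally show "partial_deriv v (partial_deriv w f) x \<bullet> b = partial_deriv w (partial_deriv v f) x \<bullet> b" .
qed

text \<open>A sum over the axes, so that smoothness and support follow from the rules for
  sums.\<close>

definition grd :: "(R3 => real) => R3 => R3" where
 "grd \<phi> x = (\<Sum>j\<in>UNIV. pd j \<phi> x *\<^sub>R axis j 1)"

lemma grd_component [simp]: "grd \<phi> x $ j = pd j \<phi> x"
 by (simp add: grd_def axis_def if_distrib[of "(*) _"] cong: if_cong)

lemma gradient_eq_grd: "gradient \<phi> = grd \<phi>"
 by (simp add: gradient_def fun_eq_iff vec_eq_iff)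

lemma smooth_grd: "smooth \<phi> ==> smooth (grd \<phi>)"
 unfolding grd_def by (intro smooth_sum smooth_scaleR smooth_partial smooth_const)

text \<open>In this form product and commutation rules follow from linearity of the cross product;
  \<open>curlv_component\<close> recovers the usual components.\<close>

definition curlv :: "(R3 => R3) => R3 => R3" where
 "curlv h x = (\<Sum>k\<in>UNIV. cross3 (axis k 1) (pd k h x))"

lemma smooth_curlv: "smooth h ==> smooth (curlv h)"
 unfolding curlv_def by (intro smooth_sum smooth_cross3 smooth_partial smooth_const)

lemma curlv_add: "smooth g ==> smooth h ==> curlv (\<lambda>x. g x + h x) x = curlv g x + curlv h x"
 by (simp add: curlv_def pd_add cross_add_right sum.distrib)

lemma curlv_sum: "(\<And>i. i \<in> I ==> smooth (g i)) ==> curlv (\<lambda>x. \<Sum>i\<in>I. g i x) x = (\<Sum>i\<in>I. curlv (g i) x)"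
proof -
 assume g: "\<And>i. i \<in> I ==> smooth (g i)"
 have "curlv (\<lambda>x. \<Sum>i\<in>I. g i x) x = (\<Sum>k\<in>UNIV. cross3 (axis k 1) (\<Sum>i\<in>I. pd k (g i) x))"
  using g by (simp add: curlv_def pd_sum)
 also have "... = (\<Sum>k\<in>UNIV. \<Sum>i\<in>I. cross3 (axis k 1) (pd k (g i) x))"
  by (simp only: linear_sum[OF bounded_linear.linear[OF bounded_linear_cross3_right]])
 also have "... = (\<Sum>i\<in>I. curlv (g i) x)" unfolding curlv_def by (rule sum.swap)
 finally show ?thesis .
qed

lemma curlv_scaleR: "smooth w ==> smooth h ==> curlv (\<lambda>x. w x *\<^sub>R h x) x = cross3 (grd w x) (h x) + w x *\<^sub>R curlv h x"
 using sum_cross3_axis[of "grd w x" "h x"]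
 by (simp add: curlv_def pd_scaleR cross_add_right sum.distrib cross_mult_right scaleR_sum_right)

definition lapl :: "(R3 => 'b::real_normed_vector) => R3 => 'b" where
 "lapl h x = (\<Sum>j\<in>UNIV. pd j (pd j h) x)"

lemma smooth_lapl: "smooth h ==> smooth (lapl h)"
 unfolding lapl_def by (intro smooth_sum smooth_partial)

lemma lapl_scaleR:
 assumes "smooth w" "smooth h"
 shows "lapl (\<lambda>x. w x *\<^sub>R h x) x = w x *\<^sub>R lapl h x + ((\<Sum>j\<in>UNIV. (2 * pd j w x) *\<^sub>R pd j h x) + lapl w x *\<^sub>R h x)"
proof -
 have e: "pd j (\<lambda>x. w x *\<^sub>R h x) = (\<lambda>x. w x *\<^sub>R pd j h x + pd j w x *\<^sub>R h x)" for j
  using pd_scaleR[OF assms] by (simp add: fun_eq_iff)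
 have "pd j (pd j (\<lambda>x. w x *\<^sub>R h x)) x = w x *\<^sub>R pd j (pd j h) x + (2 * pd j w x) *\<^sub>R pd j h x + pd j (pd j w) x *\<^sub>R h x" for j
  unfolding e using assms
  by (subst pd_add) (auto intro!: smooth_scaleR smooth_partial simp: pd_scaleR smooth_partial scaleR_left_distrib[symmetric])
 then show ?thesis
  by (simp add: lapl_def sum.distrib scaleR_sum_right scaleR_sum_left)
qed

lemma bounded_supported_cball:
 assumes "smooth g" "\<And>x. x \<notin> cball x0 t ==> g x = 0" shows "\<exists>N. \<forall>x. norm (g x) \<le> N"
 by (rule bounded_compact_support[OF smooth_continuous[OF assms(1)] compact_cball assms(2)])

lemma partial_deriv_supported_cball:
 assumes "\<And>x. x \<notin> cball x0 t ==> g x = 0" "x \<notin> cball x0 t" shows "partial_deriv v g x = 0"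
 by (rule partial_deriv_zero_outside[OF compact_cball assms])

lemma grd_supported_cball:
 assumes "\<And>x. x \<notin> cball x0 t ==> g x = 0" "x \<notin> cball x0 t" shows "grd g x = 0"
 using partial_deriv_supported_cball[OF assms] by (simp add: grd_def)

text \<open>Young's inequality pointwise, in place of Cauchy-Schwarz after integration:
  integrability of \<open>g\<close> comes along, and the weight \<open>\<mu>\<close> remains free
  for absorbing terms.\<close>

lemma abs_integral_product_le:
 fixes g u v :: "'a => real"
 assumes g: "g \<in> borel_measurable M0" and b: "\<And>x. \<bar>g x\<bar> \<le> M * (u x * v x)" and M: "M \<ge> 0" and l: "\<mu> > 0"
  and u: "integrable M0 (\<lambda>x. (u x)^2)" and v: "integrable M0 (\<lambda>x. (v x)^2)"
 shows "integrable M0 g" "\<bar>LINT x|M0. g x\<bar> \<le> M * ((1 / (4 * \<mu>)) * (LINT x|M0. (u x)^2) + \<mu> * (LINT x|M0. (v x)^2))" (is ?G1)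
proof -
 define w where "w x = M * ((1 / (4 * \<mu>)) * (u x)^2 + \<mu> * (v x)^2)" for x
 have iw: "integrable M0 w" unfolding w_def using u v by auto
 have uv: "u x * v x \<le> (1 / (4 * \<mu>)) * (u x)^2 + \<mu> * (v x)^2" for x
 proof -
  have "0 \<le> \<mu> * ((1 / (2 * \<mu>)) * u x - v x)^2" using l by simp
  also have "... = (1 / (4 * \<mu>)) * (u x)^2 - u x * v x + \<mu> * (v x)^2" using l by (simp add: power2_eq_square field_simps)
  finally show ?thesis by simp
 qed
 have gw: "\<bar>g x\<bar> \<le> w x" for x
  using b[of x] mult_left_mono[OF uv[of x] M] by (simp add: w_def)
 show ig: "integrable M0 g"
  by (rule L1_bound[OF iw g]) (auto intro!: AE_I2 order_trans[OF gw abs_ge_self])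
 have "\<bar>LINT x|M0. g x\<bar> \<le> (LINT x|M0. w x)"
  by (rule order_trans[OF integral_abs_bound integral_mono[OF integrable_abs[OF ig] iw gw]])
 also have "... = M * ((1 / (4 * \<mu>)) * (LINT x|M0. (u x)^2) + \<mu> * (LINT x|M0. (v x)^2))"
  unfolding w_def using u v by simp
 finally show ?G1 .
qed

section \<open>Fourier coefficients of the localized vorticity\<close>

context ns_cut begin

lemma curlv_T: "curlv (T F p q) = T F (\<lambda>k. cross3 k (q k)) (\<lambda>k. - cross3 k (p k))"
proof
 fix x
 have "curlv (T F p q) x = (\<Sum>i\<in>UNIV. \<Sum>k\<in>F. cos (k \<bullet> x) *\<^sub>R cross3 (axis i 1) (k $ i *\<^sub>R q k) - sin (k \<bullet> x) *\<^sub>R cross3 (axis i 1) (k $ i *\<^sub>R p k))"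
  unfolding curlv_def pd_T T_def linear_sum[OF bounded_linear.linear[OF bounded_linear_cross3_right]]
  by (simp add: cross_diff_right cross_mult_right)
 also have "... = (\<Sum>k\<in>F. cos (k \<bullet> x) *\<^sub>R (\<Sum>i\<in>UNIV. cross3 (axis i 1) (k $ i *\<^sub>R q k)) - sin (k \<bullet> x) *\<^sub>R (\<Sum>i\<in>UNIV. cross3 (axis i 1) (k $ i *\<^sub>R p k)))"
  by (subst sum.swap) (simp add: sum_subtractf scaleR_sum_right)
 finally show "curlv (T F p q) x = T F (\<lambda>k. cross3 k (q k)) (\<lambda>k. - cross3 k (p k)) x"
  unfolding sum_cross3_axis by (simp add: T_def)
qed

lemma lapl_T: "lapl (T F p q) = T F (\<lambda>k. - ((norm k)^2 *\<^sub>R p k)) (\<lambda>k. - ((norm k)^2 *\<^sub>R q k))"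
proof
 fix x
 have "lapl (T F p q) x = (\<Sum>j\<in>UNIV. \<Sum>k\<in>F. (k $ j)^2 *\<^sub>R (- (cos (k \<bullet> x) *\<^sub>R p k) - sin (k \<bullet> x) *\<^sub>R q k))"
  unfolding lapl_def pd_T T_def by (intro sum.cong refl) (simp add: power2_eq_square algebra_simps)
 also have "... = (\<Sum>k\<in>F. (norm k)^2 *\<^sub>R (- (cos (k \<bullet> x) *\<^sub>R p k) - sin (k \<bullet> x) *\<^sub>R q k))"
  by (subst sum.swap) (simp add: norm_square_real3 scaleR_sum_left)
 also have "... = T F (\<lambda>k. - ((norm k)^2 *\<^sub>R p k)) (\<lambda>k. - ((norm k)^2 *\<^sub>R q k)) x"
  unfolding T_def by (intro sum.cong refl) (simp add: algebra_simps)
 finally show "lapl (T F p q) x = T F (\<lambda>k. - ((norm k)^2 *\<^sub>R p k)) (\<lambda>k. - ((norm k)^2 *\<^sub>R q k)) x" .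
qed

lemma T_pair:
 fixes g :: "R3 => 'b::euclidean_space"
 assumes g: "L1 g"
 shows "L1 (\<lambda>x. T F p q x \<bullet> g x)" (is ?G1) "(LBINT x. T F p q x \<bullet> g x) = vol * (\<Sum>k\<in>F. p k \<bullet> Ac g k + q k \<bullet> As g k)" (is ?G2)
proof -
 have eq: "T F p q x \<bullet> g x = (\<Sum>k\<in>F. p k \<bullet> (cos (k \<bullet> x) *\<^sub>R g x) + q k \<bullet> (sin (k \<bullet> x) *\<^sub>R g x))" for x
  by (simp add: T_def inner_sum_left inner_add_left)
 note i = integrable_inner_right[OF integrable_cos_sin(1)[OF g]] integrable_inner_right[OF integrable_cos_sin(2)[OF g]]
 show ?G1
  unfolding eq by (intro L1_sum L1_add i)
 have "(LBINT x. T F p q x \<bullet> g x) = (\<Sum>k\<in>F. p k \<bullet> (LBINT x. cos (k \<bullet> x) *\<^sub>R g x) + q k \<bullet> (LBINT x. sin (k \<bullet> x) *\<^sub>R g x))"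
  unfolding eq
  by (subst LINT_sum) (auto simp del: inner_scaleR_right intro!: i L1_add sum.cong
    simp: LINT_add[OF i] integral_inner_right integrable_cos_sin[OF g])
 also have "... = vol * (\<Sum>k\<in>F. p k \<bullet> Ac g k + q k \<bullet> As g k)"
  using vol_pos by (simp add: Ac_def As_def sum_distrib_left distrib_left)
 finally show ?G2 .
qed

text \<open>An integration by parts shows that \<open>Wc f\<close> and \<open>Ws f\<close> are the cosine and sine coefficients of the distribution
 \<open>ch *\<^sub>R curl f\<close>. Testing the equation with \<open>\<theta>(t) *\<^sub>R curlv h x\<close> says that \<open>ell\<close> has the weak time derivative \<open>GG\<close>.\<close>

definition "g0 f x = f x \<bullet> grd ch x"
definition "g1 f x = cross3 (f x) (grd ch x)"
definition "cf f x = ch x *\<^sub>R (f x :: R3)"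
definition "Wc f k = Ac (g1 f) k + cross3 k (As (cf f) k)"
definition "Ws f k = As (g1 f) k - cross3 k (Ac (cf f) k)"
definition "rho f = (LBINT x. (norm (f x :: R3))^2)"
definition "ell f h = (LBINT x. f x \<bullet> curlv h x)"
definition "GG f h = (LBINT x. f x \<bullet> curlv (lapl h) x) + (LBINT x. (tri (f x) (curlv h) x))"

lemma ch0: "x \<notin> cube ==> ch x = 0" "x \<notin> cube ==> grd ch x = 0"
proof -
 assume "x \<notin> cube"
 then have x: "x \<notin> cball x0 r1" using cball_subset_cube[of r1] r by auto
 then show "ch x = 0" by (rule ch(2))
 show "grd ch x = 0" using partial_deriv_zero_outside[of "cball x0 r1" ch x] ch(2) x by (simp add: grd_def)
qed

text \<open>One constant for all derivatives of the cutoffs that will occur, independent of the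
  field, of \<open>N\<close> and of the set of modes.\<close>

definition bnd :: "real => bool" where
 "bnd M \<longleftrightarrow> 1 \<le> M \<and> (\<forall>x j. \<bar>ch x\<bar> \<le> M \<and> norm (grd ch x) \<le> M \<and> norm (pd j (grd ch) x) \<le> M \<and>
  \<bar>pd j ch x\<bar> \<le> M \<and> norm (grd (pd j ch) x) \<le> M \<and> \<bar>lapl ch x\<bar> \<le> M \<and> norm (grd (lapl ch) x) \<le> M \<and>
  \<bar>et x\<bar> \<le> M \<and> norm (grd et x) \<le> M)"

lemma ex_bnd: "\<exists>M. bnd M"
proof -
 note z1 = partial_deriv_supported_cball[where t=r1 and ?x0.0=x0] and gz1 = grd_supported_cball[where t=r1 and ?x0.0=x0]
  and gz2 = grd_supported_cball[where t=r2 and ?x0.0=x0] and b1 = bounded_supported_cball[where t=r1 and ?x0.0=x0] and b2 = bounded_supported_cball[where t=r2 and ?x0.0=x0]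
 have pz: "pd j ch x = 0" if "x \<notin> cball x0 r1" for j x by (rule z1[OF ch(2) that])
 have lz: "lapl ch x = 0" if "x \<notin> cball x0 r1" for x using z1[OF pz that] by (simp add: lapl_def)
 obtain N1 where N1: "\<And>x. norm (ch x) \<le> N1" using b1[OF ch] by blast
 obtain N2 where N2: "\<And>x. norm (grd ch x) \<le> N2" using b1[OF smooth_grd[OF ch(1)] gz1[OF ch(2)]] by blast
 have "\<forall>j. \<exists>N. \<forall>x. norm (pd j (grd ch) x) \<le> N" using b1[OF smooth_partial[OF smooth_grd[OF ch(1)]] z1[OF gz1[OF ch(2)]]] by blast
 then obtain N3 where N3: "\<And>j x. norm (pd j (grd ch) x) \<le> N3 j" unfolding choice_iff by blast
 have "\<forall>j. \<exists>N. \<forall>x. norm (pd j ch x) \<le> N" using b1[OF smooth_partial[OF ch(1)] pz] by blast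
 then obtain N4 where N4: "\<And>j x. norm (pd j ch x) \<le> N4 j" unfolding choice_iff by blast
 have "\<forall>j. \<exists>N. \<forall>x. norm (grd (pd j ch) x) \<le> N" using b1[OF smooth_grd[OF smooth_partial[OF ch(1)]] gz1[OF pz]] by blast
 then obtain N5 where N5: "\<And>j x. norm (grd (pd j ch) x) \<le> N5 j" unfolding choice_iff by blast
 obtain N6 where N6: "\<And>x. norm (lapl ch x) \<le> N6" using b1[OF smooth_lapl[OF ch(1)] lz] by blast
 obtain N7 where N7: "\<And>x. norm (grd (lapl ch) x) \<le> N7" using b1[OF smooth_grd[OF smooth_lapl[OF ch(1)]] gz1[OF lz]] by blast
 obtain N8 where N8: "\<And>x. norm (et x) \<le> N8" using b2[OF et(1,3)] by blast
 obtain N9 where N9: "\<And>x. norm (grd et x) \<le> N9" using b2[OF smooth_grd[OF et(1)] gz2[OF et(3)]] by blast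
 define M where "M = Max ({1, N1, N2, N6, N7, N8, N9} \<union> range N3 \<union> range N4 \<union> range N5)"
 have fin: "finite ({1, N1, N2, N6, N7, N8, N9} \<union> range N3 \<union> range N4 \<union> range N5)" by simp
 have le: "y \<le> M" if "y \<in> {1, N1, N2, N6, N7, N8, N9} \<union> range N3 \<union> range N4 \<union> range N5" for y
  unfolding M_def by (rule Max_ge[OF fin that])
 have le': "1 \<le> M" "N1 \<le> M" "N2 \<le> M" "N6 \<le> M" "N7 \<le> M" "N8 \<le> M" "N9 \<le> M" "N3 j \<le> M" "N4 j \<le> M" "N5 j \<le> M" for j
  by (rule le; simp)+
 have "bnd M"
  unfolding bnd_def real_norm_def[symmetric]
  using order_trans[OF N1 le'(2)] order_trans[OF N2 le'(3)] order_trans[OF N6 le'(4)] order_trans[OF N7 le'(5)] order_trans[OF N8 le'(6)]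
   order_trans[OF N9 le'(7)] order_trans[OF N3 le'(8)] order_trans[OF N4 le'(9)] order_trans[OF N5 le'(10)] le'(1)
  by blast
 then show ?thesis by blast
qed

lemma bndD:
 assumes "bnd M"
 shows "1 \<le> M" "\<bar>ch x\<bar> \<le> M" "norm (grd ch x) \<le> M" "norm (pd j (grd ch) x) \<le> M"
  "\<bar>pd j ch x\<bar> \<le> M" "norm (grd (pd j ch) x) \<le> M" "\<bar>lapl ch x\<bar> \<le> M" "norm (grd (lapl ch) x) \<le> M"
  "\<bar>et x\<bar> \<le> M" "norm (grd et x) \<le> M"
 using assms unfolding bnd_def by blast+

lemma rho_nonneg: "rho f \<ge> 0" unfolding rho_def by (rule integral_nonneg_AE) simp

lemma admD:
 assumes "adm f"
 shows "Borel f" "L1 (\<lambda>x. (norm (f x))^2)" "\<And>\<phi>. \<phi> \<in> test_functions (ball x0 R) ==> (LBINT x. f x \<bullet> grd \<phi> x) = 0"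
 using assms by (auto simp: adm_def gradient_eq_grd)

lemma inL2_dominated:
 fixes h :: "R3 => 'b::euclidean_space"
 assumes f: "adm f" and h[measurable]: "Borel h" and z: "\<And>x. x \<notin> cube ==> h x = 0" and le: "\<And>x. norm (h x) \<le> M * norm (f x)"
 shows "inL2 h" "(LBINT x. (norm (h x))^2) \<le> M^2 * rho f" (is ?G1)
proof -
 have le2: "(norm (h x))^2 \<le> M^2 * (norm (f x))^2" for x
  using power_mono[OF le[of x], of 2] by (simp add: power_mult_distrib)
 have i: "L1 (\<lambda>x. M^2 * (norm (f x))^2)" using admD(2)[OF f] by simp
 have ih: "L1 (\<lambda>x. (norm (h x))^2)"
  by (rule L1_bound[OF i]) (use le2 in \<open>auto intro!: AE_I2\<close>)
 then show "inL2 h" using z by (simp add: inL2_def)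
 show ?G1
  using integral_mono[OF ih i le2] by (simp add: rho_def)
qed

lemma adm_inL2:
 assumes f: "adm f" and M: "bnd M"
 shows "inL2 (cf f)" "inL2 (g0 f)" "inL2 (g1 f)" "(LBINT x. (norm (cf f x))^2) \<le> M^2 * rho f"
  "(LBINT x. (norm (g0 f x))^2) \<le> M^2 * rho f" "(LBINT x. (norm (g1 f x))^2) \<le> M^2 * rho f"
proof -
 have [measurable]: "Borel f" "Borel ch" "Borel (grd ch)"
  using admD[OF f] by (auto intro!: borel_measurable_smooth smooth_grd ch(1))
 have m: "Borel (cf f)" "Borel (g0 f)" "Borel (g1 f)"
 proof -
  show "Borel (cf f)" "Borel (g0 f)" unfolding cf_def[abs_def] g0_def[abs_def] by measurable
  have "(\<lambda>x. cross3 (fst x) (snd x)) \<in> borel_measurable (borel :: (R3 \<times> R3) measure)"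
   by (intro borel_measurable_continuous_onI bounded_bilinear.continuous_on[OF bounded_bilinear_cross3] continuous_intros)
  from measurable_compose[OF borel_measurable_Pair[of f _ "grd ch"] this] show "Borel (g1 f)"
   unfolding g1_def[abs_def] by simp
 qed
 have b: "norm (cf f x) \<le> M * norm (f x)" "norm (g0 f x) \<le> M * norm (f x)" "norm (g1 f x) \<le> M * norm (f x)" for x
 proof -
  show "norm (cf f x) \<le> M * norm (f x)" using bndD(2)[OF M, of x] by (simp add: cf_def mult_right_mono)
  have gb: "norm (f x) * norm (grd ch x) \<le> M * norm (f x)" using bndD(3)[OF M, of x] mult_right_mono[of "norm (grd ch x)" M "norm (f x)"] by (simp add: mult.commute)
  show "norm (g0 f x) \<le> M * norm (f x)" using Cauchy_Schwarz_ineq2[of "f x" "grd ch x"] gb by (simp add: g0_def)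
  show "norm (g1 f x) \<le> M * norm (f x)" using norm_cross3_le[of "f x" "grd ch x"] gb by (simp add: g1_def)
 qed
 have z: "cf f x = 0" "g0 f x = 0" "g1 f x = 0" if "x \<notin> cube" for x using ch0[OF that] by (simp_all add: cf_def g0_def g1_def)
 show "inL2 (cf f)" "(LBINT x. (norm (cf f x))^2) \<le> M^2 * rho f" using inL2_dominated[OF f m(1) z(1) b(1)] by simp_all
 show "inL2 (g0 f)" "(LBINT x. (norm (g0 f x))^2) \<le> M^2 * rho f" using inL2_dominated[OF f m(2) z(2) b(2)] by simp_all
 show "inL2 (g1 f)" "(LBINT x. (norm (g1 f x))^2) \<le> M^2 * rho f" using inL2_dominated[OF f m(3) z(3) b(3)] by simp_all
qed

text \<open>By the product rule the curl falls either on \<open>ch\<close> or on the polynomial.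
  Pairing the two parts with \<open>f\<close> gives coefficients of \<open>g1\<close> and of
  \<open>cf\<close>, and their combination is what \<open>Wc\<close> and \<open>Ws\<close> are
  defined to be.\<close>

lemma ell_T:
 assumes f: "adm f"
 shows "L1 (\<lambda>x. f x \<bullet> curlv (\<lambda>x. ch x *\<^sub>R T F p q x) x)" (is ?G1)
  "ell f (\<lambda>x. ch x *\<^sub>R T F p q x) = vol * (\<Sum>k\<in>F. p k \<bullet> Wc f k + q k \<bullet> Ws f k)" (is ?G2)
proof -
 obtain M where M: "bnd M" using ex_bnd by blast
 note L = adm_inL2[OF f M]
 have eq: "f x \<bullet> curlv (\<lambda>x. ch x *\<^sub>R T F p q x) x = T F p q x \<bullet> g1 f x + T F (\<lambda>k. cross3 k (q k)) (\<lambda>k. - cross3 k (p k)) x \<bullet> cf f x" for x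
  unfolding curlv_scaleR[OF ch(1) smooth_T] curlv_T g1_def cf_def
  by (simp add: inner_add_right inner_cross3[of "f x"] inner_commute)
 note t1 = T_pair[OF inL2_integrable[OF L(3)], of F p q] and t2 = T_pair[OF inL2_integrable[OF L(1)], of F "\<lambda>k. cross3 k (q k)" "\<lambda>k. - cross3 k (p k)"]
 show ?G1
  unfolding eq by (intro L1_add t1(1) t2(1))
 have c1: "cross3 k v \<bullet> w = - (v \<bullet> cross3 k w)" for k v w
  by (metis cross_triple cross_skew inner_commute inner_minus_right)
 show ?G2
  unfolding ell_def eq LINT_add[OF t1(1) t2(1)] t1(2) t2(2) distrib_left[symmetric] sum.distrib[symmetric]
  by (simp add: c1 Wc_def Ws_def inner_add_right inner_diff_right algebra_simps)
qed

text \<open>The divergence condition tested with \<open>ch\<close> times a single wave. As the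
  divergence of \<open>cf\<close> is \<open>g0\<close>, the part of a coefficient of
  \<open>cf\<close> along k is of lower order.\<close>

lemma div_relation:
 assumes f: "adm f"
 shows "Ac (g0 f) k = k \<bullet> As (cf f) k" "As (g0 f) k = - (k \<bullet> Ac (cf f) k)" (is ?G1)
proof -
 obtain M where M: "bnd M" using ex_bnd by blast
 note L = adm_inL2[OF f M]
 have s1: "smooth (T {k} p q)" for p q :: "R3 => real" by (rule smooth_T)
 have sub: "cball x0 r1 \<subseteq> ball x0 R" using r by auto
 have tf: "(\<lambda>x. ch x * T {k} p q x) \<in> test_functions (ball x0 R)" for p q :: "R3 => real"
  by (rule test_functionsI[OF _ compact_cball sub]) (use ch(2) in \<open>auto intro!: smooth_mult ch(1) smooth_T\<close>)
 have g: "grd (\<lambda>x. ch x * T {k} p q x) x = T {k} p q x *\<^sub>R grd ch x + (ch x * T {k} q (\<lambda>k. - p k) x) *\<^sub>R k" for p q :: "R3 => real" and x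
  by (simp add: vec_eq_iff pd_mult[OF ch(1) smooth_T] pd_T) (simp add: T_def algebra_simps)
 have main: "0 = vol * (p k * Ac (g0 f) k + q k * As (g0 f) k) + vol * (q k * (k \<bullet> Ac (cf f) k) - p k * (k \<bullet> As (cf f) k))" for p q :: "R3 => real"
 proof -
  have eq: "f x \<bullet> grd (\<lambda>x. ch x * T {k} p q x) x = T {k} p q x \<bullet> g0 f x + T {k} (\<lambda>k. q k *\<^sub>R k) (\<lambda>k. - (p k *\<^sub>R k)) x \<bullet> cf f x" for x
   unfolding g by (simp add: g0_def cf_def T_def inner_add_right inner_add_left inner_commute algebra_simps)
  note t1 = T_pair[OF inL2_integrable[OF L(2)], of "{k}" p q] and t2 = T_pair[OF inL2_integrable[OF L(1)], of "{k}" "\<lambda>k. q k *\<^sub>R k" "\<lambda>k. - (p k *\<^sub>R k)"]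
  have "0 = (LBINT x. f x \<bullet> grd (\<lambda>x. ch x * T {k} p q x) x)" using admD(3)[OF f tf] by simp
  also have "... = vol * (p k * Ac (g0 f) k + q k * As (g0 f) k) + vol * (q k * (k \<bullet> Ac (cf f) k) - p k * (k \<bullet> As (cf f) k))"
   unfolding eq LINT_add[OF t1(1) t2(1)] t1(2) t2(2) by simp
  finally show ?thesis .
 qed
 show "Ac (g0 f) k = k \<bullet> As (cf f) k"
  using main[of "\<lambda>_. 1" "\<lambda>_. 0"] vol_pos by (simp add: distrib_left[symmetric] flip: right_diff_distrib')
 show ?G1
  using main[of "\<lambda>_. 0" "\<lambda>_. 1"] vol_pos by (simp add: distrib_left[symmetric] eq_neg_iff_add_eq_0)
qed

text \<open>Multiplied by \<open>1 / (1 + (norm k)^2)\<close>, these are the coefficients of the part of \<open>cf f\<close> that the curl does not see;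
 for solenoidal \<open>f\<close> it is bounded in $H^1$ by the $L^2$ norm of \<open>f\<close>.\<close>

definition "rc f k = Ac (cf f) k - As (g0 f) k *\<^sub>R k - cross3 k (As (g1 f) k)"
definition "rs f k = As (cf f) k + Ac (g0 f) k *\<^sub>R k + cross3 k (Ac (g1 f) k)"

lemma cross3_cross3: "cross3 k (cross3 k v) = (k \<bullet> v) *\<^sub>R k - (norm k)^2 *\<^sub>R v"
 by (simp add: Lagrange power2_norm_eq_inner)

text \<open>A Biot-Savart formula: applying the cross product with k twice to a coefficient of
  \<open>cf\<close> gives -|k|^2 times it plus a multiple of k, and that multiple is known from
  \<open>div_relation\<close>. One more copy of the coefficient is added to both sides so that the
  factor 1 + |k|^2 never vanishes.\<close>

lemma reconstruct:
 assumes f: "adm f"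
 shows "(1 + (norm k)^2) *\<^sub>R Ac (cf f) k = cross3 k (Ws f k) + rc f k"
  "(1 + (norm k)^2) *\<^sub>R As (cf f) k = - cross3 k (Wc f k) + rs f k"
 unfolding Wc_def Ws_def rc_def rs_def div_relation[OF f]
 by (simp_all add: cross_add_right cross_diff_right cross3_cross3 scaleR_left_distrib)

text \<open>The factor \<open>1 / (1 + (norm k)^2)\<close> makes \<open>EE\<close> an $H^{-1}$ norm of the vorticity; the other factor is a Yosida
 regularization, removed at the end by \<open>N \<longlonglongrightarrow> \<infinity>\<close>.\<close>

definition "mm N k = 1 / ((1 + (norm (k::R3))^2) * (1 + (norm k)^2 / N))"
definition "zz f k = (norm (Wc f k))^2 + (norm (Ws f k))^2"
abbreviation "zs F f \<equiv> \<Sum>i\<in>F. zz f i"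
definition "EE N F f = (\<Sum>k\<in>F. mm N k * zz f k)"
definition "DD N F f = (\<Sum>k\<in>F. (1 + (norm k)^2) * mm N k * zz f k)"

text \<open>Only the bound on \<open>t * t * m\<close> uses the decay of the Yosida factor, at the
  price of \<open>N\<close>. The last identity lets \<open>1 + t / N\<close> undo that factor in
  \<open>cf_decomposition\<close>.\<close>

lemma mm_bounds:
 fixes k :: "R3"
 assumes "N \<ge> 1"
 defines "t \<equiv> (norm k)^2" and "m \<equiv> mm N k"
 shows "m > 0" "m \<le> 1" "t * m \<le> 1" "(1 + t) * m \<le> 1" "t * t * m \<le> N" "(1 + t) * ((1 + t / N) * m) = 1"
proof -
 have t: "t \<ge> 0" by (simp add: t_def)
 have d: "(1 + t) * (1 + t / N) \<ge> 1 + t" using t assms(1) by (simp add: mult_le_cancel_left1)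
 have d0: "(1 + t) * (1 + t / N) > 0" using d t by linarith
 have m: "m = 1 / ((1 + t) * (1 + t / N))" by (simp add: m_def mm_def t_def)
 show "m > 0" using d0 by (simp add: m)
 show a: "(1 + t) * m \<le> 1" using d unfolding m by (simp only: times_divide_eq_right mult_1_right divide_le_eq_1_pos[OF d0])
 show "t * m \<le> 1" using a \<open>m > 0\<close> by (simp add: distrib_right)
 have "0 \<le> t * m" using t \<open>m > 0\<close> by simp
 then show "m \<le> 1" using a by (simp add: distrib_right)
 show "(1 + t) * ((1 + t / N) * m) = 1"
  unfolding m by (simp only: mult.assoc[symmetric] times_divide_eq_right mult_1_right) (rule divide_self, use d0 in linarith)
 have "t * t \<le> (1 + t) * (N + t)" using t assms(1) by (intro mult_mono) auto
 also have "... = N * ((1 + t) * (1 + t / N))" using assms(1) by (simp add: field_simps)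
 finally have "t * t \<le> N * ((1 + t) * (1 + t / N))" .
 then show "t * t * m \<le> N" using d0 unfolding m by (simp add: divide_le_eq)
qed

end

section \<open>The estimate on a fixed time slice\<close>

context ns_cut begin

definition "rhoF f F = (LBINT x. (norm (resid (cf f) F x))^2)"

text \<open>Coefficients of the test potential and, in the last two lines, of its curl. The
  potential is the vorticity weighted by \<open>mm\<close>, so that pairing it with the vorticity
  reproduces \<open>EE\<close>.\<close>

abbreviation "apc N f \<equiv> (\<lambda>k. mm N k *\<^sub>R Wc f k)"
abbreviation "aps N f \<equiv> (\<lambda>k. mm N k *\<^sub>R Ws f k)"
abbreviation "cpc N f \<equiv> (\<lambda>k. cross3 k (mm N k *\<^sub>R Ws f k))"
abbreviation "cps N f \<equiv> (\<lambda>k. - cross3 k (mm N k *\<^sub>R Wc f k))"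

lemma zz_nonneg: "zz f k \<ge> 0" by (simp add: zz_def)

lemma EE_le_DD: "N \<ge> 1 ==> EE N F f \<le> DD N F f"
 unfolding EE_def DD_def
proof (rule sum_mono)
 fix k assume N: "N \<ge> 1"
 have "1 * (mm N k * zz f k) \<le> (1 + (norm k)^2) * (mm N k * zz f k)"
  using mm_bounds(1)[OF N, of k] zz_nonneg[of f k] by (intro mult_right_mono) auto
 then show "mm N k * zz f k \<le> (1 + (norm k)^2) * mm N k * zz f k" by (simp add: mult.assoc)
qed

lemma EE_nonneg: "N \<ge> 1 ==> EE N F f \<ge> 0"
 unfolding EE_def using mm_bounds(1)[of N] zz_nonneg[of f] by (intro sum_nonneg mult_nonneg_nonneg) (auto simp: less_imp_le)

lemma sum_mult_le:
 assumes "\<And>k. k \<in> F ==> g k \<le> i k * zz f k"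
 shows "(\<And>k. i k \<le> C * mm N k) ==> (\<Sum>k\<in>F. g k) \<le> C * EE N F f"
  and "(\<And>k. i k \<le> C * ((1 + (norm k)^2) * mm N k)) ==> (\<Sum>k\<in>F. g k) \<le> C * DD N F f"
proof -
 { assume i: "\<And>k. i k \<le> C * mm N k"
  have "(\<Sum>k\<in>F. g k) \<le> (\<Sum>k\<in>F. (C * mm N k) * zz f k)"
   by (intro sum_mono order_trans[OF assms] mult_right_mono i zz_nonneg)
  then show "(\<Sum>k\<in>F. g k) \<le> C * EE N F f" by (simp add: EE_def sum_distrib_left mult.assoc) }
 { assume i: "\<And>k. i k \<le> C * ((1 + (norm k)^2) * mm N k)"
  have "(\<Sum>k\<in>F. g k) \<le> (\<Sum>k\<in>F. (C * ((1 + (norm k)^2) * mm N k)) * zz f k)"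
   by (intro sum_mono order_trans[OF assms] mult_right_mono i zz_nonneg)
  then show "(\<Sum>k\<in>F. g k) \<le> C * DD N F f" by (simp add: DD_def sum_distrib_left mult.assoc) }
qed

lemma norm_component_scaleR_le: "(norm ((k :: R3) $ j *\<^sub>R v))^2 \<le> (norm k)^2 * (norm v)^2"
proof -
 have "(norm (k $ j *\<^sub>R v))^2 = \<bar>k $ j\<bar>^2 * (norm v)^2" by (simp add: power_mult_distrib)
 also have "... \<le> (norm k)^2 * (norm v)^2" by (intro mult_right_mono power_mono component_le_norm_cart) auto
 finally show ?thesis .
qed

lemma norm_cross3_square_le: "(norm (cross3 k v))^2 \<le> (norm k)^2 * (norm v)^2"
 using power_mono[OF norm_cross3_le[of k v], of 2] by (simp add: power_mult_distrib)

text \<open>Each bound compares \<open>m * m\<close> times a power of t = |k|^2 with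
  \<open>m\<close> or with \<open>(1 + t) * m\<close>. The factor \<open>N\<close> enters only for
  the derivatives of the curl, which are of too high order, and 1/N is gained for the defect caused
  by the Yosida factor.\<close>

lemma coefficient_bounds:
 assumes N: "N \<ge> 1"
 shows "nsum F (apc N f) (aps N f) \<le> EE N F f" (is ?G1) "nsum1 F (apc N f) (aps N f) \<le> DD N F f" (is ?G2)
  "nsum F (\<lambda>k. k $ j *\<^sub>R aps N f k) (\<lambda>k. - (k $ j *\<^sub>R apc N f k)) \<le> EE N F f" (is ?G3)
  "nsum1 F (\<lambda>k. k $ j *\<^sub>R aps N f k) (\<lambda>k. - (k $ j *\<^sub>R apc N f k)) \<le> DD N F f" (is ?G4)
  "nsum F (cpc N f) (cps N f) \<le> EE N F f" (is ?G5) "nsum1 F (cpc N f) (cps N f) \<le> DD N F f" (is ?G6)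
  "nsum F (\<lambda>k. k $ j *\<^sub>R cps N f k) (\<lambda>k. - (k $ j *\<^sub>R cpc N f k)) \<le> N * EE N F f" (is ?G7)
  "nsum1 F (\<lambda>k. k $ j *\<^sub>R cps N f k) (\<lambda>k. - (k $ j *\<^sub>R cpc N f k)) \<le> N * DD N F f" (is ?G8)
  "nsum F (\<lambda>k. ((norm k)^2 / N) *\<^sub>R cpc N f k) (\<lambda>k. ((norm k)^2 / N) *\<^sub>R cps N f k) \<le> (1 / N) * DD N F f" (is ?G9)
proof -
 define t where "t k = (norm (k::R3))^2" for k
 define m where "m = mm N"
 note mb = mm_bounds[OF N, folded t_def m_def]
 have t0: "t k \<ge> 0" for k by (simp add: t_def)
 have m0: "m k \<ge> 0" for k using mb(1)[of k] by simp
 have z0: "zz f k \<ge> 0" for k by (rule zz_nonneg)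
 have A: "(norm (apc N f k))^2 + (norm (aps N f k))^2 = (m k * m k) * zz f k" for k
  by (simp add: zz_def power_mult_distrib m_def algebra_simps) (simp add: power2_eq_square)
 have C: "(norm (cpc N f k))^2 + (norm (cps N f k))^2 \<le> (t k * (m k * m k)) * zz f k" for k
 proof -
  have "(norm (cpc N f k))^2 + (norm (cps N f k))^2 \<le> t k * (norm (aps N f k))^2 + t k * (norm (apc N f k))^2"
   unfolding t_def norm_minus_cancel by (intro add_mono norm_cross3_square_le)
  also have "... = t k * ((m k * m k) * zz f k)" unfolding A[symmetric] by (simp add: distrib_left)
  finally show ?thesis by (simp add: mult.assoc)
 qed
 have J: "(norm (k $ j *\<^sub>R v))^2 + (norm (- (k $ j *\<^sub>R w)))^2 \<le> t k * ((norm w)^2 + (norm v)^2)" for k and v w :: "R3"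
  using norm_component_scaleR_le[of k j v] norm_component_scaleR_le[of k j w] unfolding norm_minus_cancel t_def by (simp add: distrib_left)
 have k1: "m k * m k \<le> m k" "t k * (m k * m k) \<le> m k" "t k * (m k * m k) \<le> (1 + t k) * m k"
   "t k * (t k * (m k * m k)) \<le> (1 + t k) * m k" "t k * (t k * (m k * m k)) \<le> N * m k"
   "t k * (t k * (t k * (m k * m k))) \<le> N * ((1 + t k) * m k)" for k
 proof -
  note b = mb(1-5)[of k]
  show 1: "m k * m k \<le> m k" using mult_right_mono[OF b(2) m0[of k]] by simp
  show 2: "t k * (m k * m k) \<le> m k" using mult_right_mono[OF b(3) m0[of k]] by (simp add: mult.assoc)
  have 3: "m k \<le> (1 + t k) * m k" "t k * m k \<le> (1 + t k) * m k" using m0[of k] t0[of k] by (auto simp: distrib_right)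
  show "t k * (m k * m k) \<le> (1 + t k) * m k" using 2 3 by simp
  have "(t k * m k) * (t k * m k) \<le> 1 * (t k * m k)" using b(3) t0 m0 by (intro mult_right_mono) auto
  then show "t k * (t k * (m k * m k)) \<le> (1 + t k) * m k" using 3 by (simp add: ac_simps)
  show "t k * (t k * (m k * m k)) \<le> N * m k" using mult_right_mono[OF b(5) m0[of k]] by (simp add: mult.assoc)
  have "(t k * t k * m k) * (t k * m k) \<le> N * ((1 + t k) * m k)" using b(5) t0 m0 3 N by (intro mult_mono) auto
  then show "t k * (t k * (t k * (m k * m k))) \<le> N * ((1 + t k) * m k)" by (simp add: ac_simps)
 qed
 have s1: "(\<Sum>k\<in>F. g k) \<le> C * EE N F f" if "\<And>k. g k \<le> i k * zz f k" "\<And>k. i k \<le> C * m k" for g i C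
  using sum_mult_le(1)[of F g i f C N] that by (simp add: m_def)
 have s2: "(\<Sum>k\<in>F. g k) \<le> C * DD N F f" if "\<And>k. g k \<le> i k * zz f k" "\<And>k. i k \<le> C * ((1 + t k) * m k)" for g i C
  using sum_mult_le(2)[of F g i f C N] that by (simp add: m_def t_def)
 have tA: "t k * ((norm (apc N f k))^2 + (norm (aps N f k))^2) \<le> (t k * (m k * m k)) * zz f k" for k
  unfolding A by (simp add: mult.assoc)
 have tC: "t k * ((norm (cpc N f k))^2 + (norm (cps N f k))^2) \<le> (t k * (t k * (m k * m k))) * zz f k" for k
  using mult_left_mono[OF C t0[of k]] by (simp add: mult.assoc)
 have jA: "(norm (k $ j *\<^sub>R aps N f k))^2 + (norm (- (k $ j *\<^sub>R apc N f k)))^2 \<le> (t k * (m k * m k)) * zz f k" for k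
  by (rule order_trans[OF J tA])
 have jC: "(norm (k $ j *\<^sub>R cps N f k))^2 + (norm (- (k $ j *\<^sub>R cpc N f k)))^2 \<le> (t k * (t k * (m k * m k))) * zz f k" for k
  by (rule order_trans[OF J tC])
 show ?G1 using s1[of _ _ 1, OF eq_refl[OF A]] k1(1) by simp
 show ?G2 using s2[of _ _ 1, OF tA] k1(3) by (simp add: t_def)
 show ?G3 using s1[of _ _ 1, OF jA] k1(2) by simp
 show ?G5 using s1[of _ _ 1, OF C] k1(2) by simp
 show ?G6 using s2[of _ _ 1, OF tC] k1(4) by (simp add: t_def)
 show ?G7 by (rule s1[OF jC k1(5)])
 have tjA: "t k * ((norm (k $ j *\<^sub>R aps N f k))^2 + (norm (- (k $ j *\<^sub>R apc N f k)))^2) \<le> (t k * (t k * (m k * m k))) * zz f k" for k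
  using mult_left_mono[OF jA t0[of k]] by (simp add: mult.assoc)
 have tjC: "t k * ((norm (k $ j *\<^sub>R cps N f k))^2 + (norm (- (k $ j *\<^sub>R cpc N f k)))^2) \<le> (t k * (t k * (t k * (m k * m k)))) * zz f k" for k
  using mult_left_mono[OF jC t0[of k]] by (simp add: mult.assoc)
 show ?G4 using s2[of _ _ 1, OF tjA] k1(4) by (simp add: t_def)
 show ?G8 using s2[OF tjC k1(6)] by (simp add: t_def)
 have bC: "(norm ((t k / N) *\<^sub>R cpc N f k))^2 + (norm ((t k / N) *\<^sub>R cps N f k))^2 \<le> ((1 / N^2) * (t k * (t k * (t k * (m k * m k))))) * zz f k" for k
 proof -
  have "(norm ((t k / N) *\<^sub>R cpc N f k))^2 + (norm ((t k / N) *\<^sub>R cps N f k))^2 = ((1 / N^2) * t k * t k) * ((norm (cpc N f k))^2 + (norm (cps N f k))^2)"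
   by (simp add: power_mult_distrib power_divide distrib_left add_divide_distrib) (simp add: power2_eq_square)
  also have "... \<le> ((1 / N^2) * t k * t k) * ((t k * (m k * m k)) * zz f k)" using t0[of k] by (intro mult_left_mono C) auto
  finally show ?thesis by (simp add: mult.assoc)
 qed
 have "(1 / N^2) * (t k * (t k * (t k * (m k * m k)))) \<le> (1 / N) * ((1 + t k) * m k)" for k
  using mult_left_mono[OF k1(6)[of k], of "1 / N^2"] N by (simp add: power2_eq_square)
 from s2[OF bC this] show ?G9 by (simp add: t_def)
qed

text \<open>\<open>rc\<close> and \<open>rs\<close> consist of coefficients of square-integrable
  fields times at most one factor |k|, so that division by 1 + |k|^2 leaves one derivative to spare.
  The 9 is 3 from squaring a sum of three terms, times 3 fields under Bessel's inequality.\<close>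

lemma remainder_bounds:
 assumes f: "adm f" and F: "finite F" "F \<subseteq> lat" and M: "bnd M"
 defines "p \<equiv> (\<lambda>k. (1 / (1 + (norm k)^2)) *\<^sub>R rc f k)" and "q \<equiv> (\<lambda>k. (1 / (1 + (norm k)^2)) *\<^sub>R rs f k)"
 shows "vol * nsum F p q \<le> 9 * M^2 * rho f" (is ?G1) "vol * nsum1 F p q \<le> 9 * M^2 * rho f" (is ?G2)
proof -
 define S where "S k = ((norm (Ac (cf f) k))^2 + (norm (As (cf f) k))^2) + ((norm (Ac (g0 f) k))^2 + (norm (As (g0 f) k))^2) + ((norm (Ac (g1 f) k))^2 + (norm (As (g1 f) k))^2)" for k
 have three: "(norm (a + b + c))^2 \<le> 3 * ((norm a)^2 + (norm b)^2 + (norm c)^2)" for a b c :: "R3"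
 proof -
  have "norm (a + b + c) \<le> norm a + norm b + norm c" using norm_triangle_ineq[of "a + b" c] norm_triangle_ineq[of a b] by linarith
  then have "(norm (a + b + c))^2 \<le> (norm a + norm b + norm c)^2" by (intro power_mono) auto
  also have "... \<le> 3 * ((norm a)^2 + (norm b)^2 + (norm c)^2)"
   using zero_le_power2[of "norm a - norm b"] zero_le_power2[of "norm b - norm c"] zero_le_power2[of "norm a - norm c"] by (simp add: power2_eq_square algebra_simps)
  finally show ?thesis .
 qed
 have c: "(norm (p k))^2 + (norm (q k))^2 \<le> (1 / (1 + (norm k)^2)^2) * ((1 + (norm k)^2) * (3 * S k))" for k
 proof -
  define t where "t = (norm k)^2"
  have t: "t \<ge> 0" by (simp add: t_def)
  have a: "(norm (rc f k))^2 \<le> 3 * ((norm (Ac (cf f) k))^2 + t * (norm (As (g0 f) k))^2 + t * (norm (As (g1 f) k))^2)"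
   using three[of "Ac (cf f) k" "- (As (g0 f) k *\<^sub>R k)" "- cross3 k (As (g1 f) k)"] norm_cross3_square_le[of k "As (g1 f) k"]
   by (simp add: rc_def t_def power_mult_distrib mult.commute)
  have b: "(norm (rs f k))^2 \<le> 3 * ((norm (As (cf f) k))^2 + t * (norm (Ac (g0 f) k))^2 + t * (norm (Ac (g1 f) k))^2)"
   using three[of "As (cf f) k" "Ac (g0 f) k *\<^sub>R k" "cross3 k (Ac (g1 f) k)"] norm_cross3_square_le[of k "Ac (g1 f) k"]
   by (simp add: rs_def t_def power_mult_distrib mult.commute)
  have "(norm (rc f k))^2 + (norm (rs f k))^2 \<le> (1 + t) * (3 * S k)"
  proof -
   have h: "x1 + t * x2 + t * x3 \<le> (1 + t) * (x1 + x2 + x3)" if "x1 \<ge> 0" "x2 \<ge> 0" "x3 \<ge> 0" for x1 x2 x3 :: real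
    using that mult_nonneg_nonneg[OF t that(1)] by (simp add: algebra_simps)
   have "(norm (rc f k))^2 + (norm (rs f k))^2 \<le> 3 * ((1 + t) * ((norm (Ac (cf f) k))^2 + (norm (As (g0 f) k))^2 + (norm (As (g1 f) k))^2))
    + 3 * ((1 + t) * ((norm (As (cf f) k))^2 + (norm (Ac (g0 f) k))^2 + (norm (Ac (g1 f) k))^2))"
    by (intro add_mono order_trans[OF a] order_trans[OF b] mult_left_mono h) auto
   also have "... = (1 + t) * (3 * S k)" by (simp add: S_def algebra_simps)
   finally show ?thesis .
  qed
  then have "(1 / (1 + t)^2) * ((norm (rc f k))^2 + (norm (rs f k))^2) \<le> (1 / (1 + t)^2) * ((1 + t) * (3 * S k))"
   by (intro mult_left_mono) auto
  then show ?thesis by (simp add: p_def q_def t_def power_mult_distrib power_divide distrib_left add_divide_distrib)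
 qed
 have S0: "S k \<ge> 0" for k by (simp add: S_def)
 have c1: "(norm (p k))^2 + (norm (q k))^2 \<le> 3 * S k" "(norm k)^2 * ((norm (p k))^2 + (norm (q k))^2) \<le> 3 * S k" for k
 proof -
  define t where "t = (norm k)^2"
  have t: "t \<ge> 0" by (simp add: t_def)
  define y where "y = (norm (p k))^2 + (norm (q k))^2"
  have y: "(1 + t) * y \<le> 3 * S k" "y \<ge> 0"
  proof -
   have "(1 + t) * y \<le> (1 + t) * ((1 / (1 + t)^2) * ((1 + t) * (3 * S k)))" using c[of k] t unfolding y_def t_def by (intro mult_left_mono) auto
   also have "... = 3 * S k" using t by (simp add: power2_eq_square)
   finally show "(1 + t) * y \<le> 3 * S k" .
  qed (simp add: y_def)
  have "t * y \<ge> 0" using t y by simp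
  then show "(norm (p k))^2 + (norm (q k))^2 \<le> 3 * S k" "(norm k)^2 * ((norm (p k))^2 + (norm (q k))^2) \<le> 3 * S k"
   using y unfolding y_def[symmetric] t_def[symmetric] by (simp_all add: distrib_right)
 qed
 note L = adm_inL2[OF f M]
 have "vol * (\<Sum>k\<in>F. S k) \<le> 3 * M^2 * rho f"
  using Bessel_vec[OF F L(1)] Bessel_vec[OF F L(2)] Bessel_vec[OF F L(3)] L(4,5,6)
  unfolding S_def sum.distrib by (simp add: distrib_left)
 moreover have "vol * (\<Sum>k\<in>F. 3 * S k) = 3 * (vol * (\<Sum>k\<in>F. S k))" by (simp add: sum_distrib_left[symmetric])
 ultimately have S: "vol * (\<Sum>k\<in>F. 3 * S k) \<le> 9 * M^2 * rho f" by linarith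
 show ?G1
  by (rule order_trans[OF mult_left_mono[OF sum_mono[OF c1(1)]] S]) (use vol_pos in simp)
 show ?G2
  by (rule order_trans[OF mult_left_mono[OF sum_mono[OF c1(2)]] S]) (use vol_pos in simp)
qed

lemma measurable_smooth_T[measurable]: "Borel (T F p q)"
 by (rule borel_measurable_smooth[OF smooth_T])

lemma measurable_cross3[measurable (raw)]:
 assumes "g \<in> borel_measurable M1" "h \<in> borel_measurable M1"
 shows "(\<lambda>x. cross3 (g x) (h x)) \<in> borel_measurable M1"
proof -
 have "(\<lambda>p. cross3 (fst p) (snd p)) \<in> borel_measurable (borel :: (R3 \<times> R3) measure)"
  by (intro borel_measurable_continuous_onI bounded_bilinear.continuous_on[OF bounded_bilinear_cross3] continuous_intros)
 from measurable_compose[OF borel_measurable_Pair[OF assms] this] show ?thesis by simp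
qed

lemma K_subset_cube: "K \<subseteq> cube" using cball_subset_cube[of r2] r by auto

lemma cut_zero: "x \<notin> cball x0 r1 ==> pd j ch x = 0" "x \<notin> cball x0 r1 ==> lapl ch x = 0" "x \<notin> cball x0 r1 ==> grd ch x = 0"
 "x \<notin> cball x0 r1 ==> pd j (grd ch) x = 0" "x \<notin> K ==> grd et x = 0"
proof -
 have a: "pd j ch x = 0" if "x \<notin> cball x0 r1" for x j by (rule partial_deriv_supported_cball[OF ch(2) that])
 show "pd j ch x = 0" if "x \<notin> cball x0 r1" by (rule a[OF that])
 show "lapl ch x = 0" if "x \<notin> cball x0 r1" using partial_deriv_supported_cball[OF a that] by (simp add: lapl_def)
 have b: "grd ch x = 0" if "x \<notin> cball x0 r1" for x by (rule grd_supported_cball[OF ch(2) that])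
 show "grd ch x = 0" if "x \<notin> cball x0 r1" by (rule b[OF that])
 show "pd j (grd ch) x = 0" if "x \<notin> cball x0 r1" by (rule partial_deriv_supported_cball[OF b that])
 show "grd et x = 0" if "x \<notin> K" by (rule grd_supported_cball[OF et(3) that])
qed

text \<open>For the terms in which a derivative has fallen on the cutoff: by the product rule the
  curl leaves at most one derivative on the polynomial, which then enters through its H^1 norm with
  the small weight \<open>\<mu>\<close>.\<close>

lemma first_order_term:
 fixes p q :: "R3 => R3"
 assumes f: "adm f" and F: "finite F" "F \<subseteq> lat" and w: "smooth w" "\<And>x. x \<notin> cball x0 r1 ==> w x = 0" "\<And>x. \<bar>w x\<bar> \<le> M" "\<And>x. norm (grd w x) \<le> M"
  and \<mu>: "\<mu> > 0"
 shows "L1 (\<lambda>x. f x \<bullet> curlv (\<lambda>x. w x *\<^sub>R T F p q x) x)" (is ?G1)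
  "\<bar>LBINT x. f x \<bullet> curlv (\<lambda>x. w x *\<^sub>R T F p q x) x\<bar> \<le> M * ((1 / (2 * \<mu>)) * rho f + \<mu> * (vol * nsum F p q + vol * nsum1 F p q))" (is ?G2)
proof -
 have [measurable]: "Borel f" "Borel w" "Borel (grd w)"
  using admD[OF f] by (auto intro!: borel_measurable_smooth smooth_grd w(1))
 have M0: "M \<ge> 0" using w(3)[of x0] by linarith
 define P Q where "P = (\<lambda>k. cross3 k (q k))" and "Q = (\<lambda>k. - cross3 k (p k))"
 define u1 where "u1 x = f x \<bullet> cross3 (grd w x) (T F p q x)" for x
 define u2 where "u2 x = f x \<bullet> (w x *\<^sub>R T F P Q x)" for x
 have eq: "f x \<bullet> curlv (\<lambda>x. w x *\<^sub>R T F p q x) x = u1 x + u2 x" for x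
  unfolding curlv_scaleR[OF w(1) smooth_T] curlv_T u1_def u2_def P_def Q_def by (simp add: inner_add_right)
 have gw0: "grd w x = 0" if "x \<notin> cball x0 r1" for x by (rule grd_supported_cball[OF w(2) that])
 have cc: "cball x0 r1 \<subseteq> cube" using cball_subset_cube[of r1] r by auto
 have b1: "\<bar>u1 x\<bar> \<le> M * (norm (f x) * (ind cube x * norm (T F p q x)))" for x
 proof (cases "x \<in> cball x0 r1")
  case True
  have "\<bar>u1 x\<bar> \<le> norm (f x) * norm (cross3 (grd w x) (T F p q x))" unfolding u1_def by (rule Cauchy_Schwarz_ineq2)
  also have "... \<le> norm (f x) * (M * norm (T F p q x))"
   by (intro mult_left_mono order_trans[OF norm_cross3_le] mult_right_mono w) auto
  finally show ?thesis using True cc by (auto simp: ac_simps)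
 next
  case False then show ?thesis using gw0 M0 by (simp add: u1_def)
 qed
 have b2: "\<bar>u2 x\<bar> \<le> M * (norm (f x) * (ind cube x * norm (T F P Q x)))" for x
 proof (cases "x \<in> cball x0 r1")
  case True
  have "\<bar>u2 x\<bar> \<le> norm (f x) * norm (w x *\<^sub>R T F P Q x)" unfolding u2_def by (rule Cauchy_Schwarz_ineq2)
  also have "... \<le> norm (f x) * (M * norm (T F P Q x))" by (auto intro!: mult_left_mono mult_right_mono w)
  finally show ?thesis using True cc by (auto simp: ac_simps)
 next
  case False then show ?thesis using w(2) M0 by (simp add: u2_def)
 qed
 have sq: "(\<lambda>x. (ind cube x * norm (T F p q x))^2) = (\<lambda>x. ind cube x * (norm (T F p q x))^2)" for p q :: "R3 => R3"
  by (auto simp: indicator_def fun_eq_iff)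
 have iv: "L1 (\<lambda>x. (ind cube x * norm (T F p q x))^2)" for p q :: "R3 => R3"
  unfolding sq by (rule integrable_cube_T)
 note A1 = abs_integral_product_le[OF _ b1 M0 \<mu> admD(2)[OF f] iv] and A2 = abs_integral_product_le[OF _ b2 M0 \<mu> admD(2)[OF f] iv]
 have m: "u1 \<in> borel_measurable lborel" "u2 \<in> borel_measurable lborel" unfolding u1_def u2_def by measurable
 show ?G1
  unfolding eq using A1(1)[OF m(1)] A2(1)[OF m(2)] by simp
 have "\<bar>LBINT x. f x \<bullet> curlv (\<lambda>x. w x *\<^sub>R T F p q x) x\<bar> \<le> \<bar>LBINT x. u1 x\<bar> + \<bar>LBINT x. u2 x\<bar>"
  unfolding eq using A1(1)[OF m(1)] A2(1)[OF m(2)] by (simp add: abs_triangle_ineq)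
 also have "... \<le> M * ((1 / (4 * \<mu>)) * rho f + \<mu> * (vol * nsum F p q)) + M * ((1 / (4 * \<mu>)) * rho f + \<mu> * (vol * nsum1 F p q))"
 proof (intro add_mono)
  show "\<bar>LBINT x. u1 x\<bar> \<le> M * ((1 / (4 * \<mu>)) * rho f + \<mu> * (vol * nsum F p q))"
   by (rule order_trans[OF A1(2)[OF m(1)]], unfold sq rho_def) (intro mult_left_mono add_left_mono T_L2 F M0, use \<mu> in simp)
  have "nsum F P Q \<le> nsum1 F p q"
   unfolding P_def Q_def norm_minus_cancel distrib_left by (intro sum_mono) (use norm_cross3_square_le in \<open>simp add: add_mono add.commute\<close>)
  then have n: "vol * nsum F P Q \<le> vol * nsum1 F p q" using vol_pos by simp
  show "\<bar>LBINT x. u2 x\<bar> \<le> M * ((1 / (4 * \<mu>)) * rho f + \<mu> * (vol * nsum1 F p q))"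
   by (rule order_trans[OF A2(2)[OF m(2)]], unfold sq rho_def) (intro mult_left_mono add_left_mono order_trans[OF T_L2[OF F] n] M0, use \<mu> in simp)
 qed
 also have "... = M * ((1 / (2 * \<mu>)) * rho f + \<mu> * (vol * nsum F p q + vol * nsum1 F p q))" using \<mu> by (simp add: field_simps)
 finally show ?G2 .
qed

text \<open>The Laplacian of \<open>ch\<close> times the potential is \<open>ch\<close> times the
  Laplacian, which yields the dissipation exactly through \<open>ell_T\<close>, plus commutators
  covered by \<open>first_order_term\<close>.\<close>

lemma linear_part:
 assumes f: "adm f" and N: "N \<ge> 1" and F: "finite F" "F \<subseteq> lat" and M: "bnd M"
 shows "(LBINT x. f x \<bullet> curlv (lapl (\<lambda>x. ch x *\<^sub>R T F (apc N f) (aps N f) x)) x)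
  \<le> - (vol * (DD N F f - EE N F f)) + 392 * M^2 * rho f + 1 / 8 * (vol * DD N F f)"
proof -
 define a where "a = T F (apc N f) (aps N f)"
 have sa: "smooth a" unfolding a_def by (rule smooth_T)
 \<comment> \<open>The commutators add up to \<open>7 * M * ?Z\<close>. This weight makes their
   share of the dissipation 14/112 = 1/8, and the same choice produces 392 = 7 * 56.\<close>
 define \<mu> where "\<mu> = 1 / (112 * M)"
 have M1: "M \<ge> 1" by (rule bndD(1)[OF M])
 let ?Z = "(1 / (2 * \<mu>)) * rho f + \<mu> * (2 * (vol * DD N F f))"
 have \<mu>: "\<mu> > 0" using M1 by (simp add: \<mu>_def)
 have lap: "lapl (\<lambda>x. ch x *\<^sub>R a x) = (\<lambda>x. ch x *\<^sub>R lapl a x + ((\<Sum>j\<in>UNIV. (2 * pd j ch x) *\<^sub>R pd j a x) + lapl ch x *\<^sub>R a x))"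
  by (rule ext) (rule lapl_scaleR[OF ch(1) sa])
 have s1: "smooth (\<lambda>x. ch x *\<^sub>R lapl a x)" "smooth (\<lambda>x. (2 * pd j ch x) *\<^sub>R pd j a x)" "smooth (\<lambda>x. lapl ch x *\<^sub>R a x)" for j
  by (intro smooth_scaleR smooth_mult smooth_const smooth_lapl smooth_partial ch(1) sa)+
 have cl: "curlv (lapl (\<lambda>x. ch x *\<^sub>R a x)) x = curlv (\<lambda>x. ch x *\<^sub>R lapl a x) x + ((\<Sum>j\<in>UNIV. curlv (\<lambda>x. (2 * pd j ch x) *\<^sub>R pd j a x) x) + curlv (\<lambda>x. lapl ch x *\<^sub>R a x) x)" for x
  unfolding lap using s1 by (simp add: curlv_add curlv_sum smooth_add smooth_sum)
 define I0 where "I0 x = f x \<bullet> curlv (\<lambda>x. ch x *\<^sub>R lapl a x) x" for x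
 define I1 where "I1 j x = f x \<bullet> curlv (\<lambda>x. (2 * pd j ch x) *\<^sub>R pd j a x) x" for j x
 define I2 where "I2 x = f x \<bullet> curlv (\<lambda>x. lapl ch x *\<^sub>R a x) x" for x
 have eq: "f x \<bullet> curlv (lapl (\<lambda>x. ch x *\<^sub>R a x)) x = I0 x + ((\<Sum>j\<in>UNIV. I1 j x) + I2 x)" for x
  unfolding cl I0_def I1_def I2_def by (simp add: inner_add_right inner_sum_right)
 have i0: "L1 I0" unfolding I0_def a_def lapl_T by (rule ell_T(1)[OF f])
 have v0: "(LBINT x. I0 x) = - (vol * (DD N F f - EE N F f))"
 proof -
  have "(LBINT x. I0 x) = vol * (\<Sum>k\<in>F. - ((norm k)^2 *\<^sub>R apc N f k) \<bullet> Wc f k + - ((norm k)^2 *\<^sub>R aps N f k) \<bullet> Ws f k)"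
   unfolding I0_def a_def lapl_T using ell_T(2)[OF f] by (simp add: ell_def)
  also have "... = vol * (\<Sum>k\<in>F. mm N k * zz f k - (1 + (norm k)^2) * mm N k * zz f k)"
   by (intro arg_cong[where f="\<lambda>y. vol * y"] sum.cong refl) (simp add: zz_def power2_norm_eq_inner algebra_simps)
  finally show ?thesis unfolding EE_def DD_def sum_subtractf by (simp only: right_diff_distrib minus_diff_eq)
 qed
 have ED: "vol * EE N F f \<le> vol * DD N F f" using EE_le_DD[OF N] vol_pos by simp
 note cb = coefficient_bounds[OF N]
 have vD: "vol * y \<le> vol * DD N F f" if "y \<le> DD N F f" for y using that vol_pos by simp
 have g2: "grd (\<lambda>x. 2 * pd j ch x) x = 2 *\<^sub>R grd (pd j ch) x" for j x
  using pd_bounded_linear[OF bounded_linear_mult_right smooth_partial[OF ch(1)], of _ 2] by (simp add: vec_eq_iff)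
 have i1: "L1 (I1 j)" "\<bar>LBINT x. I1 j x\<bar> \<le> 2 * M * ?Z" for j
 proof -
  have z: "2 * pd j ch x = 0" if "x \<notin> cball x0 r1" for x using cut_zero(1)[OF that] by simp
  have b: "\<bar>2 * pd j ch x\<bar> \<le> 2 * M" "norm (grd (\<lambda>x. 2 * pd j ch x) x) \<le> 2 * M" for x
   using bndD(5)[OF M, of j x] bndD(6)[OF M, of j x] unfolding g2 by auto
  have sw: "smooth (\<lambda>x. 2 * pd j ch x)" by (intro smooth_mult smooth_const smooth_partial ch(1))
  note fo = first_order_term[OF f F sw z b \<mu>, of "\<lambda>k. k $ j *\<^sub>R aps N f k" "\<lambda>k. - (k $ j *\<^sub>R apc N f k)"]
  have e: "I1 j = (\<lambda>x. f x \<bullet> curlv (\<lambda>x. (2 * pd j ch x) *\<^sub>R T F (\<lambda>k. k $ j *\<^sub>R aps N f k) (\<lambda>k. - (k $ j *\<^sub>R apc N f k)) x) x)"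
   unfolding I1_def a_def pd_T ..
  show "L1 (I1 j)" unfolding e by (rule fo(1))
  show "\<bar>LBINT x. I1 j x\<bar> \<le> 2 * M * ?Z"
  proof -
   note fo(2)[folded e]
   also have "2 * M * ((1 / (2 * \<mu>)) * rho f + \<mu> * (vol * nsum F (\<lambda>k. k $ j *\<^sub>R aps N f k) (\<lambda>k. - (k $ j *\<^sub>R apc N f k)) + vol * nsum1 F (\<lambda>k. k $ j *\<^sub>R aps N f k) (\<lambda>k. - (k $ j *\<^sub>R apc N f k))))
    \<le> 2 * M * ((1 / (2 * \<mu>)) * rho f + \<mu> * (vol * DD N F f + vol * DD N F f))"
    by (intro mult_left_mono add_mono order_refl vD order_trans[OF cb(3) EE_le_DD[OF N]] cb(4)) (use M1 \<mu> in auto)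
   finally show ?thesis by simp
  qed
 qed
 have i2: "L1 I2" "\<bar>LBINT x. I2 x\<bar> \<le> M * ?Z"
 proof -
  note fo = first_order_term[OF f F smooth_lapl[OF ch(1)] cut_zero(2) bndD(7)[OF M] bndD(8)[OF M] \<mu>, of "apc N f" "aps N f"]
  have e: "I2 = (\<lambda>x. f x \<bullet> curlv (\<lambda>x. lapl ch x *\<^sub>R T F (apc N f) (aps N f) x) x)" unfolding I2_def a_def ..
  show "L1 I2" unfolding e by (rule fo(1))
  show "\<bar>LBINT x. I2 x\<bar> \<le> M * ?Z"
  proof -
   note fo(2)[folded e]
   also have "M * ((1 / (2 * \<mu>)) * rho f + \<mu> * (vol * nsum F (apc N f) (aps N f) + vol * nsum1 F (apc N f) (aps N f)))
    \<le> M * ((1 / (2 * \<mu>)) * rho f + \<mu> * (vol * DD N F f + vol * DD N F f))"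
    by (intro mult_left_mono add_mono order_refl vD order_trans[OF cb(1) EE_le_DD[OF N]] cb(2)) (use M1 \<mu> in auto)
   finally show ?thesis by simp
  qed
 qed
 have abs_leD: "y \<le> z" if "\<bar>y\<bar> \<le> z" for y z :: real using that by simp
 have "(LBINT x. f x \<bullet> curlv (lapl (\<lambda>x. ch x *\<^sub>R a x)) x) = (LBINT x. I0 x) + ((\<Sum>j\<in>UNIV. LBINT x. I1 j x) + (LBINT x. I2 x))"
  unfolding eq using i0 i1(1) i2(1) by (simp add: LINT_add LINT_sum L1_sum)
 also have "... \<le> - (vol * (DD N F f - EE N F f)) + ((\<Sum>j\<in>(UNIV::3 set). 2 * M * ?Z) + M * ?Z)"
  unfolding v0 by (intro add_left_mono add_mono sum_mono abs_leD[OF i1(2)] abs_leD[OF i2(2)])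
 also have "... = - (vol * (DD N F f - EE N F f)) + 7 * (M * ?Z)" by simp
 also have "M * ?Z = 56 * M^2 * rho f + 1 / 56 * (vol * DD N F f)"
  using M1 by (simp add: \<mu>_def field_simps power2_eq_square)
 finally show ?thesis unfolding a_def by simp
qed

text \<open>By \<open>reconstruct\<close> a coefficient of \<open>cf\<close> is the cross product of
  k with the vorticity over 1 + |k|^2, plus a remainder, and \<open>mm\<close> times 1 + |k|^2 / N
  is 1 / (1 + |k|^2). The four summands are the curl of the test potential, the Yosida defect, the
  H^1 remainder and the Fourier truncation error.\<close>

lemma cf_decomposition:
 assumes f: "adm f" and N: "N \<ge> 1" and x: "x \<in> cube"
 shows "cf f x = T F (cpc N f) (cps N f) x
  + T F (\<lambda>k. ((norm k)^2 / N) *\<^sub>R cpc N f k) (\<lambda>k. ((norm k)^2 / N) *\<^sub>R cps N f k) x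
  + T F (\<lambda>k. (1 / (1 + (norm k)^2)) *\<^sub>R rc f k) (\<lambda>k. (1 / (1 + (norm k)^2)) *\<^sub>R rs f k) x
  + resid (cf f) F x"
proof -
 have c: "Ac (cf f) k = cpc N f k + ((norm k)^2 / N) *\<^sub>R cpc N f k + (1 / (1 + (norm k)^2)) *\<^sub>R rc f k"
  "As (cf f) k = cps N f k + ((norm k)^2 / N) *\<^sub>R cps N f k + (1 / (1 + (norm k)^2)) *\<^sub>R rs f k" for k
 proof -
  define t where "t = (norm k)^2"
  have t1: "1 + t \<noteq> 0" using zero_le_power2[of "norm k"] unfolding t_def by linarith
  have m: "(1 + t / N) * mm N k = 1 / (1 + t)" using mm_bounds(6)[OF N, of k, folded t_def] t1 by (simp add: nonzero_eq_divide_eq mult.commute)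
  have i: "v = (1 / (1 + t)) *\<^sub>R w" if "(1 + t) *\<^sub>R v = w" for v w :: "R3" unfolding that[symmetric] using t1 by simp
  have e: "(mm N k *\<^sub>R v) + (t / N) *\<^sub>R (mm N k *\<^sub>R v) = (1 / (1 + t)) *\<^sub>R v" for v :: "R3"
   unfolding m[symmetric] by (simp add: scaleR_left_distrib distrib_right)
  show "Ac (cf f) k = cpc N f k + ((norm k)^2 / N) *\<^sub>R cpc N f k + (1 / (1 + (norm k)^2)) *\<^sub>R rc f k"
   unfolding t_def[symmetric] cross_mult_right e using i[OF reconstruct(1)[OF f, of k, folded t_def]] by (simp add: scaleR_right_distrib)
  show "As (cf f) k = cps N f k + ((norm k)^2 / N) *\<^sub>R cps N f k + (1 / (1 + (norm k)^2)) *\<^sub>R rs f k"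
   unfolding t_def[symmetric] cross_mult_right scaleR_minus_right[symmetric] e using i[OF reconstruct(2)[OF f, of k, folded t_def]] by (simp add: scaleR_right_distrib scaleR_right_diff_distrib)
 qed
 have "T F (Ac (cf f)) (As (cf f)) x = T F (cpc N f) (cps N f) x
  + T F (\<lambda>k. ((norm k)^2 / N) *\<^sub>R cpc N f k) (\<lambda>k. ((norm k)^2 / N) *\<^sub>R cps N f k) x
  + T F (\<lambda>k. (1 / (1 + (norm k)^2)) *\<^sub>R rc f k) (\<lambda>k. (1 / (1 + (norm k)^2)) *\<^sub>R rs f k) x"
  unfolding T_def sum.distrib[symmetric] by (intro sum.cong refl) (simp only: c scaleR_right_distrib ac_simps)
 then show ?thesis using x by (simp add: resid_def)
qed

text \<open>Where the derivative of the test field falls on \<open>cc\<close>, the curl of the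
  potential, the cutoff is moved to \<open>f\<close> and \<open>cf_decomposition\<close> is
  inserted. The products with \<open>cc\<close>, \<open>bb\<close> and \<open>RR\<close> are bounded
  directly; the product with the remainder \<open>rr\<close> is integrated by parts first, using
  that \<open>f\<close> is solenoidal.\<close>

lemma nonlinear_part:
 assumes f: "adm f" "form_bounded \<delta> c f" and N: "N \<ge> 1" and F: "finite F" "F \<subseteq> lat" and M: "bnd M" and \<delta>: "\<delta> > 0" and c: "c > 0"
 defines "X \<equiv> vol * DD N F f" and "Y \<equiv> \<delta> * (vol * DD N F f) + c * \<kappa> f * (vol * EE N F f)"
 shows "(LBINT x. (\<Sum>j\<in>UNIV. f x $ j * (f x \<bullet> pd j (curlv (\<lambda>x. ch x *\<^sub>R T F (apc N f) (aps N f) x)) x)))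
  \<le> 55 * M^2 * Y + 1 / 8 * X + 60 * M ^ 3 * rho f + 3 * M * N * rhoF f F"
proof -
 define a where "a = T F (apc N f) (aps N f)"
 define cc where "cc = T F (cpc N f) (cps N f)"
 define bb where "bb = T F (\<lambda>k. ((norm k)^2 / N) *\<^sub>R cpc N f k) (\<lambda>k. ((norm k)^2 / N) *\<^sub>R cps N f k)"
 define rr where "rr = T F (\<lambda>k. (1 / (1 + (norm k)^2)) *\<^sub>R rc f k) (\<lambda>k. (1 / (1 + (norm k)^2)) *\<^sub>R rs f k)"
 define RR where "RR = resid (cf f) F"
 have sm: "smooth a" "smooth cc" "smooth rr" unfolding a_def cc_def rr_def by (rule smooth_T)+
 have M1: "M \<ge> 1" and M0: "M \<ge> 0" using bndD(1)[OF M] by auto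
 have N0: "N > 0" using N by simp
 have RRL: "inL2 RR" unfolding RR_def by (rule inL2_resid[OF adm_inL2(1)[OF f(1) M]])
 define \<Phi> where "\<Phi> g x = ind K x * ((norm (f x))^2 * (norm (g x))^2)" for g :: "R3 => R3" and x
 define \<Psi> where "\<Psi> g x = ind cube x * (norm (g x))^2" for g :: "R3 => R3" and x
 have \<Phi>: "L1 (\<Phi> (T F p q))" "integral\<^sup>L lborel (\<Phi> (T F p q)) \<le> \<delta> * (vol * nsum1 F p q) + c * \<kappa> f * (vol * nsum F p q)" for p q
  using f(2)[unfolded form_bounded_def, rule_format, OF F, of p q] unfolding \<Phi>_def by auto
 have \<Psi>: "L1 (\<Psi> (T F p q))" "integral\<^sup>L lborel (\<Psi> (T F p q)) \<le> vol * nsum F p q" for p q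
  unfolding \<Psi>_def by (rule integrable_cube_T) (rule T_L2[OF F])
 have fj: "\<bar>f x $ j\<bar> \<le> norm (f x)" for x j by (rule component_le_norm_cart)
 have yg: "y * z \<le> (1 / (4 * \<mu>)) * y^2 + \<mu> * z^2" if "\<mu> > 0" for y z \<mu> :: real
  using zero_le_power2[of "y - 2 * \<mu> * z"] that by (simp add: field_simps power2_eq_square)
 have cubic: "\<bar>\<alpha> * (f x $ j * (v \<bullet> w))\<bar> \<le> M * ((1 / (4 * \<mu>)) * (ind K x * ((norm (f x))^2 * (norm v)^2)) + \<mu> * (ind K x * (norm w)^2))"
  if "\<bar>\<alpha>\<bar> \<le> M" "x \<in> K \<or> \<alpha> = 0" "\<mu> > 0" for \<alpha> \<mu> x j and v w :: "R3"
 proof (cases "x \<in> K")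
  case True
  have "\<bar>\<alpha> * (f x $ j * (v \<bullet> w))\<bar> \<le> M * (norm (f x) * (norm v * norm w))"
   unfolding abs_mult by (intro mult_mono that fj Cauchy_Schwarz_ineq2) (use M0 in auto)
  also have "... \<le> M * ((1 / (4 * \<mu>)) * (norm (f x) * norm v)^2 + \<mu> * (norm w)^2)"
   using mult_left_mono[OF yg[OF that(3), of "norm (f x) * norm v" "norm w"] M0] by (simp only: mult.assoc)
  finally show ?thesis using True by (simp add: power_mult_distrib)
 qed (use that in simp)
 have quad: "\<bar>f x $ j * (f x \<bullet> y)\<bar> \<le> M * (1 / 2 * (norm (f x))^2 + 1 / 2 * (ind K x * ((norm (f x))^2 * (norm v)^2)))"
  if "norm y \<le> M * norm v" "x \<notin> K ==> y = 0" for x j and v y :: "R3"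
 proof (cases "x \<in> K")
  case True
  have "\<bar>f x $ j * (f x \<bullet> y)\<bar> \<le> norm (f x) * (norm (f x) * (M * norm v))"
   unfolding abs_mult by (intro mult_mono fj order_trans[OF Cauchy_Schwarz_ineq2] mult_left_mono that) auto
  also have "... = M * (norm (f x) * (norm (f x) * norm v))" by (simp add: ac_simps)
  also have "... \<le> M * (1 / 2 * (norm (f x))^2 + 1 / 2 * (norm (f x) * norm v)^2)"
   using mult_left_mono[OF yg[of "1 / 2" "norm (f x)" "norm (f x) * norm v"] M0] by simp
  finally show ?thesis using True by (simp add: power_mult_distrib)
 qed (use that M0 in simp)
 have K\<Psi>: "ind K x * (norm (g x))^2 \<le> \<Psi> g x" for g x using K_subset_cube by (auto simp: \<Psi>_def indicator_def)
 \<comment> \<open>\<open>f\<close> is orthogonal to the gradient of this function, which moves the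
   derivative from \<open>cc\<close> to \<open>rr\<close>. Applying the form bound to
   \<open>rr\<close> instead would give \<open>\<kappa> f * rho f\<close>, which need not be
   integrable in time. The factor \<open>et\<close> provides compact support and is 1 on the support
   of \<open>ch\<close>.\<close>
 define \<phi> where "\<phi> x = et x * (rr x \<bullet> cc x)" for x
 have s\<phi>: "smooth \<phi>" unfolding \<phi>_def by (intro smooth_mult smooth_inner et(1) sm)
 have \<phi>0: "\<phi> x = 0" if "x \<notin> K" for x using et(3)[OF that] by (simp add: \<phi>_def)
 \<comment> \<open>The weights of the Young inequalities: 1/(16 M) and N/(48 M) leave a sixteenth of
   \<open>X\<close> each after summation over the three directions, and \<open>N\<close> in front of
   \<open>RR\<close> compensates the factor \<open>N\<close> in the form bound for the derivatives
   of \<open>cc\<close>.\<close>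
 define H where "H j x = M * (1 / 2 * (norm (f x))^2 + 1 / 2 * \<Phi> (pd j a) x) + M * (1 / 2 * (norm (f x))^2 + 1 / 2 * \<Phi> a x)
  + M * (1 / 2 * (norm (f x))^2 + 1 / 2 * \<Phi> cc x) + M * (4 * M * \<Phi> cc x + 1 / (16 * M) * \<Psi> (pd j cc) x)
  + M * (12 * M / N * \<Phi> (pd j cc) x + N / (48 * M) * \<Psi> bb x) + M * (1 / (4 * N) * \<Phi> (pd j cc) x + N * (norm (RR x))^2)
  + M * (1 / 4 * \<Phi> cc x + \<Psi> rr x) + M * (1 / 4 * \<Phi> cc x + \<Psi> (pd j rr) x)" for j x
 have pw: "f x $ j * (f x \<bullet> pd j (curlv (\<lambda>x. ch x *\<^sub>R a x)) x) \<le> H j x + f x $ j * pd j \<phi> x" for j x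
 proof -
  have "curlv a = cc" by (simp only: a_def cc_def curlv_T)
  then have cur: "curlv (\<lambda>x. ch x *\<^sub>R a x) = (\<lambda>x. cross3 (grd ch x) (a x) + ch x *\<^sub>R cc x)"
   by (simp only: curlv_scaleR[OF ch(1) sm(1)] fun_eq_iff simp_thms)
  have pdc: "pd j (curlv (\<lambda>x. ch x *\<^sub>R a x)) x = cross3 (grd ch x) (pd j a x) + cross3 (pd j (grd ch) x) (a x) + (ch x *\<^sub>R pd j cc x + pd j ch x *\<^sub>R cc x)"
   unfolding cur using smooth_grd[OF ch(1)] sm ch(1) by (subst pd_add) (auto intro!: smooth_cross3 smooth_scaleR simp: pd_cross3 pd_scaleR)
  have pd\<phi>: "pd j \<phi> x = et x * (rr x \<bullet> pd j cc x + pd j rr x \<bullet> cc x) + pd j et x * (rr x \<bullet> cc x)"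
   unfolding \<phi>_def using pd_mult[OF et(1) smooth_inner[OF sm(3,2)], of j x] pd_inner[OF sm(3,2), of j x] by simp
  have m: "ch x *\<^sub>R f x = et x *\<^sub>R (cc x + bb x + rr x + RR x)"
  proof (cases "x \<in> K")
   case True
   have "cf f x = cc x + bb x + rr x + RR x"
    unfolding cc_def bb_def rr_def RR_def by (rule cf_decomposition[OF f(1) N]) (use True K_subset_cube in blast)
   moreover have "et x *\<^sub>R cf f x = cf f x" using et(2)[of x] ch(2)[of x] by (cases "x \<in> cball x0 r1") (auto simp: cf_def)
   ultimately show ?thesis by (simp add: cf_def)
  next
   case False
   then have "x \<notin> cball x0 r1" using r by auto
   then show ?thesis using et(3)[OF False] ch(2) by simp
  qed
  \<comment> \<open>The cutoff passes to \<open>f\<close>; in the term with \<open>rr\<close> the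
    product rule for \<open>\<phi>\<close> then replaces the derivative of
    \<open>cc\<close>.\<close>
  have "f x \<bullet> (ch x *\<^sub>R pd j cc x) = (ch x *\<^sub>R f x) \<bullet> pd j cc x" by simp
  then have dec: "f x $ j * (f x \<bullet> pd j (curlv (\<lambda>x. ch x *\<^sub>R a x)) x) = f x $ j * (f x \<bullet> cross3 (grd ch x) (pd j a x)) + f x $ j * (f x \<bullet> cross3 (pd j (grd ch) x) (a x))
   + f x $ j * (f x \<bullet> (pd j ch x *\<^sub>R cc x)) + et x * (f x $ j * (cc x \<bullet> pd j cc x)) + et x * (f x $ j * (pd j cc x \<bullet> bb x)) + et x * (f x $ j * (pd j cc x \<bullet> RR x))
   + (f x $ j * pd j \<phi> x - pd j et x * (f x $ j * (cc x \<bullet> rr x)) - et x * (f x $ j * (cc x \<bullet> pd j rr x)))"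
   unfolding pdc pd\<phi> inner_add_right m by (simp add: inner_add_left inner_commute algebra_simps)
  have out: "x \<notin> cball x0 r1" if "x \<notin> K" using that r by auto
  have et': "\<bar>pd j et x\<bar> \<le> M" "x \<in> K \<or> pd j et x = 0" and etK: "x \<in> K \<or> et x = 0"
   using et(3)[of x] component_le_norm_cart[of "grd et x" j] bndD(10)[OF M, of x] arg_cong[OF cut_zero(5), of x "\<lambda>v. v $ j"] by auto
  have cr: "norm (cross3 v w) \<le> M * norm w" if "norm v \<le> M" for v w
   by (rule order_trans[OF norm_cross3_le mult_right_mono[OF that norm_ge_zero]])
  have 1: "f x $ j * (f x \<bullet> cross3 (grd ch x) (pd j a x)) \<le> M * (1 / 2 * (norm (f x))^2 + 1 / 2 * \<Phi> (pd j a) x)"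
   unfolding \<Phi>_def by (rule order_trans[OF abs_ge_self quad[OF cr[OF bndD(3)[OF M]]]]) (simp add: cut_zero(3)[OF out])
  have 2: "f x $ j * (f x \<bullet> cross3 (pd j (grd ch) x) (a x)) \<le> M * (1 / 2 * (norm (f x))^2 + 1 / 2 * \<Phi> a x)"
   unfolding \<Phi>_def by (rule order_trans[OF abs_ge_self quad[OF cr[OF bndD(4)[OF M]]]]) (simp add: cut_zero(4)[OF out])
  have 3: "f x $ j * (f x \<bullet> (pd j ch x *\<^sub>R cc x)) \<le> M * (1 / 2 * (norm (f x))^2 + 1 / 2 * \<Phi> cc x)"
   unfolding \<Phi>_def by (rule order_trans[OF abs_ge_self quad]) (auto simp: cut_zero(1)[OF out] intro!: mult_right_mono bndD(5)[OF M])
  have cub: "\<bar>\<alpha> * (f x $ j * (v x \<bullet> w x))\<bar> \<le> M * ((1 / (4 * \<mu>)) * \<Phi> v x + \<mu> * \<Psi> w x)" if "\<bar>\<alpha>\<bar> \<le> M" "x \<in> K \<or> \<alpha> = 0" "\<mu> > 0" for \<alpha> \<mu> v w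
  proof -
   have "M * (1 / (4 * \<mu>) * (ind K x * ((norm (f x))^2 * (norm (v x))^2)) + \<mu> * (ind K x * (norm (w x))^2)) \<le> M * ((1 / (4 * \<mu>)) * \<Phi> v x + \<mu> * \<Psi> w x)"
    unfolding \<Phi>_def using that(3) by (intro mult_left_mono M0 add_left_mono K\<Psi>) simp
   then show ?thesis by (rule order_trans[OF cubic[OF that]])
  qed
  have 4: "et x * (f x $ j * (cc x \<bullet> pd j cc x)) \<le> M * (4 * M * \<Phi> cc x + 1 / (16 * M) * \<Psi> (pd j cc) x)"
   using cub[OF bndD(9)[OF M] etK, of "1 / (16 * M)" cc "pd j cc"] M1 by simp
  have 5: "et x * (f x $ j * (pd j cc x \<bullet> bb x)) \<le> M * (12 * M / N * \<Phi> (pd j cc) x + N / (48 * M) * \<Psi> bb x)"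
   using cub[OF bndD(9)[OF M] etK, of "N / (48 * M)" "pd j cc" bb] M1 N0 by simp
  have 6: "et x * (f x $ j * (pd j cc x \<bullet> RR x)) \<le> M * (1 / (4 * N) * \<Phi> (pd j cc) x + N * (norm (RR x))^2)"
  proof -
   have "\<Psi> RR x \<le> (norm (RR x))^2" by (simp add: \<Psi>_def indicator_def)
   then have "M * (1 / (4 * N) * \<Phi> (pd j cc) x + N * \<Psi> RR x) \<le> M * (1 / (4 * N) * \<Phi> (pd j cc) x + N * (norm (RR x))^2)" using M0 N0 by (intro mult_left_mono add_left_mono) auto
   then show ?thesis using cub[OF bndD(9)[OF M] etK N0, of "pd j cc" RR] by linarith
  qed
  have 7: "- (pd j et x * (f x $ j * (cc x \<bullet> rr x))) \<le> M * (1 / 4 * \<Phi> cc x + \<Psi> rr x)"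
   using cub[OF et' zero_less_one, of cc rr] by simp
  have 8: "- (et x * (f x $ j * (cc x \<bullet> pd j rr x))) \<le> M * (1 / 4 * \<Phi> cc x + \<Psi> (pd j rr) x)"
   using cub[OF bndD(9)[OF M] etK zero_less_one, of cc "pd j rr"] by simp
  show ?thesis unfolding dec H_def using 1 2 3 4 5 6 7 8 by linarith
 qed
 note cb = coefficient_bounds[OF N]
 have kc: "c * \<kappa> f \<ge> 0" using c kappa_ge_1[of f] by simp
 have Yb: "integral\<^sup>L lborel (\<Phi> (T F p q)) \<le> y * Y" if "nsum1 F p q \<le> y * DD N F f" "nsum F p q \<le> y * EE N F f" for p q y
 proof -
  have "\<delta> * (vol * nsum1 F p q) + c * \<kappa> f * (vol * nsum F p q) \<le> \<delta> * (vol * (y * DD N F f)) + c * \<kappa> f * (vol * (y * EE N F f))"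
   using that \<delta> kc vol_pos by (intro add_mono mult_left_mono) auto
  then show ?thesis using \<Phi>(2)[of p q] by (simp add: Y_def algebra_simps)
 qed
 have i: "L1 (\<Phi> (pd j a))" "L1 (\<Phi> a)" "L1 (\<Phi> cc)" "L1 (\<Phi> (pd j cc))"
  "L1 (\<Psi> (pd j cc))" "L1 (\<Psi> bb)" "L1 (\<Psi> rr)" "L1 (\<Psi> (pd j rr))" "L1 (\<lambda>x. (norm (RR x))^2)" for j
  using RRL unfolding a_def cc_def bb_def rr_def pd_T by (auto intro: \<Phi> \<Psi> simp: inL2_def)
 have b\<Phi>: "integral\<^sup>L lborel (\<Phi> (pd j a)) \<le> Y" "integral\<^sup>L lborel (\<Phi> a) \<le> Y" "integral\<^sup>L lborel (\<Phi> cc) \<le> Y" "integral\<^sup>L lborel (\<Phi> (pd j cc)) \<le> N * Y" for j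
  using Yb[of _ _ 1] cb unfolding a_def cc_def pd_T by (auto intro: Yb)
 define dj where "dj j = integral\<^sup>L lborel (\<Psi> (pd j cc))" for j
 have sdj: "(\<Sum>j\<in>UNIV. dj j) \<le> X"
  unfolding dj_def cc_def X_def \<Psi>_def by (rule order_trans[OF sum_pd_T_L2[OF F]]) (use cb(6) vol_pos in simp)
 have bbb: "integral\<^sup>L lborel (\<Psi> bb) \<le> X / N"
  unfolding bb_def by (rule order_trans[OF \<Psi>(2)]) (use mult_left_mono[OF cb(9), of vol] vol_pos in \<open>simp add: X_def\<close>)
 have brr: "integral\<^sup>L lborel (\<Psi> rr) \<le> 9 * M^2 * rho f" "integral\<^sup>L lborel (\<Psi> (pd j rr)) \<le> 9 * M^2 * rho f" for j
 proof -
  show "integral\<^sup>L lborel (\<Psi> rr) \<le> 9 * M^2 * rho f" unfolding rr_def by (rule order_trans[OF \<Psi>(2) remainder_bounds(1)[OF f(1) F M]])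
  have "integral\<^sup>L lborel (\<Psi> (pd j rr)) \<le> (\<Sum>i\<in>UNIV. integral\<^sup>L lborel (\<Psi> (pd i rr)))"
   by (rule member_le_sum) (auto simp: \<Psi>_def intro!: integral_nonneg_AE)
  also have "... \<le> 9 * M^2 * rho f" unfolding rr_def \<Psi>_def by (rule order_trans[OF sum_pd_T_L2[OF F] remainder_bounds(2)[OF f(1) F M]])
  finally show "integral\<^sup>L lborel (\<Psi> (pd j rr)) \<le> 9 * M^2 * rho f" .
 qed
 note f2 = admD(2)[OF f(1)]
 have iH: "L1 (H j)" for j
  unfolding H_def by (intro L1_add integrable_mult_right f2 i)
 have HI: "integral\<^sup>L lborel (H j) \<le> 3 * (M * (1 / 2 * rho f + 1 / 2 * Y)) + M * (4 * M * Y + (1 / (16 * M)) * dj j) + M * (12 * M * Y + (1 / (48 * M)) * X)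
   + M * (1 / 4 * Y + N * rhoF f F) + 2 * (M * (1 / 4 * Y + 9 * M^2 * rho f))" for j
 proof -
  let ?I = "integral\<^sup>L lborel"
  have "?I (H j) = M * (1 / 2 * rho f + 1 / 2 * ?I (\<Phi> (pd j a))) + M * (1 / 2 * rho f + 1 / 2 * ?I (\<Phi> a))
   + M * (1 / 2 * rho f + 1 / 2 * ?I (\<Phi> cc)) + M * (4 * M * ?I (\<Phi> cc) + 1 / (16 * M) * dj j)
   + M * (12 * M / N * ?I (\<Phi> (pd j cc)) + N / (48 * M) * ?I (\<Psi> bb)) + M * (1 / (4 * N) * ?I (\<Phi> (pd j cc)) + N * rhoF f F)
   + M * (1 / 4 * ?I (\<Phi> cc) + ?I (\<Psi> rr)) + M * (1 / 4 * ?I (\<Phi> cc) + ?I (\<Psi> (pd j rr)))"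
   unfolding H_def rho_def rhoF_def dj_def RR_def[symmetric] using f2 i
   by (simp add: LINT_add L1_add)
  also have "... \<le> M * (1 / 2 * rho f + 1 / 2 * Y) + M * (1 / 2 * rho f + 1 / 2 * Y)
   + M * (1 / 2 * rho f + 1 / 2 * Y) + M * (4 * M * Y + 1 / (16 * M) * dj j)
   + M * (12 * M / N * (N * Y) + N / (48 * M) * (X / N)) + M * (1 / (4 * N) * (N * Y) + N * rhoF f F)
   + M * (1 / 4 * Y + 9 * M^2 * rho f) + M * (1 / 4 * Y + 9 * M^2 * rho f)"
   using M0 N0 by (intro add_mono mult_left_mono b\<Phi> bbb brr order_refl) auto
  also have "... = 3 * (M * (1 / 2 * rho f + 1 / 2 * Y)) + M * (4 * M * Y + (1 / (16 * M)) * dj j) + M * (12 * M * Y + (1 / (48 * M)) * X)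
   + M * (1 / 4 * Y + N * rhoF f F) + 2 * (M * (1 / 4 * Y + 9 * M^2 * rho f))"
   using N0 by simp
  finally show ?thesis .
 qed
 have DE0: "DD N F f \<ge> 0" "EE N F f \<ge> 0" using EE_nonneg[OF N, of F f] EE_le_DD[OF N, of F f] by auto
 have Y0: "Y \<ge> 0" "X \<ge> 0" unfolding Y_def X_def using \<delta> kc vol_pos DE0 by (auto intro!: add_nonneg_nonneg mult_nonneg_nonneg)
 have Mp: "M \<le> M^2" "M \<le> M ^ 3"
  using self_le_power[OF M1, of 2] self_le_power[OF M1, of 3] by auto
 have SH: "(\<Sum>j\<in>UNIV. integral\<^sup>L lborel (H j)) \<le> 55 * M^2 * Y + 1 / 8 * X + 60 * M ^ 3 * rho f + 3 * M * N * rhoF f F"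
 proof -
  have "(\<Sum>j\<in>UNIV. integral\<^sup>L lborel (H j)) \<le> (\<Sum>j\<in>UNIV. 3 * (M * (1 / 2 * rho f + 1 / 2 * Y)) + M * (4 * M * Y + (1 / (16 * M)) * dj j) + M * (12 * M * Y + (1 / (48 * M)) * X)
   + M * (1 / 4 * Y + N * rhoF f F) + 2 * (M * (1 / 4 * Y + 9 * M^2 * rho f)))" by (intro sum_mono HI)
  also have "... = (27 / 4 * M + 48 * M^2) * Y + (1 / 16) * (\<Sum>j\<in>UNIV. dj j) + 1 / 16 * X + (9 / 2 * M + 54 * M ^ 3) * rho f + 3 * M * N * rhoF f F"
   using M1 by (simp add: sum.distrib sum_distrib_left[symmetric] sum_divide_distrib[symmetric] algebra_simps power2_eq_square power3_eq_cube)
  also have "... \<le> (7 * M^2 + 48 * M^2) * Y + (1 / 16) * X + 1 / 16 * X + (6 * M ^ 3 + 54 * M ^ 3) * rho f + 3 * M * N * rhoF f F"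
   using Mp M0 by (intro add_mono mult_right_mono mult_left_mono sdj Y0 rho_nonneg order_refl) auto
  finally show ?thesis by (simp add: algebra_simps)
 qed
 show ?thesis
 \<comment> \<open>If the integrand is not integrable, its integral is 0 by convention, and the
   bound holds because the right-hand side is nonnegative.\<close>
 proof (cases "L1 (\<lambda>x. tri (f x) (curlv (\<lambda>x. ch x *\<^sub>R a x)) x)")
  case False
  have "0 \<le> rhoF f F" unfolding rhoF_def by (rule integral_nonneg_AE) simp
  then have "0 \<le> 55 * M^2 * Y + 1 / 8 * X + 60 * M ^ 3 * rho f + 3 * M * N * rhoF f F"
   using Y0 M0 N0 rho_nonneg[of f] by (intro add_nonneg_nonneg mult_nonneg_nonneg) auto
  then show ?thesis using not_integrable_integral_eq[OF False] unfolding a_def by simp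
 next
  case True
  have "\<phi> \<in> test_functions (ball x0 R)"
   by (rule test_functionsI[OF s\<phi> compact_cball _ \<phi>0]) (use r in auto)
  then have z: "(LBINT x. f x \<bullet> grd \<phi> x) = 0" by (rule admD(3)[OF f(1)])
  have ig: "L1 (\<lambda>x. f x \<bullet> grd \<phi> x)"
  proof (rule L1_bound[OF L1_add[OF f2]])
   show "L1 (\<lambda>x. (norm (grd \<phi> x))^2)"
    by (rule integrable_compact_support[OF _ compact_cball[of x0 r2]])
     (use grd_supported_cball[OF \<phi>0] smooth_continuous[OF smooth_grd[OF s\<phi>]] in \<open>auto intro!: continuous_on_power continuous_on_norm\<close>)
   show "(\<lambda>x. f x \<bullet> grd \<phi> x) \<in> borel_measurable lborel"
    using admD(1)[OF f(1)] borel_measurable_smooth[OF smooth_grd[OF s\<phi>]] by measurable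
   show "AE x in lborel. norm (f x \<bullet> grd \<phi> x) \<le> norm ((norm (f x))^2 + (norm (grd \<phi> x))^2)" (is "AE x in _. ?P x")
   proof (rule AE_I2)
    fix x
    have "norm (f x) * norm (grd \<phi> x) \<le> (norm (f x))^2 + (norm (grd \<phi> x))^2"
     using yg[of "1 / 2" "norm (f x)" "norm (grd \<phi> x)"] zero_le_power2[of "norm (f x)"] zero_le_power2[of "norm (grd \<phi> x)"] by linarith
    then show "?P x"
     using Cauchy_Schwarz_ineq2[of "f x" "grd \<phi> x"] by simp
   qed
  qed
  have "(LBINT x. (tri (f x) (curlv (\<lambda>x. ch x *\<^sub>R a x)) x)) \<le> (LBINT x. (\<Sum>j\<in>UNIV. H j x) + f x \<bullet> grd \<phi> x)"
  proof (rule integral_mono[OF True])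
   show "L1 (\<lambda>x. (\<Sum>j\<in>UNIV. H j x) + f x \<bullet> grd \<phi> x)" by (intro L1_add L1_sum iH ig)
   fix x
   have "f x \<bullet> grd \<phi> x = (\<Sum>j\<in>UNIV. f x $ j * pd j \<phi> x)" by (simp add: grd_def inner_sum_right inner_axis mult.commute)
   then show "(tri (f x) (curlv (\<lambda>x. ch x *\<^sub>R a x)) x) \<le> (\<Sum>j\<in>UNIV. H j x) + f x \<bullet> grd \<phi> x"
    using sum_mono[of UNIV, OF pw] by (simp add: sum.distrib)
  qed
  also have "... = (\<Sum>j\<in>UNIV. integral\<^sup>L lborel (H j))"
   using ig iH z by (simp add: LINT_add LINT_sum L1_sum)
  finally show ?thesis using SH unfolding a_def by simp
 qed
qed

text \<open>Of the full dissipation three eighths are spent: one on the commutators of the Laplacian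
  and two on the convection. What is left is more than the stated half.\<close>

theorem stationary_estimate:
 obtains C where "C > 0" "\<And>f N F. adm f ==> N \<ge> 1 ==> finite F ==> F \<subseteq> lat ==>
  GG f (\<lambda>x. ch x *\<^sub>R T F (apc N f) (aps N f) x)
   \<le> vol * (- (1 / 2) * DD N F f + C * \<kappa> f * EE N F f) + C * (rho f + N * rhoF f F)"
proof -
 obtain M where M: "bnd M" using ex_bnd by blast
 have M1: "M \<ge> 1" by (rule bndD(1)[OF M])
 \<comment> \<open>Chosen so that \<open>55 * M^2 * \<delta>\<close> is 1/8.\<close>
 define \<delta> where "\<delta> = 1 / (440 * M^2)"
 have \<delta>: "\<delta> > 0" using M1 by (simp add: \<delta>_def)
 obtain c where c: "c > 0" "\<And>f. adm f ==> form_bounded \<delta> c f" using form_bound[OF \<delta>] by blast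
 define C where "C = 1 + 55 * M^2 * c + (392 * M^2 + 60 * M ^ 3) + 3 * M"
 have pos: "55 * M^2 * c \<ge> 0" "392 * M^2 + 60 * M ^ 3 \<ge> 0" "3 * M \<ge> 0" using M1 c(1) by auto
 show ?thesis
 proof (rule that)
  show "C > 0" unfolding C_def using pos by linarith
  fix f N F assume f: "adm f" and N: "N \<ge> (1::real)" and F: "finite F" "F \<subseteq> lat"
  have D0: "vol * DD N F f \<ge> 0" "vol * EE N F f \<ge> 0" using EE_nonneg[OF N, of F f] EE_le_DD[OF N, of F f] vol_pos by auto
  have k: "vol * EE N F f \<le> \<kappa> f * (vol * EE N F f)" using mult_right_mono[OF kappa_ge_1[of f] D0(2)] by simp
  have rF: "rhoF f F \<ge> 0" unfolding rhoF_def by (rule integral_nonneg_AE) simp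
  have NF: "N * rhoF f F \<ge> 0" using rF N by simp
  have kE: "\<kappa> f * (vol * EE N F f) \<ge> 0" using k D0 by linarith
  have "GG f (\<lambda>x. ch x *\<^sub>R T F (apc N f) (aps N f) x)
   \<le> (- (vol * (DD N F f - EE N F f)) + 392 * M^2 * rho f + 1 / 8 * (vol * DD N F f))
    + (55 * M^2 * (\<delta> * (vol * DD N F f) + c * \<kappa> f * (vol * EE N F f)) + 1 / 8 * (vol * DD N F f) + 60 * M ^ 3 * rho f + 3 * M * N * rhoF f F)"
   unfolding GG_def by (rule add_mono[OF linear_part[OF f N F M] nonlinear_part[OF f c(2)[OF f] N F M \<delta> c(1)]])
  also have "... = - (5 / 8) * (vol * DD N F f) + vol * EE N F f + 55 * M^2 * c * (\<kappa> f * (vol * EE N F f)) + (392 * M^2 + 60 * M ^ 3) * rho f + 3 * M * (N * rhoF f F)"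
   using M1 by (simp add: \<delta>_def field_simps)
  also have "... \<le> - (1 / 2) * (vol * DD N F f) + 1 * (\<kappa> f * (vol * EE N F f)) + 55 * M^2 * c * (\<kappa> f * (vol * EE N F f)) + (392 * M^2 + 60 * M ^ 3) * rho f + 3 * M * (N * rhoF f F)"
   using D0 k by linarith
  also have "... = - (1 / 2) * (vol * DD N F f) + (1 + 55 * M^2 * c) * (\<kappa> f * (vol * EE N F f)) + ((392 * M^2 + 60 * M ^ 3) * rho f + 3 * M * (N * rhoF f F))"
   by (simp only: distrib_right add.assoc)
  also have "... \<le> - (1 / 2) * (vol * DD N F f) + C * (\<kappa> f * (vol * EE N F f)) + (C * rho f + C * (N * rhoF f F))"
   using pos by (intro add_mono order_refl mult_right_mono kE rho_nonneg NF) (use pos in \<open>unfold C_def, linarith+\<close>)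
  also have "... = vol * (- (1 / 2) * DD N F f + C * \<kappa> f * EE N F f) + C * (rho f + N * rhoF f F)"
   by (simp add: algebra_simps)
  finally show "GG f (\<lambda>x. ch x *\<^sub>R T F (apc N f) (aps N f) x)
   \<le> vol * (- (1 / 2) * DD N F f + C * \<kappa> f * EE N F f) + C * (rho f + N * rhoF f F)" .
 qed
qed

end

section \<open>Weak derivatives in time and the evolution of the coefficients\<close>

text \<open>Primitive from minus infinity. Such primitives take the place of absolutely continuous
  functions: the product rule and Gronwall's inequality are stated for them.\<close>

definition prim :: "(real => real) => real => real" where
 "prim g t = (LBINT q. ind {..t} q * g q)"

lemma prim_integrable:
 fixes g :: "real => real"
 shows "L1 g ==> L1 (\<lambda>q. ind {..t} q * g q :: real)"
 by (rule integrable_mult_indicator[where 'b=real, simplified real_scaleR_def]) (simp_all add: borel_closed)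

lemma prim_measurable [measurable]:
 assumes [measurable]: "Borel g"
 shows "Borel (prim g)"
proof -
 have "Borel (\<lambda>t. LBINT q. (if q \<le> t then 1 else 0) * g q)" by measurable
 moreover have "prim g = (\<lambda>t. LBINT q. (if q \<le> t then 1 else 0) * g q)"
  unfolding prim_def by (intro ext LINT_cong) auto
 ultimately show ?thesis by simp
qed

lemma prim_add: "L1 g ==> L1 h ==> prim (\<lambda>q. g q + h q) t = prim g t + prim h t"
 unfolding prim_def by (simp add: distrib_left LINT_add[OF prim_integrable prim_integrable])

lemma prim_cmult: "prim (\<lambda>q. c * g q) t = c * prim g t"
 unfolding prim_def by (simp add: mult.left_commute)

lemma prim_sum: "(\<And>i. i \<in> I ==> L1 (g i)) ==> prim (\<lambda>q. \<Sum>i\<in>I. g i q) t = (\<Sum>i\<in>I. prim (g i) t)"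
 unfolding prim_def by (simp add: sum_distrib_left LINT_sum[OF prim_integrable])

lemma prim_mono: "L1 g ==> L1 h ==> (\<And>q. g q \<le> h q) ==> prim g t \<le> prim h t"
 unfolding prim_def by (intro integral_mono prim_integrable mult_left_mono) auto

lemma prim_abs_le:
 assumes "L1 g"
 shows "\<bar>prim g t\<bar> \<le> (LBINT q. \<bar>g q\<bar>)"
proof -
 have "\<bar>prim g t\<bar> \<le> (LBINT q. \<bar>ind {..t} q * g q\<bar>)" unfolding prim_def by (rule integral_abs_bound)
 also have "... \<le> (LBINT q. \<bar>g q\<bar>)"
  by (rule integral_mono[OF integrable_abs[OF prim_integrable[OF assms]] integrable_abs[OF assms]]) (simp add: indicator_def)
 finally show ?thesis .
qed

lemma prim_nonneg: "(\<And>q. g q \<ge> 0) ==> prim g t \<ge> 0"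
 unfolding prim_def by (rule integral_nonneg_AE) simp

lemma prim_le_integral: "L1 g ==> (\<And>q. g q \<ge> 0) ==> prim g t \<le> integral\<^sup>L lborel g"
 unfolding prim_def by (intro integral_mono prim_integrable) (auto simp: indicator_def)

lemma integrable_mult_prim:
 assumes "L1 g" "L1 h"
 shows "L1 (\<lambda>q. prim g q * h q)"
proof -
 have [measurable]: "Borel g" "Borel h" using assms by auto
 show ?thesis
 proof (rule L1_bound)
  show "L1 (\<lambda>q. (LBINT q. \<bar>g q\<bar>) * h q)" using assms by simp
  show "AE q in lborel. norm (prim g q * h q) \<le> norm ((LBINT q. \<bar>g q\<bar>) * h q)"
   using prim_abs_le[OF assms(1)] by (auto simp: abs_mult intro!: mult_right_mono intro: order_trans[OF _ abs_ge_self])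
  show "(\<lambda>q. prim g q * h q) \<in> borel_measurable lborel" by measurable
 qed
qed

text \<open>Integration by parts as Fubini: the product of the two integrals is an integral over a
  square, split into the triangles r \<le> q and q < r.\<close>

lemma prim_product:
 assumes g: "L1 g" and h: "L1 h"
 shows "prim g t * prim h t = prim (\<lambda>q. prim g q * h q + prim h q * g q) t"
proof -
 have [measurable]: "Borel g" "Borel h" using g h by auto
 define g' where "g' q = (if q \<le> t then g q else 0)" for q
 define h' where "h' q = (if q \<le> t then h q else 0)" for q
 have [measurable]: "Borel g'" "Borel h'" unfolding g'_def h'_def by measurable
 have e: "(\<lambda>q. ind {..t} q * g q) = g'" "(\<lambda>q. ind {..t} q * h q) = h'" by (auto simp: g'_def h'_def)
 have i: "L1 g'" "L1 h'" using prim_integrable[OF g, of t] prim_integrable[OF h, of t] by (simp_all add: e)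
 have ip: "integrable lborel2 (\<lambda>(r, q). g' r * h' q)"
  using i by (intro lborel_pair.Fubini_integrable) (auto simp: abs_mult)
 define P where "P = (\<lambda>r q. (if r \<le> q then 1 else 0) * (g' r * h' q))"
 define S where "S = (\<lambda>r q. (if q < r then 1 else 0) * (g' r * h' q))"
 have iP: "integrable lborel2 (case_prod P)"
  by (rule L1_bound[OF ip]) (auto simp: P_def)
 have iS: "integrable lborel2 (case_prod S)"
  by (rule L1_bound[OF ip]) (auto simp: S_def)
 have "prim g t * prim h t = (LBINT r. LBINT q. g' r * h' q)" by (simp add: prim_def e)
 also have "... = integral\<^sup>L lborel2 (\<lambda>z. case z of (r, q) => g' r * h' q)"
  by (rule lborel_pair.integral_fst[OF ip])
 also have "(\<lambda>z. case z of (r, q) => g' r * h' q) = (\<lambda>z. case_prod P z + case_prod S z)" by (auto simp: P_def S_def)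
 also have "integral\<^sup>L lborel2 (\<lambda>z. case_prod P z + case_prod S z) = (LBINT q. LBINT r. P r q) + (LBINT r. LBINT q. S r q)"
  unfolding lborel_pair.integral_fst[OF iS] lborel_pair.integral_snd[OF iP] by (rule LINT_add[OF iP iS])
 also have "(LBINT q. LBINT r. P r q) = prim (\<lambda>q. prim g q * h q) t"
  unfolding prim_def
 proof (rule LINT_cong[OF refl])
  fix q
  have "(LBINT r. P r q) = (LBINT r. (ind {..q} r * g r) * (ind {..t} q * h q))"
   by (rule LINT_cong) (auto simp: P_def g'_def h'_def)
  then show "(LBINT r. P r q) = ind {..t} q * ((LBINT r. ind {..q} r * g r) * h q)"
   by (simp add: mult.left_commute)
 qed
 also have "(LBINT r. LBINT q. S r q) = prim (\<lambda>q. prim h q * g q) t"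
  unfolding prim_def
 proof (rule LINT_cong[OF refl])
  fix r
  have "(LBINT q. S r q) = (LBINT q. (ind {..r} q * h q) * (ind {..t} r * g r))"
  proof (rule integral_cong_AE)
   show "AE q in lborel. S r q = ind {..r} q * h q * (ind {..t} r * g r)"
    using AE_lborel_singleton[of r] by eventually_elim (auto simp: S_def g'_def h'_def)
  qed (simp_all add: S_def)
  then show "(LBINT q. S r q) = ind {..t} r * ((LBINT q. ind {..r} q * h q) * g r)"
   by (simp add: mult.left_commute)
 qed
 also have "prim (\<lambda>q. prim g q * h q) t + prim (\<lambda>q. prim h q * g q) t = prim (\<lambda>q. prim g q * h q + prim h q * g q) t"
  by (rule prim_add[symmetric]) (intro integrable_mult_prim g h)+
 finally show ?thesis .
qed

text \<open>The chain rule for powers of a primitive, by induction with the product rule.\<close>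

lemma integrable_prim_power:
 assumes k: "L1 k" "\<And>q. k q \<ge> 0"
 shows "L1 (\<lambda>q. real (Suc j) * (k q * prim k q ^ j)) \<and> (\<forall>t. prim k t ^ Suc j = prim (\<lambda>q. real (Suc j) * (k q * prim k q ^ j)) t)"
proof (induction j)
 case 0
 then show ?case using k by simp
next
 case (Suc j)
 define kj where "kj q = real (Suc j) * (k q * prim k q ^ j)" for q
 have kj: "L1 kj" "\<And>t. prim k t ^ Suc j = prim kj t" using Suc unfolding kj_def by auto
 have e: "(\<lambda>q. real (Suc (Suc j)) * (k q * prim k q ^ Suc j)) = (\<lambda>q. prim k q * kj q + prim kj q * k q)"
  unfolding kj(2)[symmetric] by (simp add: kj_def fun_eq_iff algebra_simps)
 show ?case
  unfolding e using prim_product[OF k(1) kj(1)] L1_add[OF integrable_mult_prim[OF k(1) kj(1)] integrable_mult_prim[OF kj(1) k(1)]]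
  by (simp add: kj(2)[symmetric])
qed

text \<open>Picard iteration: inserting the inequality into itself n times bounds \<open>e\<close>
  by \<open>A\<close> times a partial sum of the exponential series plus \<open>S\<close> times K^n
  / n!, where K is the primitive of \<open>k\<close>. The last term tends to 0 because the a priori
  bound \<open>S\<close> is fixed.\<close>

lemma Gronwall_prim:
 assumes k: "L1 k" "\<And>q. k q \<ge> 0" and e: "Borel e" "\<And>t. 0 \<le> e t" "\<And>t. e t \<le> S"
  and A: "A \<ge> 0" and le: "\<And>t. e t \<le> A + prim (\<lambda>q. k q * e q) t"
 shows "e t \<le> A * exp (prim k t)"
proof -
 note [measurable] = e(1) borel_measurable_integrable[OF k(1)]
 have S0: "S \<ge> 0" using order_trans[OF e(2,3)] .
 have K0: "prim k t \<ge> 0" for t by (rule prim_nonneg) (rule k(2))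
 have ke: "L1 (\<lambda>q. k q * e q)"
 proof (rule L1_bound)
  show "L1 (\<lambda>q. k q * S)" using k by simp
  show "AE q in lborel. norm (k q * e q) \<le> norm (k q * S)" using e k S0 by (auto intro!: mult_left_mono)
 qed measurable
 have kK: "L1 (\<lambda>q. k q * prim k q ^ j)" for j
  using conjunct1[OF integrable_prim_power[OF k, of j]] by (simp del: of_nat_Suc)
 have kKp: "prim (\<lambda>q. k q * prim k q ^ j) t = prim k t ^ Suc j / real (Suc j)" for j t
  using integrable_prim_power[OF k, of j] by (simp add: prim_cmult del: of_nat_Suc power_Suc)
 have it: "e t \<le> A * (\<Sum>j<n. prim k t ^ j / fact j) + S * (prim k t ^ n / fact n)" for n t
 proof (induction n arbitrary: t)
  case 0
  show ?case using e(3) by simp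
 next
  case (Suc n)
  define b where "b q = A * (\<Sum>j<n. (1 / fact j) * (k q * prim k q ^ j)) + (S / fact n) * (k q * prim k q ^ n)" for q
  have ib: "L1 b" unfolding b_def by (intro L1_add integrable_mult_right L1_sum kK)
  have "k q * e q \<le> b q" for q
   using mult_left_mono[OF Suc[of q] k(2)[of q]] by (simp add: b_def distrib_left sum_distrib_left ac_simps)
  then have "e t \<le> A + prim b t" using le[of t] prim_mono[OF ke ib, of t] by simp
  also have "prim b t = A * (\<Sum>j<n. (1 / fact j) * (prim k t ^ Suc j / real (Suc j))) + (S / fact n) * (prim k t ^ Suc n / real (Suc n))"
  proof -
   have "prim (\<lambda>q. \<Sum>j<n. (1 / fact j) * (k q * prim k q ^ j)) t = (\<Sum>j<n. (1 / fact j) * (prim k t ^ Suc j / real (Suc j)))"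
    unfolding kKp[symmetric] prim_cmult[symmetric] by (rule prim_sum) (intro integrable_mult_right kK)
   moreover have "prim b t = prim (\<lambda>q. A * (\<Sum>j<n. (1 / fact j) * (k q * prim k q ^ j))) t + prim (\<lambda>q. (S / fact n) * (k q * prim k q ^ n)) t"
    unfolding b_def by (rule prim_add) (intro integrable_mult_right L1_sum kK)+
   ultimately show ?thesis by (simp only: prim_cmult kKp)
  qed
  also have "A + (A * (\<Sum>j<n. (1 / fact j) * (prim k t ^ Suc j / real (Suc j))) + (S / fact n) * (prim k t ^ Suc n / real (Suc n)))
    = A * (1 + (\<Sum>j<n. prim k t ^ Suc j / fact (Suc j))) + S * (prim k t ^ Suc n / fact (Suc n))"
   by (simp add: distrib_left mult.commute)
  also have "1 + (\<Sum>j<n. prim k t ^ Suc j / fact (Suc j)) = (\<Sum>j<Suc n. prim k t ^ j / fact j)"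
   by (subst sum.lessThan_Suc_shift) simp
  finally show ?case .
 qed
 have "(\<lambda>n. prim k t ^ n / fact n) \<longlonglongrightarrow> 0"
  using summable_LIMSEQ_zero[OF summable_exp_generic[of "prim k t"]] by (simp add: divide_inverse mult.commute)
 then have "(\<lambda>n. A * exp (prim k t) + S * (prim k t ^ n / fact n)) \<longlonglongrightarrow> A * exp (prim k t) + S * 0"
  by (intro tendsto_intros)
 moreover have "e t \<le> A * exp (prim k t) + S * (prim k t ^ n / fact n)" for n
 proof -
  have "(\<Sum>j<n. prim k t ^ j / fact j) \<le> exp (prim k t)"
   using sum_le_suminf[OF summable_exp_generic[of "prim k t"], of "{..<n}"] K0 by (simp add: exp_def divide_inverse mult.commute)
  then show ?thesis using it[of t n] mult_left_mono[OF _ A] by fastforce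
 qed
 ultimately show ?thesis by (intro LIMSEQ_le_const[where a="e t"]) auto
qed

lemma prim_partial_deriv:
 fixes \<theta> :: "real => real"
 assumes \<theta>: "smooth \<theta>" "compact K" "\<And>t. t \<notin> K ==> \<theta> t = 0"
 shows "prim (partial_deriv 1 \<theta>) t = \<theta> t"
proof -
 obtain L where L: "\<And>x. x \<in> K ==> \<bar>x\<bar> \<le> L" using compact_imp_bounded[OF \<theta>(2)] by (auto simp: bounded_iff)
 define l where "l = min t (- \<bar>L\<bar> - 1)"
 have z: "\<theta> x = 0" "partial_deriv 1 \<theta> x = 0" if "x \<le> l" for x
 proof -
  have "x \<notin> K" using L[of x] that by (auto simp: l_def)
  then show "\<theta> x = 0" "partial_deriv 1 \<theta> x = 0" using \<theta>(3) partial_deriv_zero_outside[OF \<theta>(2,3)] by auto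
 qed
 have "(LBINT x. ind {l..t} x *\<^sub>R partial_deriv 1 \<theta> x) = \<theta> t - \<theta> l"
 proof (rule integral_FTC_Icc)
  show "l \<le> t" by (simp add: l_def)
  show "(\<theta> has_vector_derivative partial_deriv 1 \<theta> x) (at x within {l..t})" for x
   using smooth_line[OF \<theta>(1), of 0 1 x] by simp
  show "continuous_on {l..t} (partial_deriv 1 \<theta>)"
   by (rule continuous_on_subset[OF smooth_continuous[OF smooth_partial[OF \<theta>(1)]]]) simp
 qed
 moreover have "(LBINT x. ind {l..t} x *\<^sub>R partial_deriv 1 \<theta> x) = prim (partial_deriv 1 \<theta>) t"
  unfolding prim_def using z(2) by (intro LINT_cong) (auto simp: indicator_def)
 ultimately show ?thesis using z(1)[of l] by simp
qed

lemma smooth_prim: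
 assumes z: "smooth \<zeta>" "compact K" "\<And>t. t \<notin> K ==> \<zeta> t = 0"
 shows "smooth (prim \<zeta>)" "partial_deriv 1 (prim \<zeta>) = \<zeta>" (is ?G1)
proof -
 obtain L where L: "\<And>x. x \<in> K ==> \<bar>x\<bar> \<le> L" using compact_imp_bounded[OF z(2)] by (auto simp: bounded_iff)
 have D: "(prim \<zeta> has_derivative (\<lambda>h. h * \<zeta> t)) (at t)" for t
 proof -
  define l where "l = min t (- \<bar>L\<bar>) - 1"
  have co: "continuous_on {l..t+1} \<zeta>" by (rule continuous_on_subset[OF smooth_continuous[OF z(1)]]) simp
  have "((\<lambda>u. integral {l..u} \<zeta>) has_vector_derivative \<zeta> t) (at t within {l..t+1})"
   by (rule integral_has_vector_derivative[OF co]) (auto simp: l_def)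
  then have "((\<lambda>u. integral {l..u} \<zeta>) has_derivative (\<lambda>h. h * \<zeta> t)) (at t within {l<..<t+1})"
   unfolding has_vector_derivative_def real_scaleR_def by (rule has_derivative_subset) auto
  note d = this
  have e: "integral {l..u} \<zeta> = prim \<zeta> u" if "u \<in> {l<..<t+1}" for u
  proof -
   have "set_integrable lborel {l..u} \<zeta>"
    unfolding set_integrable_def using borel_integrable_compact[of "{l..u}" \<zeta>] continuous_on_subset[OF smooth_continuous[OF z(1)], of "{l..u}"] by auto
   from set_borel_integral_eq_integral(2)[OF this] have "integral {l..u} \<zeta> = (LBINT x. ind {l..u} x * \<zeta> x)" by (simp add: set_lebesgue_integral_def)
   also have "... = prim \<zeta> u" unfolding prim_def
   proof (rule LINT_cong[OF refl])
    fix x show "ind {l..u} x * \<zeta> x = ind {..u} x * \<zeta> x"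
    proof (cases "x < l")
     case True
     then have "x \<notin> K" using L[of x] by (auto simp: l_def)
     then show ?thesis using z(3) by simp
    qed (auto simp: indicator_def)
   qed
   finally show ?thesis .
  qed
  have tl: "t \<in> {l<..<t+1}" by (auto simp: l_def)
  have "(prim \<zeta> has_derivative (\<lambda>h. h * \<zeta> t)) (at t within {l<..<t+1})"
   by (rule has_derivative_transform[OF tl _ d]) (simp add: e)
  then show ?thesis by (simp only: at_within_open[OF tl open_greaterThanLessThan])
 qed
 show "smooth (prim \<zeta>)" by (rule smoothI[OF D]) (use z(1) in simp)
 show ?G1 by (rule ext) (simp add: partial_deriv_eq[OF D])
qed

text \<open>The positive and the negative part are densities of measures that agree on all
  half-lines, hence coincide; densities are unique almost everywhere.\<close>

lemma AE_zero_of_interval_integrals: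
 fixes Y :: "real => real"
 assumes Y: "L1 Y" and z: "\<And>x. (LBINT t. ind {x<..} t * Y t) = 0"
 shows "AE t in lborel. Y t = 0"
proof -
 note [measurable] = borel_measurable_integrable[OF Y]
 define p where "p t = max 0 (Y t)" for t
 define n where "n t = max 0 (- Y t)" for t
 have [measurable]: "Borel p" "Borel n" unfolding p_def n_def by measurable
 have ip: "L1 p" "L1 n"
  by (rule L1_bound[OF Y]; auto simp: p_def n_def)+
 have i: "L1 (\<lambda>t. ind {x<..} t * p t)" "L1 (\<lambda>t. ind {x<..} t * n t)" for x :: real
  using integrable_real_mult_indicator[OF _ ip(1), of "{x<..}"] integrable_real_mult_indicator[OF _ ip(2), of "{x<..}"] by (auto simp: mult.commute)
 have pq: "(LBINT t. ind {x<..} t * p t) - (LBINT t. ind {x<..} t * n t) = (LBINT t. ind {x<..} t * Y t)" for x :: real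
  unfolding LINT_diff[OF i, symmetric] by (rule LINT_cong) (auto simp: p_def n_def indicator_def)
 have eq: "(LBINT t. ind {x<..} t * p t) = (LBINT t. ind {x<..} t * n t)" for x :: real using pq[of x] z[of x] by linarith
 have em: "emeasure (density lborel (\<lambda>t. ennreal (g t))) {x<..} = ennreal (LBINT t. ind {x<..} t * g t)"
  if [measurable]: "Borel g" and "L1 (\<lambda>t. ind {x<..} t * g t)" "\<And>t. g t \<ge> 0" for g and x :: real
 proof -
  have "emeasure (density lborel (\<lambda>t. ennreal (g t))) {x<..} = (\<integral>\<^sup>+t. ennreal (g t) * ind {x<..} t \<partial>lborel)"
   by (rule emeasure_density) auto
  also have "... = (\<integral>\<^sup>+t. ennreal (ind {x<..} t * g t) \<partial>lborel)"
   by (rule nn_integral_cong) (auto simp: indicator_def)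
  also have "... = ennreal (LBINT t. ind {x<..} t * g t)"
   by (rule nn_integral_eq_integral[OF that(2)]) (use that(3) in auto)
  finally show ?thesis .
 qed
 have pn: "p t \<ge> 0" "n t \<ge> 0" for t by (auto simp: p_def n_def)
 have "density lborel (\<lambda>t. ennreal (p t)) = density lborel (\<lambda>t. ennreal (n t))"
  by (rule measure_eqI_lessThan) (simp_all add: em i pn eq)
 then have "AE t in lborel. ennreal (p t) = ennreal (n t)"
  by (intro sigma_finite_measure.density_unique[OF sigma_finite_lborel]) auto
 then show ?thesis by eventually_elim (auto simp: pn p_def n_def max_def split: if_splits)
qed

text \<open>The indicator of a half-line, restricted to the interval, is a bounded pointwise limit
  of test functions, so the integrals over half-lines vanish.\<close>

lemma fundamental_lemma_real:
 fixes Y :: "real => real"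
 assumes Y: "L1 Y" "\<And>t. t \<notin> {a<..<b} ==> Y t = 0"
  and z: "\<And>\<eta>. \<eta> \<in> test_functions {a<..<b} ==> (LBINT t. \<eta> t * Y t) = 0"
 shows "AE t in lborel. Y t = 0"
proof (rule AE_zero_of_interval_integrals[OF Y(1)])
 fix x :: real
 note [measurable] = borel_measurable_integrable[OF Y(1)]
 define c where "c = max a x"
 show "(LBINT t. ind {x<..} t * Y t) = 0"
 proof (cases "c < b")
  case False
  then have "(\<lambda>t. ind {x<..} t * Y t) = (\<lambda>t. 0)" using Y(2) by (auto simp: fun_eq_iff c_def indicator_def)
  then show ?thesis by simp
 next
  case True
  define m where "m = (c + b) / 2"
  define r where "r = (b - c) / 2"
  have r: "r > 0" using True by (simp add: r_def)
  \<comment> \<open>The radii increase to \<open>r\<close>, so that the plateaus exhaust the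
    interval while every support stays inside it.\<close>
  have "\<exists>\<psi> :: real => real. smooth \<psi> \<and> (\<forall>t. t \<in> cball m (r * (1 - 1 / real (n+1))) \<longrightarrow> \<psi> t = 1) \<and> (\<forall>t. t \<notin> cball m (r * (1 - 1 / real (n+2))) \<longrightarrow> \<psi> t = 0)
    \<and> (\<forall>t. 0 \<le> \<psi> t) \<and> (\<forall>t. \<psi> t \<le> 1)" for n
  proof -
   have rr: "0 \<le> r * (1 - 1 / real (n+1))" "r * (1 - 1 / real (n+1)) < r * (1 - 1 / real (n+2))"
    using r by (auto simp: field_simps)
   show ?thesis
   proof (rule smooth_cutoff[OF rr, of m])
    fix \<psi> :: "real => real"
    assume \<psi>: "smooth \<psi>" "\<And>x. x \<in> cball m (r * (1 - 1 / real (n+1))) ==> \<psi> x = 1"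
     "\<And>x. x \<notin> cball m (r * (1 - 1 / real (n+2))) ==> \<psi> x = 0" "\<And>x. 0 \<le> \<psi> x" "\<And>x. \<psi> x \<le> 1"
    show ?thesis by (intro exI[of _ \<psi>] conjI allI impI \<psi>)
   qed
  qed
  from choice[OF allI[OF this]] obtain \<psi> :: "nat => real => real" where P: "\<forall>n. smooth (\<psi> n) \<and> (\<forall>t. t \<in> cball m (r * (1 - 1 / real (n+1))) \<longrightarrow> \<psi> n t = 1)
   \<and> (\<forall>t. t \<notin> cball m (r * (1 - 1 / real (n+2))) \<longrightarrow> \<psi> n t = 0) \<and> (\<forall>t. 0 \<le> \<psi> n t) \<and> (\<forall>t. \<psi> n t \<le> 1)"
   by (rule exE)
  have \<psi>: "\<And>n. smooth (\<psi> n)" "\<And>n t. t \<in> cball m (r * (1 - 1 / real (n+1))) ==> \<psi> n t = 1"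
   "\<And>n t. t \<notin> cball m (r * (1 - 1 / real (n+2))) ==> \<psi> n t = 0" "\<And>n t. 0 \<le> \<psi> n t" "\<And>n t. \<psi> n t \<le> 1"
   using P by blast+
  have bl: "ball m r = {c<..<b}" by (auto simp: ball_def dist_real_def m_def r_def abs_if field_simps split: if_splits)
  have sub: "cball m (r * (1 - 1 / real (n+2))) \<subseteq> {c<..<b}" for n
  proof -
   have "r * (1 - 1 / real (n+2)) < r" using r by (simp add: field_simps)
   then have "cball m (r * (1 - 1 / real (n+2))) \<subseteq> ball m r" by (auto simp: cball_def ball_def)
   then show ?thesis using bl by simp
  qed
  have tf: "\<psi> n \<in> test_functions {a<..<b}" for n
   by (rule test_functionsI[OF \<psi>(1) compact_cball[of m "r * (1 - 1 / real (n+2))"] _ \<psi>(3)]) (use sub[of n] in \<open>auto simp: c_def\<close>)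
  have [measurable]: "Borel (\<psi> n)" for n
   by (rule borel_measurable_continuous_onI[OF smooth_continuous[OF \<psi>(1)]])
  have "(\<lambda>n. LBINT t. \<psi> n t * Y t) \<longlonglongrightarrow> (LBINT t. ind {c<..<b} t * Y t)"
  proof (rule integral_dominated_convergence[where w="\<lambda>t. \<bar>Y t\<bar>"])
   show "AE t in lborel. (\<lambda>n. \<psi> n t * Y t) \<longlonglongrightarrow> ind {c<..<b} t * Y t" (is "AE t in _. ?P t")
   proof (rule AE_I2)
    fix t
    have "(\<lambda>n. \<psi> n t) \<longlonglongrightarrow> ind {c<..<b} t"
    proof (cases "t \<in> {c<..<b}")
     case True
     then have d: "dist m t < r" using bl by (auto simp: ball_def)
     have "(\<lambda>n. r * (1 - 1 / real (n+1))) \<longlonglongrightarrow> r * (1 - 0)"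
      using LIMSEQ_Suc[OF lim_1_over_n[where 'a=real]] by (intro tendsto_intros) simp
     then have "eventually (\<lambda>n. dist m t < r * (1 - 1 / real (n+1))) sequentially"
      using order_tendstoD(1)[of _ "r * (1 - 0)"] d by simp
     then have "eventually (\<lambda>n. \<psi> n t = ind {c<..<b} t) sequentially"
      by eventually_elim (use \<psi>(2) True in auto)
     then show ?thesis by (rule tendsto_eventually)
    next
     case False
     then have "\<psi> n t = 0" for n using \<psi>(3) sub by blast
     then show ?thesis using False by simp
    qed
    then show "?P t" by (intro tendsto_intros)
   qed
   show "AE t in lborel. norm (\<psi> n t * Y t) \<le> \<bar>Y t\<bar>" for n
    using \<psi>(4,5)[of n] by (auto simp: abs_mult intro!: mult_left_le_one_le)
  qed (use Y(1) in auto)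
  then have "(LBINT t. ind {c<..<b} t * Y t) = 0" using z[OF tf] by (simp add: LIMSEQ_const_iff)
  moreover have "ind {c<..<b} t * Y t = ind {x<..} t * Y t" for t
   using Y(2)[of t] by (auto simp: c_def indicator_def)
  ultimately show ?thesis by simp
 qed
qed

text \<open>The du Bois-Reymond lemma: the difference of \<open>X\<close> and the primitive of
  \<open>G\<close> has weak derivative zero and is therefore constant.\<close>

lemma weak_derivative_primitive:
 fixes X G :: "real => real"
 assumes ab: "a < b" and X: "L1 X" and G: "L1 G"
  and w: "\<And>\<theta>. \<theta> \<in> test_functions {a<..<b} ==> (LBINT t. partial_deriv 1 \<theta> t * X t + \<theta> t * G t) = 0"
 obtains c where "AE t in lborel. t \<in> {a<..<b} \<longrightarrow> X t = c + prim G t"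
proof -
 note [measurable] = borel_measurable_integrable[OF X] borel_measurable_integrable[OF G]
 define Z where "Z t = ind {a<..<b} t * (X t - prim G t)" for t
 have iX: "L1 (\<lambda>t. ind {a<..<b} t * X t)"
  using integrable_real_mult_indicator[OF _ X, of "{a<..<b}"] by (simp add: mult.commute)
 have iI: "L1 (\<lambda>t. ind {a<..<b} t :: real)" using ab by simp
 have iP: "L1 (\<lambda>t. prim G t * ind {a<..<b} t)" by (rule integrable_mult_prim[OF G iI])
 have iZ: "L1 Z" unfolding Z_def using L1_diff[OF iX iP] by (simp add: algebra_simps)
 have Zt: "(LBINT t. partial_deriv 1 \<theta> t * Z t) = 0" if \<theta>: "\<theta> \<in> test_functions {a<..<b}" for \<theta>
 proof -
  obtain K where K: "smooth \<theta>" "compact K" "K \<subseteq> {a<..<b}" "\<And>t. t \<notin> K ==> \<theta> t = 0" using test_functionsD[OF \<theta>] by metis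
  have d0: "partial_deriv 1 \<theta> t = 0" if "t \<notin> K" for t by (rule partial_deriv_zero_outside[OF K(2,4) that])
  have i\<theta>: "L1 \<theta>" "L1 (partial_deriv 1 \<theta>)"
   by (rule integrable_compact_support[OF smooth_continuous[OF K(1)] K(2,4)]; assumption)
    (rule integrable_compact_support[OF smooth_continuous[OF smooth_partial[OF K(1)]] K(2) d0])
  obtain M where M: "\<And>t. norm (partial_deriv 1 \<theta> t) \<le> M" using bounded_compact_support[OF smooth_continuous[OF smooth_partial[OF K(1), of 1]] K(2) d0] by blast
  obtain M' where M': "\<And>t. norm (\<theta> t) \<le> M'" using bounded_compact_support[OF smooth_continuous[OF K(1)] K(2,4)] by blast
  have [measurable]: "Borel \<theta>" "Borel (partial_deriv 1 \<theta>)" using i\<theta> by auto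
  have i1: "L1 (\<lambda>t. partial_deriv 1 \<theta> t * X t)"
   by (rule L1_mult_bounded[OF X, of _ M]) (use M in auto)
  have i2: "L1 (\<lambda>t. \<theta> t * G t)"
   by (rule L1_mult_bounded[OF G, of _ M']) (use M' in auto)
  have i3: "L1 (\<lambda>t. prim G t * partial_deriv 1 \<theta> t)" by (rule integrable_mult_prim[OF G i\<theta>(2)])
  \<comment> \<open>By the product rule for primitives, \<open>\<theta> * G\<close> and the
    derivative of \<open>\<theta>\<close> times \<open>prim G\<close> have opposite integrals, since
    \<open>\<theta>\<close> vanishes at \<open>b\<close>.\<close>
  have "\<theta> b * prim G b = prim (\<lambda>q. \<theta> q * G q + prim G q * partial_deriv 1 \<theta> q) b"
   using prim_product[OF i\<theta>(2) G, of b] by (simp add: prim_partial_deriv[OF K(1,2,4)])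
  also have "... = (LBINT q. \<theta> q * G q + prim G q * partial_deriv 1 \<theta> q)"
   unfolding prim_def[of "\<lambda>q. \<theta> q * G q + prim G q * partial_deriv 1 \<theta> q"]
  proof (rule LINT_cong[OF refl])
   fix x
   have "x \<le> b" if "x \<in> K" using K(3) that by auto
   then show "ind {..b} x * (\<theta> x * G x + prim G x * partial_deriv 1 \<theta> x) = \<theta> x * G x + prim G x * partial_deriv 1 \<theta> x"
    using K(4)[of x] d0[of x] by (cases "x \<in> K") (auto simp: indicator_def)
  qed
  also have "\<theta> b * prim G b = 0" using K(3) K(4)[of b] by force
  finally have "(LBINT q. \<theta> q * G q) + (LBINT q. prim G q * partial_deriv 1 \<theta> q) = 0" using i2 i3 by (simp add: LINT_add)
  moreover have "(LBINT t. partial_deriv 1 \<theta> t * X t) + (LBINT t. \<theta> t * G t) = 0" using w[OF \<theta>] i1 i2 by (simp add: LINT_add)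
  moreover have "(LBINT t. partial_deriv 1 \<theta> t * Z t) = (LBINT t. partial_deriv 1 \<theta> t * X t - prim G t * partial_deriv 1 \<theta> t)"
  proof (rule LINT_cong[OF refl])
   fix x show "partial_deriv 1 \<theta> x * Z x = partial_deriv 1 \<theta> x * X x - prim G x * partial_deriv 1 \<theta> x"
    using K(3) d0[of x] by (cases "x \<in> K") (auto simp: Z_def algebra_simps)
  qed
  ultimately show ?thesis using i1 i3 by (simp add: LINT_diff)
 qed
 define m where "m = (a + b) / 2"
 define r where "r = (b - a) / 8"
 have r: "0 < r" using ab by (simp add: r_def)
 obtain \<psi> :: "real => real" where \<psi>: "smooth \<psi>" "\<And>x. x \<in> cball m r ==> \<psi> x = 1" "\<And>x. x \<notin> cball m (2 * r) ==> \<psi> x = 0" "\<And>x. 0 \<le> \<psi> x" "\<And>x. \<psi> x \<le> 1"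
  using smooth_cutoff[of r "2 * r" m] r by auto
 have i\<psi>: "L1 \<psi>" by (rule integrable_compact_support[OF smooth_continuous[OF \<psi>(1)] compact_cball \<psi>(3)])
 have iI': "L1 (ind {m-r..m+r} :: real => real)" using r by simp
 have "integral\<^sup>L lborel (ind {m-r..m+r} :: real => real) \<le> integral\<^sup>L lborel \<psi>"
  by (rule integral_mono[OF iI' i\<psi>]) (use \<psi>(2,4) in \<open>auto simp: indicator_def dist_real_def\<close>)
 then have J: "integral\<^sup>L lborel \<psi> > 0" using r by simp
 define J where "J = integral\<^sup>L lborel \<psi>"
 have J0: "J > 0" using J by (simp add: J_def)
 define c where "c = (LBINT t. \<psi> t * Z t) / J"
 note bnd\<eta> = L1_mult_bounded[OF iZ]
 have main: "(LBINT t. \<eta> t * (ind {a<..<b} t * (Z t - c))) = 0" if \<eta>: "\<eta> \<in> test_functions {a<..<b}" for \<eta>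
 proof -
  obtain K where K: "smooth \<eta>" "compact K" "K \<subseteq> {a<..<b}" "\<And>t. t \<notin> K ==> \<eta> t = 0" using test_functionsD[OF \<eta>] by metis
  have i\<eta>: "L1 \<eta>" by (rule integrable_compact_support[OF smooth_continuous[OF K(1)] K(2,4)])
  obtain M where M: "\<And>t. \<bar>\<eta> t\<bar> \<le> M" using bounded_compact_support[OF smooth_continuous[OF K(1)] K(2,4)] by auto
  define I where "I = integral\<^sup>L lborel \<eta>"
  \<comment> \<open>Subtracting a multiple of \<open>\<psi>\<close> makes the integral zero; the
    primitive of \<open>\<zeta>\<close> then has compact support and is a test function to which
    \<open>Zt\<close> applies.\<close>
  define \<zeta> where "\<zeta> t = \<eta> t - (I / J) * \<psi> t" for t
  have s\<zeta>: "smooth \<zeta>" unfolding \<zeta>_def by (intro smooth_diff smooth_mult smooth_const K(1) \<psi>(1))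
  define K' where "K' = K \<union> cball m (2 * r)"
  have K': "compact K'" "K' \<subseteq> {a<..<b}" using K(2,3) ab by (auto simp: K'_def m_def r_def dist_real_def abs_if field_simps split: if_splits intro!: compact_Un)
  have \<zeta>0: "\<zeta> t = 0" if "t \<notin> K'" for t using that K(4) \<psi>(3) by (auto simp: \<zeta>_def K'_def)
  have i\<zeta>: "L1 \<zeta>" unfolding \<zeta>_def using i\<eta> i\<psi> by auto
  have I\<zeta>: "integral\<^sup>L lborel \<zeta> = 0" unfolding \<zeta>_def using i\<eta> i\<psi> J0 by (simp add: I_def J_def)
  have "K' \<noteq> {}" using r by (auto simp: K'_def)
  then obtain \<alpha> \<beta> where \<alpha>\<beta>: "\<alpha> \<in> K'" "\<beta> \<in> K'" "\<And>t. t \<in> K' ==> \<alpha> \<le> t \<and> t \<le> \<beta>"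
   using compact_attains_inf[OF K'(1)] compact_attains_sup[OF K'(1)] by blast
  have "prim \<zeta> \<in> test_functions {a<..<b}"
  proof (rule test_functionsI[OF smooth_prim(1)[OF s\<zeta> K'(1) \<zeta>0] compact_Icc])
   show "{\<alpha>..\<beta>} \<subseteq> {a<..<b}" using subsetD[OF K'(2) \<alpha>\<beta>(1)] subsetD[OF K'(2) \<alpha>\<beta>(2)] by auto
   fix t assume t: "t \<notin> {\<alpha>..\<beta>}"
   show "prim \<zeta> t = 0"
   proof (cases "t < \<alpha>")
    case True
    then have "(\<lambda>q. ind {..t} q * \<zeta> q) = (\<lambda>q. 0)" using \<zeta>0 \<alpha>\<beta>(3) by (fastforce simp: fun_eq_iff indicator_def)
    then show ?thesis unfolding prim_def by simp
   next
    case False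
    then have "(\<lambda>q. ind {..t} q * \<zeta> q) = \<zeta>" using t \<zeta>0 \<alpha>\<beta>(3) by (fastforce simp: fun_eq_iff indicator_def)
    then show ?thesis unfolding prim_def using I\<zeta> by simp
   qed
  qed
  note Zt[OF this]
  moreover have "partial_deriv 1 (prim \<zeta>) = \<zeta>" by (rule smooth_prim(2)[OF s\<zeta> K'(1) \<zeta>0])
  ultimately have "(LBINT t. \<zeta> t * Z t) = 0" by (rule subst[rotated])
  moreover have "(LBINT t. \<zeta> t * Z t) = (LBINT t. \<eta> t * Z t) - I / J * (LBINT t. \<psi> t * Z t)"
  proof -
   have "L1 (\<lambda>t. \<eta> t * Z t)" using bnd\<eta>[OF _ M] i\<eta> by auto
   moreover have "L1 (\<lambda>t. \<psi> t * Z t)" using bnd\<eta>[of \<psi> 1] i\<psi> \<psi>(4,5) by auto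
   ultimately show ?thesis by (simp add: \<zeta>_def left_diff_distrib LINT_diff mult.assoc)
  qed
  ultimately have 1: "(LBINT t. \<eta> t * Z t) = c * I" by (simp add: c_def)
  have "(LBINT t. \<eta> t * (ind {a<..<b} t * (Z t - c))) = (LBINT t. \<eta> t * Z t - c * \<eta> t)"
  proof (rule LINT_cong[OF refl])
   fix x show "\<eta> x * (ind {a<..<b} x * (Z x - c)) = \<eta> x * Z x - c * \<eta> x"
    using K(3) K(4)[of x] by (cases "x \<in> K") (auto simp: algebra_simps)
  qed
  also have "... = 0" using 1 bnd\<eta>[OF _ M] i\<eta> by (simp add: LINT_diff I_def)
  finally show ?thesis .
 qed
 have "AE t in lborel. ind {a<..<b} t * (Z t - c) = 0"
 proof (rule fundamental_lemma_real[OF _ _ main])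
  have "L1 (\<lambda>t. Z t - c * ind {a<..<b} t)" using iZ iI by auto
  moreover have "(\<lambda>t. Z t - c * ind {a<..<b} t) = (\<lambda>t. ind {a<..<b} t * (Z t - c))" by (auto simp: Z_def indicator_def)
  ultimately show "L1 (\<lambda>t. ind {a<..<b} t * (Z t - c))" by simp
 qed auto
 then have "AE t in lborel. t \<in> {a<..<b} \<longrightarrow> X t = c + prim G t" by eventually_elim (auto simp: Z_def)
 then show ?thesis by (rule that)
qed

section \<open>The equation tested with products of functions of time and space\<close>

lemma smooth_fst_snd:
 fixes \<theta> :: "real => real" and g :: "R3 => 'b::euclidean_space"
 assumes "smooth \<theta>" "smooth g"
 shows "smooth (\<lambda>z. \<theta> (snd z) *\<^sub>R g (fst z))"
 using smooth_scaleR[OF smooth_comp_affine[OF bounded_linear_snd assms(1), of 0] smooth_comp_affine[OF bounded_linear_fst assms(2), of 0]] by simp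

lemma partial_deriv_fst_snd:
 fixes \<theta> :: "real => real" and g :: "R3 => 'b::euclidean_space"
 assumes "smooth \<theta>" "smooth g"
 shows "partial_deriv (w, \<tau>) (\<lambda>z. \<theta> (snd z) *\<^sub>R g (fst z)) z = \<theta> (snd z) *\<^sub>R partial_deriv w g (fst z) + partial_deriv \<tau> \<theta> (snd z) *\<^sub>R g (fst z)"
proof -
 have "((\<lambda>z. \<theta> (snd z)) has_derivative (\<lambda>d. partial_deriv (snd d) \<theta> (snd z))) (at z)"
  by (rule has_derivative_compose[OF has_derivative_snd[OF has_derivative_ident] smooth_has_derivative[OF assms(1)]])
 moreover have "((\<lambda>z. g (fst z)) has_derivative (\<lambda>d. partial_deriv (fst d) g (fst z))) (at z)"
  by (rule has_derivative_compose[OF has_derivative_fst[OF has_derivative_ident] smooth_has_derivative[OF assms(2)]])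
 ultimately show ?thesis
  using partial_deriv_eq[OF has_derivative_scaleR, of "\<lambda>z. \<theta> (snd z)" _ z "\<lambda>z. g (fst z)" _ "(w, \<tau>)"] by simp
qed

lemma partial_deriv_zero_direction: "smooth g ==> partial_deriv 0 g x = 0"
 using linear_0[OF bounded_linear.linear[OF has_derivative_bounded_linear[OF smooth_has_derivative[of g x]]]] by simp

lemma dt_fst_snd: "smooth \<theta> ==> smooth g ==> dt (\<lambda>z. \<theta> (snd z) *\<^sub>R g (fst z)) = (\<lambda>z. partial_deriv 1 \<theta> (snd z) *\<^sub>R (g (fst z) :: R3))"
 unfolding dt_def by (rule ext) (simp add: partial_deriv_fst_snd partial_deriv_zero_direction)

lemma dx_fst_snd: "smooth \<theta> ==> smooth g ==> dx j (\<lambda>z. \<theta> (snd z) *\<^sub>R g (fst z)) = (\<lambda>z. \<theta> (snd z) *\<^sub>R (pd j g (fst z) :: R3))"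
 unfolding dx_def by (rule ext) (simp add: partial_deriv_fst_snd partial_deriv_zero_direction)

lemma pd_curlv: "smooth h ==> pd j (curlv h) x = curlv (pd j h) x"
proof -
 assume h: "smooth h"
 have "pd j (curlv h) x = (\<Sum>k\<in>UNIV. pd j (\<lambda>x. cross3 (axis k 1) (pd k h x)) x)"
  unfolding curlv_def[abs_def] by (rule pd_sum) (intro smooth_cross3 smooth_const smooth_partial h)
 also have "... = (\<Sum>k\<in>UNIV. cross3 (axis k 1) (pd j (pd k h) x))"
  by (intro sum.cong refl pd_bounded_linear bounded_linear_cross3_right smooth_partial h)
 finally show ?thesis unfolding curlv_def by (simp add: smooth_partial_commute_vec[OF h, of "axis j 1"])
qed

text \<open>Mixed derivatives are symmetric and the cross product is antisymmetric, so exchanging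
  the two summation indices shows that the sum is its own negative.\<close>

lemma divergence_curlv: "smooth h ==> (\<Sum>j\<in>UNIV. pd j (curlv h) x $ j) = 0"
proof -
 assume h: "smooth h"
 define H where "H j k = pd k (pd j h) x" for j k
 have sym: "H j k = H k j" for j k unfolding H_def by (rule smooth_partial_commute_vec[OF h])
 have "(\<Sum>j\<in>UNIV. pd j (curlv h) x $ j) = (\<Sum>j\<in>UNIV. \<Sum>k\<in>UNIV. H j k \<bullet> cross3 (axis j 1) (axis k 1))"
  unfolding pd_curlv[OF h] curlv_def cart_eq_inner_axis inner_sum_left H_def
  by (intro sum.cong refl) (simp add: inner_commute[of _ "axis _ _"] inner_cross3[of "axis _ _"] inner_commute)
 also have "... = (\<Sum>k\<in>UNIV. \<Sum>j\<in>UNIV. H j k \<bullet> cross3 (axis j 1) (axis k 1))" by (rule sum.swap)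
 also have "... = - (\<Sum>k\<in>UNIV. \<Sum>j\<in>UNIV. H k j \<bullet> cross3 (axis k 1) (axis j 1))"
  unfolding sum_negf[symmetric] by (intro sum.cong refl) (metis sym cross_skew inner_minus_right)
 finally have "(\<Sum>j\<in>UNIV. pd j (curlv h) x $ j) = - (\<Sum>j\<in>UNIV. pd j (curlv h) x $ j)"
  unfolding pd_curlv[OF h] curlv_def cart_eq_inner_axis inner_sum_left H_def
  by (simp add: inner_commute[of _ "axis _ _"] inner_cross3[of "axis _ _"] inner_commute)
 then show ?thesis by simp
qed

lemma lapl_curlv: "smooth h ==> (\<Sum>j\<in>UNIV. pd j (pd j (curlv h)) x) = curlv (lapl h) x"
proof -
 assume h: "smooth h"
 have "pd j (curlv h) = curlv (pd j h)" for j by (rule ext) (rule pd_curlv[OF h])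
 moreover have "curlv (lapl h) x = (\<Sum>j\<in>UNIV. curlv (pd j (pd j h)) x)"
  unfolding lapl_def[abs_def] by (intro curlv_sum smooth_partial h)
 ultimately show ?thesis by (simp add: pd_curlv smooth_partial h)
qed

text \<open>\<open>v\<close> stands for a Borel version of the solution extended by zero, so that
  all integrals are over the whole space. \<open>vs\<close> carries the Serrin condition on compact
  time intervals.\<close>

locale ns_sol = ns_cut +
 fixes Tm :: real and v :: "R3 \<times> real => R3"
 assumes Tm: "0 < Tm"
  and v_meas [measurable]: "Borel v"
  and v0: "\<And>z. z \<notin> cyl x0 R Tm ==> v z = 0"
  and v2: "L1 (\<lambda>z. (norm (v z))^2)"
  and weak: "\<And>\<phi>. \<phi> \<in> solenoidal_test_functions (cyl x0 R Tm) ==>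
   (LBINT z. v z \<bullet> (nst v \<phi> z)) = 0"
  and divfree: "AE t in lborel. \<forall>\<phi>\<in>test_functions (ball x0 R). (LBINT x. v (x, t) \<bullet> gradient \<phi> x) = 0"
  and vs: "\<And>t1 t2. 0 < t1 ==> t1 < t2 ==> t2 < Tm ==>
   (AE t in lborel. t \<in> {t1<..<t2} \<longrightarrow> L1 (\<lambda>x. ind K x * norm (v (x, t)) powr s)) \<and>
   L1 (\<lambda>t. ind {t1<..<t2} t * \<kappa> (\<lambda>x. v (x, t)))"
begin

abbreviation "vt t \<equiv> (\<lambda>x. v (x, t))"

lemma vt_meas [measurable]: "Borel (vt t)" by measurable

text \<open>Fubini in the form needed for weak derivatives: \<open>\<theta>\<close> is the time
  factor of a test field.\<close>

lemma slice:
 fixes P :: "R3 \<times> real => real"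
 assumes P: "L1 P" and \<theta>: "Borel \<theta>" "\<And>t. \<bar>\<theta> t\<bar> \<le> M"
 shows "L1 (\<lambda>t. LBINT x. P (x, t))" "L1 (\<lambda>z. \<theta> (snd z) * P z)"
  "(LBINT z. \<theta> (snd z) * P z) = (LBINT t. \<theta> t * (LBINT x. P (x, t)))" (is ?G1)
  "AE t in lborel. L1 (\<lambda>x. P (x, t))" (is ?G2)
proof -
 note [measurable] = \<theta>(1) borel_measurable_integrable[OF P]
 have P': "integrable lborel2 (\<lambda>(x, t). P (x, t))" using P by (simp add: lborel_prod)
 show "L1 (\<lambda>t. LBINT x. P (x, t))" by (rule lborel_pair.integrable_snd[OF P'])
 show ?G2 by (rule lborel_pair.AE_integrable_snd[OF P'])
 show i: "L1 (\<lambda>z. \<theta> (snd z) * P z)"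
 proof (rule L1_mult_bounded[OF P _ \<theta>(2)])
  show "Borel (\<lambda>z :: R3 \<times> real. \<theta> (snd z))" by (rule measurable_compose[OF _ \<theta>(1)]) (simp add: borel_prod[symmetric])
 qed
 then have i': "integrable lborel2 (\<lambda>(x, t). \<theta> t * P (x, t))" by (simp add: lborel_prod case_prod_beta')
 have "(LBINT z. \<theta> (snd z) * P z) = integral\<^sup>L lborel2 (\<lambda>(x, t). \<theta> t * P (x, t))"
  by (simp add: lborel_prod case_prod_beta')
 also have "... = (LBINT t. LBINT x. \<theta> t * P (x, t))" by (rule lborel_pair.integral_snd[OF i', symmetric])
 finally show ?G1 by simp
qed

lemma integrable_v: "L1 v"
proof (rule L1_bound)
 have "bounded (cyl x0 R Tm)" by (intro bounded_Times bounded_ball bounded_box[of 0 Tm, unfolded box_real])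
 then have "emeasure lborel (cyl x0 R Tm) < \<infinity>" by (rule emeasure_bounded_finite)
 moreover have "cyl x0 R Tm \<in> sets borel" by (intro borel_open open_Times) auto
 ultimately show "L1 (\<lambda>z. ind (cyl x0 R Tm) z + (norm (v z))^2)"
  using v2 by (intro L1_add integrable_real_indicator) auto
 show "AE z in lborel. norm (v z) \<le> norm (ind (cyl x0 R Tm) z + (norm (v z))^2)" (is "AE z in _. ?P z")
 proof (rule AE_I2)
  fix z
  have "norm (v z) \<le> 1 + (norm (v z))^2" using zero_le_power2[of "norm (v z) - 1"] by (simp add: power2_diff) (use norm_ge_zero[of "v z"] in linarith)
  then show "?P z"
   using v0[of z] by (cases "z \<in> cyl x0 R Tm") auto
 qed
qed simp

text \<open>The class of test potentials at a fixed time; it is closed under differentiation, curl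
  and Laplacian.\<close>

definition hs :: "(R3 => 'b::euclidean_space) => bool" where
 "hs h \<longleftrightarrow> smooth h \<and> (\<forall>x. x \<notin> cball x0 r1 \<longrightarrow> h x = 0)"

lemma hs_pd: "hs h ==> hs (pd j h)"
 unfolding hs_def using smooth_partial partial_deriv_zero_outside[OF compact_cball[of x0 r1]] by blast

lemma hs_curlv: "hs h ==> hs (curlv h)"
 using hs_pd[of h] by (simp add: hs_def smooth_curlv curlv_def)

lemma hs_sum: "(\<And>i. i \<in> I ==> hs (g i)) ==> hs (\<lambda>x. \<Sum>i\<in>I. g i x)"
 by (auto simp: hs_def intro!: smooth_sum sum.neutral)

lemma hs_lapl: "hs h ==> hs (lapl h)"
 unfolding lapl_def[abs_def] by (intro hs_sum hs_pd)

lemma hs_bounded: "hs h ==> \<exists>M. \<forall>x. norm (h x) \<le> M"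
 unfolding hs_def by (intro bounded_compact_support[OF smooth_continuous compact_cball[of x0 r1]]) auto

lemma hs_measurable: "hs h ==> h \<in> borel_measurable borel"
 unfolding hs_def by (auto intro: borel_measurable_continuous_onI smooth_continuous)

lemma measurable_fst_comp: "g \<in> borel_measurable borel ==> (\<lambda>z :: R3 \<times> real. g (fst z)) \<in> borel_measurable borel"
 by (rule measurable_compose[of fst _ borel]) (auto intro!: borel_measurable_continuous_onI continuous_intros)

text \<open>A bounded factor \<open>g\<close> makes terms linear and quadratic in \<open>v\<close>
  integrable, so that the convection term can be sliced in time for a field that is only
  square-integrable.\<close>

lemma integrable_pairing:
 assumes g: "hs g"
 shows "L1 (\<lambda>z. v z \<bullet> g (fst z))" (is ?G1) "L1 (\<lambda>z. v z $ j * (v z \<bullet> g (fst z)))" (is ?G2)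
proof -
 obtain M where M: "\<And>x. norm (g x) \<le> M" using hs_bounded[OF g] by blast
 note [measurable] = measurable_fst_comp[OF hs_measurable[OF g]]
 have b: "\<bar>v z \<bullet> g (fst z)\<bar> \<le> norm (v z) * M" for z
  by (rule order_trans[OF Cauchy_Schwarz_ineq2]) (intro mult_left_mono M norm_ge_zero)
 have M0: "M \<ge> 0" using order_trans[OF norm_ge_zero M] .
 show ?G1
 proof (rule L1_bound)
  show "L1 (\<lambda>z. norm (v z) * M)" using integrable_v by simp
  show "AE z in lborel. norm (v z \<bullet> g (fst z)) \<le> norm (norm (v z) * M)" using b M0 by (simp add: abs_mult)
 qed simp
 show ?G2
 proof (rule L1_bound)
  show "L1 (\<lambda>z. (norm (v z))^2 * M)" using v2 by simp
  have "\<bar>v z $ j\<bar> * \<bar>v z \<bullet> g (fst z)\<bar> \<le> norm (v z) * (norm (v z) * M)" for z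
   by (intro mult_mono b component_le_norm_cart) auto
  then show "AE z in lborel. norm (v z $ j * (v z \<bullet> g (fst z))) \<le> norm ((norm (v z))^2 * M)" using M0 by (simp add: abs_mult power2_eq_square mult.assoc)
  show "(\<lambda>z. v z $ j * (v z \<bullet> g (fst z))) \<in> borel_measurable lborel" by measurable
 qed
qed

lemma GG_slices:
 assumes h: "hs h" and \<theta>: "Borel \<theta>" "\<And>t. \<bar>\<theta> t\<bar> \<le> M"
 shows "L1 (\<lambda>t. ell (vt t) h)" "L1 (\<lambda>t. GG (vt t) h)"
  "(LBINT z. \<theta> (snd z) * (v z \<bullet> curlv h (fst z))) = (LBINT t. \<theta> t * ell (vt t) h)" (is ?G1)
  "L1 (\<lambda>z. \<theta> (snd z) * (v z \<bullet> curlv h (fst z)))" (is ?G2)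
  "L1 (\<lambda>z. \<theta> (snd z) * (v z \<bullet> curlv (lapl h) (fst z) + (tri (v z) (curlv h) (fst z))))" (is ?G3)
  "(LBINT z. \<theta> (snd z) * (v z \<bullet> curlv (lapl h) (fst z) + (tri (v z) (curlv h) (fst z)))) = (LBINT t. \<theta> t * GG (vt t) h)" (is ?G4)
proof -
 note p1 = integrable_pairing(1)[OF hs_curlv[OF h]]
 note S1 = slice[OF p1 \<theta>]
 show "L1 (\<lambda>t. ell (vt t) h)" using S1(1) by (simp add: ell_def)
 show ?G1 using S1(3) by (simp add: ell_def)
 show ?G2 by (rule S1(2))
 note p2 = integrable_pairing(1)[OF hs_curlv[OF hs_lapl[OF h]]]
 have p3: "L1 (\<lambda>z. tri (v z) (curlv h) (fst z))"
  by (intro L1_sum integrable_pairing(2) hs_pd hs_curlv h)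
 note S2 = slice[OF p2 \<theta>] and S3 = slice[OF p3 \<theta>]
 have G: "GG (vt t) h = (LBINT x. v (x, t) \<bullet> curlv (lapl h) (fst (x, t))) + (LBINT x. (\<Sum>j\<in>UNIV. v (x, t) $ j * (v (x, t) \<bullet> pd j (curlv h) (fst (x, t)))))" for t
  by (simp add: GG_def)
 show "L1 (\<lambda>t. GG (vt t) h)" unfolding G by (rule L1_add[OF S2(1) S3(1)])
 show ?G3
  using L1_add[OF S2(2) S3(2)] by (simp only: distrib_left)
 have i: "L1 (\<lambda>t. \<theta> t * f t)" if "L1 f" for f :: "real => real"
  by (rule L1_mult_bounded[OF that \<theta>])
 show ?G4
  unfolding distrib_left G LINT_add[OF S2(2) S3(2)] S2(3) S3(3)
  by (rule LINT_add[symmetric]) (rule i[OF S2(1)], rule i[OF S3(1)])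
qed

text \<open>A curl is solenoidal and commutes with the Laplacian, so \<open>\<theta>\<close> times
  \<open>curlv h\<close> is an admissible test field, and the equation becomes a scalar weak
  differential equation in time.\<close>

lemma weak_ode:
 assumes h: "hs h" and \<theta>: "\<theta> \<in> test_functions {0<..<Tm}"
 shows "(LBINT t. partial_deriv 1 \<theta> t * ell (vt t) h + \<theta> t * GG (vt t) h) = 0"
proof -
 have sh: "smooth h" using h by (simp add: hs_def)
 obtain L where L: "smooth \<theta>" "compact L" "L \<subseteq> {0<..<Tm}" "\<And>t. t \<notin> L ==> \<theta> t = 0" using test_functionsD[OF \<theta>] by metis
 have d0: "partial_deriv 1 \<theta> t = 0" if "t \<notin> L" for t by (rule partial_deriv_zero_outside[OF L(2,4) that])
 obtain M where M: "\<And>t. \<bar>\<theta> t\<bar> \<le> M" using bounded_compact_support[OF smooth_continuous[OF L(1)] L(2,4)] by auto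
 obtain M' where M': "\<And>t. \<bar>partial_deriv 1 \<theta> t\<bar> \<le> M'" using bounded_compact_support[OF smooth_continuous[OF smooth_partial[OF L(1)]] L(2) d0] by auto
 have mm: "Borel \<theta>" "Borel (partial_deriv 1 \<theta>)"
  by (auto intro!: borel_measurable_continuous_onI smooth_continuous smooth_partial L(1))
 define \<phi> where "\<phi> z = \<theta> (snd z) *\<^sub>R curlv h (fst z)" for z :: "R3 \<times> real"
 note sc = smooth_curlv[OF sh]
 have dj: "dx j \<phi> = (\<lambda>z. \<theta> (snd z) *\<^sub>R pd j (curlv h) (fst z))" for j
  unfolding \<phi>_def[abs_def] by (rule dx_fst_snd[OF L(1) sc])
 have djj: "dx j (dx j \<phi>) = (\<lambda>z. \<theta> (snd z) *\<^sub>R pd j (pd j (curlv h)) (fst z))" for j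
  unfolding dj by (rule dx_fst_snd[OF L(1) smooth_partial[OF sc]])
 have "\<phi> \<in> test_functions (cyl x0 R Tm)"
 proof (rule test_functionsI[of _ "cball x0 r1 \<times> L"])
  show "smooth \<phi>" unfolding \<phi>_def[abs_def] by (rule smooth_fst_snd[OF L(1) sc])
  show "compact (cball x0 r1 \<times> L)" by (intro compact_Times compact_cball L(2))
  have "cball x0 r1 \<subseteq> ball x0 R" using r by auto
  then show "cball x0 r1 \<times> L \<subseteq> cyl x0 R Tm" using L(3) by auto
  show "\<phi> z = 0" if "z \<notin> cball x0 r1 \<times> L" for z
   using that hs_curlv[OF h] L(4) unfolding \<phi>_def hs_def by (cases z) auto
 qed
 moreover have "div_x \<phi> z = 0" for z
  using divergence_curlv[OF sh, of "fst z"] by (simp add: div_x_def dj sum_distrib_left[symmetric])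
 ultimately have "\<phi> \<in> solenoidal_test_functions (cyl x0 R Tm)" by (simp add: solenoidal_test_functions_def)
 from weak[OF this] have "(LBINT z. v z \<bullet> (nst v \<phi> z)) = 0" .
 also have "(\<lambda>z. v z \<bullet> (nst v \<phi> z)) = (\<lambda>z. partial_deriv 1 \<theta> (snd z) * (v z \<bullet> curlv h (fst z))
   + \<theta> (snd z) * (v z \<bullet> curlv (lapl h) (fst z) + (tri (v z) (curlv h) (fst z))))"
 proof (rule ext)
  fix z
  have "dt \<phi> z = partial_deriv 1 \<theta> (snd z) *\<^sub>R curlv h (fst z)" unfolding \<phi>_def[abs_def] dt_fst_snd[OF L(1) sc] ..
  moreover have "laplacian_x \<phi> z = \<theta> (snd z) *\<^sub>R curlv (lapl h) (fst z)"
   unfolding laplacian_x_def djj lapl_curlv[OF sh, symmetric] by (simp add: scaleR_sum_right)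
  moreover have "v z \<bullet> convection v \<phi> z = \<theta> (snd z) * (tri (v z) (curlv h) (fst z))"
   unfolding convection_def dj by (simp add: inner_sum_right sum_distrib_left ac_simps)
  ultimately show "v z \<bullet> (nst v \<phi> z) = partial_deriv 1 \<theta> (snd z) * (v z \<bullet> curlv h (fst z))
   + \<theta> (snd z) * (v z \<bullet> curlv (lapl h) (fst z) + (tri (v z) (curlv h) (fst z)))"
   by (simp only: inner_add_right inner_scaleR_right distrib_left add.assoc)
 qed
 finally have "(LBINT t. partial_deriv 1 \<theta> t * ell (vt t) h) + (LBINT t. \<theta> t * GG (vt t) h) = 0"
  unfolding LINT_add[OF GG_slices(4)[OF h mm(2) M'] GG_slices(5)[OF h mm(1) M]] GG_slices(3)[OF h mm(2) M'] GG_slices(6)[OF h mm(1) M] .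
 moreover have i: "L1 (\<lambda>t. \<eta> t * f t)" if "L1 f" "Borel \<eta>" "\<And>t. \<bar>\<eta> t\<bar> \<le> C" for f \<eta> :: "real => real" and C
  by (rule L1_mult_bounded[OF that])
 ultimately show ?thesis
  by (subst LINT_add[OF i[OF GG_slices(1)[OF h mm(1) M] mm(2) M'] i[OF GG_slices(2)[OF h mm(1) M] mm(1) M]])
qed

lemma ell_primitive:
 assumes h: "hs h"
 obtains c where "AE t in lborel. t \<in> {0<..<Tm} \<longrightarrow> ell (vt t) h = c + prim (\<lambda>t. GG (vt t) h) t"
 using weak_derivative_primitive[OF Tm _ _ weak_ode[OF h]] GG_slices(1,2)[OF h, of "\<lambda>_. 0" 0] by auto

lemma vt_zero: "t \<notin> {0<..<Tm} ==> vt t = (\<lambda>x. 0)"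
 using v0 by (auto simp: fun_eq_iff)

text \<open>The bounds are given on compact time intervals; countably many of these exhaust the time
  interval, and outside it the slice is zero.\<close>

lemma adm_AE: "AE t in lborel. adm (vt t)"
proof -
 \<comment> \<open>The summand 3 keeps the left end point below the right one for every
   \<open>n\<close>.\<close>
 have "AE t in lborel. \<forall>n::nat. t \<in> {Tm / (real n + 3) <..< Tm - Tm / (real n + 3)} \<longrightarrow> L1 (\<lambda>x. ind K x * norm (v (x, t)) powr s)"
  unfolding AE_all_countable
 proof
  fix n :: nat
  have "0 < Tm / (real n + 3)" "Tm / (real n + 3) < Tm - Tm / (real n + 3)" "Tm - Tm / (real n + 3) < Tm"
  proof -
   have "Tm / (real n + 3) \<le> Tm / 3" using Tm by (intro divide_left_mono) auto
   moreover show "0 < Tm / (real n + 3)" using Tm by simp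
   ultimately show "Tm / (real n + 3) < Tm - Tm / (real n + 3)" "Tm - Tm / (real n + 3) < Tm" using Tm by linarith+
  qed
  from vs[OF this] show "AE t in lborel. t \<in> {Tm / (real n + 3) <..< Tm - Tm / (real n + 3)} \<longrightarrow> L1 (\<lambda>x. ind K x * norm (v (x, t)) powr s)" by blast
 qed
 moreover have "AE t in lborel. L1 (\<lambda>x. (norm (v (x, t)))^2)"
  using slice(4)[OF v2, of "\<lambda>_. 0" 0] by auto
 ultimately show ?thesis using divfree
 proof eventually_elim
  case (elim t)
  have "L1 (\<lambda>x. ind K x * norm (v (x, t)) powr s)"
  proof (cases "t \<in> {0<..<Tm}")
   case False
   then show ?thesis using fun_cong[OF vt_zero[OF False]] by simp
  next
   case True
   have "(\<lambda>n. Tm / (real n + 3)) \<longlonglongrightarrow> 0" using LIMSEQ_ignore_initial_segment[OF lim_const_over_n[of Tm], of 3] by simp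
   moreover have "min t (Tm - t) > 0" using True by auto
   ultimately have "eventually (\<lambda>n. Tm / (real n + 3) < min t (Tm - t)) sequentially" by (rule order_tendstoD(2))
   then obtain n where "Tm / (real n + 3) < min t (Tm - t)" by (auto simp: eventually_sequentially)
   then have "t \<in> {Tm / (real n + 3) <..< Tm - Tm / (real n + 3)}" by auto
   then show ?thesis using elim(1) by blast
  qed
  then show ?case unfolding adm_def using elim(2,3) by simp
 qed
qed

end

section \<open>The energy estimate\<close>

context ns_cut begin

text \<open>The localized vorticity is a first derivative of a square-integrable field up to terms
  of order zero, and \<open>mm\<close> compensates one derivative on each factor. This bound
  supplies the initial value for Gronwall's inequality.\<close>

lemma EE_le_rho:
 assumes f: "adm f" and N: "N \<ge> 1" and F: "finite F" "F \<subseteq> lat" and M: "bnd M"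
 shows "EE N F f \<le> 4 * M^2 / vol * rho f"
proof -
 note L = adm_inL2[OF f M]
 have sq: "(norm (a + b))^2 \<le> 2 * ((norm a)^2 + (norm b)^2)" for a b :: "R3"
 proof -
  have "(norm (a + b))^2 \<le> (norm a + norm b)^2" by (intro power_mono norm_triangle_ineq norm_ge_zero)
  also have "... \<le> 2 * ((norm a)^2 + (norm b)^2)" using zero_le_power2[of "norm a - norm b"] by (simp add: power2_eq_square algebra_simps)
  finally show ?thesis .
 qed
 define S1 where "S1 k = (norm (Ac (g1 f) k))^2 + (norm (As (g1 f) k))^2" for k
 define S2 where "S2 k = (norm (Ac (cf f) k))^2 + (norm (As (cf f) k))^2" for k
 have z: "zz f k \<le> 2 * S1 k + 2 * ((norm k)^2 * S2 k)" for k
  using sq[of "Ac (g1 f) k" "cross3 k (As (cf f) k)"] sq[of "As (g1 f) k" "- cross3 k (Ac (cf f) k)"]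
   norm_cross3_square_le[of k "As (cf f) k"] norm_cross3_square_le[of k "Ac (cf f) k"]
  by (simp add: zz_def Wc_def Ws_def S1_def S2_def algebra_simps)
 have "mm N k * zz f k \<le> 2 * (S1 k + S2 k)" for k
 proof -
  note mb = mm_bounds[OF N, of k]
  have "mm N k * zz f k \<le> mm N k * (2 * S1 k + 2 * ((norm k)^2 * S2 k))" using mb(1) by (intro mult_left_mono z) auto
  also have "... = 2 * (mm N k * S1 k + ((norm k)^2 * mm N k) * S2 k)" by (simp add: algebra_simps)
  also have "... \<le> 2 * (1 * S1 k + 1 * S2 k)" using mb(2,3) by (intro mult_left_mono add_mono mult_right_mono) (auto simp: S1_def S2_def)
  finally show ?thesis by simp
 qed
 then have "EE N F f \<le> (\<Sum>k\<in>F. 2 * (S1 k + S2 k))" unfolding EE_def by (rule sum_mono)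
 also have "... = 2 / vol * (vol * (\<Sum>k\<in>F. S1 k) + vol * (\<Sum>k\<in>F. S2 k))" using vol_pos by (simp add: sum.distrib sum_distrib_left distrib_left)
 also have "... \<le> 2 / vol * (M^2 * rho f + M^2 * rho f)"
  using vol_pos order_trans[OF Bessel_vec[OF F L(3)] L(6)] order_trans[OF Bessel_vec[OF F L(1)] L(4)]
  by (intro mult_left_mono add_mono) (auto simp: S1_def S2_def)
 finally show ?thesis by (simp add: ac_simps)
qed

end

section \<open>The energy as a sum over scalar modes\<close>

context ns_sol begin

definition "modes F = F \<times> (Basis :: R3 set) \<times> (UNIV :: bool set)"

text \<open>A mode consists of a frequency, a direction and the choice between cosine and sine. Each
  gives a scalar functional with a weak derivative in time, so that the energy can be differentiated
  term by term.\<close>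

definition hh :: "R3 \<times> R3 \<times> bool => R3 => R3" where
 "hh i x = ch x *\<^sub>R T {fst i} (\<lambda>_. if snd (snd i) then fst (snd i) else 0) (\<lambda>_. if snd (snd i) then 0 else fst (snd i)) x"

lemma finite_modes: "finite F ==> finite (modes F)" by (simp add: modes_def)

lemma sum_modes: "(\<Sum>i\<in>modes F. g i) = (\<Sum>k\<in>F. \<Sum>e\<in>Basis. g (k, e, True) + g (k, e, False))"
 unfolding modes_def by (simp add: sum.cartesian_product' UNIV_bool add.commute)

lemma hs_cut_T: "hs (\<lambda>x. ch x *\<^sub>R T F p q x)"
 using ch by (auto simp: hs_def intro: smooth_scaleR smooth_T)

lemma hs_hh: "hs (hh i)" unfolding hh_def[abs_def] by (rule hs_cut_T)

lemma ell_hh: "adm f ==> ell f (hh (k, e, b)) / vol = (if b then Wc f k else Ws f k) \<bullet> e"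
 unfolding hh_def[abs_def] ell_T(2) using vol_pos by (simp add: inner_commute)

lemma sum_zz:
 assumes "adm f"
 shows "(\<Sum>k\<in>F. w k * zz f k) = (\<Sum>i\<in>modes F. w (fst i) * (ell f (hh i) / vol)^2)"
 unfolding sum_modes ell_hh[OF assms] zz_def norm_square_Basis by (simp add: sum.distrib sum_distrib_left distrib_left)

lemma cut_T_modes:
 "ch x *\<^sub>R T F p q x = (\<Sum>i\<in>modes F. ((if snd (snd i) then p (fst i) else q (fst i)) \<bullet> fst (snd i)) *\<^sub>R hh i x)"
proof -
 have 1: "(\<Sum>e\<in>Basis. (y \<bullet> e * c) *\<^sub>R e) = c *\<^sub>R y" for y :: "R3" and c
 proof -
  have "(\<Sum>e\<in>Basis. (y \<bullet> e * c) *\<^sub>R e) = c *\<^sub>R (\<Sum>e\<in>Basis. (y \<bullet> e) *\<^sub>R e)"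
   by (simp add: scaleR_sum_right ac_simps)
  then show ?thesis by (simp add: euclidean_representation)
 qed
 show ?thesis unfolding sum_modes hh_def T_def
  by (simp add: sum.distrib 1 scaleR_add_right scaleR_sum_right)
qed

lemma pd_lincomb:
 assumes sm: "\<forall>i\<in>I. smooth (h i)"
 shows "pd j (lc I c h) = (\<lambda>x. \<Sum>i\<in>I. c i *\<^sub>R pd j (h i) x)"
proof (rule ext)
 fix x
 have "pd j (lc I c h) x = (\<Sum>i\<in>I. pd j (\<lambda>x. c i *\<^sub>R h i x) x)"
  by (rule pd_sum) (intro smooth_scaleR smooth_const bspec[OF sm])
 also have "... = (\<Sum>i\<in>I. c i *\<^sub>R pd j (h i) x)"
  by (intro sum.cong refl pd_bounded_linear[OF bounded_linear_scaleR_right] bspec[OF sm])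
 finally show "pd j (lc I c h) x = (\<Sum>i\<in>I. c i *\<^sub>R pd j (h i) x)" .
qed

lemma curlv_lincomb:
 assumes sm: "\<forall>i\<in>I. smooth (h i)"
 shows "curlv (lc I c h) = (\<lambda>x. \<Sum>i\<in>I. c i *\<^sub>R curlv (h i) x)"
proof (rule ext)
 fix x
 have cs: "cross3 a (\<Sum>i\<in>I. g i) = (\<Sum>i\<in>I. cross3 a (g i))" for a g
  by (rule bounded_linear.linear[OF bounded_linear_cross3_right, THEN linear_sum])
 show "curlv (lc I c h) x = (\<Sum>i\<in>I. c i *\<^sub>R curlv (h i) x)"
  unfolding curlv_def pd_lincomb[OF sm] cs cross_mult_right scaleR_sum_right by (rule sum.swap)
qed

lemma lapl_lincomb:
 assumes sm: "\<forall>i\<in>I. smooth (h i)"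
 shows "lapl (lc I c h) = (\<lambda>x. \<Sum>i\<in>I. c i *\<^sub>R lapl (h i) x)"
proof (rule ext)
 fix x
 have "pd j (pd j (lc I c h)) x = (\<Sum>i\<in>I. c i *\<^sub>R pd j (pd j (h i)) x)" for j
 proof -
  have sp: "\<forall>i\<in>I. smooth (pd j (h i))" using sm smooth_partial by blast
  show ?thesis unfolding pd_lincomb[OF sm] pd_lincomb[OF sp] ..
 qed
 then show "lapl (lc I c h) x = (\<Sum>i\<in>I. c i *\<^sub>R lapl (h i) x)"
  unfolding lapl_def scaleR_sum_right by (simp only:) (rule sum.swap)
qed

lemma integrable_inner_hs:
 assumes f: "adm f" and g: "hs g"
 shows "L1 (\<lambda>x. f x \<bullet> g x)" "L1 (\<lambda>x. f x $ j * (f x \<bullet> g x))" (is ?G1)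
proof -
 note [measurable] = admD(1)[OF f] hs_measurable[OF g]
 obtain M where M: "\<And>x. norm (g x) \<le> M" using hs_bounded[OF g] by blast
 have gs: "smooth g" "\<And>x. x \<notin> cball x0 r1 ==> g x = 0" using g by (auto simp: hs_def)
 have i: "L1 (\<lambda>x. (norm (g x))^2)"
  by (rule integrable_compact_support[OF _ compact_cball[of x0 r1]]) (use gs(2) smooth_continuous[OF gs(1)] in \<open>auto intro!: continuous_on_power continuous_on_norm\<close>)
 show "L1 (\<lambda>x. f x \<bullet> g x)"
 proof (rule L1_bound[OF L1_add[OF admD(2)[OF f] i]])
  show "AE x in lborel. norm (f x \<bullet> g x) \<le> norm ((norm (f x))^2 + (norm (g x))^2)" (is "AE x in _. ?P x")
  proof (rule AE_I2)
   fix x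
   have "\<bar>f x \<bullet> g x\<bar> \<le> norm (f x) * norm (g x)" by (rule Cauchy_Schwarz_ineq2)
   also have "... \<le> (norm (f x))^2 + (norm (g x))^2"
    using sum_squares_bound[of "norm (f x)" "norm (g x)"] mult_nonneg_nonneg[OF norm_ge_zero[of "f x"] norm_ge_zero[of "g x"]] by linarith
   finally show "?P x" by simp
  qed
 qed simp
 show ?G1
 proof (rule L1_bound[OF integrable_mult_left[OF admD(2)[OF f], of M]])
  have M0: "M \<ge> 0" using order_trans[OF norm_ge_zero M] .
  have "\<bar>f x $ j\<bar> * \<bar>f x \<bullet> g x\<bar> \<le> norm (f x) * (norm (f x) * M)" for x
   by (intro mult_mono component_le_norm_cart order_trans[OF Cauchy_Schwarz_ineq2] M) auto
  then show "AE x in lborel. norm (f x $ j * (f x \<bullet> g x)) \<le> norm ((norm (f x))^2 * M)" using M0 by (simp add: abs_mult power2_eq_square mult.assoc)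
  show "(\<lambda>x. f x $ j * (f x \<bullet> g x)) \<in> borel_measurable lborel" by measurable
 qed
qed

lemma GG_lincomb:
 assumes f: "adm f" and h: "\<And>i. i \<in> I ==> hs (h i)"
 shows "GG f (lc I c h) = (\<Sum>i\<in>I. c i * GG f (h i))"
proof -
 have sm: "\<forall>i\<in>I. smooth (h i)" "\<forall>i\<in>I. smooth (lapl (h i))" "\<forall>i\<in>I. smooth (curlv (h i))"
  using h hs_lapl[OF h] hs_curlv[OF h] by (auto simp: hs_def)
 note i1 = integrable_inner_hs(1)[OF f hs_curlv[OF hs_lapl[OF h]]]
 have i2: "L1 (\<lambda>x. tri (f x) (curlv (h i)) x)" if "i \<in> I" for i
  by (intro L1_sum integrable_inner_hs(2)[OF f] hs_pd hs_curlv h that)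
 have 1: "(LBINT x. f x \<bullet> curlv (lapl (lc I c h)) x) = (\<Sum>i\<in>I. c i * (LBINT x. f x \<bullet> curlv (lapl (h i)) x))"
  unfolding lapl_lincomb[OF sm(1)] curlv_lincomb[OF sm(2)] inner_sum_right inner_scaleR_right
  by (subst LINT_sum) (auto intro: i1)
 have e: "(tri (f x) (curlv (lc I c h)) x) = (\<Sum>i\<in>I. c i * (tri (f x) (curlv (h i)) x))" for x
  unfolding curlv_lincomb[OF sm(1)] pd_lincomb[OF sm(3)] inner_sum_right inner_scaleR_right sum_distrib_left
  by (subst sum.swap) (simp add: ac_simps)
 have 2: "(LBINT x. (tri (f x) (curlv (lc I c h)) x)) = (\<Sum>i\<in>I. c i * (LBINT x. (tri (f x) (curlv (h i)) x)))"
  unfolding e by (subst LINT_sum) (auto intro: i2)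
 show ?thesis unfolding GG_def 1 2 by (simp add: sum.distrib distrib_left)
qed

text \<open>The chain rule for the energy: by linearity of \<open>GG\<close> in the potential, the
  sum over modes of weight times value times derivative is \<open>GG\<close> at the potential used
  in \<open>stationary_estimate\<close>.\<close>

lemma GG_modes:
 assumes f: "adm f"
 shows "GG f (\<lambda>x. ch x *\<^sub>R T F (apc N f) (aps N f) x) = (\<Sum>i\<in>modes F. mm N (fst i) * (ell f (hh i) / vol) * GG f (hh i))"
proof -
 have "((if b then apc N f k else aps N f k) \<bullet> e) = mm N k * (ell f (hh (k, e, b)) / vol)" for k e b
  unfolding ell_hh[OF f] by simp
 then have "((if snd (snd i) then apc N f (fst i) else aps N f (fst i)) \<bullet> fst (snd i)) = mm N (fst i) * (ell f (hh i) / vol)" for i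
  by (cases i) auto
 then show ?thesis unfolding cut_T_modes GG_lincomb[OF f hs_hh] by simp
qed

end

section \<open>The energy inequality integrated in time\<close>

lemma prim_diff:
 assumes g: "L1 g" and "a \<le> t"
 shows "prim g t - prim g a = (LBINT q. ind {a<..t} q * g q)"
 unfolding prim_def LINT_diff[OF prim_integrable[OF g] prim_integrable[OF g], symmetric]
 by (rule LINT_cong) (use \<open>a \<le> t\<close> in \<open>auto simp: indicator_def\<close>)

lemma integrable_indicator_mult:
 fixes g :: "'a => real"
 shows "A \<in> sets M ==> integrable M g ==> integrable M (\<lambda>x. ind A x * g x)"
 using integrable_real_mult_indicator[of A M g] by (simp add: mult.commute)

context ns_sol begin

lemma integrable_rho: "L1 (\<lambda>t. rho (vt t))"
 using slice(1)[OF v2, of "\<lambda>_. 0" 0] by (simp add: rho_def)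

lemma ch_measurable [measurable]: "Borel ch"
 by (rule borel_measurable_continuous_onI[OF smooth_continuous[OF ch(1)]])

lemma measurable_v_swap [measurable]: "(\<lambda>p. v (snd p, fst p)) \<in> borel_measurable (borel \<Otimes>\<^sub>M borel)"
 by measurable

lemma Ac_cf_measurable [measurable]:
 "Borel (\<lambda>t. Ac (\<lambda>x. ch x *\<^sub>R v (x, t)) k)" "Borel (\<lambda>t. As (\<lambda>x. ch x *\<^sub>R v (x, t)) k)"
 unfolding Ac_def As_def by measurable

lemma rhoF_measurable: "Borel (\<lambda>t. rhoF (vt t) F)"
proof -
 note [measurable] = measurable_compose[OF measurable_fst Ac_cf_measurable(1)] measurable_compose[OF measurable_fst Ac_cf_measurable(2)]
 have [measurable]: "cube \<in> sets borel" by (rule cube_measurable)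
 show ?thesis unfolding rhoF_def resid_def T_def cf_def[abs_def] by measurable
qed

lemma zz_measurable [measurable]: "Borel (\<lambda>t. zz (vt t) k)"
proof -
 have [measurable]: "Borel (grd ch)"
  by (rule borel_measurable_continuous_onI[OF smooth_continuous[OF smooth_grd[OF ch(1)]]])
 note [measurable (raw)] = measurable_cross3
 show ?thesis unfolding zz_def Wc_def Ws_def cf_def[abs_def] g1_def[abs_def] Ac_def As_def by measurable
qed

lemma rhoF_le: "adm f ==> finite F ==> F \<subseteq> lat ==> bnd M ==> rhoF f F \<le> M^2 * rho f"
 unfolding rhoF_def by (rule order_trans[OF resid_bound adm_inL2(4)]) (auto intro: adm_inL2(1))

lemma rhoF_nonneg: "rhoF f F \<ge> 0" unfolding rhoF_def by (rule integral_nonneg_AE) simp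

lemma integrable_rhoF:
 assumes F: "finite F" "F \<subseteq> lat"
 shows "L1 (\<lambda>t. rhoF (vt t) F)"
proof -
 obtain M where M: "bnd M" using ex_bnd by blast
 show ?thesis
 proof (rule L1_bound[OF integrable_mult_right[OF integrable_rho, of "M^2"]])
  show "(\<lambda>t. rhoF (vt t) F) \<in> borel_measurable lborel" using rhoF_measurable by simp
  show "AE t in lborel. norm (rhoF (vt t) F) \<le> norm (M^2 * rho (vt t))"
   using adm_AE by eventually_elim (use rhoF_le[OF _ F M] rhoF_nonneg in \<open>simp add: order_trans[OF _ abs_ge_self]\<close>)
 qed
qed

lemma rhoF_tendsto: "(\<lambda>n. LBINT t. rhoF (vt t) (Fn n)) \<longlonglongrightarrow> 0"
proof -
 obtain M where M: "bnd M" using ex_bnd by blast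
 have "(\<lambda>n. LBINT t. rhoF (vt t) (Fn n)) \<longlonglongrightarrow> (LINT t|(lborel :: real measure). 0)"
 proof (rule integral_dominated_convergence[where w="\<lambda>t. M^2 * rho (vt t)"])
  show "L1 (\<lambda>t. M^2 * rho (vt t))" by (rule integrable_mult_right[OF integrable_rho])
  show "AE t in lborel. (\<lambda>n. rhoF (vt t) (Fn n)) \<longlonglongrightarrow> 0"
   using adm_AE
  proof eventually_elim
   case (elim t)
   show ?case unfolding rhoF_def
    by (rule resid_tendsto[OF adm_inL2(1)[OF elim M], of r1]) (use ch(2) r in \<open>auto simp: cf_def\<close>)
  qed
  show "AE t in lborel. norm (rhoF (vt t) (Fn n)) \<le> M^2 * rho (vt t)" for n
   using adm_AE by eventually_elim (use rhoF_le[OF _ Fn(1,2) M] rhoF_nonneg in simp)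
 qed (use rhoF_measurable in simp_all)
 then show ?thesis by simp
qed

text \<open>Gronwall's inequality is started at a time in (\<open>\<tau>0\<close>,
  \<open>\<tau>1\<close>) where the energy is not too large and is run up to \<open>\<tau>2\<close>;
  the same integrated inequality then bounds the time integral of the dissipation. \<open>L\<close>
  is the integral of the Gronwall coefficient, and \<open>A\<close> collects the bounds for the
  initial value and the source terms.\<close>

lemma energy_inequality:
 assumes M: "bnd M"
  and C: "C > 0" "\<And>f N F. adm f ==> N \<ge> 1 ==> finite F ==> F \<subseteq> lat ==>
   GG f (\<lambda>x. ch x *\<^sub>R T F (apc N f) (aps N f) x)
    \<le> vol * (- (1 / 2) * DD N F f + C * \<kappa> f * EE N F f) + C * (rho f + N * rhoF f F)"
  and \<tau>: "0 < \<tau>0" "\<tau>0 < \<tau>1" "\<tau>1 < \<tau>2" "\<tau>2 < \<tau>3" "\<tau>3 < Tm"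
  and N: "N \<ge> 1" and F: "finite F" "F \<subseteq> lat"
 defines "L \<equiv> LBINT t. 2 * C * (ind {\<tau>0<..<\<tau>3} t * \<kappa> (vt t))"
  and "A \<equiv> 4 * M^2 / vol * (2 * ((LBINT t. rho (vt t)) + 1) / (\<tau>1 - \<tau>0))
   + 2 * C / vol * ((LBINT t. rho (vt t)) + N * (LBINT t. rhoF (vt t) F))"
 shows "L1 (\<lambda>t. ind {\<tau>1<..\<tau>2} t * DD N F (vt t))"
  "(LBINT t. ind {\<tau>1<..\<tau>2} t * DD N F (vt t)) \<le> A * exp L * L + A" (is ?G1)
proof -
 define X where "X i t = ell (vt t) (hh i)" for i t
 define G where "G i t = GG (vt t) (hh i)" for i t
 have iX: "L1 (X i)" and iG: "L1 (G i)" for i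
  using GG_slices(1,2)[OF hs_hh[of i], of "\<lambda>_. 0" 0] by (simp_all add: X_def[abs_def] G_def[abs_def])
 have [measurable]: "Borel (X i)" "Borel (G i)" for i using iX[of i] iG[of i] by auto
 have "\<exists>c. AE t in lborel. t \<in> {0<..<Tm} \<longrightarrow> X i t = c + prim (G i) t" for i
  using ell_primitive[OF hs_hh[of i]] unfolding X_def G_def[abs_def] by blast
 then obtain c where c: "\<And>i. AE t in lborel. t \<in> {0<..<Tm} \<longrightarrow> X i t = c i + prim (G i) t" by metis
 define I where "I = modes F"
 have fI: "finite I" unfolding I_def by (rule finite_modes[OF F(1)])
 \<comment> \<open>A representative of \<open>X i\<close> that is a constant plus a primitive at
   every time; the two agree at almost every time of the interval.\<close>
 define Y where "Y i t = c i + prim (G i) t" for i t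
 have [measurable]: "Borel (Y i)" for i unfolding Y_def by measurable
 define w where "w i = mm N (fst i) / vol^2" for i :: "R3 \<times> R3 \<times> bool"
 have w0: "w i \<ge> 0" for i using mm_bounds(1)[OF N, of "fst i"] by (simp add: w_def)
 define Eh where "Eh t = (\<Sum>i\<in>I. w i * (Y i t)^2)" for t
 define Dh where "Dh q = (\<Sum>i\<in>I. w i * (2 * (Y i q * G i q)))" for q
 have [measurable]: "Borel Eh" "Borel Dh" unfolding Eh_def Dh_def by measurable
 have iYG: "L1 (\<lambda>q. Y i q * G i q)" for i
  unfolding Y_def distrib_right by (intro L1_add integrable_mult_right integrable_mult_prim iG)
 have iDh: "L1 Dh" unfolding Dh_def by (intro L1_sum integrable_mult_right iYG)
 \<comment> \<open>The product rule for primitives writes the square as a constant plus a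
   primitive.\<close>
 have Y2: "(Y i t)^2 = (c i)^2 + prim (\<lambda>q. 2 * (Y i q * G i q)) t" for i t
 proof -
  have "prim (\<lambda>q. 2 * (Y i q * G i q)) t = prim (\<lambda>q. 2 * c i * G i q + (prim (G i) q * G i q + prim (G i) q * G i q)) t"
   by (rule arg_cong[where f="\<lambda>g. prim g t"]) (simp add: fun_eq_iff Y_def algebra_simps)
  also have "... = prim (\<lambda>q. 2 * c i * G i q) t + prim (\<lambda>q. prim (G i) q * G i q + prim (G i) q * G i q) t"
   by (rule prim_add) (intro integrable_mult_right L1_add integrable_mult_prim iG)+
  also have "... = 2 * c i * prim (G i) t + prim (G i) t * prim (G i) t" by (simp only: prim_cmult prim_product[OF iG iG])
  finally show ?thesis by (simp add: Y_def power2_eq_square algebra_simps)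
 qed
 have E_prim: "Eh t = (\<Sum>i\<in>I. w i * (c i)^2) + prim Dh t" for t
 proof -
  have "prim Dh t = (\<Sum>i\<in>I. w i * prim (\<lambda>q. 2 * (Y i q * G i q)) t)"
   unfolding Dh_def prim_cmult[symmetric] by (rule prim_sum) (intro integrable_mult_right iYG)
  then show ?thesis unfolding Eh_def Y2 by (simp add: distrib_left sum.distrib)
 qed
 have E_diff: "Eh t - Eh a = (LBINT q. ind {a<..t} q * Dh q)" if "a \<le> t" for a t
  using prim_diff[OF iDh that] E_prim[of t] E_prim[of a] by simp
 have XY: "AE t in lborel. t \<in> {0<..<Tm} \<longrightarrow> (\<forall>i\<in>I. X i t = Y i t)"
 proof -
  have "AE t in lborel. \<forall>i\<in>I. t \<in> {0<..<Tm} \<longrightarrow> X i t = Y i t"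
   using c fI unfolding Y_def by (intro AE_finite_allI) auto
  then show ?thesis by eventually_elim blast
 qed
 \<comment> \<open>The differential inequality at almost every time: \<open>Dh\<close> is the
   derivative of \<open>Eh\<close>, and \<open>stationary_estimate\<close> bounds it.\<close>
 have key: "AE t in lborel. t \<in> {0<..<Tm} \<longrightarrow> adm (vt t) \<and> Eh t = EE N F (vt t) \<and>
  Dh t \<le> - DD N F (vt t) + 2 * C * \<kappa> (vt t) * Eh t + 2 * C / vol * (rho (vt t) + N * rhoF (vt t) F)"
  using adm_AE XY
 proof eventually_elim
  case (elim t)
  show ?case
  proof
   assume t: "t \<in> {0<..<Tm}"
   then have xy: "\<And>i. i \<in> I ==> X i t = Y i t" using elim(2) by blast
   have E: "Eh t = EE N F (vt t)"
    unfolding EE_def sum_zz[OF elim(1)] Eh_def I_def[symmetric] by (intro sum.cong refl) (simp add: w_def xy[symmetric] X_def power_divide)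
   have "Dh t = 2 / vol * GG (vt t) (\<lambda>x. ch x *\<^sub>R T F (apc N (vt t)) (aps N (vt t)) x)"
    unfolding GG_modes[OF elim(1)] Dh_def I_def[symmetric] sum_distrib_left
    by (intro sum.cong refl) (simp add: w_def xy[symmetric] X_def G_def power2_eq_square)
   also have "... \<le> 2 / vol * (vol * (- (1 / 2) * DD N F (vt t) + C * \<kappa> (vt t) * EE N F (vt t)) + C * (rho (vt t) + N * rhoF (vt t) F))"
    using vol_pos by (intro mult_left_mono C(2) elim(1) N F) auto
   also have "... = - DD N F (vt t) + 2 * C * \<kappa> (vt t) * Eh t + 2 * C / vol * (rho (vt t) + N * rhoF (vt t) F)"
    unfolding E using vol_pos by (simp add: field_simps)
   finally show "adm (vt t) \<and> Eh t = EE N F (vt t) \<and>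
    Dh t \<le> - DD N F (vt t) + 2 * C * \<kappa> (vt t) * Eh t + 2 * C / vol * (rho (vt t) + N * rhoF (vt t) F)" using E elim(1) by blast
  qed
 qed
 define Rt where "Rt t = 2 * C / vol * (rho (vt t) + N * rhoF (vt t) F)" for t
 have Rt0: "Rt t \<ge> 0" for t unfolding Rt_def
  by (intro mult_nonneg_nonneg divide_nonneg_nonneg add_nonneg_nonneg rho_nonneg rhoF_nonneg) (use C(1) vol_pos N in auto)
 have iRt: "L1 Rt" unfolding Rt_def by (intro integrable_mult_right L1_add integrable_rho integrable_rhoF F)
 have IRt: "integral\<^sup>L lborel Rt = 2 * C / vol * ((LBINT t. rho (vt t)) + N * (LBINT t. rhoF (vt t) F))"
  unfolding Rt_def using integrable_rho integrable_rhoF[OF F] by (simp add: LINT_add)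
 define k where "k t = 2 * C * (ind {\<tau>0<..<\<tau>3} t * \<kappa> (vt t))" for t
 have k0: "k t \<ge> 0" for t using C(1) order_trans[OF zero_le_one kappa_ge_1[of "vt t"]] by (simp add: k_def)
 have ik: "L1 k" unfolding k_def using vs[of \<tau>0 \<tau>3] \<tau> by (intro integrable_mult_right) auto
 have Lk: "L = integral\<^sup>L lborel k" unfolding L_def k_def[abs_def] ..
 have L0: "L \<ge> 0" unfolding Lk by (rule integral_nonneg_AE) (simp add: k0)
 define rb where "rb = 2 * ((LBINT t. rho (vt t)) + 1) / (\<tau>1 - \<tau>0)"
 have A: "A = 4 * M^2 / vol * rb + integral\<^sup>L lborel Rt" by (simp add: A_def rb_def IRt)
 have Ir0: "(LBINT t. rho (vt t)) \<ge> 0" by (rule integral_nonneg_AE) (simp add: rho_nonneg)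
 \<comment> \<open>If the energy exceeded the bound on all of (\<open>\<tau>0\<close>,
   \<open>\<tau>1\<close>), then \<open>rho\<close> would exceed \<open>rb\<close> there almost
   everywhere; the factor 2 and the summand 1 in \<open>rb\<close> make its integral larger than the
   integral of \<open>rho\<close>.\<close>
 have "\<exists>\<sigma>. \<sigma> \<in> {\<tau>0<..<\<tau>1} \<and> Eh \<sigma> \<le> 4 * M^2 / vol * rb"
 proof (rule ccontr)
  assume "\<not> ?thesis"
  then have no: "Eh \<sigma> > 4 * M^2 / vol * rb" if "\<sigma> \<in> {\<tau>0<..<\<tau>1}" for \<sigma> using that by force
  have "AE t in lborel. ind {\<tau>0<..<\<tau>1} t * rb \<le> rho (vt t)"
   using key
  proof eventually_elim
   case (elim t)
   show ?case
   proof (cases "t \<in> {\<tau>0<..<\<tau>1}")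
    case True
    then have "t \<in> {0<..<Tm}" using \<tau> by auto
    with elim have "Eh t = EE N F (vt t)" "adm (vt t)" by blast+
    then have "4 * M^2 / vol * rb < 4 * M^2 / vol * rho (vt t)" using no[OF True] EE_le_rho[OF _ N F M] by fastforce
    moreover have "4 * M^2 / vol > 0" using bndD(1)[OF M] vol_pos by simp
    ultimately have "rb < rho (vt t)" by (simp only: mult_less_cancel_left_pos)
    then show ?thesis using True by simp
   qed (simp add: rho_nonneg)
  qed
  then have "(LBINT t. ind {\<tau>0<..<\<tau>1} t * rb) \<le> (LBINT t. rho (vt t))"
   by (intro integral_mono_AE integrable_mult_left integrable_real_indicator integrable_rho) (use \<tau> in auto)
  moreover have "(LBINT t. ind {\<tau>0<..<\<tau>1} t * rb) = 2 * ((LBINT t. rho (vt t)) + 1)" using \<tau> by (simp add: rb_def)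
  ultimately show False using Ir0 by simp
 qed
 then obtain \<sigma> where \<sigma>: "\<tau>0 < \<sigma>" "\<sigma> < \<tau>1" "Eh \<sigma> \<le> 4 * M^2 / vol * rb" by auto
 have Eh0: "Eh t \<ge> 0" for t unfolding Eh_def by (intro sum_nonneg mult_nonneg_nonneg w0) auto
 have IR0: "integral\<^sup>L lborel Rt \<ge> 0" by (rule integral_nonneg_AE) (simp add: Rt0)
 have A0: "A \<ge> 0" unfolding A using order_trans[OF Eh0 \<sigma>(3)] IR0 by linarith
 have Yb: "\<bar>Y i t\<bar> \<le> \<bar>c i\<bar> + (LBINT q. \<bar>G i q\<bar>)" for i t
  unfolding Y_def using prim_abs_le[OF iG, of i t] by linarith
 have Y2b: "(Y i t)^2 \<le> (\<bar>c i\<bar> + (LBINT q. \<bar>G i q\<bar>))^2" for i t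
  unfolding power2_abs[of "Y i t", symmetric] by (intro power_mono Yb) auto
 define S where "S = (\<Sum>i\<in>I. w i * (\<bar>c i\<bar> + (LBINT q. \<bar>G i q\<bar>))^2)"
 have EhS: "Eh t \<le> S" for t unfolding Eh_def S_def by (intro sum_mono mult_left_mono Y2b w0)
 have S0: "S \<ge> 0" using order_trans[OF Eh0 EhS] .
 \<comment> \<open>\<open>Gronwall_prim\<close> integrates from minus infinity, so the energy is cut
   off before \<open>\<sigma>\<close>.\<close>
 define e where "e t = ind {\<sigma><..\<tau>2} t * Eh t" for t
 have em[measurable]: "Borel e" unfolding e_def by measurable
 have e0: "e t \<ge> 0" and eS: "e t \<le> S" for t using Eh0 EhS S0 by (auto simp: e_def indicator_def)
 have ike: "L1 (\<lambda>q. k q * e q)"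
 proof (rule L1_bound[OF integrable_mult_left[OF ik, of S]])
  show "(\<lambda>q. k q * e q) \<in> borel_measurable lborel" using borel_measurable_integrable[OF ik] by measurable
  show "AE q in lborel. norm (k q * e q) \<le> norm (k q * S)" using k0 e0 eS S0 by (auto simp: abs_mult intro!: mult_left_mono)
 qed
 have DD0: "DD N F f \<ge> 0" for f using order_trans[OF EE_nonneg[OF N] EE_le_DD[OF N]] .
 have Dle: "AE q in lborel. q \<in> {\<sigma><..\<tau>2} \<longrightarrow> DD N F (vt q) + Dh q \<le> k q * e q + Rt q"
  using key
 proof eventually_elim
  case (elim q)
  show ?case
  proof
   assume q: "q \<in> {\<sigma><..\<tau>2}"
   then have "q \<in> {0<..<Tm}" "q \<in> {\<tau>0<..<\<tau>3}" using \<tau> \<sigma> by auto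
   moreover from this(1) elim have "Dh q \<le> - DD N F (vt q) + 2 * C * \<kappa> (vt q) * Eh q + Rt q" unfolding Rt_def by blast
   ultimately show "DD N F (vt q) + Dh q \<le> k q * e q + Rt q" using q by (simp add: k_def e_def mult.assoc)
  qed
 qed
 have le: "e t \<le> A + prim (\<lambda>q. k q * e q) t" for t
 proof (cases "t \<in> {\<sigma><..\<tau>2}")
  case False
  then have "e t = 0" by (simp add: e_def)
  then show ?thesis using A0 prim_nonneg[of "\<lambda>q. k q * e q" t] k0 e0 by simp
 next
  case True
  have "Eh t - Eh \<sigma> = (LBINT q. ind {\<sigma><..t} q * Dh q)" using True by (intro E_diff) auto
  also have "... \<le> (LBINT q. ind {..t} q * (k q * e q) + Rt q)"
  proof (rule integral_mono_AE)
   show "L1 (\<lambda>q. ind {\<sigma><..t} q * Dh q)" by (rule integrable_indicator_mult[OF _ iDh]) simp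
   show "L1 (\<lambda>q. ind {..t} q * (k q * e q) + Rt q)" by (intro L1_add iRt prim_integrable ike)
   show "AE q in lborel. ind {\<sigma><..t} q * Dh q \<le> ind {..t} q * (k q * e q) + Rt q"
    using Dle
   proof eventually_elim
    case (elim q)
    have n: "0 \<le> k q * e q" using k0[of q] e0[of q] by simp
    show ?case
    proof (cases "q \<in> {\<sigma><..t}")
     case T: True
     then have "q \<in> {\<sigma><..\<tau>2}" using True by auto
     then show ?thesis using elim T DD0[of "vt q"] by auto
    qed (use n Rt0[of q] in \<open>auto simp: indicator_def\<close>)
   qed
  qed
  also have "... = prim (\<lambda>q. k q * e q) t + integral\<^sup>L lborel Rt"
   unfolding prim_def by (rule LINT_add[OF prim_integrable[OF ike] iRt])
  finally show ?thesis using True \<sigma>(3) by (simp add: A e_def)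
 qed
 have eb: "e t \<le> A * exp L" for t
 proof -
  have "e t \<le> A * exp (prim k t)" by (rule Gronwall_prim[OF ik k0 em e0 eS A0 le])
  also have "... \<le> A * exp L" unfolding Lk using A0 prim_le_integral[OF ik k0, of t] by (intro mult_left_mono) auto
  finally show ?thesis .
 qed
 define w1 where "w1 i = (1 + (norm (fst i))^2) * mm N (fst i)" for i :: "R3 \<times> R3 \<times> bool"
 have w10: "w1 i \<ge> 0" for i using mm_bounds(1)[OF N, of "fst i"] by (simp add: w1_def)
 \<comment> \<open>The dissipation expressed by the functions \<open>X i\<close>, which are bounded
   almost everywhere on the interval through \<open>Y i\<close>; this gives integrability.\<close>
 define dd where "dd t = ind {\<sigma><..\<tau>2} t * (\<Sum>i\<in>I. w1 i * (X i t / vol)^2)" for t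
 have [measurable]: "Borel dd" unfolding dd_def by measurable
 have DDX: "adm (vt t) ==> DD N F (vt t) = (\<Sum>i\<in>I. w1 i * (X i t / vol)^2)" for t
  unfolding DD_def I_def w1_def X_def by (rule sum_zz)
 have idd: "L1 dd"
 proof (rule L1_bound)
  define S1 where "S1 = (\<Sum>i\<in>I. w1 i * ((\<bar>c i\<bar> + (LBINT q. \<bar>G i q\<bar>))^2 / vol^2))"
  show "L1 (\<lambda>t. ind {\<sigma><..\<tau>2} t * S1)"
   using \<tau> \<sigma> by (intro integrable_mult_left integrable_real_indicator) auto
  show "AE t in lborel. norm (dd t) \<le> norm (ind {\<sigma><..\<tau>2} t * S1)"
   using XY
  proof eventually_elim
   case (elim t)
   show ?case
   proof (cases "t \<in> {\<sigma><..\<tau>2}")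
    case True
    then have xy: "\<And>i. i \<in> I ==> X i t = Y i t" using elim \<sigma> \<tau> by auto
    have "(\<Sum>i\<in>I. w1 i * (X i t / vol)^2) \<le> S1"
     unfolding S1_def power_divide by (intro sum_mono mult_left_mono w10 divide_right_mono) (use xy Y2b in auto)
    moreover have "(\<Sum>i\<in>I. w1 i * (X i t / vol)^2) \<ge> 0" by (intro sum_nonneg mult_nonneg_nonneg w10) auto
    ultimately show ?thesis using True by (simp add: dd_def)
   qed (simp add: dd_def)
  qed
 qed simp
 have Idd: "integral\<^sup>L lborel dd \<le> A * exp L * L + A"
 proof -
  have "integral\<^sup>L lborel dd \<le> (LBINT q. (k q * e q + Rt q) - ind {\<sigma><..\<tau>2} q * Dh q)"
  proof (rule integral_mono_AE[OF idd])
   show "L1 (\<lambda>q. (k q * e q + Rt q) - ind {\<sigma><..\<tau>2} q * Dh q)"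
    by (intro L1_diff L1_add ike iRt integrable_indicator_mult iDh) simp
   show "AE q in lborel. dd q \<le> (k q * e q + Rt q) - ind {\<sigma><..\<tau>2} q * Dh q"
    using Dle adm_AE
   proof eventually_elim
    case (elim q)
    have n: "0 \<le> k q * e q" using k0[of q] e0[of q] by simp
    show ?case using elim n Rt0[of q] DDX[OF elim(2)] by (cases "q \<in> {\<sigma><..\<tau>2}") (auto simp: dd_def)
   qed
  qed
  also have "... = (LBINT q. k q * e q) + integral\<^sup>L lborel Rt - (Eh \<tau>2 - Eh \<sigma>)"
  proof -
   have "\<sigma> \<le> \<tau>2" using \<sigma> \<tau> by simp
   show ?thesis unfolding E_diff[OF \<open>\<sigma> \<le> \<tau>2\<close>]
    by (simp add: LINT_diff LINT_add ike iRt integrable_indicator_mult[OF _ iDh])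
  qed
  also have "(LBINT q. k q * e q) \<le> (LBINT q. k q * (A * exp L))"
   by (intro integral_mono ike integrable_mult_left ik mult_left_mono eb k0)
  also have "(LBINT q. k q * (A * exp L)) = A * exp L * L" by (simp add: Lk)
  finally show ?thesis using Eh0[of \<tau>2] \<sigma>(3) by (simp add: A)
 qed
 have ae: "AE t in lborel. ind {\<tau>1<..\<tau>2} t * DD N F (vt t) = ind {\<tau>1<..\<tau>2} t * dd t"
  using adm_AE by eventually_elim (use \<sigma> in \<open>auto simp: DDX dd_def indicator_def\<close>)
 have i1: "L1 (\<lambda>t. ind {\<tau>1<..\<tau>2} t * dd t)" by (rule integrable_indicator_mult[OF _ idd]) simp
 have DDm: "Borel (\<lambda>t. DD N F (vt t))" unfolding DD_def by measurable
 show i2: "L1 (\<lambda>t. ind {\<tau>1<..\<tau>2} t * DD N F (vt t))"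
  using i1 ae DDm by (subst integrable_cong_AE) auto
 have "(LBINT t. ind {\<tau>1<..\<tau>2} t * DD N F (vt t)) = (LBINT t. ind {\<tau>1<..\<tau>2} t * dd t)"
  using ae DDm by (intro integral_cong_AE) auto
 also have "... \<le> integral\<^sup>L lborel dd"
  using w10 by (intro integral_mono i1 idd) (auto simp: dd_def indicator_def intro!: sum_nonneg mult_nonneg_nonneg)
 finally show ?G1 using Idd by simp
qed

text \<open>First the modes exhaust the lattice with \<open>N\<close> fixed, so that
  \<open>N\<close> times the truncation error disappears from the bound. What remains is independent
  of \<open>N\<close>, which can therefore be adapted to the given finite set
  \<open>F\<close>.\<close>

lemma energy_bound:
 assumes \<tau>: "0 < \<tau>1" "\<tau>1 < \<tau>2" "\<tau>2 < Tm"
 obtains C where "\<And>F. finite F ==> F \<subseteq> lat ==> L1 (\<lambda>t. ind {\<tau>1<..\<tau>2} t * (zs F (vt t))) \<and>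
  (LBINT t. ind {\<tau>1<..\<tau>2} t * (zs F (vt t))) \<le> C"
proof -
 obtain M where M: "bnd M" using ex_bnd by blast
 obtain C where C: "C > 0" "\<And>f N F. adm f ==> N \<ge> 1 ==> finite F ==> F \<subseteq> lat ==>
   GG f (\<lambda>x. ch x *\<^sub>R T F (apc N f) (aps N f) x)
    \<le> vol * (- (1 / 2) * DD N F f + C * \<kappa> f * EE N F f) + C * (rho f + N * rhoF f F)"
  by (rule stationary_estimate) blast
 have t0: "0 < \<tau>1 / 2" "\<tau>1 / 2 < \<tau>1" "\<tau>2 < (\<tau>2 + Tm) / 2" "(\<tau>2 + Tm) / 2 < Tm" using \<tau> by auto
 define L where "L = (LBINT t. 2 * C * (ind {\<tau>1 / 2<..<(\<tau>2 + Tm) / 2} t * \<kappa> (vt t)))"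
 define A where "A N n = 4 * M^2 / vol * (2 * ((LBINT t. rho (vt t)) + 1) / (\<tau>1 - \<tau>1 / 2))
   + 2 * C / vol * ((LBINT t. rho (vt t)) + N * (LBINT t. rhoF (vt t) (Fn n)))" for N n
 \<comment> \<open>The limit of \<open>A N n\<close> as \<open>n\<close> tends to infinity, in which
   \<open>N\<close> no longer occurs.\<close>
 define A0 where "A0 = 4 * M^2 / vol * (2 * ((LBINT t. rho (vt t)) + 1) / (\<tau>1 - \<tau>1 / 2))
   + 2 * C / vol * ((LBINT t. rho (vt t)) + 0)"
 have e: "L1 (\<lambda>t. ind {\<tau>1<..\<tau>2} t * DD N (Fn n) (vt t)) \<and>
  (LBINT t. ind {\<tau>1<..\<tau>2} t * DD N (Fn n) (vt t)) \<le> A N n * exp L * L + A N n" if "N \<ge> 1" for N n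
  using energy_inequality[OF M C t0(1,2) \<tau>(2) t0(3,4) that Fn(1,2)[of n]] unfolding A_def L_def by blast
 have lim: "(\<lambda>n. 2 * (A N n * exp L * L + A N n)) \<longlonglongrightarrow> 2 * (A0 * exp L * L + A0)" for N
 proof -
  have "(\<lambda>n. N * (LBINT t. rhoF (vt t) (Fn n))) \<longlonglongrightarrow> N * 0" by (intro tendsto_intros rhoF_tendsto)
  then have "(\<lambda>n. A N n) \<longlonglongrightarrow> A0" unfolding A_def A0_def by (intro tendsto_intros) simp
  then show ?thesis by (intro tendsto_intros)
 qed
 show ?thesis
 proof (rule that, intro conjI)
  fix F assume F: "finite F" "F \<subseteq> lat"
  \<comment> \<open>With this choice |k|^2 \<le> N on \<open>F\<close>, so the Yosida factor is at
    least 1/2 there and \<open>zz\<close> is at most twice its term in \<open>DD\<close>.\<close>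
  define N where "N = 1 + (\<Sum>k\<in>F. (norm k)^2)"
  have N1: "N \<ge> 1" unfolding N_def by (simp add: sum_nonneg)
  have zD: "(zs F f) \<le> 2 * DD N F' f" if "F \<subseteq> F'" "finite F'" for f F'
  proof -
   have "zz f k \<le> 2 * ((1 + (norm k)^2) * mm N k * zz f k)" if "k \<in> F" for k
   proof -
    have "(norm k)^2 \<le> N" using member_le_sum[of k F "\<lambda>k. (norm k)^2"] F(1) that by (simp add: N_def)
    then have "1 + (norm k)^2 / N \<le> 2" using N1 by simp
    moreover have p: "(1 + (norm k)^2) * mm N k \<ge> 0" using mm_bounds(1)[OF N1, of k] by simp
    ultimately have "((1 + (norm k)^2) * mm N k) * (1 + (norm k)^2 / N) \<le> ((1 + (norm k)^2) * mm N k) * 2" by (intro mult_left_mono) auto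
    then have "1 \<le> 2 * ((1 + (norm k)^2) * mm N k)" using mm_bounds(6)[OF N1, of k] by (simp add: ac_simps)
    from mult_right_mono[OF this zz_nonneg[of f k]] show ?thesis by (simp add: mult.assoc)
   qed
   then have "(zs F f) \<le> (\<Sum>k\<in>F. 2 * ((1 + (norm k)^2) * mm N k * zz f k))" by (rule sum_mono)
   also have "... \<le> (\<Sum>k\<in>F'. 2 * ((1 + (norm k)^2) * mm N k * zz f k))"
    using mm_bounds(1)[OF N1] zz_nonneg[of f] that by (intro sum_mono2) (auto simp: less_imp_le)
   finally show ?thesis by (simp add: DD_def sum_distrib_left)
  qed
  obtain n0 where n0: "\<And>n. n \<ge> n0 ==> F \<subseteq> Fn n" using Fn_exhausts[OF F] by blast
  have zs0: "(zs F f) \<ge> 0" for f by (intro sum_nonneg zz_nonneg)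
  have iD: "L1 (\<lambda>t. 2 * (ind {\<tau>1<..\<tau>2} t * DD N (Fn n) (vt t)))" for n using e[OF N1, of n] by simp
  show i: "L1 (\<lambda>t. ind {\<tau>1<..\<tau>2} t * (zs F (vt t)))"
  proof (rule L1_bound[OF iD[of n0]])
   show "AE t in lborel. norm (ind {\<tau>1<..\<tau>2} t * (zs F (vt t))) \<le> norm (2 * (ind {\<tau>1<..\<tau>2} t * DD N (Fn n0) (vt t)))"
    using zD[OF n0 Fn(1)] zs0 by (intro AE_I2) (auto simp: indicator_def abs_of_nonneg intro: order_trans[OF _ abs_ge_self])
  qed measurable
  have "(LBINT t. ind {\<tau>1<..\<tau>2} t * (zs F (vt t))) \<le> 2 * (A N n * exp L * L + A N n)" if "n \<ge> n0" for n
  proof -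
   have "(LBINT t. ind {\<tau>1<..\<tau>2} t * (zs F (vt t))) \<le> (LBINT t. 2 * (ind {\<tau>1<..\<tau>2} t * DD N (Fn n) (vt t)))"
    using zD[OF n0[OF that] Fn(1)] by (intro integral_mono i iD) (auto simp: indicator_def)
   then show ?thesis using e[OF N1, of n] by simp
  qed
  then show "(LBINT t. ind {\<tau>1<..\<tau>2} t * (zs F (vt t))) \<le> 2 * (A0 * exp L * L + A0)"
   by (intro LIMSEQ_le_const[OF lim[of N]]) blast
 qed
qed

end

section \<open>Completeness of L^2\<close>

lemma norm_add_square_le: "(norm (a + b))^2 \<le> 2 * ((norm a)^2 + (norm (b :: 'a::real_normed_vector))^2)"
proof -
 have "(norm (a + b))^2 \<le> (norm a + norm b)^2" by (intro power_mono norm_triangle_ineq norm_ge_zero)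
 also have "... \<le> 2 * ((norm a)^2 + (norm b)^2)" using zero_le_power2[of "norm a - norm b"] by (simp add: power2_eq_square algebra_simps)
 finally show ?thesis .
qed

text \<open>The limit is taken pointwise along a rapidly converging subsequence; Fatou's lemma identifies it as the limit in $L^2$.\<close>

lemma Riesz_Fischer:
 fixes f :: "nat => 'a => 'b::euclidean_space"
 assumes f[measurable]: "\<And>n. f n \<in> borel_measurable M" and i: "\<And>n. integrable M (\<lambda>x. (norm (f n x))^2)"
  and cauchy: "\<And>e. e > 0 ==> \<exists>N. \<forall>m\<ge>N. \<forall>n\<ge>N. (LINT x|M. (norm (f m x - f n x))^2) < e"
 obtains w r where "w \<in> borel_measurable M" "integrable M (\<lambda>x. (norm (w x))^2)" "\<And>k :: nat. r k \<ge> k"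
  "\<And>k. integrable M (\<lambda>x. (norm (w x - f (r k) x))^2)"
  "(\<lambda>k. LINT x|M. (norm (w x - f (r k) x))^2) \<longlonglongrightarrow> 0"
proof -
 have id: "integrable M (\<lambda>x. (norm (f m x - f n x))^2)" for m n
 proof (rule L1_bound)
  show "integrable M (\<lambda>x. 2 * ((norm (f m x))^2 + (norm (f n x))^2))" using i by auto
  show "AE x in M. norm ((norm (f m x - f n x))^2) \<le> norm (2 * ((norm (f m x))^2 + (norm (f n x))^2))"
   using norm_add_square_le[of "f m _" "- f n _"] by simp
 qed measurable
 have "\<exists>N. \<forall>m\<ge>N. \<forall>n\<ge>N. (LINT x|M. (norm (f m x - f n x))^2) < (1 / 8) ^ k" for k :: nat by (rule cauchy) simp
 then obtain N where N: "\<And>k m n. m \<ge> N k ==> n \<ge> N k ==> (LINT x|M. (norm (f m x - f n x))^2) < (1 / 8) ^ k" by metis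
 \<comment> \<open>At least \<open>k\<close>, and at least every \<open>N j\<close> with j \<le>
   k.\<close>
 define r where "r k = k + (\<Sum>j\<le>k. N j)" for k
 have rN: "r m \<ge> N k" if "k \<le> m" for k m
  using member_le_sum[of k "{..m}" N] that by (simp add: r_def)
 have rb: "(LINT x|M. (norm (f (r m) x - f (r n) x))^2) \<le> (1 / 8) ^ k" if "k \<le> m" "k \<le> n" for k m n
  by (rule less_imp_le[OF N[OF rN[OF that(1)] rN[OF that(2)]]])
 \<comment> \<open>The weight 2^k is affordable because the integrals decay like 8^-k; it is what
   makes the norms of the increments summable.\<close>
 define p where "p k x = 2 ^ k * (norm (f (r (Suc k)) x - f (r k) x))^2" for k x
 have pm[measurable]: "p k \<in> borel_measurable M" for k unfolding p_def by measurable
 have p0: "p k x \<ge> 0" for k x by (simp add: p_def)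
 have ip: "integrable M (p k)" for k unfolding p_def by (rule integrable_mult_right[OF id])
 have Ip: "integral\<^sup>L M (p k) \<le> (1 / 4) ^ k" for k
 proof -
  have "integral\<^sup>L M (p k) \<le> 2 ^ k * (1 / 8) ^ k" unfolding p_def using rb[of k "Suc k" k] by simp
  also have "... = (1 / 4) ^ k" by (simp add: power_mult_distrib[symmetric])
  finally show ?thesis .
 qed
 have Ip0: "integral\<^sup>L M (p k) \<ge> 0" for k by (rule integral_nonneg_AE[OF AE_I2]) (rule p0)
 have "(\<integral>\<^sup>+x. (\<Sum>k. ennreal (p k x)) \<partial>M) = (\<Sum>k. \<integral>\<^sup>+x. ennreal (p k x) \<partial>M)" by (rule nn_integral_suminf) measurable
 also have "... = (\<Sum>k. ennreal (integral\<^sup>L M (p k)))"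
  by (intro suminf_cong nn_integral_eq_integral ip AE_I2 p0)
 also have "... \<noteq> \<infinity>"
  unfolding infinity_ennreal_def
 proof (rule ennreal_suminf_neq_top)
  show "summable (\<lambda>k. integral\<^sup>L M (p k))"
  proof (rule summable_comparison_test')
   show "summable (\<lambda>k. (1 / 4 :: real) ^ k)" by (rule summable_geometric) simp
   show "norm (integral\<^sup>L M (p k)) \<le> (1 / 4) ^ k" for k
    using Ip[of k] Ip0[of k] by simp
  qed
  show "integral\<^sup>L M (p k) \<ge> 0" for k by (rule Ip0)
 qed
 finally have "AE x in M. (\<Sum>k. ennreal (p k x)) \<noteq> \<infinity>" by (intro nn_integral_PInf_AE) simp_all
 then have conv: "AE x in M. convergent (\<lambda>k. f (r k) x)"
 proof eventually_elim
  case (elim x)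
  have "summable (\<lambda>k. p k x)" by (rule summable_suminf_not_top) (use p0 elim in auto)
  then have "summable (\<lambda>k. (1 / 2 :: real) ^ k + p k x)" by (intro summable_add summable_geometric) auto
  then have "summable (\<lambda>k. norm (f (r (Suc k)) x - f (r k) x))"
  proof (rule summable_comparison_test'[where N=0])
   fix k
   define d where "d = norm (f (r (Suc k)) x - f (r k) x)"
   have d0: "d \<ge> 0" by (simp add: d_def)
   \<comment> \<open>An increment is either at most 2^-k or at most 2^k times its square.\<close>
   have "d \<le> (1 / 2) ^ k + 2 ^ k * d^2"
   proof (cases "d \<le> (1 / 2) ^ k")
    case False
    then have "1 \<le> 2 ^ k * d" by (simp add: power_one_over field_simps)
    from mult_right_mono[OF this d0] have "d \<le> 2 ^ k * d^2" by (simp add: power2_eq_square)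
    then show ?thesis by (simp add: add_increasing)
   qed (simp add: add_increasing2)
   then show "norm (norm (f (r (Suc k)) x - f (r k) x)) \<le> (1 / 2) ^ k + p k x" by (simp add: d_def p_def)
  qed
  then have "summable (\<lambda>k. f (r (Suc k)) x - f (r k) x)" by (rule summable_norm_cancel)
  then have "convergent (\<lambda>n. \<Sum>k<n. f (r (Suc k)) x - f (r k) x)" by (simp add: summable_iff_convergent)
  then have "convergent (\<lambda>n. f (r n) x - f (r 0) x)" unfolding sum_lessThan_telescope[of "\<lambda>k. f (r k) x"] .
  then have "convergent (\<lambda>n. (f (r n) x - f (r 0) x) + f (r 0) x)" by (intro convergent_add convergent_const)
  then show ?case by simp
 qed
 define w where "w x = lim (\<lambda>k. f (r k) x)" for x
 have wm[measurable]: "w \<in> borel_measurable M" unfolding w_def by measurable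
 have fatou: "(\<integral>\<^sup>+x. ennreal ((norm (w x - f (r n) x))^2) \<partial>M) \<le> ennreal ((1 / 8) ^ n)" for n
 proof -
  have "(\<integral>\<^sup>+x. ennreal ((norm (w x - f (r n) x))^2) \<partial>M) = (\<integral>\<^sup>+x. liminf (\<lambda>m. ennreal ((norm (f (r m) x - f (r n) x))^2)) \<partial>M)"
  proof (rule nn_integral_cong_AE)
   show "AE x in M. ennreal ((norm (w x - f (r n) x))^2) = liminf (\<lambda>m. ennreal ((norm (f (r m) x - f (r n) x))^2))"
    using conv
   proof eventually_elim
    case (elim x)
    then have "(\<lambda>k. f (r k) x) \<longlonglongrightarrow> w x" unfolding w_def by (simp add: convergent_LIMSEQ_iff)
    then have "(\<lambda>m. ennreal ((norm (f (r m) x - f (r n) x))^2)) \<longlonglongrightarrow> ennreal ((norm (w x - f (r n) x))^2)"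
     by (intro tendsto_intros)
    from lim_imp_Liminf[OF trivial_limit_sequentially this] show ?case by (rule sym)
   qed
  qed
  also have "... \<le> liminf (\<lambda>m. \<integral>\<^sup>+x. ennreal ((norm (f (r m) x - f (r n) x))^2) \<partial>M)" by (rule nn_integral_liminf) measurable
  also have "... \<le> ennreal ((1 / 8) ^ n)"
  proof (rule Liminf_le)
   have "(\<integral>\<^sup>+x. ennreal ((norm (f (r m) x - f (r n) x))^2) \<partial>M) \<le> ennreal ((1 / 8) ^ n)" if "m \<ge> n" for m
    using rb[OF that, of n] by (subst nn_integral_eq_integral[OF id]) (auto simp: ennreal_leI)
   then show "\<forall>\<^sub>F m in sequentially. (\<integral>\<^sup>+x. ennreal ((norm (f (r m) x - f (r n) x))^2) \<partial>M) \<le> ennreal ((1 / 8) ^ n)"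
    by (auto simp: eventually_sequentially)
  qed simp
  finally show ?thesis .
 qed
 have iw: "integrable M (\<lambda>x. (norm (w x - f (r n) x))^2)" for n
  unfolding integrable_iff_bounded using le_less_trans[OF fatou[of n] ennreal_less_top] by simp
 have Iw: "(LINT x|M. (norm (w x - f (r n) x))^2) \<le> (1 / 8) ^ n" for n
  using fatou[of n] by (subst (asm) nn_integral_eq_integral[OF iw]) auto
 show ?thesis
 proof (rule that[of w r])
  show "w \<in> borel_measurable M" by (rule wm)
  show "r k \<ge> k" for k by (simp add: r_def)
  show "integrable M (\<lambda>x. (norm (w x - f (r k) x))^2)" for k by (rule iw)
  show "integrable M (\<lambda>x. (norm (w x))^2)"
  proof (rule L1_bound)
   show "integrable M (\<lambda>x. 2 * ((norm (w x - f (r 0) x))^2 + (norm (f (r 0) x))^2))" using iw i by auto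
   show "AE x in M. norm ((norm (w x))^2) \<le> norm (2 * ((norm (w x - f (r 0) x))^2 + (norm (f (r 0) x))^2))" (is "AE x in _. ?P x")
   proof (rule AE_I2)
    fix x show "?P x"
     using norm_add_square_le[of "w x - f (r 0) x" "f (r 0) x"] by simp
   qed
  qed measurable
  show "(\<lambda>k. LINT x|M. (norm (w x - f (r k) x))^2) \<longlonglongrightarrow> 0"
  proof (rule tendsto_sandwich[OF _ _ tendsto_const LIMSEQ_power_zero])
   show "\<forall>\<^sub>F k in sequentially. (LINT x|M. (norm (w x - f (r k) x))^2) \<le> (1 / 8) ^ k" using Iw by simp
   show "\<forall>\<^sub>F k in sequentially. 0 \<le> (LINT x|M. (norm (w x - f (r k) x))^2)" by (simp add: integral_nonneg_AE)
  qed simp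
 qed
qed

section \<open>Local vorticity\<close>

text \<open>Companion to \<open>abs_integral_product_le\<close>: as the weight is arbitrary, the
  fixed term with \<open>A\<close> is made small by a large \<open>\<mu>\<close> before
  \<open>d n\<close> tends to 0.\<close>

lemma tendsto_of_weighted_bound:
 fixes x :: "nat => real"
 assumes d: "d \<longlonglongrightarrow> 0" "\<And>n. d n \<ge> 0" and A: "A \<ge> 0"
  and b: "\<And>n \<mu>. \<mu> > 0 ==> \<bar>x n - l\<bar> \<le> (1 / (4 * \<mu>)) * A + \<mu> * d n"
 shows "x \<longlonglongrightarrow> l"
proof (rule LIMSEQ_I)
 fix e :: real assume e: "e > 0"
 define \<mu> where "\<mu> = (A + 1) / e"
 have \<mu>: "\<mu> > 0" using A e by (simp add: \<mu>_def)
 have "(1 / (4 * \<mu>)) * A < e / 2" using A e by (simp add: \<mu>_def field_simps add_pos_nonneg)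
 moreover have "eventually (\<lambda>n. d n < e / (2 * \<mu>)) sequentially" using d(1) e \<mu> by (intro order_tendstoD(2)) auto
 then obtain N where N: "\<And>n. n \<ge> N ==> d n < e / (2 * \<mu>)" by (auto simp: eventually_sequentially)
 have "\<mu> * d n < e / 2" if "n \<ge> N" for n using N[OF that] \<mu> by (simp add: field_simps)
 ultimately have "\<bar>x n - l\<bar> < e" if "n \<ge> N" for n using b[OF \<mu>, of n] that by fastforce
 then show "\<exists>N. \<forall>n\<ge>N. norm (x n - l) < e" by auto
qed

lemma compact_subset_ball:
 assumes "compact S" "S \<subseteq> ball x0 R" "0 < R"
 obtains r where "0 < r" "r < R" "S \<subseteq> cball x0 r"
proof (cases "S = {}")
 case True
 then show ?thesis using that[of "R / 2"] assms by auto
next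
 case False
 obtain y where y: "y \<in> S" "\<And>z. z \<in> S ==> dist x0 z \<le> dist x0 y"
  using continuous_attains_sup[OF assms(1) False, of "dist x0"] continuous_on_dist[OF continuous_on_const continuous_on_id, of S x0] by auto
 have "dist x0 y < R" using y(1) assms(2) by auto
 moreover have "S \<subseteq> cball x0 ((dist x0 y + R) / 2)" using y(2) \<open>dist x0 y < R\<close> by fastforce
 moreover have "0 < (dist x0 y + R) / 2" using assms(3) zero_le_dist[of x0 y] by (simp add: add_nonneg_pos)
 ultimately show ?thesis using that[of "(dist x0 y + R) / 2"] by auto
qed

section \<open>Fourier truncation of test fields\<close>

context box3 begin

text \<open>Integration by parts, without boundary terms because \<open>h\<close> has compact
  support.\<close>

lemma Fourier_coefficients_pd:
 fixes h :: "R3 => 'b::euclidean_space"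
 assumes h: "smooth h" "\<And>x. x \<notin> cball x0 r ==> h x = 0"
 shows "Ac (pd i h) k = k $ i *\<^sub>R As h k" (is ?G1) "As (pd i h) k = - (k $ i *\<^sub>R Ac h k)" (is ?G2)
proof -
 have pd0: "pd i h x = 0" if "x \<notin> cball x0 r" for x by (rule partial_deriv_zero_outside[OF compact_cball h(2) that])
 have ih: "L1 h" by (rule integrable_compact_support[OF smooth_continuous[OF h(1)] compact_cball h(2)])
 have ip: "L1 (pd i h)" by (rule integrable_compact_support[OF smooth_continuous[OF smooth_partial[OF h(1)]] compact_cball pd0])
 have key: "(LBINT x. cos (k \<bullet> x) * (pd i h x \<bullet> b)) = k $ i * (LBINT x. sin (k \<bullet> x) * (h x \<bullet> b)) \<and>
  (LBINT x. sin (k \<bullet> x) * (pd i h x \<bullet> b)) = - (k $ i * (LBINT x. cos (k \<bullet> x) * (h x \<bullet> b)))" for b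
 proof -
  have sb: "smooth (cmp h b)" by (intro smooth_inner smooth_const h(1))
  have ibh: "L1 (cmp h b)" and ibp: "L1 (\<lambda>x. pd i h x \<bullet> b)" using ih ip by auto
  note ic = integrable_cos_sin[OF ibh, of k] integrable_cos_sin[OF ibp, of k]
  have z: "(LBINT x. T {k} (\<lambda>_. p) (\<lambda>_. q) x * (pd i h x \<bullet> b) + pd i (T {k} (\<lambda>_. p) (\<lambda>_. q)) x * (h x \<bullet> b)) = 0" for p q :: real
  proof -
   have "integral\<^sup>L lborel (pd i (\<lambda>x. T {k} (\<lambda>_. p) (\<lambda>_. q) x * (h x \<bullet> b))) = 0"
    by (rule integral_partial_deriv[of _ "cball x0 r"]) (auto intro!: smooth_mult smooth_T sb simp: h(2))
   moreover have "pd i (\<lambda>x. T {k} (\<lambda>_. p) (\<lambda>_. q) x * (h x \<bullet> b)) = (\<lambda>x. T {k} (\<lambda>_. p) (\<lambda>_. q) x * (pd i h x \<bullet> b) + pd i (T {k} (\<lambda>_. p) (\<lambda>_. q)) x * (h x \<bullet> b))"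
    by (rule ext) (simp only: pd_mult[OF smooth_T sb] partial_deriv_inner_const[OF h(1)])
   ultimately show ?thesis by simp
  qed
  have "(LBINT x. cos (k \<bullet> x) * (pd i h x \<bullet> b) - k $ i * (sin (k \<bullet> x) * (h x \<bullet> b))) = 0"
   using z[of 1 0] by (simp add: pd_T T_def algebra_simps)
  moreover have "(LBINT x. sin (k \<bullet> x) * (pd i h x \<bullet> b) + k $ i * (cos (k \<bullet> x) * (h x \<bullet> b))) = 0"
   using z[of 0 1] by (simp add: pd_T T_def algebra_simps)
  ultimately show ?thesis using ic by (simp add: LINT_diff LINT_add)
 qed
 show ?G1
 proof (rule euclidean_eqI)
  fix b show "(Ac (pd i h) k) \<bullet> b = (k $ i *\<^sub>R As h k) \<bullet> b"
   unfolding inner_scaleR_left inner_minus_left Ac_inner[OF ip] Ac_inner[OF ih] unfolding Ac_def As_def using key[of b] by simp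
 qed
 show ?G2
 proof (rule euclidean_eqI)
  fix b show "(As (pd i h) k) \<bullet> b = (- (k $ i *\<^sub>R Ac h k)) \<bullet> b"
   unfolding inner_scaleR_left inner_minus_left Ac_inner[OF ip] Ac_inner[OF ih] unfolding Ac_def As_def using key[of b] by simp
 qed
qed

text \<open>Differentiation commutes with Fourier truncation, so that the derivative of a truncation
  error is the truncation error of the derivative.\<close>

lemma pd_T_coefficients:
 assumes "smooth h" "\<And>x. x \<notin> cball x0 r ==> h x = 0"
 shows "pd i (T F (Ac h) (As h)) = T F (Ac (pd i h)) (As (pd i h))"
proof -
 have "Ac (pd i h) = (\<lambda>k. k $ i *\<^sub>R As h k)" "As (pd i h) = (\<lambda>k. - (k $ i *\<^sub>R Ac h k))"
  by (rule ext, rule Fourier_coefficients_pd[OF assms(1)], rule assms(2), assumption)+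
 then show ?thesis unfolding pd_T by simp
qed

lemma inL2_smooth:
 fixes h :: "R3 => 'b::euclidean_space"
 assumes "smooth h" "\<And>x. x \<notin> cball x0 r ==> h x = 0" "r < R"
 shows "inL2 h"
proof -
 have "L1 (\<lambda>x. (norm (h x))^2)"
  by (rule integrable_compact_support[OF _ compact_cball[of x0 r]])
   (use assms(2) smooth_continuous[OF assms(1)] in \<open>auto intro!: continuous_on_power continuous_on_norm\<close>)
 moreover have "h x = 0" if "x \<notin> cube" for x using assms(2)[of x] that cball_subset_cube[OF assms(3)] by blast
 ultimately show ?thesis using borel_measurable_smooth[OF assms(1)] by (simp add: inL2_def)
qed

lemma integral_norm_square_le:
 fixes h :: "R3 => 'b::euclidean_space"
 assumes "inL2 h" "\<And>x. norm (h x) \<le> M"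
 shows "(LBINT x. (norm (h x))^2) \<le> M^2 * vol"
proof -
 have "L1 (ind cube :: R3 => real)" using cube_measurable emeasure_cube by (intro integrable_real_indicator) auto
 from integrable_mult_right[OF this, of "M^2"] have "(LBINT x. (norm (h x))^2) \<le> (LBINT x. M^2 * ind cube x)"
  by (intro integral_mono) (use assms in \<open>auto simp: inL2_def indicator_def intro!: power_mono\<close>)
 also have "... = M^2 * vol" by (simp add: vol_def)
 finally show ?thesis .
qed

end

context ns_sol begin

text \<open>The squared H^1 norm of the truncation error on the cube.\<close>

definition "err h F = (\<Sum>k\<in>UNIV. LBINT x. (norm (resid (pd k h) F x))^2) + (LBINT x. (norm (resid h F x))^2)"

lemma err_nonneg: "err h F \<ge> 0" unfolding err_def by (intro add_nonneg_nonneg sum_nonneg integral_nonneg_AE) auto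

text \<open>\<open>ell\<close> sees its test field only through values and first derivatives, so the
  difference is controlled by the norm of \<open>f\<close> and the H^1 error. The 4 comes from
  squaring a sum of four terms.\<close>

lemma ell_truncation:
 assumes f: "adm f" and M: "bnd M" and F: "finite F" "F \<subseteq> lat" and \<mu>: "\<mu> > 0"
  and h: "smooth h" "\<And>x. x \<notin> cball x0 r ==> h x = 0" "r < R"
 shows "\<bar>ell f (\<lambda>x. ch x *\<^sub>R T F (Ac h) (As h) x) - ell f (\<lambda>x. ch x *\<^sub>R h x)\<bar> \<le> (1 / (4 * \<mu>)) * (M * rho f) + \<mu> * (4 * M * err h F)"
proof -
 define g where "g = T F (Ac h) (As h)"
 have sg: "smooth g" unfolding g_def by (rule smooth_T)
 have ph: "smooth (pd k h)" "\<And>x. x \<notin> cball x0 r ==> pd k h x = 0" for k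
  using smooth_partial[OF h(1)] partial_deriv_zero_outside[OF compact_cball h(2)] by auto
 have hsh: "hs (\<lambda>x. ch x *\<^sub>R h x)" "hs (\<lambda>x. ch x *\<^sub>R g x)" using ch h(1) sg by (auto simp: hs_def intro!: smooth_scaleR)
 note i1 = integrable_inner_hs(1)[OF f hs_curlv[OF hsh(1)]] and i2 = integrable_inner_hs(1)[OF f hs_curlv[OF hsh(2)]]
 have pg: "pd k g = T F (Ac (pd k h)) (As (pd k h))" for k
  unfolding g_def by (rule pd_T_coefficients[OF h(1)]) (rule h(2))
 define y where "y x = f x \<bullet> curlv (\<lambda>x. ch x *\<^sub>R g x) x - f x \<bullet> curlv (\<lambda>x. ch x *\<^sub>R h x) x" for x
 define u where "u x = (\<Sum>k\<in>UNIV. norm (resid (pd k h) F x)) + norm (resid h F x)" for x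
 have M1: "M \<ge> 0" using bndD(1)[OF M] by simp
 have e: "ell f (\<lambda>x. ch x *\<^sub>R T F (Ac h) (As h) x) - ell f (\<lambda>x. ch x *\<^sub>R h x) = (LBINT x. y x)"
  unfolding ell_def y_def g_def[symmetric] by (rule LINT_diff[OF i2 i1, symmetric])
 have iy: "L1 y" unfolding y_def by (rule L1_diff[OF i2 i1])
 have b: "\<bar>y x\<bar> \<le> M * (norm (f x) * u x)" for x
 proof (cases "x \<in> cube")
  case False
  then show ?thesis using M1 by (simp add: y_def curlv_scaleR[OF ch(1) sg] curlv_scaleR[OF ch(1) h(1)] ch0 cross_zero_left u_def sum_nonneg)
 next
  case True
  have rk: "resid (pd k h) F x = pd k h x - pd k g x" for k
   using True by (simp add: resid_def pg)
  have r0: "resid h F x = h x - g x" using True by (simp add: resid_def g_def)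
  have "curlv h x - curlv g x = (\<Sum>k\<in>UNIV. cross3 (axis k 1) (resid (pd k h) F x))"
   unfolding curlv_def rk by (simp add: cross_diff_right sum_subtractf)
  also have "norm \<dots> \<le> (\<Sum>k\<in>UNIV. norm (resid (pd k h) F x))"
   by (rule sum_norm_le) (rule order_trans[OF norm_cross3_le], simp add: norm_axis_1)
  finally have c: "norm (curlv h x - curlv g x) \<le> (\<Sum>k\<in>UNIV. norm (resid (pd k h) F x))" .
  have "y x = - (f x \<bullet> (cross3 (grd ch x) (resid h F x) + ch x *\<^sub>R (curlv h x - curlv g x)))"
   unfolding y_def curlv_scaleR[OF ch(1) sg] curlv_scaleR[OF ch(1) h(1)] r0 by (simp add: cross_diff_right algebra_simps)
  then have yb: "\<bar>y x\<bar> \<le> norm (f x) * norm (cross3 (grd ch x) (resid h F x) + ch x *\<^sub>R (curlv h x - curlv g x))"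
   using Cauchy_Schwarz_ineq2[of "f x" "cross3 (grd ch x) (resid h F x) + ch x *\<^sub>R (curlv h x - curlv g x)"] by (simp only: abs_minus_cancel)
  have "norm (cross3 (grd ch x) (resid h F x) + ch x *\<^sub>R (curlv h x - curlv g x)) \<le> M * norm (resid h F x) + M * (\<Sum>k\<in>UNIV. norm (resid (pd k h) F x))"
  proof (rule order_trans[OF norm_triangle_ineq], rule add_mono)
   show "norm (cross3 (grd ch x) (resid h F x)) \<le> M * norm (resid h F x)"
    by (rule order_trans[OF norm_cross3_le]) (intro mult_right_mono bndD(3)[OF M] norm_ge_zero)
   show "norm (ch x *\<^sub>R (curlv h x - curlv g x)) \<le> M * (\<Sum>k\<in>UNIV. norm (resid (pd k h) F x))"
    unfolding norm_scaleR by (intro mult_mono bndD(2)[OF M] c M1 norm_ge_zero)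
  qed
  from order_trans[OF yb mult_left_mono[OF this norm_ge_zero]] show ?thesis by (simp add: u_def algebra_simps)
 qed
 have L2: "inL2 (resid h F)" "inL2 (resid (pd k h) F)" for k
 proof -
  show "inL2 (resid h F)" by (rule inL2_resid, rule inL2_smooth[OF h(1) _ h(3)], rule h(2))
  show "inL2 (resid (pd k h) F)" by (rule inL2_resid, rule inL2_smooth[OF ph(1) _ h(3)], rule ph(2))
 qed
 have iL: "L1 (\<lambda>x. (norm (resid h F x))^2)" "L1 (\<lambda>x. (norm (resid (pd k h) F x))^2)" for k
  using L2(1) L2(2)[of k] by (auto simp: inL2_def)
 have mL: "Borel (resid h F)" "Borel (resid (pd k h) F)" for k
  using L2(1) L2(2)[of k] by (auto simp: inL2_def)
 note [measurable] = mL
 have u2: "(u x)^2 \<le> 4 * ((\<Sum>k\<in>UNIV. (norm (resid (pd k h) F x))^2) + (norm (resid h F x))^2)" for x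
 proof -
  have q: "(a + b + c + d)^2 \<le> 4 * (a^2 + b^2 + c^2 + d^2)" for a b c d :: real
   using zero_le_power2[of "a - b"] zero_le_power2[of "a - c"] zero_le_power2[of "a - d"] zero_le_power2[of "b - c"] zero_le_power2[of "b - d"] zero_le_power2[of "c - d"]
   by (simp add: power2_eq_square algebra_simps)
  show ?thesis unfolding u_def sum_3 by (rule q)
 qed
 have ib: "L1 (\<lambda>x. 4 * ((\<Sum>k\<in>UNIV. (norm (resid (pd k h) F x))^2) + (norm (resid h F x))^2))"
  by (intro integrable_mult_right L1_add L1_sum iL)
 have um: "Borel u" unfolding u_def by measurable
 have iu: "L1 (\<lambda>x. (u x)^2)"
 proof (rule L1_bound[OF ib])
  show "AE x in lborel. norm ((u x)^2) \<le> norm (4 * ((\<Sum>k\<in>UNIV. (norm (resid (pd k h) F x))^2) + (norm (resid h F x))^2))"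
   by (intro AE_I2) (use u2 in \<open>simp add: order_trans[OF _ abs_ge_self]\<close>)
 qed (use um in simp)
 have Iu: "(LBINT x. (u x)^2) \<le> 4 * err h F"
 proof -
  have "(LBINT x. (u x)^2) \<le> (LBINT x. 4 * ((\<Sum>k\<in>UNIV. (norm (resid (pd k h) F x))^2) + (norm (resid h F x))^2))"
   by (rule integral_mono[OF iu ib u2])
  also have "... = 4 * err h F" unfolding err_def using iL by (simp add: LINT_add LINT_sum L1_sum)
  finally show ?thesis .
 qed
 have "\<bar>LBINT x. y x\<bar> \<le> M * ((1 / (4 * \<mu>)) * (LBINT x. (norm (f x))^2) + \<mu> * (LBINT x. (u x)^2))"
  by (rule abs_integral_product_le(2)[OF _ b M1 \<mu> admD(2)[OF f] iu]) (use iy in auto)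
 also have "... \<le> M * ((1 / (4 * \<mu>)) * rho f + \<mu> * (4 * err h F))"
  unfolding rho_def using \<mu> by (intro mult_left_mono add_left_mono Iu M1) auto
 finally show ?thesis unfolding e by (simp add: algebra_simps)
qed

lemma err_tendsto:
 assumes h: "smooth h" "\<And>x. x \<notin> cball x0 r ==> h x = 0" "r < R"
 shows "(\<lambda>n. err h (Fn n)) \<longlonglongrightarrow> 0"
proof -
 have ph: "smooth (pd k h)" "\<And>x. x \<notin> cball x0 r ==> pd k h x = 0" for k
  using smooth_partial[OF h(1)] partial_deriv_zero_outside[OF compact_cball h(2)] by auto
 have "(\<lambda>n. err h (Fn n)) \<longlonglongrightarrow> (\<Sum>k\<in>(UNIV :: 3 set). 0) + 0"
  unfolding err_def by (intro tendsto_add tendsto_sum resid_tendsto[OF inL2_smooth[OF h] h(2,3)] resid_tendsto[OF inL2_smooth[OF ph h(3)] ph(2) h(3)])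
 then show ?thesis by simp
qed

lemma err_le:
 assumes h: "smooth h" "\<And>x. x \<notin> cball x0 r ==> h x = 0" "r < R" and F: "finite F" "F \<subseteq> lat"
  and b: "\<And>x. norm (h x) \<le> M" "\<And>k x. norm (pd k h x) \<le> M"
 shows "err h F \<le> 4 * (M^2 * vol)"
proof -
 have ph: "smooth (pd k h)" "\<And>x. x \<notin> cball x0 r ==> pd k h x = 0" for k
  using smooth_partial[OF h(1)] partial_deriv_zero_outside[OF compact_cball h(2)] by auto
 have "err h F \<le> (\<Sum>k\<in>(UNIV :: 3 set). M^2 * vol) + M^2 * vol"
  unfolding err_def
  by (intro add_mono sum_mono order_trans[OF resid_bound[OF F]] inL2_smooth[OF h] inL2_smooth[OF ph h(3)] integral_norm_square_le b)
 then show ?thesis by (simp add: mult.commute)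
qed

end

section \<open>Slices in time and the limit of the Fourier sums\<close>

lemma smooth_slice:
 fixes \<phi> :: "R3 \<times> real => 'b::euclidean_space"
 assumes "smooth \<phi>"
 shows "smooth (\<lambda>x. \<phi> (x, t))"
proof -
 have "bounded_linear (\<lambda>x :: R3. (x, 0 :: real))" by (intro bounded_linear_Pair bounded_linear_ident bounded_linear_zero)
 from smooth_comp_affine[OF this assms, of "(0, t)"] show ?thesis by simp
qed

lemma pd_slice:
 fixes \<phi> :: "R3 \<times> real => 'b::euclidean_space"
 assumes "smooth \<phi>"
 shows "pd k (\<lambda>x. \<phi> (x, t)) x = dx k \<phi> (x, t)"
proof -
 have "((\<lambda>x :: R3. (x, t)) has_derivative (\<lambda>v. (v, 0))) (at x)" by (intro derivative_eq_intros) auto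
 from has_derivative_compose[OF this smooth_has_derivative[OF assms]]
 show ?thesis unfolding dx_def by (simp add: partial_deriv_eq)
qed

lemma curlv_component: "curlv h x = vector [pd 2 h x $ 3 - pd 3 h x $ 2, pd 3 h x $ 1 - pd 1 h x $ 3, pd 1 h x $ 2 - pd 2 h x $ 1]"
 by (simp add: curlv_def sum_3 cross3_def vec_eq_iff forall_3 axis_def)

lemma curl_x_slice: "smooth \<phi> ==> curl_x \<phi> (x, t) = curlv (\<lambda>x. \<phi> (x, t)) x"
 by (simp add: curl_x_def curlv_component pd_slice)

lemma LINT_slices:
 fixes P :: "R3 \<times> real => real"
 assumes [measurable]: "Borel P" and P: "\<And>z. P z \<ge> 0"
  and i: "AE t in lborel. L1 (\<lambda>x. P (x, t)) \<and> (LBINT x. P (x, t)) \<le> b t" and b: "L1 b"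
 shows "L1 P" "integral\<^sup>L lborel P \<le> integral\<^sup>L lborel b" (is ?G1)
proof -
 have b0: "AE t in lborel. 0 \<le> b t"
  using i
 proof eventually_elim
  case (elim t)
  have "0 \<le> (LBINT x. P (x, t))" by (rule integral_nonneg_AE) (simp add: P)
  then show ?case using elim by linarith
 qed
 have "(\<integral>\<^sup>+z. ennreal (P z) \<partial>lborel) = (\<integral>\<^sup>+z. ennreal (P z) \<partial>lborel2)" by (simp add: lborel_prod)
 also have "... = (\<integral>\<^sup>+t. (\<integral>\<^sup>+x. ennreal (P (x, t)) \<partial>lborel) \<partial>lborel)"
  by (rule lborel_pair.nn_integral_snd[symmetric]) (simp add: lborel_prod)
 also have "... \<le> (\<integral>\<^sup>+t. ennreal (b t) \<partial>lborel)"
 proof (rule nn_integral_mono_AE)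
  show "AE t in lborel. (\<integral>\<^sup>+x. ennreal (P (x, t)) \<partial>lborel) \<le> ennreal (b t)"
   using i by eventually_elim (use P in \<open>simp add: nn_integral_eq_integral ennreal_leI\<close>)
 qed
 also have "... = ennreal (integral\<^sup>L lborel b)"
 proof (rule nn_integral_eq_integral[OF b])
  show "AE t in lborel. 0 \<le> b t" by (rule b0)
 qed
 finally have le: "(\<integral>\<^sup>+z. ennreal (P z) \<partial>lborel) \<le> ennreal (integral\<^sup>L lborel b)" .
 show ip: "L1 P"
  unfolding integrable_iff_bounded using P le_less_trans[OF le ennreal_less_top] by simp
 have "integral\<^sup>L lborel b \<ge> 0"
 proof (rule integral_nonneg_AE)
  show "AE t in lborel. 0 \<le> b t" by (rule b0)
 qed
 then show ?G1 using le P by (simp add: nn_integral_eq_integral[OF ip])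
qed

context ns_sol begin

lemma W_measurable [measurable]: "Borel (\<lambda>t. Wc (vt t) k)" "Borel (\<lambda>t. Ws (vt t) k)"
proof -
 have [measurable]: "Borel (grd ch)"
  by (rule borel_measurable_continuous_onI[OF smooth_continuous[OF smooth_grd[OF ch(1)]]])
 note [measurable (raw)] = measurable_cross3
 show "Borel (\<lambda>t. Wc (vt t) k)" "Borel (\<lambda>t. Ws (vt t) k)"
  unfolding Wc_def Ws_def cf_def[abs_def] g1_def[abs_def] Ac_def As_def by measurable
qed

text \<open>A partial Fourier sum of the localized vorticity, restricted to the time set
  \<open>I\<close> and to the cube.\<close>

definition "wF I F z = ind I (snd z) *\<^sub>R (ind cube (fst z) *\<^sub>R T F (Wc (vt (snd z))) (Ws (vt (snd z))) (fst z))"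

lemma wF_measurable:
 assumes [measurable]: "I \<in> sets borel"
 shows "Borel (wF I F)"
proof -
 note [measurable] = measurable_compose[OF measurable_snd W_measurable(1)] measurable_compose[OF measurable_snd W_measurable(2)]
 have [measurable]: "cube \<in> sets borel" by (rule cube_measurable)
 have "wF I F \<in> borel_measurable (borel \<Otimes>\<^sub>M borel)" unfolding wF_def[abs_def] T_def by measurable
 then show ?thesis by (simp add: borel_prod)
qed

text \<open>\<open>T_L2\<close> bounds the space integral by the coefficients at each time, and
  Tonelli combines the times.\<close>

lemma wF_L2:
 assumes I: "I \<in> sets borel" and F: "finite F" "F \<subseteq> lat" and i: "L1 (\<lambda>t. ind I t * (zs F (vt t)))"
 shows "L1 (\<lambda>z. (norm (wF I F z))^2)"
  "(LBINT z. (norm (wF I F z))^2) \<le> vol * (LBINT t. ind I t * (zs F (vt t)))" (is ?G1)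
proof -
 note [measurable] = wF_measurable[OF I]
 have e: "(norm (wF I F (x, t)))^2 = ind I t * (ind cube x * (norm (T F (Wc (vt t)) (Ws (vt t)) x))^2)" for x t
  by (simp add: wF_def indicator_def)
 have b: "AE t in lborel. L1 (\<lambda>x. (norm (wF I F (x, t)))^2) \<and> (LBINT x. (norm (wF I F (x, t)))^2) \<le> vol * (ind I t * (zs F (vt t)))"
 proof (rule AE_I2, rule conjI)
  fix t
  show "L1 (\<lambda>x. (norm (wF I F (x, t)))^2)" unfolding e by (intro integrable_mult_right integrable_cube_T)
  show "(LBINT x. (norm (wF I F (x, t)))^2) \<le> vol * (ind I t * (zs F (vt t)))"
   unfolding e using T_L2[OF F, of "Wc (vt t)" "Ws (vt t)"] by (simp add: zz_def indicator_def)
 qed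
 have iv: "L1 (\<lambda>t. vol * (ind I t * (zs F (vt t))))" by (rule integrable_mult_right[OF i])
 note S = LINT_slices[OF _ _ b iv]
 show "L1 (\<lambda>z. (norm (wF I F z))^2)" by (rule S(1)) simp_all
 show ?G1
  using S(2) by simp
qed

lemma test_pairing:
 assumes \<phi>: "\<phi> \<in> test_functions (cyl x0 R Tm)"
 shows "L1 (\<lambda>t. ell (vt t) (\<lambda>x. ch x *\<^sub>R \<phi> (x, t)))" (is ?G1)
  "(LBINT z. v z \<bullet> curl_x (\<lambda>z. ch (fst z) *\<^sub>R \<phi> z) z) = (LBINT t. ell (vt t) (\<lambda>x. ch x *\<^sub>R \<phi> (x, t)))" (is ?G2)
proof -
 obtain L where L: "smooth \<phi>" "compact L" "L \<subseteq> cyl x0 R Tm" "\<And>z. z \<notin> L ==> \<phi> z = 0" using test_functionsD[OF \<phi>] by metis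
 define \<psi> where "\<psi> z = ch (fst z) *\<^sub>R \<phi> z" for z
 have s\<psi>: "smooth \<psi>" unfolding \<psi>_def[abs_def]
  using smooth_scaleR[OF smooth_comp_affine[OF bounded_linear_fst ch(1), of 0] L(1)] by simp
 have \<psi>0: "\<psi> z = 0" if "z \<notin> L" for z using L(4)[OF that] by (simp add: \<psi>_def)
 have dx0: "dx k \<psi> z = 0" if "z \<notin> L" for k z unfolding dx_def by (rule partial_deriv_zero_outside[OF L(2) \<psi>0 that])
 have c0: "curl_x \<psi> z = 0" if "z \<notin> L" for z using dx0[OF that] by (simp add: curl_x_def vec_eq_iff forall_3)
 have cc: "continuous_on UNIV (curl_x \<psi>)"
 proof -
  have "smooth (dx k \<psi>)" for k unfolding dx_def by (rule smooth_partial[OF s\<psi>])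
  then have "smooth (\<lambda>z. \<Sum>k\<in>UNIV. cross3 (axis k 1) (dx k \<psi> z))" by (intro smooth_sum smooth_cross3 smooth_const)
  moreover have "(\<lambda>z. \<Sum>k\<in>UNIV. cross3 (axis k 1) (dx k \<psi> z)) = curl_x \<psi>"
   by (simp add: fun_eq_iff curl_x_def sum_3 cross3_def vec_eq_iff forall_3 axis_def)
  ultimately show ?thesis using smooth_continuous by metis
 qed
 obtain M where M: "\<And>z. norm (curl_x \<psi> z) \<le> M" using bounded_compact_support[OF cc L(2) c0] by blast
 have [measurable]: "Borel (curl_x \<psi>)" by (rule borel_measurable_continuous_onI[OF cc])
 have M0: "M \<ge> 0" using order_trans[OF norm_ge_zero M] .
 have i: "L1 (\<lambda>z. v z \<bullet> curl_x \<psi> z)"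
 proof (rule L1_bound[OF integrable_mult_left[OF integrable_norm[OF integrable_v], of M]])
  show "AE z in lborel. norm (v z \<bullet> curl_x \<psi> z) \<le> norm (norm (v z) * M)" (is "AE z in _. ?P z")
  proof (rule AE_I2)
   fix z show "?P z"
    using order_trans[OF Cauchy_Schwarz_ineq2 mult_left_mono[OF M norm_ge_zero], of "v z" z] M0 by (simp add: abs_mult)
  qed
 qed simp
 have e: "(LBINT x. v (x, t) \<bullet> curl_x \<psi> (x, t)) = ell (vt t) (\<lambda>x. ch x *\<^sub>R \<phi> (x, t))" for t
  unfolding ell_def curl_x_slice[OF s\<psi>] by (simp add: \<psi>_def)
 have one: "Borel (\<lambda>_. 1)" "\<And>t :: real. \<bar>1 :: real\<bar> \<le> 1" by auto
 note S = slice[OF i one(1)]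
 show ?G1 using S(1)[of 1] by (simp add: e)
 show ?G2
  using S(3)[of 1] by (simp add: e \<psi>_def[abs_def, symmetric])
qed

text \<open>The truncation is moved from the vorticity to the test field. The truncated test field
  converges in H^1 at each time, and the convergence is dominated by an integrable function of
  time.\<close>

lemma wF_pairing_tendsto:
 assumes \<phi>: "\<phi> \<in> test_functions (ball x0 R \<times> {a<..<b})" and ab: "0 < a" "a < b" "b < Tm"
  and i: "\<And>n. L1 (\<lambda>z. wF {a<..b} (Fn n) z \<bullet> \<phi> z)"
 shows "(\<lambda>n. LBINT z. wF {a<..b} (Fn n) z \<bullet> \<phi> z) \<longlonglongrightarrow> (LBINT z. v z \<bullet> curl_x (\<lambda>z. ch (fst z) *\<^sub>R \<phi> z) z)"
proof -
 obtain M where M: "bnd M" using ex_bnd by blast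
 have M1: "M \<ge> 0" using bndD(1)[OF M] by simp
 obtain L where L: "smooth \<phi>" "compact L" "L \<subseteq> ball x0 R \<times> {a<..<b}" "\<And>z. z \<notin> L ==> \<phi> z = 0" using test_functionsD[OF \<phi>] by metis
 have "L \<subseteq> cyl x0 R Tm" using L(3) ab by fastforce
 then have \<phi>': "\<phi> \<in> test_functions (cyl x0 R Tm)" using L by (intro test_functionsI[of _ L]) auto
 have "compact (fst ` L)" by (intro compact_continuous_image continuous_intros L(2))
 moreover have "fst ` L \<subseteq> ball x0 R" using L(3) by auto
 ultimately obtain rr where rr: "0 < rr" "rr < R" "fst ` L \<subseteq> cball x0 rr" using R by (rule compact_subset_ball)
 define h where "h t = (\<lambda>x. \<phi> (x, t))" for t
 have sh: "smooth (h t)" for t unfolding h_def by (rule smooth_slice[OF L(1)])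
 have h0: "h t x = 0" if "x \<notin> cball x0 rr" for t x
 proof -
  have "(x, t) \<notin> L" using that rr(3) by force
  then show ?thesis unfolding h_def by (rule L(4))
 qed
 have ht0: "h t = (\<lambda>x. 0)" if "t \<notin> {a<..<b}" for t
 proof
  fix x have "(x, t) \<notin> L" using that L(3) by auto
  then show "h t x = 0" unfolding h_def by (rule L(4))
 qed
 have hL2: "inL2 (h t)" for t by (rule inL2_smooth[OF sh _ rr(2)]) (rule h0)
 obtain B0 where B0: "\<And>z. norm (\<phi> z) \<le> B0" using bounded_compact_support[OF smooth_continuous[OF L(1)] L(2,4)] by blast
 have dx0: "dx k \<phi> z = 0" if "z \<notin> L" for k z unfolding dx_def by (rule partial_deriv_zero_outside[OF L(2,4) that])
 have sdx: "smooth (dx k \<phi>)" for k unfolding dx_def by (rule smooth_partial[OF L(1)])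
 have "\<exists>B. \<forall>z. norm (dx k \<phi> z) \<le> B" for k by (rule bounded_compact_support[OF smooth_continuous[OF sdx] L(2) dx0])
 then obtain B1 where B1: "\<And>k z. norm (dx k \<phi> z) \<le> B1 k" by metis
 define B where "B = B0 + (\<Sum>k\<in>UNIV. B1 k)"
 have B1': "B1 k \<ge> 0" "B0 \<ge> 0" for k using order_trans[OF norm_ge_zero B1] order_trans[OF norm_ge_zero B0] by auto
 have Bh: "norm (h t x) \<le> B" "norm (pd k (h t) x) \<le> B" for t k x
 proof -
  have "B1 k \<le> (\<Sum>k\<in>UNIV. B1 k)" using B1' by (intro member_le_sum) auto
  then show "norm (h t x) \<le> B" "norm (pd k (h t) x) \<le> B"
   using B0[of "(x, t)"] B1[of k "(x, t)"] sum_nonneg[of UNIV B1] B1' unfolding h_def pd_slice[OF L(1)] B_def by fastforce+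
 qed
 define q where "q n t = (LBINT x. wF {a<..b} (Fn n) (x, t) \<bullet> \<phi> (x, t))" for n t
 define l where "l t = ell (vt t) (\<lambda>x. ch x *\<^sub>R h t x)" for t
 have il: "L1 l" unfolding l_def[abs_def] h_def by (rule test_pairing(1)[OF \<phi>'])
 have one: "Borel (\<lambda>_. 1)" "\<And>t :: real. \<bar>1 :: real\<bar> \<le> 1" by auto
 have iq: "L1 (q n)" for n unfolding q_def[abs_def] by (rule slice(1)[OF i one(1), of 1]) simp
 have Iq: "(LBINT z. wF {a<..b} (Fn n) z \<bullet> \<phi> z) = integral\<^sup>L lborel (q n)" for n
  using slice(3)[OF i one(1), of 1 n] unfolding q_def[abs_def] by simp
 \<comment> \<open>Both sides are \<open>vol\<close> times the same sum of products of coefficients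
   of the vorticity and of the test field.\<close>
 have q_ell: "q n t = ell (vt t) (\<lambda>x. ch x *\<^sub>R T (Fn n) (Ac (h t)) (As (h t)) x)" if f: "adm (vt t)" for n t
 proof (cases "t \<in> {a<..<b}")
  case False
  have "q n t = 0" using fun_cong[OF ht0[OF False]] by (simp add: q_def h_def)
  moreover have "Ac (h t) = (\<lambda>\<xi>. 0)" "As (h t) = (\<lambda>\<xi>. 0)" unfolding ht0[OF False] by (simp_all add: Ac_def As_def fun_eq_iff)
  ultimately show ?thesis unfolding ell_T(2)[OF f] by simp
 next
  case True
  have "q n t = (LBINT x. T (Fn n) (Wc (vt t)) (Ws (vt t)) x \<bullet> h t x)"
   unfolding q_def
  proof (rule LINT_cong[OF refl])
   fix x
   have "x \<notin> cube ==> h t x = 0" using hL2[of t] by (simp add: inL2_def)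
   then show "wF {a<..b} (Fn n) (x, t) \<bullet> \<phi> (x, t) = T (Fn n) (Wc (vt t)) (Ws (vt t)) x \<bullet> h t x"
    using True by (cases "x \<in> cube") (auto simp: wF_def h_def)
  qed
  also have "... = vol * (\<Sum>\<xi>\<in>Fn n. Wc (vt t) \<xi> \<bullet> Ac (h t) \<xi> + Ws (vt t) \<xi> \<bullet> As (h t) \<xi>)"
   by (rule T_pair(2)[OF inL2_integrable[OF hL2]])
  finally show ?thesis unfolding ell_T(2)[OF f] by (simp add: inner_commute)
 qed
 have diff: "\<bar>q n t - l t\<bar> \<le> (1 / (4 * \<mu>)) * (M * rho (vt t)) + \<mu> * (4 * M * err (h t) (Fn n))" if f: "adm (vt t)" and \<mu>: "\<mu> > 0" for n t \<mu>
  unfolding q_ell[OF f] l_def by (rule ell_truncation[OF f M Fn(1,2) \<mu> sh _ rr(2)]) (rule h0)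
 have "(\<lambda>n. integral\<^sup>L lborel (q n)) \<longlonglongrightarrow> integral\<^sup>L lborel l"
 proof (rule integral_dominated_convergence)
  \<comment> \<open>Here \<open>diff\<close> is used with \<open>\<mu>\<close> = 1; the 16 is 4 from
    \<open>ell_truncation\<close> times 4 from \<open>err_le\<close>.\<close>
  show "L1 (\<lambda>t. \<bar>l t\<bar> + (1 / 4 * (M * rho (vt t)) + ind {a<..<b} t * (16 * M * (B^2 * vol))))"
   using il integrable_rho ab by (intro L1_add integrable_abs integrable_mult_right integrable_mult_left integrable_real_indicator) auto
  show "AE t in lborel. (\<lambda>n. q n t) \<longlonglongrightarrow> l t"
   using adm_AE
  proof eventually_elim
   case (elim t)
   have e0: "(\<lambda>n. err (h t) (Fn n)) \<longlonglongrightarrow> 0" by (rule err_tendsto[OF sh _ rr(2)]) (rule h0)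
   show ?case
   proof (rule tendsto_of_weighted_bound)
    show "(\<lambda>n. 4 * M * err (h t) (Fn n)) \<longlonglongrightarrow> 0" using tendsto_mult_left[OF e0, of "4 * M"] by simp
    show "0 \<le> 4 * M * err (h t) (Fn n)" for n by (intro mult_nonneg_nonneg err_nonneg) (use M1 in auto)
    show "0 \<le> M * rho (vt t)" using M1 rho_nonneg[of "vt t"] by simp
    show "\<bar>q n t - l t\<bar> \<le> (1 / (4 * \<mu>)) * (M * rho (vt t)) + \<mu> * (4 * M * err (h t) (Fn n))" if "\<mu> > 0" for n \<mu> by (rule diff[OF elim that])
   qed
  qed
  show "AE t in lborel. norm (q n t) \<le> \<bar>l t\<bar> + (1 / 4 * (M * rho (vt t)) + ind {a<..<b} t * (16 * M * (B^2 * vol)))" for n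
   using adm_AE
  proof eventually_elim
   case (elim t)
   have "4 * M * err (h t) (Fn n) \<le> ind {a<..<b} t * (16 * M * (B^2 * vol))"
   proof (cases "t \<in> {a<..<b}")
    case True
    have "err (h t) (Fn n) \<le> 4 * (B^2 * vol)" by (rule err_le[OF sh _ rr(2) Fn(1,2) Bh]) (rule h0)
    from mult_left_mono[OF this, of "4 * M"] show ?thesis using True M1 by (simp add: mult.assoc)
   next
    case False
    have "pd k (h t) = (\<lambda>x. 0)" for k unfolding ht0[OF False] by (rule ext) (rule partial_deriv_eq, rule has_derivative_const)
    then have "err (h t) (Fn n) = 0" unfolding err_def ht0[OF False] by (simp add: resid_def Ac_def As_def T_def)
    then show ?thesis using False by simp
   qed
   moreover have "\<bar>q n t - l t\<bar> \<le> 1 / 4 * (M * rho (vt t)) + 4 * M * err (h t) (Fn n)" using diff[OF elim zero_less_one, of n] by simp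
   ultimately show ?case unfolding real_norm_def by linarith
  qed
 qed (use il iq in auto)
 then show ?thesis unfolding Iq test_pairing(2)[OF \<phi>'] unfolding l_def[abs_def] h_def .
qed

text \<open>Coefficient sums over disjoint sets of modes add up, so by \<open>energy_bound\<close>
  their time integrals form an increasing bounded sequence. Hence the partial Fourier sums are
  Cauchy in L^2, and \<open>wF_pairing_tendsto\<close> identifies the limit with the localized
  curl.\<close>

theorem local_vorticity:
 assumes ab: "0 < a" "a < b" "b < Tm"
 obtains w where "Borel w" "L1 (\<lambda>z. (norm (w z))^2)"
  "\<And>\<phi>. \<phi> \<in> test_functions (ball x0 R \<times> {a<..<b}) ==>
   (LBINT z. v z \<bullet> curl_x (\<lambda>z. ch (fst z) *\<^sub>R \<phi> z) z) = (LBINT z. w z \<bullet> \<phi> z)"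
proof -
 obtain C where C: "\<And>F. finite F ==> F \<subseteq> lat ==> L1 (\<lambda>t. ind {a<..b} t * (zs F (vt t))) \<and>
  (LBINT t. ind {a<..b} t * (zs F (vt t))) \<le> C" by (rule energy_bound[OF ab]) blast
 define S where "S F = (LBINT t. ind {a<..b} t * (zs F (vt t)))" for F
 have SI: "{a<..b} \<in> sets borel" by simp
 have iS: "L1 (\<lambda>t. ind {a<..b} t * (zs F (vt t)))" if "finite F" "F \<subseteq> lat" for F using C[OF that] by blast
 have Sdiff: "S (Fn m - Fn n) = S (Fn m) - S (Fn n)" if "n \<le> m" for m n
 proof -
  have "S (Fn m - Fn n) + S (Fn n) = S (Fn m)"
  proof -
   have "(\<Sum>\<xi>\<in>Fn m. zz (vt t) \<xi>) = (\<Sum>\<xi>\<in>Fn m - Fn n. zz (vt t) \<xi>) + (\<Sum>\<xi>\<in>Fn n. zz (vt t) \<xi>)" for t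
    using sum.subset_diff[OF Fn(3)[OF that] Fn(1)] .
   then show ?thesis unfolding S_def using iS[of "Fn m - Fn n"] iS[of "Fn n"] Fn(1,2)
    by (subst LINT_add[symmetric]) (auto simp: distrib_left)
  qed
  then show ?thesis by simp
 qed
 have Snn: "S F \<ge> 0" for F unfolding S_def by (rule integral_nonneg_AE, rule AE_I2) (intro mult_nonneg_nonneg sum_nonneg zz_nonneg, simp)
 define f where "f n = wF {a<..b} (Fn n)" for n
 have fd: "f m z - f n z = wF {a<..b} (Fn m - Fn n) z" if "n \<le> m" for m n z
 proof -
  have "T (Fn m) p q x = T (Fn m - Fn n) p q x + T (Fn n) p q x" for p q :: "R3 => R3" and x
   unfolding T_def using sum.subset_diff[OF Fn(3)[OF that] Fn(1)] .
  then show ?thesis by (simp add: f_def wF_def scaleR_add_right)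
 qed
 have inc: "incseq (\<lambda>n. S (Fn n))"
 proof (rule monoI)
  fix m n :: nat assume "m \<le> n"
  from Sdiff[OF this] Snn[of "Fn n - Fn m"] show "S (Fn m) \<le> S (Fn n)" by simp
 qed
 have "Cauchy (\<lambda>n. S (Fn n))"
 proof -
  have "S (Fn n) \<le> C" for n using C[OF Fn(1,2)] unfolding S_def by blast
  then obtain l where "(\<lambda>n. S (Fn n)) \<longlonglongrightarrow> l" using incseq_convergent[OF inc] by blast
  then show ?thesis by (rule LIMSEQ_imp_Cauchy)
 qed
 note cau = this
 have main: "\<exists>N. \<forall>m\<ge>N. \<forall>n\<ge>N. (LBINT z. (norm (f m z - f n z))^2) < e" if e: "e > 0" for e
 proof -
  have "e / vol > 0" using e vol_pos by simp
  from metric_CauchyD[OF cau this] obtain N where N: "\<And>m n. m \<ge> N ==> n \<ge> N ==> \<bar>S (Fn m) - S (Fn n)\<bar> < e / vol" by (auto simp: dist_real_def)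
  have 1: "(LBINT z. (norm (f m z - f n z))^2) < e" if "n \<le> m" "N \<le> n" for m n
  proof -
   have "(LBINT z. (norm (f m z - f n z))^2) \<le> vol * S (Fn m - Fn n)"
    unfolding fd[OF that(1)] S_def using Fn(1,2) by (intro wF_L2(2)[OF SI] iS) auto
   also have "... < vol * (e / vol)" unfolding Sdiff[OF that(1)] using N[of m n] that vol_pos by (intro mult_strict_left_mono) auto
   finally show ?thesis using vol_pos by simp
  qed
  have "(LBINT z. (norm (f m z - f n z))^2) < e" if "N \<le> m" "N \<le> n" for m n
  proof (cases "n \<le> m")
   case False
   then show ?thesis using 1[of m n] that by (simp add: norm_minus_commute[of "f m _"])
  qed (use 1 that in auto)
  then show ?thesis by blast
 qed
 have fm: "Borel (f n)" and fi: "L1 (\<lambda>z. (norm (f n z))^2)" for n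
  unfolding f_def by (rule wF_measurable[OF SI]) (rule wF_L2(1)[OF SI Fn(1,2) iS[OF Fn(1,2)]])
 have fm': "f n \<in> borel_measurable lborel" for n using fm by simp
 show ?thesis
 proof (rule Riesz_Fischer[of f lborel, OF fm' fi])
  show "\<exists>N. \<forall>m\<ge>N. \<forall>n\<ge>N. (LBINT z. (norm (f m z - f n z))^2) < e" if "e > 0" for e by (rule main[OF that])
  fix w r assume w: "w \<in> borel_measurable lborel" "L1 (\<lambda>z. (norm (w z))^2)" "\<And>k :: nat. r k \<ge> k"
   "\<And>k. L1 (\<lambda>z. (norm (w z - f (r k) z))^2)" "(\<lambda>k. LBINT z. (norm (w z - f (r k) z))^2) \<longlonglongrightarrow> 0"
  have wm[measurable]: "Borel w" using w(1) by simp
  show ?thesis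
  proof (rule that[OF wm w(2)])
  fix \<phi> :: "R3 \<times> real => R3" assume \<phi>: "\<phi> \<in> test_functions (ball x0 R \<times> {a<..<b})"
  obtain L where L: "smooth \<phi>" "compact L" "\<And>z. z \<notin> L ==> \<phi> z = 0" using test_functionsD[OF \<phi>] by metis
  have [measurable]: "Borel \<phi>" by (rule borel_measurable_continuous_onI[OF smooth_continuous[OF L(1)]])
  note [measurable] = fm
  have i\<phi>: "L1 (\<lambda>z. (norm (\<phi> z))^2)"
   by (rule integrable_compact_support[OF _ L(2)]) (use L(3) smooth_continuous[OF L(1)] in \<open>auto intro!: continuous_on_power continuous_on_norm\<close>)
  have pair: "L1 (\<lambda>z. g z \<bullet> \<phi> z)" "\<And>\<mu>. \<mu> > 0 ==> \<bar>LBINT z. g z \<bullet> \<phi> z\<bar> \<le> (1 / (4 * \<mu>)) * (LBINT z. (norm (\<phi> z))^2) + \<mu> * (LBINT z. (norm (g z))^2)"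
   if [measurable]: "Borel g" and g: "L1 (\<lambda>z. (norm (g z))^2)" for g
  proof -
   have gm: "(\<lambda>z. g z \<bullet> \<phi> z) \<in> borel_measurable lborel" by measurable
   have b: "\<bar>g z \<bullet> \<phi> z\<bar> \<le> 1 * (norm (\<phi> z) * norm (g z))" for z using Cauchy_Schwarz_ineq2[of "g z" "\<phi> z"] by (simp add: mult.commute)
   show "L1 (\<lambda>z. g z \<bullet> \<phi> z)" using abs_integral_product_le(1)[OF gm b _ zero_less_one i\<phi> g] by simp
   show "\<bar>LBINT z. g z \<bullet> \<phi> z\<bar> \<le> (1 / (4 * \<mu>)) * (LBINT z. (norm (\<phi> z))^2) + \<mu> * (LBINT z. (norm (g z))^2)" if "\<mu> > 0" for \<mu>
    using abs_integral_product_le(2)[OF gm b _ that i\<phi> g] by simp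
  qed
  have lim: "(\<lambda>n. LBINT z. f n z \<bullet> \<phi> z) \<longlonglongrightarrow> (LBINT z. v z \<bullet> curl_x (\<lambda>z. ch (fst z) *\<^sub>R \<phi> z) z)"
   unfolding f_def by (rule wF_pairing_tendsto[OF \<phi> ab]) (rule pair(1)[OF fm fi, unfolded f_def])
  have "filterlim r at_top sequentially" using w(3) by (intro filterlim_at_top_mono[OF filterlim_ident]) auto
  from filterlim_compose[OF lim this] have l1: "(\<lambda>k. LBINT z. f (r k) z \<bullet> \<phi> z) \<longlonglongrightarrow> (LBINT z. v z \<bullet> curl_x (\<lambda>z. ch (fst z) *\<^sub>R \<phi> z) z)" .
  have l2: "(\<lambda>k. LBINT z. f (r k) z \<bullet> \<phi> z) \<longlonglongrightarrow> (LBINT z. w z \<bullet> \<phi> z)"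
  proof (rule tendsto_of_weighted_bound[OF w(5)])
   show "0 \<le> (LBINT z. (norm (w z - f (r k) z))^2)" for k by (simp add: integral_nonneg_AE)
   show "0 \<le> (LBINT z. (norm (\<phi> z))^2)" by (simp add: integral_nonneg_AE)
   fix k and \<mu> :: real assume \<mu>: "\<mu> > 0"
   have "Borel (\<lambda>z. w z - f (r k) z)" by measurable
   note p = pair(2)[OF this w(4) \<mu>]
   have "(LBINT z. f (r k) z \<bullet> \<phi> z) - (LBINT z. w z \<bullet> \<phi> z) = - (LBINT z. (w z - f (r k) z) \<bullet> \<phi> z)"
    unfolding inner_diff_left using LINT_diff[OF pair(1)[OF wm w(2)] pair(1)[OF fm fi]] by simp
   then show "\<bar>(LBINT z. f (r k) z \<bullet> \<phi> z) - (LBINT z. w z \<bullet> \<phi> z)\<bar> \<le> (1 / (4 * \<mu>)) * (LBINT z. (norm (\<phi> z))^2) + \<mu> * (LBINT z. (norm (w z - f (r k) z))^2)"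
    using p by simp
  qed
  show "(LBINT z. v z \<bullet> curl_x (\<lambda>z. ch (fst z) *\<^sub>R \<phi> z) z) = (LBINT z. w z \<bullet> \<phi> z)" by (rule LIMSEQ_unique[OF l1 l2])
  qed
 qed
qed

end

section \<open>Gluing and transfer to Lebesgue measurable fields\<close>

text \<open>As \<open>ns_sol\<close>, but with the integrability on every smaller closed ball,
  before any cutoffs are fixed.\<close>

locale ns_glob = box3 +
 fixes s s' Tm :: real and v :: "R3 \<times> real => R3"
 assumes s: "2 < s'" "2 / s' + 3 / s = 1"
  and Tm: "0 < Tm"
  and v_meas [measurable]: "Borel v"
  and v0: "\<And>z. z \<notin> cyl x0 R Tm ==> v z = 0"
  and v2: "L1 (\<lambda>z. (norm (v z))^2)"
  and weak: "\<And>\<phi>. \<phi> \<in> solenoidal_test_functions (cyl x0 R Tm) ==>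
   (LBINT z. v z \<bullet> (nst v \<phi> z)) = 0"
  and divfree: "AE t in lborel. \<forall>\<phi>\<in>test_functions (ball x0 R). (LBINT x. v (x, t) \<bullet> gradient \<phi> x) = 0"
  and vs: "\<And>r t1 t2. 0 < r ==> r < R ==> 0 < t1 ==> t1 < t2 ==> t2 < Tm ==>
   (AE t in lborel. t \<in> {t1<..<t2} \<longrightarrow> L1 (\<lambda>x. ind (cball x0 r) x * norm (v (x, t)) powr s)) \<and>
   L1 (\<lambda>t. ind {t1<..<t2} t * (1 + (LBINT x. ind (cball x0 r) x * norm (v (x, t)) powr s)) powr (s' / s))"
begin

text \<open>Three cutoffs with equally spaced radii between \<open>\<rho>\<close> and
  \<open>R\<close>. As \<open>ch\<close> is 1 on the ball of radius \<open>\<rho>\<close>, the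
  localized identity is the full one for test fields supported there.\<close>

lemma interior_vorticity:
 assumes \<rho>: "0 < \<rho>" "\<rho> < R" and ab: "0 < a" "a < b" "b < Tm"
 shows "\<exists>w. w \<in> borel_measurable borel \<and> L1 (\<lambda>z. (norm (w z))^2) \<and>
  (\<forall>\<phi>. smooth \<phi> \<longrightarrow> (\<forall>z. z \<notin> cball x0 \<rho> \<times> {a..b} \<longrightarrow> \<phi> z = 0) \<longrightarrow> (LBINT z. v z \<bullet> curl_x \<phi> z) = (LBINT z. w z \<bullet> \<phi> z))"
proof -
 define r1 where "r1 = \<rho> + (R - \<rho>) / 4"
 define r2 where "r2 = \<rho> + (R - \<rho>) / 2"
 define r3 where "r3 = \<rho> + (R - \<rho>) * 3 / 4"
 have r: "0 < r1" "\<rho> < r1" "r1 < r2" "r2 < r3" "r3 < R" using \<rho> by (auto simp: r1_def r2_def r3_def field_simps)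
 have r0: "0 \<le> \<rho>" "0 \<le> r1" "0 \<le> r2" using \<rho> r by auto
 show ?thesis
 proof (rule smooth_cutoff[OF r0(1) r(2), of x0], rule smooth_cutoff[OF r0(2) r(3), of x0], rule smooth_cutoff[OF r0(3) r(4), of x0])
  fix ch et ps :: "R3 => real"
  assume ch: "smooth ch" "\<And>x. x \<in> cball x0 \<rho> ==> ch x = 1" "\<And>x. x \<notin> cball x0 r1 ==> ch x = 0" "\<And>x. 0 \<le> ch x" "\<And>x. ch x \<le> 1"
   and et: "smooth et" "\<And>x. x \<in> cball x0 r1 ==> et x = 1" "\<And>x. x \<notin> cball x0 r2 ==> et x = 0" "\<And>x. 0 \<le> et x" "\<And>x. et x \<le> 1"
   and ps: "smooth ps" "\<And>x. x \<in> cball x0 r2 ==> ps x = 1" "\<And>x. x \<notin> cball x0 r3 ==> ps x = 0" "\<And>x. 0 \<le> ps x" "\<And>x. ps x \<le> 1"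
  interpret N: ns_cut x0 R s s' r1 r2 r3 ch et ps
   by unfold_locales (use s r ch et ps in auto)
  have r2: "0 < r2" "r2 < R" using r by auto
  interpret S: ns_sol x0 R s s' r1 r2 r3 ch et ps Tm v
  proof
   fix t1 t2 :: real assume "0 < t1" "t1 < t2" "t2 < Tm"
   from vs[OF r2 this] show "(AE t in lborel. t \<in> {t1<..<t2} \<longrightarrow> L1 (\<lambda>x. ind (cball x0 r2) x * norm (v (x, t)) powr s)) \<and>
    L1 (\<lambda>t. ind {t1<..<t2} t * N.\<kappa> (\<lambda>x. v (x, t)))" by (simp only: N.\<kappa>_def N.V_def)
  qed (fact Tm v_meas v0 v2 weak divfree)+
  \<comment> \<open>The time interval is enlarged so that the closed interval lies inside the open
    one.\<close>
  define a' where "a' = a / 2"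
  define b' where "b' = (b + Tm) / 2"
  have ab': "0 < a'" "a' < b'" "b' < Tm" and sub: "{a..b} \<subseteq> {a'<..<b'}" using ab by (auto simp: a'_def b'_def)
  show ?thesis
  proof (rule S.local_vorticity[OF ab'])
   fix w assume w: "Borel w" "L1 (\<lambda>z. (norm (w z))^2)"
    "\<And>\<phi>. \<phi> \<in> test_functions (ball x0 R \<times> {a'<..<b'}) ==> (LBINT z. v z \<bullet> curl_x (\<lambda>z. ch (fst z) *\<^sub>R \<phi> z) z) = (LBINT z. w z \<bullet> \<phi> z)"
   show ?thesis
   proof (intro exI[of _ w] conjI w(1,2) allI impI)
    fix \<phi> :: "R3 \<times> real => R3" assume \<phi>: "smooth \<phi>" "\<forall>z. z \<notin> cball x0 \<rho> \<times> {a..b} \<longrightarrow> \<phi> z = 0"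
    have "cball x0 \<rho> \<subseteq> ball x0 R" using \<rho> by auto
    then have "cball x0 \<rho> \<times> {a..b} \<subseteq> ball x0 R \<times> {a'<..<b'}" using sub by blast
    from test_functionsI[OF \<phi>(1) compact_Times[OF compact_cball compact_Icc] this] \<phi>(2)
    have t: "\<phi> \<in> test_functions (ball x0 R \<times> {a'<..<b'})" by blast
    show "(LBINT z. v z \<bullet> curl_x \<phi> z) = (LBINT z. w z \<bullet> \<phi> z)"
    proof -
     have "(\<lambda>z. ch (fst z) *\<^sub>R \<phi> z) = \<phi>"
     proof
      fix z show "ch (fst z) *\<^sub>R \<phi> z = \<phi> z"
      proof (cases "z \<in> cball x0 \<rho> \<times> {a..b}")
       case True
       then show ?thesis using ch(2)[of "fst z"] by auto
      next
       case False
       then have "\<phi> z = 0" using \<phi>(2) by blast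
       then show ?thesis by simp
      qed
     qed
     then show ?thesis using w(3)[OF t] by simp
    qed
   qed
  qed
 qed
qed

text \<open>Relative size of the compact cylinders \<open>KK n\<close>, which exhaust the space-time
  domain; \<open>level 0\<close> is 0, so the first of them is a single point.\<close>

definition "level n = 1 - 1 / (real n + 1)"
definition "KK n = cball x0 (R * level n) \<times> cball (Tm / 2) (Tm / 2 * level n)"

lemma level: "0 \<le> level n" "level n < 1" "m < n ==> level m < level n" "0 < n ==> 0 < level n" "level \<longlonglongrightarrow> 1"
proof -
 show "0 \<le> level n" "level n < 1" by (auto simp: level_def field_simps)
 show "level m < level n" if "m < n" using that by (simp add: level_def field_simps)
 show "0 < level n" if "0 < n" using that by (simp add: level_def field_simps)
 have "(\<lambda>n. 1 - 1 / (real n + 1)) \<longlonglongrightarrow> 1 - 0"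
  using LIMSEQ_ignore_initial_segment[OF lim_const_over_n[of "1::real"], of 1] by (intro tendsto_intros) (simp add: add.commute)
 then show "level \<longlonglongrightarrow> 1" by (simp add: level_def[abs_def])
qed

lemma KK_mono: "m \<le> n ==> KK m \<subseteq> KK n"
proof -
 assume "m \<le> n"
 then have "level m \<le> level n" using level(3)[of m n] by (cases "m = n") auto
 then have "R * level m \<le> R * level n" "Tm / 2 * level m \<le> Tm / 2 * level n" using R Tm by auto
 then show ?thesis unfolding KK_def by (intro Sigma_mono) (auto intro: order_trans)
qed

lemma compact_KK: "compact (KK n)"
 unfolding KK_def by (intro compact_Times compact_cball)

lemma KK_subset: "KK n \<subseteq> cyl x0 R Tm"
proof -
 have "R * level n < R * 1" "Tm / 2 * level n < Tm / 2 * 1" using R Tm level(2)[of n] by (auto intro: mult_strict_left_mono)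
 then show ?thesis unfolding KK_def by (auto simp: dist_real_def abs_if split: if_splits)
qed

lemma KK_exhausts:
 assumes L: "compact L" "L \<subseteq> cyl x0 R Tm"
 obtains n where "0 < n" "L \<subseteq> KK n"
proof -
 have c: "compact (fst ` L)" "compact (snd ` L)" by (intro compact_continuous_image continuous_intros L(1))+
 have b: "ball (Tm / 2) (Tm / 2) = {0<..<Tm}" by (auto simp: ball_def dist_real_def abs_if split: if_splits)
 have f: "fst ` L \<subseteq> ball x0 R" "snd ` L \<subseteq> ball (Tm / 2) (Tm / 2)" using L(2) unfolding b by auto
 obtain r where "0 < r" and r: "r < R" "fst ` L \<subseteq> cball x0 r" by (rule compact_subset_ball[OF c(1) f(1) R])
 have T2: "0 < Tm / 2" using Tm by simp
 obtain q where "0 < q" and q: "q < Tm / 2" "snd ` L \<subseteq> cball (Tm / 2) q" by (rule compact_subset_ball[OF c(2) f(2) T2])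
 have "(\<lambda>n. R * level n) \<longlonglongrightarrow> R * 1" "(\<lambda>n. Tm / 2 * level n) \<longlonglongrightarrow> Tm / 2 * 1" by (intro tendsto_intros level(5))+
 note l = this
 have "eventually (\<lambda>n. r < R * level n) sequentially" by (rule order_tendstoD(1)[OF l(1)]) (use r(1) in simp)
 moreover have "eventually (\<lambda>n. q < Tm / 2 * level n) sequentially" by (rule order_tendstoD(1)[OF l(2)]) (use q(1) in simp)
 ultimately have "eventually (\<lambda>n. r < R * level n \<and> q < Tm / 2 * level n \<and> 0 < n) sequentially"
  by (intro eventually_conj eventually_gt_at_top)
 then obtain n where n: "r < R * level n" "q < Tm / 2 * level n" "0 < n" by (auto simp: eventually_sequentially)
 have "z \<in> KK n" if z: "z \<in> L" for z
 proof -
  have "dist x0 (fst z) \<le> r" "dist (Tm / 2) (snd z) \<le> q" using r(2) q(2) z by auto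
  then show ?thesis using n unfolding KK_def by (cases z) auto
 qed
 then show ?thesis using that[OF n(3)] by blast
qed

lemma KK_cutoff:
 "\<exists>\<psi> :: R3 \<times> real => real. smooth \<psi> \<and> (\<forall>z. z \<in> KK n \<longrightarrow> \<psi> z = 1) \<and> (\<forall>z. z \<notin> KK (Suc n) \<longrightarrow> \<psi> z = 0) \<and> (\<forall>z. 0 \<le> \<psi> z \<and> \<psi> z \<le> 1)"
proof -
 have f: "0 \<le> R * level n" "R * level n < R * level (Suc n)" "0 \<le> Tm / 2 * level n" "Tm / 2 * level n < Tm / 2 * level (Suc n)"
  using R Tm level(1)[of n] level(3)[of n "Suc n"] by auto
 show ?thesis
 proof (rule smooth_cutoff[OF f(1,2), of x0], rule smooth_cutoff[OF f(3,4), of "Tm / 2"])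
  fix c :: "R3 => real" and d :: "real => real"
  assume c: "smooth c" "\<And>x. x \<in> cball x0 (R * level n) ==> c x = 1" "\<And>x. x \<notin> cball x0 (R * level (Suc n)) ==> c x = 0" "\<And>x. 0 \<le> c x" "\<And>x. c x \<le> 1"
   and d: "smooth d" "\<And>x. x \<in> cball (Tm / 2) (Tm / 2 * level n) ==> d x = 1" "\<And>x. x \<notin> cball (Tm / 2) (Tm / 2 * level (Suc n)) ==> d x = 0" "\<And>x. 0 \<le> d x" "\<And>x. d x \<le> 1"
  show ?thesis
  proof (intro exI[of _ "\<lambda>z. d (snd z) *\<^sub>R c (fst z)"] conjI allI impI)
   show "smooth (\<lambda>z. d (snd z) *\<^sub>R c (fst z))" by (rule smooth_fst_snd[OF d(1) c(1)])
   show "d (snd z) *\<^sub>R c (fst z) = 1" if "z \<in> KK n" for z using that c(2)[of "fst z"] d(2)[of "snd z"] by (auto simp: KK_def)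
   show "d (snd z) *\<^sub>R c (fst z) = 0" if "z \<notin> KK (Suc n)" for z
    using that c(3)[of "fst z"] d(3)[of "snd z"] by (cases "fst z \<in> cball x0 (R * level (Suc n))") (auto simp: KK_def mem_Times_iff)
   show "0 \<le> d (snd z) *\<^sub>R c (fst z)" "d (snd z) *\<^sub>R c (fst z) \<le> 1" for z using c(4,5)[of "fst z"] d(4,5)[of "snd z"] by (auto intro: mult_le_one)
  qed
 qed
qed

text \<open>The local representatives are glued by telescoping cutoffs: the difference of two
  consecutive cutoffs times a test field is supported where \<open>W n\<close> represents the curl,
  and on a compact set finitely many differences add up to 1.\<close>

theorem vorticity:
 obtains w where "Borel w" "\<And>z. z \<notin> cyl x0 R Tm ==> w z = 0"
  "\<And>L. compact L ==> L \<subseteq> cyl x0 R Tm ==> L1 (\<lambda>z. ind L z * (norm (w z))^2)"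
  "\<And>\<phi>. \<phi> \<in> test_functions (cyl x0 R Tm) ==> (LBINT z. v z \<bullet> curl_x \<phi> z) = (LBINT z. w z \<bullet> \<phi> z)"
proof -
 \<comment> \<open>The index is \<open>n + 2\<close> because the cutoff with number
   \<open>Suc n\<close> is supported in \<open>KK (n + 2)\<close>.\<close>
 have "\<exists>w. w \<in> borel_measurable borel \<and> L1 (\<lambda>z. (norm (w z))^2) \<and>
  (\<forall>\<phi>. smooth \<phi> \<longrightarrow> (\<forall>z. z \<notin> KK (n + 2) \<longrightarrow> \<phi> z = 0) \<longrightarrow> (LBINT z. v z \<bullet> curl_x \<phi> z) = (LBINT z. w z \<bullet> \<phi> z))" for n
 proof -
  have f: "0 < level (n + 2)" "level (n + 2) < 1" by (rule level(4), simp) (rule level(2))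
  have i: "cball (Tm / 2) (Tm / 2 * level (n + 2)) = {Tm / 2 * (1 - level (n + 2))..Tm / 2 * (1 + level (n + 2))}"
   by (auto simp: cball_eq_atLeastAtMost algebra_simps)
  have "0 < R * level (n + 2)" "R * level (n + 2) < R" "0 < Tm / 2 * (1 - level (n + 2))"
   "Tm / 2 * (1 - level (n + 2)) < Tm / 2 * (1 + level (n + 2))" "Tm / 2 * (1 + level (n + 2)) < Tm"
   using R Tm f by (auto simp: field_simps)
  from interior_vorticity[OF this] show ?thesis unfolding KK_def i .
 qed
 from choice[OF allI[OF this]] obtain W where W: "\<forall>n. W n \<in> borel_measurable borel \<and> L1 (\<lambda>z. (norm (W n z))^2) \<and>
  (\<forall>\<phi>. smooth \<phi> \<longrightarrow> (\<forall>z. z \<notin> KK (n + 2) \<longrightarrow> \<phi> z = 0) \<longrightarrow> (LBINT z. v z \<bullet> curl_x \<phi> z) = (LBINT z. W n z \<bullet> \<phi> z))" by (rule exE)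
 have Wm[measurable]: "Borel (W n)" for n using W by blast
 have W2: "L1 (\<lambda>z. (norm (W n z))^2)" for n using W by blast
 have Wr: "(LBINT z. v z \<bullet> curl_x \<phi> z) = (LBINT z. W n z \<bullet> \<phi> z)" if "smooth \<phi>" "\<And>z. z \<notin> KK (n + 2) ==> \<phi> z = 0" for n \<phi> using W that by blast
 from choice[OF allI[OF KK_cutoff]] obtain p :: "nat => R3 \<times> real => real" where p: "\<forall>n. smooth (p n) \<and> (\<forall>z. z \<in> KK n \<longrightarrow> p n z = 1) \<and> (\<forall>z. z \<notin> KK (Suc n) \<longrightarrow> p n z = 0) \<and> (\<forall>z. 0 \<le> p n z \<and> p n z \<le> 1)" by (rule exE)
 \<comment> \<open>The first cutoff is replaced by 0, so that the telescoping sum starts from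
   zero.\<close>
 define \<psi> where "\<psi> n z = (if n = 0 then 0 else p n z)" for n z
 have \<psi>0: "\<psi> 0 z = 0" for z by (simp add: \<psi>_def)
 have \<psi>s: "smooth (\<psi> n)" for n unfolding \<psi>_def[abs_def] using p by (cases "n = 0") (auto simp: smooth_const)
 have p1: "p n z = 1" if "z \<in> KK n" for n z using p that by blast
 have p2: "p n z = 0" if "z \<notin> KK (Suc n)" for n z using p that by blast
 have p3: "0 \<le> p n z" "p n z \<le> 1" for n z using p by blast+
 have \<psi>1: "\<psi> n z = 1" if "0 < n" "z \<in> KK n" for n z using that p1 by (simp add: \<psi>_def)
 have \<psi>z: "\<psi> n z = 0" if "z \<notin> KK (Suc n)" for n z using that p2 by (simp add: \<psi>_def)
 have \<psi>b: "\<bar>\<psi> n z\<bar> \<le> 1" for n z using p3[of n z] by (simp add: \<psi>_def)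
 have [measurable]: "Borel (\<psi> n)" for n by (rule borel_measurable_continuous_onI[OF smooth_continuous[OF \<psi>s]])
 define w where "w z = (\<Sum>n. (\<psi> (Suc n) z - \<psi> n z) *\<^sub>R W n z)" for z
 have wm[measurable]: "Borel w" unfolding w_def by measurable
 have wK: "w z = (\<Sum>n<M. (\<psi> (Suc n) z - \<psi> n z) *\<^sub>R W n z)" if M: "0 < M" "z \<in> KK M" for M z
  unfolding w_def
 proof (rule suminf_finite)
  fix n assume "n \<notin> {..<M}"
  then have "M \<le> n" by simp
  then have "\<psi> (Suc n) z = 1" "\<psi> n z = 1" using \<psi>1[of n z] \<psi>1[of "Suc n" z] M KK_mono[of M n] KK_mono[of M "Suc n"] by auto
  then show "(\<psi> (Suc n) z - \<psi> n z) *\<^sub>R W n z = 0" by simp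
 qed simp
 have W1: "norm ((\<psi> (Suc n) z - \<psi> n z) *\<^sub>R W n z) \<le> 2 * norm (W n z)" for n z
  unfolding norm_scaleR using \<psi>b[of "Suc n" z] \<psi>b[of n z] by (intro mult_right_mono) auto
 have wi: "L1 (\<lambda>z. ind (KK M) z * (norm (w z))^2)" if M: "0 < M" for M
 proof (rule L1_bound)
  show "L1 (\<lambda>z. real M * (\<Sum>n<M. 4 * (norm (W n z))^2))" by (intro integrable_mult_right L1_sum W2)
  have [measurable]: "KK M \<in> sets borel" by (rule borel_compact[OF compact_KK])
  show "(\<lambda>z. ind (KK M) z * (norm (w z))^2) \<in> borel_measurable lborel" by measurable
  show "AE z in lborel. norm (ind (KK M) z * (norm (w z))^2) \<le> norm (real M * (\<Sum>n<M. 4 * (norm (W n z))^2))" (is "AE z in _. ?P z")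
  proof (rule AE_I2)
   fix z
   show "?P z"
   proof (cases "z \<in> KK M")
    case True
    have "norm (w z) \<le> (\<Sum>n<M. 2 * norm (W n z))" unfolding wK[OF M True] by (intro sum_norm_le W1)
    then have "(norm (w z))^2 \<le> (\<Sum>n<M. 2 * norm (W n z))^2" by (intro power_mono) auto
    also have "... \<le> real M * (\<Sum>n<M. (2 * norm (W n z))^2)"
     using sum_squared_le_sum_of_squares[of "\<lambda>n. 2 * norm (W n z)" "{..<M}"] by (simp add: mult.commute)
    finally show ?thesis using True by (simp add: power_mult_distrib sum_nonneg)
   qed (simp add: sum_nonneg)
  qed
 qed
 show ?thesis
 proof (rule that[OF wm])
  show "w z = 0" if "z \<notin> cyl x0 R Tm" for z
  proof -
   have "\<psi> n z = 0" for n using \<psi>z[of z n] KK_subset[of "Suc n"] that by blast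
   then show ?thesis by (simp add: w_def)
  qed
  show "L1 (\<lambda>z. ind L z * (norm (w z))^2)" if L: "compact L" "L \<subseteq> cyl x0 R Tm" for L
  proof -
   obtain M where M: "0 < M" "L \<subseteq> KK M" using KK_exhausts[OF L] by blast
   have [measurable]: "L \<in> sets borel" by (rule borel_compact[OF L(1)])
   show ?thesis by (rule L1_bound[OF wi[OF M(1)]]) (use M(2) in \<open>auto simp: indicator_def\<close>)
  qed
  fix \<phi> :: "R3 \<times> real => R3" assume \<phi>: "\<phi> \<in> test_functions (cyl x0 R Tm)"
  obtain L where L: "smooth \<phi>" "compact L" "L \<subseteq> cyl x0 R Tm" "\<And>z. z \<notin> L ==> \<phi> z = 0" using test_functionsD[OF \<phi>] by metis
  obtain M where M: "0 < M" "L \<subseteq> KK M" using KK_exhausts[OF L(2,3)] by blast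
  obtain B where B: "\<And>z. norm (\<phi> z) \<le> B" using bounded_compact_support[OF smooth_continuous[OF L(1)] L(2,4)] by blast
  have [measurable]: "Borel \<phi>" by (rule borel_measurable_continuous_onI[OF smooth_continuous[OF L(1)]])
  have i\<phi>: "L1 (\<lambda>z. (norm (\<phi> z))^2)"
   by (rule integrable_compact_support[OF _ L(2)]) (use L(4) smooth_continuous[OF L(1)] in \<open>auto intro!: continuous_on_power continuous_on_norm\<close>)
  define D where "D n = (LBINT z. v z \<bullet> curl_x (\<lambda>z. \<psi> n z *\<^sub>R \<phi> z) z)" for n
  have s\<phi>: "smooth (\<lambda>z. \<psi> n z *\<^sub>R \<phi> z)" for n by (intro smooth_scaleR \<psi>s L(1))
  have iW: "L1 (\<lambda>z. W n z \<bullet> (\<psi> m z *\<^sub>R \<phi> z))" for n m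
  proof (rule L1_bound[OF L1_add[OF W2 i\<phi>]])
   show "AE z in lborel. norm (W n z \<bullet> (\<psi> m z *\<^sub>R \<phi> z)) \<le> norm ((norm (W n z))^2 + (norm (\<phi> z))^2)" (is "AE z in _. ?P z")
   proof (rule AE_I2)
    fix z
    have "\<bar>W n z \<bullet> (\<psi> m z *\<^sub>R \<phi> z)\<bar> = \<bar>\<psi> m z\<bar> * \<bar>W n z \<bullet> \<phi> z\<bar>" by (simp add: abs_mult)
    also have "... \<le> 1 * (norm (W n z) * norm (\<phi> z))" by (intro mult_mono \<psi>b Cauchy_Schwarz_ineq2) auto
    also have "... \<le> (norm (W n z))^2 + (norm (\<phi> z))^2"
     using sum_squares_bound[of "norm (W n z)" "norm (\<phi> z)"] mult_nonneg_nonneg[OF norm_ge_zero[of "W n z"] norm_ge_zero[of "\<phi> z"]] by linarith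
    finally show "?P z" by simp
   qed
  qed measurable
  have DW: "(LBINT z. ((\<psi> (Suc n) z - \<psi> n z) *\<^sub>R W n z) \<bullet> \<phi> z) = D (Suc n) - D n" for n
  proof -
   have 1: "D (Suc n) = (LBINT z. W n z \<bullet> (\<psi> (Suc n) z *\<^sub>R \<phi> z))"
    unfolding D_def by (rule Wr[OF s\<phi>]) (simp add: \<psi>z)
   have 2: "D n = (LBINT z. W n z \<bullet> (\<psi> n z *\<^sub>R \<phi> z))"
    unfolding D_def
   proof (rule Wr[OF s\<phi>])
    fix z assume "z \<notin> KK (n + 2)"
    then have "z \<notin> KK (Suc n)" using KK_mono[of "Suc n" "n + 2"] by auto
    then show "\<psi> n z *\<^sub>R \<phi> z = 0" by (simp add: \<psi>z)
   qed
   show ?thesis unfolding 1 2 LINT_diff[OF iW iW, symmetric]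
    by (rule LINT_cong) (auto simp: left_diff_distrib)
  qed
  have iD: "L1 (\<lambda>z. ((\<psi> (Suc n) z - \<psi> n z) *\<^sub>R W n z) \<bullet> \<phi> z)" for n
   using L1_diff[OF iW[of n "Suc n"] iW[of n n]] by (simp add: left_diff_distrib)
  have "(LBINT z. w z \<bullet> \<phi> z) = (LBINT z. (\<Sum>n<M. ((\<psi> (Suc n) z - \<psi> n z) *\<^sub>R W n z) \<bullet> \<phi> z))"
  proof (rule LINT_cong[OF refl])
   fix z show "w z \<bullet> \<phi> z = (\<Sum>n<M. ((\<psi> (Suc n) z - \<psi> n z) *\<^sub>R W n z) \<bullet> \<phi> z)"
    using wK[OF M(1), of z] L(4)[of z] M(2) by (cases "z \<in> L") (auto simp: inner_sum_left)
  qed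
  also have "... = (\<Sum>n<M. D (Suc n) - D n)" unfolding DW[symmetric] by (rule LINT_sum[OF iD])
  also have "... = D M - D 0" by (rule sum_lessThan_telescope)
  also have "D 0 = 0"
  proof -
   have "dx j (\<lambda>z. 0 :: R3) z = 0" for j z unfolding dx_def by (rule partial_deriv_eq) (rule has_derivative_const)
   then have "curl_x (\<lambda>z. 0) z = 0" for z by (simp add: curl_x_def vec_eq_iff forall_3)
   then show ?thesis by (simp add: D_def \<psi>0)
  qed
  also have "(\<lambda>z. \<psi> M z *\<^sub>R \<phi> z) = \<phi>"
  proof
   fix z show "\<psi> M z *\<^sub>R \<phi> z = \<phi> z" using \<psi>1[OF M(1), of z] L(4)[of z] M(2) by (cases "z \<in> L") auto
  qed
  then have "D M = (LBINT z. v z \<bullet> curl_x \<phi> z)" by (simp add: D_def)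
  finally show "(LBINT z. v z \<bullet> curl_x \<phi> z) = (LBINT z. w z \<bullet> \<phi> z)" by simp
 qed
qed

end

section \<open>Transfer between Lebesgue and Borel measurability\<close>

lemma AE_lborel_swap_slices:
 fixes P :: "R3 \<times> real => bool"
 assumes "AE z in lborel. P z"
 shows "AE t in lborel. AE x in lborel. P (x, t)"
proof -
 obtain N where N: "{z \<in> space lborel. \<not> P z} \<subseteq> N" "emeasure lborel N = 0" "N \<in> sets lborel" using AE_E[OF assms] by blast
 have [measurable]: "N \<in> sets borel" using N(3) by simp
 have "(\<integral>\<^sup>+t. (\<integral>\<^sup>+x. ind N (x, t) \<partial>lborel) \<partial>lborel) = (\<integral>\<^sup>+z. ind N z \<partial>lborel2)"
  by (rule lborel_pair.nn_integral_snd) (simp add: lborel_prod)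
 also have "... = 0" using N(2,3) by (simp add: lborel_prod)
 finally have "AE t in lborel. (\<integral>\<^sup>+x. ind N (x, t) \<partial>lborel) = 0"
  by (subst (asm) nn_integral_0_iff_AE) (auto simp: borel_prod[symmetric])
 then show ?thesis
 proof eventually_elim
  case (elim t)
  then have "AE x in lborel. ind N (x, t) = (0 :: ennreal)" by (subst (asm) nn_integral_0_iff_AE) auto
  then show ?case by eventually_elim (use N(1) in \<open>auto simp: indicator_def split: if_splits\<close>)
 qed
qed

lemma lebesgue_measurable_AE:
 fixes f g :: "'a::euclidean_space => 'b::euclidean_space"
 assumes g: "Borel g" and ae: "AE x in lborel. f x = g x"
 shows "f \<in> borel_measurable lebesgue"
proof (rule measurableI)
 fix A :: "'b set" assume A: "A \<in> sets borel"
 have gl: "g \<in> borel_measurable lebesgue" using g by (intro measurable_completion) simp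
 show "f -` A \<inter> space lebesgue \<in> sets lebesgue"
 proof (rule completion.in_sets_AE)
  show "g -` A \<inter> space lebesgue \<in> sets lebesgue" by (rule measurable_sets[OF gl A])
  show "AE x in lebesgue. x \<in> g -` A \<inter> space lebesgue \<longleftrightarrow> x \<in> f -` A \<inter> space lebesgue"
   unfolding AE_completion_iff using ae by eventually_elim auto
 qed auto
qed simp

text \<open>Translates integrals over \<open>lebesgue_on S\<close>, in which the definitions are
  phrased, into integrals over the whole space of Borel functions that vanish outside
  \<open>S\<close>.\<close>

lemma lebesgue_on_borel_representative:
 fixes f g :: "'a::euclidean_space => 'b::euclidean_space"
 assumes S: "S \<in> sets borel" and g: "Borel g" and g0: "\<And>x. x \<notin> S ==> g x = 0"
  and ae: "AE x in lborel. x \<in> S \<longrightarrow> f x = g x"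
 shows "f \<in> borel_measurable (lebesgue_on S)" (is ?G1) "integrable (lebesgue_on S) f \<longleftrightarrow> L1 g" (is ?G2)
  "integral\<^sup>L (lebesgue_on S) f = integral\<^sup>L lborel g" (is ?G3)
proof -
 have S': "S \<inter> space lebesgue \<in> sets lebesgue" using S by auto
 have ae': "AE x in lborel. ind S x *\<^sub>R f x = g x"
  using ae by eventually_elim (use g0 in \<open>auto simp: indicator_def\<close>)
 then have ael: "AE x in lebesgue. ind S x *\<^sub>R f x = g x" by (simp add: AE_completion_iff)
 have m: "(\<lambda>x. ind S x *\<^sub>R f x) \<in> borel_measurable lebesgue" by (rule lebesgue_measurable_AE[OF g ae'])
 have gl: "g \<in> borel_measurable lebesgue" "g \<in> borel_measurable lborel" using g by (auto intro: measurable_completion)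
 show ?G1 using m by (simp add: borel_measurable_restrict_space_iff[OF S'])
 show ?G2
  unfolding integrable_restrict_space[OF S'] integrable_completion[OF gl(2), symmetric] by (rule integrable_cong_AE[OF m gl(1) ael])
 show ?G3
  unfolding integral_restrict_space[OF S'] integral_completion[OF gl(2), symmetric] by (rule integral_cong_AE[OF m gl(1) ael])
qed

lemma AE_lebesgue_on_iff: "S \<in> sets borel ==> (AE x in lebesgue_on S. P x) \<longleftrightarrow> (AE x in lborel. x \<in> S \<longrightarrow> P x)"
 by (simp add: AE_restrict_space_iff AE_completion_iff)

text \<open>The result for real functions is applied to each component; multiplication by the
  indicator enforces the value 0 outside \<open>S\<close>.\<close>

lemma ex_borel_representative:
 fixes u :: "'a::euclidean_space => 'b::euclidean_space"
 assumes S: "S \<in> sets borel" and u: "u \<in> borel_measurable (lebesgue_on S)"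
 obtains v where "Borel v" "\<And>x. x \<notin> S ==> v x = 0" "AE x in lborel. x \<in> S \<longrightarrow> u x = v x"
proof -
 have S': "S \<inter> space lebesgue \<in> sets lebesgue" using S by auto
 have m: "(\<lambda>x. ind S x *\<^sub>R u x) \<in> borel_measurable lebesgue"
  using u by (simp add: borel_measurable_restrict_space_iff[OF S'])
 have "\<exists>g\<in>borel_measurable lborel. (AE x in lborel. (ind S x *\<^sub>R u x) \<bullet> b = g x)" for b
  by (rule completion_ex_borel_measurable_real) (intro borel_measurable_inner m borel_measurable_const)
 then have "\<forall>b. \<exists>g. g \<in> borel_measurable lborel \<and> (AE x in lborel. (ind S x *\<^sub>R u x) \<bullet> b = g x)" by blast
 from choice[OF this] obtain g where g: "\<forall>b. g b \<in> borel_measurable lborel \<and> (AE x in lborel. (ind S x *\<^sub>R u x) \<bullet> b = g b x)" by (rule exE)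
 have [measurable]: "Borel (g b)" for b using g by simp
 define v where "v x = ind S x *\<^sub>R (\<Sum>b\<in>Basis. g b x *\<^sub>R b)" for x
 have "AE x in lborel. \<forall>b\<in>Basis. (ind S x *\<^sub>R u x) \<bullet> b = g b x" using g by (intro AE_finite_allI) auto
 then have "AE x in lborel. x \<in> S \<longrightarrow> u x = v x"
 proof eventually_elim
  case (elim x)
  show ?case
  proof
   assume "x \<in> S"
   then have "\<And>b. b \<in> Basis ==> g b x = u x \<bullet> b" using elim by simp
   then show "u x = v x" using \<open>x \<in> S\<close> by (simp add: v_def euclidean_representation)
  qed
 qed
 moreover have "Borel v" unfolding v_def using S by measurable
 ultimately show ?thesis using that by (simp add: v_def)
qed

lemma compactly_contained_cylinder:
 fixes t1 t2 T :: real
 assumes "0 < r" "r < R" "0 < t1" "t1 < t2" "t2 < T"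
 shows "compactly_contained (ball x0 r \<times> {t1<..<t2}) (ball (x0 :: R3) R \<times> {0<..<T})"
proof -
 have "closure (ball x0 r \<times> {t1<..<t2}) = cball x0 r \<times> {t1..t2}" using assms by (simp add: closure_Times)
 moreover have "cball x0 r \<subseteq> ball x0 R" "{t1..t2} \<subseteq> {0<..<T}" using assms by auto
 ultimately show ?thesis unfolding compactly_contained_def by (auto intro: compact_Times)
qed

text \<open>\<open>u\<close> is replaced by a Borel version that vanishes outside \<open>Q\<close>.
  Each integral condition on \<open>u\<close> is transferred to it to obtain \<open>ns_glob\<close>,
  and the vorticity found there is transferred back, with the local mixed norm computed by
  Fubini.\<close>

theorem vorticity_in_L2:
 fixes u :: "R3 \<times> real => R3" and x0 :: "R3"
 assumes R: "0 < R" and T: "0 < T" and sol: "distributional_solution (ball x0 R) T u"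
  and s: "2 < s'" "2 / s' + 3 / s = 1" and uL: "u \<in> Lloc (ball x0 R) T s' s"
 defines "Q \<equiv> cyl x0 R T"
 shows "\<exists>w\<in>Lloc (ball x0 R) T 2 2. distr_represented_by Q (curl_distr Q u) w"
proof -
 define B where "B = ball x0 R"
 have QB: "Q = B \<times> {0<..<T}" by (simp add: Q_def B_def)
 have Q[measurable]: "Q \<in> sets borel" unfolding Q_def by (intro borel_open open_Times) auto
 have B[measurable]: "B \<in> sets borel" by (simp add: B_def)
 have sol': "in_Lp 2 (lebesgue_on Q) u" "\<And>\<phi>. \<phi> \<in> solenoidal_test_functions Q ==> (LINT z|lebesgue_on Q. u z \<bullet> (nst u \<phi> z)) = 0"
  "AE t in lebesgue_on {0<..<T}. \<forall>\<phi>\<in>test_functions B. (LINT x|lebesgue_on B. u (x, t) \<bullet> gradient \<phi> x) = 0"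
  using sol unfolding distributional_solution_def Q_def B_def by auto
 obtain v where v[measurable]: "Borel v" and vQ: "\<And>z. z \<notin> Q ==> v z = 0" and uv: "AE z in lborel. z \<in> Q \<longrightarrow> u z = v z"
  using ex_borel_representative[OF Q] sol'(1) unfolding in_Lp_def by blast
 have slice: "AE t in lborel. t \<in> {0<..<T} \<longrightarrow> (AE x in lborel. x \<in> B \<longrightarrow> u (x, t) = v (x, t))"
  using AE_lborel_swap_slices[OF uv]
 proof eventually_elim
  case (elim t)
  show ?case
  proof
   assume t: "t \<in> {0<..<T}"
   show "AE x in lborel. x \<in> B \<longrightarrow> u (x, t) = v (x, t)" using elim by eventually_elim (use t in \<open>auto simp: QB\<close>)
  qed
 qed
 have v2: "L1 (\<lambda>z. (norm (v z))^2)"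
 proof -
  have "integrable (lebesgue_on Q) (\<lambda>z. norm (u z) powr 2)" using sol'(1) by (simp add: in_Lp_def)
  moreover have "integrable (lebesgue_on Q) (\<lambda>z. norm (u z) powr 2) \<longleftrightarrow> L1 (\<lambda>z. (norm (v z))^2)"
  proof (rule lebesgue_on_borel_representative(2)[OF Q])
   show "AE z in lborel. z \<in> Q \<longrightarrow> norm (u z) powr 2 = (norm (v z))^2" using uv by eventually_elim simp
  qed (use vQ in auto)
  ultimately show ?thesis by blast
 qed
 interpret ns_glob x0 R s s' T v
 proof
  show "v z = 0" if "z \<notin> cyl x0 R T" for z using vQ[of z] that by (simp add: Q_def)
  fix \<phi> :: "R3 \<times> real => R3" assume "\<phi> \<in> solenoidal_test_functions (cyl x0 R T)"
  then have \<phi>: "\<phi> \<in> solenoidal_test_functions Q" by (simp add: Q_def)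
  then have s\<phi>: "smooth \<phi>" by (simp add: solenoidal_test_functions_def test_functions_def smooth_def)
  have sd: "smooth (dt \<phi>)" "smooth (dx j \<phi>)" "smooth (dx j (dx j \<phi>))" for j
   unfolding dt_def dx_def by (intro smooth_partial s\<phi>)+
  have [measurable]: "Borel (dt \<phi>)" "Borel (dx j \<phi>)" "Borel (dx j (dx j \<phi>))" for j
   by (intro borel_measurable_continuous_onI smooth_continuous sd)+
  have "(LINT z|lebesgue_on Q. u z \<bullet> (nst u \<phi> z)) = (LBINT z. v z \<bullet> (nst v \<phi> z))"
  proof (rule lebesgue_on_borel_representative(3)[OF Q])
   show "Borel (\<lambda>z. v z \<bullet> (nst v \<phi> z))"
    unfolding laplacian_x_def convection_def by measurable
   show "AE z in lborel. z \<in> Q \<longrightarrow> u z \<bullet> (nst u \<phi> z) = v z \<bullet> (nst v \<phi> z)"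
    using uv by eventually_elim (simp add: convection_def)
  qed (simp add: vQ)
  then show "(LBINT z. v z \<bullet> (nst v \<phi> z)) = 0" using sol'(2)[OF \<phi>] by simp
 next
  have "AE t in lborel. t \<in> {0<..<T} \<longrightarrow> (\<forall>\<phi>\<in>test_functions B. (LINT x|lebesgue_on B. u (x, t) \<bullet> gradient \<phi> x) = 0)"
   using sol'(3) by (subst (asm) AE_lebesgue_on_iff) auto
  then show "AE t in lborel. \<forall>\<phi>\<in>test_functions (ball x0 R). (LBINT x. v (x, t) \<bullet> gradient \<phi> x) = 0"
   using slice
  proof eventually_elim
   case (elim t)
   show ?case
   proof (intro ballI)
    fix \<phi> :: "R3 => real" assume "\<phi> \<in> test_functions (ball x0 R)"
    then have \<phi>: "\<phi> \<in> test_functions B" by (simp add: B_def)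
    then have "smooth \<phi>" by (simp add: test_functions_def smooth_def)
    then have [measurable]: "Borel (gradient \<phi>)"
     unfolding gradient_eq_grd by (intro borel_measurable_continuous_onI smooth_continuous smooth_grd)
    show "(LBINT x. v (x, t) \<bullet> gradient \<phi> x) = 0"
    proof (cases "t \<in> {0<..<T}")
     case False
     then have "v (x, t) = 0" for x by (intro vQ) (simp add: QB)
     then show ?thesis by simp
    next
     case True
     have "(LINT x|lebesgue_on B. u (x, t) \<bullet> gradient \<phi> x) = (LBINT x. v (x, t) \<bullet> gradient \<phi> x)"
     proof (rule lebesgue_on_borel_representative(3)[OF B])
      have "AE x in lborel. x \<in> B \<longrightarrow> u (x, t) = v (x, t)" using elim(2) True by blast
      then show "AE x in lborel. x \<in> B \<longrightarrow> u (x, t) \<bullet> gradient \<phi> x = v (x, t) \<bullet> gradient \<phi> x" by eventually_elim simp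
     qed (use vQ in \<open>auto simp: QB\<close>)
     then show ?thesis using elim(1) True \<phi> by simp
    qed
   qed
  qed
 next
  fix r t1 t2 :: real assume r: "0 < r" "r < R" and t: "0 < t1" "t1 < t2" "t2 < T"
  \<comment> \<open>\<open>Lloc\<close> speaks of open sets, whereas \<open>ns_glob\<close> uses
    closed balls; an open ball of intermediate radius connects them.\<close>
  define r' where "r' = (r + R) / 2"
  have r': "0 < r'" "r' < R" "r < r'" using r by (auto simp: r'_def)
  define B' where "B' = ball x0 r'"
  define I where "I = {t1<..<t2}"
  have [measurable]: "B' \<in> sets borel" "I \<in> sets borel" by (auto simp: B'_def I_def)
  have sub: "cball x0 r \<subseteq> B'" "B' \<subseteq> B" "I \<subseteq> {0<..<T}" using r' r t by (auto simp: B'_def B_def I_def)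
  have "in_mixed_Lp s' s B' I u"
   using uL compactly_contained_cylinder[OF r'(1,2) t, of x0] unfolding Lloc_def B'_def I_def by blast
  then have m1: "AE t in lborel. t \<in> I \<longrightarrow> in_Lp s (lebesgue_on B') (\<lambda>x. u (x, t))"
   and m2: "in_Lp s' (lebesgue_on I) (\<lambda>t. Lp_norm s (lebesgue_on B') (\<lambda>x. u (x, t)))"
   unfolding in_mixed_Lp_def by (auto simp: AE_lebesgue_on_iff)
  have s3: "s > 0"
  proof -
   have "2 / s' < 1" using s(1) by simp
   then have "3 / s > 0" using s(2) by linarith
   then show ?thesis by (simp add: zero_less_divide_iff)
  qed
  have s'0: "s' / s > 0" using s3 s(1) by simp
  define U where "U t = (LBINT x. ind B' x * norm (v (x, t)) powr s)" for t
  define W where "W t = (LBINT x. ind (cball x0 r) x * norm (v (x, t)) powr s)" for t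
  have [measurable]: "(\<lambda>p. v (snd p, fst p)) \<in> borel_measurable (borel \<Otimes>\<^sub>M borel)" "cball x0 r \<in> sets borel" by measurable
  have [measurable]: "Borel (\<lambda>t. U t)" "Borel (\<lambda>t. W t)" unfolding U_def W_def by measurable
  have U0: "U t \<ge> 0" "W t \<ge> 0" for t unfolding U_def W_def by (auto intro!: integral_nonneg_AE)
  have tr: "AE t in lborel. t \<in> I \<longrightarrow> L1 (\<lambda>x. ind B' x * norm (v (x, t)) powr s) \<and> (LINT x|lebesgue_on B'. norm (u (x, t)) powr s) = U t"
   using m1 slice
  proof eventually_elim
   case (elim t)
   show ?case
   proof
    assume tI: "t \<in> I"
    then have "AE x in lborel. x \<in> B \<longrightarrow> u (x, t) = v (x, t)" using elim(2) sub(3) by blast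
    then have ae: "AE x in lborel. x \<in> B' \<longrightarrow> norm (u (x, t)) powr s = ind B' x * norm (v (x, t)) powr s"
     by eventually_elim (use sub(2) in auto)
    have B's: "B' \<in> sets borel" by simp
    have gm: "Borel (\<lambda>x. ind B' x * norm (v (x, t)) powr s)" by measurable
    note L = lebesgue_on_borel_representative[OF B's gm _ ae]
    have "integrable (lebesgue_on B') (\<lambda>x. norm (u (x, t)) powr s)" using elim(1) tI by (simp add: in_Lp_def)
    then show "L1 (\<lambda>x. ind B' x * norm (v (x, t)) powr s) \<and> (LINT x|lebesgue_on B'. norm (u (x, t)) powr s) = U t"
     using L(2,3) by (simp add: U_def)
   qed
  qed
  have Wi: "AE t in lborel. t \<in> I \<longrightarrow> L1 (\<lambda>x. ind (cball x0 r) x * norm (v (x, t)) powr s) \<and> W t \<le> U t"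
   using tr
  proof eventually_elim
   case (elim t)
   show ?case
   proof
    assume "t \<in> I"
    then have i: "L1 (\<lambda>x. ind B' x * norm (v (x, t)) powr s)" using elim by blast
    have i2: "L1 (\<lambda>x. ind (cball x0 r) x * norm (v (x, t)) powr s)"
    proof (rule L1_bound[OF i])
     show "AE x in lborel. norm (ind (cball x0 r) x * norm (v (x, t)) powr s) \<le> norm (ind B' x * norm (v (x, t)) powr s)"
      using sub(1) by (intro AE_I2) (auto simp: indicator_def)
    qed measurable
    moreover have "W t \<le> U t" unfolding W_def U_def using sub(1) by (intro integral_mono i i2) (auto simp: indicator_def)
    ultimately show "L1 (\<lambda>x. ind (cball x0 r) x * norm (v (x, t)) powr s) \<and> W t \<le> U t" by blast
   qed
  qed
  have iU: "L1 (\<lambda>t. ind I t * U t powr (s' / s))"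
  proof -
   have Is: "I \<in> sets borel" by simp
   have gm: "Borel (\<lambda>t. ind I t * U t powr (s' / s))" by measurable
   \<comment> \<open>The exponent 1/s in \<open>Lp_norm\<close> and the power s' combine to
     s'/s.\<close>
   have ae: "AE t in lborel. t \<in> I \<longrightarrow> norm (Lp_norm s (lebesgue_on B') (\<lambda>x. u (x, t))) powr s' = ind I t * U t powr (s' / s)"
    using tr by eventually_elim (auto simp: Lp_norm_def powr_powr)
   note L = lebesgue_on_borel_representative[OF Is gm _ ae]
   have "integrable (lebesgue_on I) (\<lambda>t. norm (Lp_norm s (lebesgue_on B') (\<lambda>x. u (x, t))) powr s')" using m2 by (simp add: in_Lp_def)
   then show ?thesis using L(2) by simp
  qed
  have "L1 (\<lambda>t. ind I t * (1 + W t) powr (s' / s))"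
  proof (rule L1_bound)
   show "L1 (\<lambda>t. 2 powr (s' / s) * (ind I t + ind I t * U t powr (s' / s)))"
    using t by (intro integrable_mult_right L1_add iU integrable_real_indicator) (auto simp: I_def)
   show "AE t in lborel. norm (ind I t * (1 + W t) powr (s' / s)) \<le> norm (2 powr (s' / s) * (ind I t + ind I t * U t powr (s' / s)))"
    using Wi
   proof eventually_elim
    case (elim t)
    show ?case
    proof (cases "t \<in> I")
     case True
     then have "W t \<le> U t" using elim by blast
     \<comment> \<open>With p = s'/s this leads to (1 + W)^p \<le> 2^p (1 + U^p), whose right-hand
       side is integrable on \<open>I\<close>.\<close>
     then have "1 + W t \<le> 2 * max 1 (U t)" by (auto simp: max_def)
     then have "(1 + W t) powr (s' / s) \<le> (2 * max 1 (U t)) powr (s' / s)" using U0 s'0 by (intro powr_mono2) auto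
     also have "... = 2 powr (s' / s) * (max 1 (U t)) powr (s' / s)" by (simp add: powr_mult)
     also have "... \<le> 2 powr (s' / s) * (1 + U t powr (s' / s))" by (intro mult_left_mono) (auto simp: max_def)
     finally show ?thesis using True by simp
    qed simp
   qed
  qed measurable
  then show "(AE t in lborel. t \<in> {t1<..<t2} \<longrightarrow> L1 (\<lambda>x. ind (cball x0 r) x * norm (v (x, t)) powr s)) \<and>
   L1 (\<lambda>t. ind {t1<..<t2} t * (1 + (LBINT x. ind (cball x0 r) x * norm (v (x, t)) powr s)) powr (s' / s))"
   using Wi unfolding W_def I_def by (auto elim: eventually_mono)
 qed (fact R T s v v2)+
 show ?thesis
 proof (rule vorticity)
  fix w assume w[measurable]: "Borel w" and w0: "\<And>z. z \<notin> cyl x0 R T ==> w z = 0"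
   and w2: "\<And>L. compact L ==> L \<subseteq> cyl x0 R T ==> L1 (\<lambda>z. ind L z * (norm (w z))^2)"
   and wc: "\<And>\<phi>. \<phi> \<in> test_functions (cyl x0 R T) ==> (LBINT z. v z \<bullet> curl_x \<phi> z) = (LBINT z. w z \<bullet> \<phi> z)"
  have wl: "w \<in> borel_measurable (lebesgue_on S)" for S
   by (intro measurable_restrict_space1 measurable_completion) simp
  show ?thesis
  proof (rule bexI[of _ w])
   show "w \<in> Lloc (ball x0 R) T 2 2"
    unfolding Lloc_def mem_Collect_eq
   proof (intro allI impI)
    fix B' :: "R3 set" and t1 t2 :: real
    assume "open B' \<and> compactly_contained (B' \<times> {t1<..<t2}) (cyl x0 R T)"
    then have oB: "open B'" and cc: "compact (closure (B' \<times> {t1<..<t2}))" "closure (B' \<times> {t1<..<t2}) \<subseteq> cyl x0 R T"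
     by (auto simp: compactly_contained_def)
    define I where "I = {t1<..<t2}"
    have [measurable]: "B' \<in> sets borel" "I \<in> sets borel" using oB by (auto simp: I_def)
    have i: "L1 (\<lambda>z. ind (B' \<times> I) z * (norm (w z))^2)"
    proof (rule L1_bound[OF w2[OF cc]])
     have "B' \<times> I \<in> sets borel" unfolding I_def by (intro borel_open open_Times oB) auto
     then show "(\<lambda>z. ind (B' \<times> I) z * (norm (w z))^2) \<in> borel_measurable lborel" by measurable
     have "B' \<times> I \<subseteq> closure (B' \<times> {t1<..<t2})" unfolding I_def by (rule closure_subset)
     then show "AE z in lborel. norm (ind (B' \<times> I) z * (norm (w z))^2) \<le> norm (ind (closure (B' \<times> {t1<..<t2})) z * (norm (w z))^2)"
      by (intro AE_I2) (auto simp: indicator_def)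
    qed
    have i': "integrable lborel2 (\<lambda>(x, t). ind I t * (ind B' x * (norm (w (x, t)))^2))"
    proof -
     have "(\<lambda>(x, t). ind I t * (ind B' x * (norm (w (x, t)))^2)) = (\<lambda>z. ind (B' \<times> I) z * (norm (w z))^2)"
      by (auto simp: fun_eq_iff indicator_def)
     then show ?thesis using i by (simp add: lborel_prod)
    qed
    have tr: "integrable (lebesgue_on B') (\<lambda>x. norm (w (x, t)) powr 2) \<longleftrightarrow> L1 (\<lambda>x. ind B' x * (norm (w (x, t)))^2)"
     "(LINT x|lebesgue_on B'. norm (w (x, t)) powr 2) = (LBINT x. ind B' x * (norm (w (x, t)))^2)" for t
     by (intro lebesgue_on_borel_representative(2,3); auto)+
    show "in_mixed_Lp 2 2 B' {t1<..<t2} w"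
     unfolding in_mixed_Lp_def I_def[symmetric]
    proof (intro conjI)
     show "w \<in> borel_measurable (lebesgue_on (B' \<times> I))" by (rule wl)
     have Is: "I \<in> sets borel" by simp
     have "AE t in lborel. L1 (\<lambda>x. ind I t * (ind B' x * (norm (w (x, t)))^2))"
      by (rule lborel_pair.AE_integrable_snd[OF i'])
     then have "AE t in lborel. t \<in> I \<longrightarrow> L1 (\<lambda>x. ind B' x * (norm (w (x, t)))^2)"
      by eventually_elim auto
     then show "AE t in lebesgue_on I. in_Lp 2 (lebesgue_on B') (\<lambda>x. w (x, t))"
      unfolding AE_lebesgue_on_iff[OF Is]
     proof eventually_elim
      case (elim t)
      have "(\<lambda>x. w (x, t)) \<in> borel_measurable (lebesgue_on B')" by (intro measurable_restrict_space1 measurable_completion) simp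
      then show ?case unfolding in_Lp_def tr using elim by blast
     qed
     have N: "Lp_norm 2 (lebesgue_on B') (\<lambda>x. w (x, t)) = (LBINT x. ind B' x * (norm (w (x, t)))^2) powr (1 / 2)" for t
      unfolding Lp_norm_def tr ..
     have nn: "(LBINT x. ind B' x * (norm (w (x, t)))^2) \<ge> 0" for t by (auto intro!: integral_nonneg_AE)
     have [measurable]: "(\<lambda>p. w (snd p, fst p)) \<in> borel_measurable (borel \<Otimes>\<^sub>M borel)" by measurable
     have "Borel (\<lambda>t. (LBINT x. ind B' x * (norm (w (x, t)))^2) powr (1 / 2))" by measurable
     then have m: "(\<lambda>t. Lp_norm 2 (lebesgue_on B') (\<lambda>x. w (x, t))) \<in> borel_measurable (lebesgue_on I)"
      unfolding N by (intro measurable_restrict_space1 measurable_completion) simp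
     have "L1 (\<lambda>t. LBINT x. ind I t * (ind B' x * (norm (w (x, t)))^2))"
      by (rule lborel_pair.integrable_snd[OF i'])
     then have g: "L1 (\<lambda>t. ind I t * (LBINT x. ind B' x * (norm (w (x, t)))^2))" by simp
     have gm: "Borel (\<lambda>t. ind I t * (LBINT x. ind B' x * (norm (w (x, t)))^2))"
      by measurable
     have "integrable (lebesgue_on I) (\<lambda>t. norm (Lp_norm 2 (lebesgue_on B') (\<lambda>x. w (x, t))) powr 2)"
      by (rule lebesgue_on_borel_representative(2)[OF Is gm, THEN iffD2, OF _ _ g]) (use nn in \<open>auto simp: N powr_powr\<close>)
     then show "in_Lp 2 (lebesgue_on I) (\<lambda>t. Lp_norm 2 (lebesgue_on B') (\<lambda>x. w (x, t)))" using m by (simp add: in_Lp_def)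
    qed
   qed
   show "distr_represented_by Q (curl_distr Q u) w"
    unfolding distr_represented_by_def locally_integrable_on_def
   proof (intro conjI allI impI ballI)
    fix L assume "compact L \<and> L \<subseteq> Q"
    then have L: "compact L" "L \<subseteq> cyl x0 R T" by (auto simp: Q_def)
    have Ls[measurable]: "L \<in> sets borel" by (rule borel_compact[OF L(1)])
    have i1: "L1 (ind L :: R3 \<times> real => real)"
     using emeasure_bounded_finite[OF compact_imp_bounded[OF L(1)]] Ls by (intro integrable_real_indicator) auto
    have "L1 (\<lambda>z. ind L z *\<^sub>R w z)"
    proof (rule L1_bound[OF L1_add[OF i1 w2[OF L]]])
     show "(\<lambda>z. ind L z *\<^sub>R w z) \<in> borel_measurable lborel" by measurable
     show "AE z in lborel. norm (ind L z *\<^sub>R w z) \<le> norm (ind L z + ind L z * (norm (w z))^2)" (is "AE z in _. ?P z")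
     proof (rule AE_I2)
      fix z
      have "norm (w z) \<le> 1 + (norm (w z))^2" using zero_le_power2[of "norm (w z) - 1"] norm_ge_zero[of "w z"] unfolding power2_diff power_one by linarith
      then show "?P z" by (auto simp: indicator_def)
     qed
    qed
    then show "integrable (lebesgue_on L) w"
     by (subst lebesgue_on_borel_representative(2)[OF Ls, of "\<lambda>z. ind L z *\<^sub>R w z"]) auto
   next
    fix \<phi> :: "R3 \<times> real => R3" assume "\<phi> \<in> test_functions Q"
    then have \<phi>: "\<phi> \<in> test_functions (cyl x0 R T)" by (simp add: Q_def)
    then have s\<phi>: "smooth \<phi>" by (simp add: test_functions_def smooth_def)
    have "smooth (\<lambda>z. \<Sum>k\<in>UNIV. cross3 (axis k 1) (dx k \<phi> z))" unfolding dx_def by (intro smooth_sum smooth_cross3 smooth_const smooth_partial s\<phi>)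
    moreover have "(\<lambda>z. \<Sum>k\<in>UNIV. cross3 (axis k 1) (dx k \<phi> z)) = curl_x \<phi>"
     by (simp add: fun_eq_iff curl_x_def sum_3 cross3_def vec_eq_iff forall_3 axis_def)
    ultimately have sc: "smooth (curl_x \<phi>)" by simp
    have [measurable]: "Borel \<phi>" "Borel (curl_x \<phi>)"
     by (intro borel_measurable_continuous_onI smooth_continuous s\<phi> sc)+
    have "curl_distr Q u \<phi> = (LBINT z. v z \<bullet> curl_x \<phi> z)"
     unfolding curl_distr_def
    proof (rule lebesgue_on_borel_representative(3)[OF Q])
     show "AE z in lborel. z \<in> Q \<longrightarrow> u z \<bullet> curl_x \<phi> z = v z \<bullet> curl_x \<phi> z" using uv by eventually_elim simp
    qed (simp_all add: vQ)
    also have "... = (LBINT z. w z \<bullet> \<phi> z)" by (rule wc[OF \<phi>])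
    also have "... = (LINT z|lebesgue_on Q. w z \<bullet> \<phi> z)"
     by (rule lebesgue_on_borel_representative(3)[OF Q, symmetric]) (use w0 in \<open>auto simp: Q_def\<close>)
    finally show "curl_distr Q u \<phi> = (LINT z|lebesgue_on Q. w z \<bullet> \<phi> z)" .
   qed
  qed
 qed
qed

theorem theorem3p1:
  fixes B :: "(real^3) set" and x0 :: "real^3" and R T s s' :: real
    and Q :: "((real^3) \<times> real) set"
    and u :: "(real^3) \<times> real \<Rightarrow> real^3"
  assumes "0 < R" and "B = ball x0 R" and "0 < T" and "Q = B \<times> {0<..<T}"
    and "distributional_solution B T u"
    and "2 < s'" and "2 / s' + 3 / s = 1"
    and "u \<in> Lloc B T s' s"
  shows "(4 \<le> s' \<longrightarrow> (\<exists>w\<in>Lloc B T 2 2. distr_represented_by Q (curl_distr Q u) w)) \<and>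
         (s' < 4 \<and> (\<exists>p>1. u \<in> Lloc B T 4 p) \<longrightarrow>
            (\<exists>w\<in>Lloc B T 2 2. distr_represented_by Q (curl_distr Q u) w))"
 using vorticity_in_L2[of R T x0 u s' s] assms by simp

end
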